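(* Let $\sigma:\overline{\mathbb F}\to\overline{\mathbb F}$ be an activation function satisfying Condition 1 (defined in the context). Then for every $d\in\mathbb N$ and every target function $f:\mathbb R^d\to\mathbb R$ there exists a $\sigma$-network $\nu:\overline{\mathbb F}^d\to\overline{\mathbb F}$ such that $$\gamma\big(\nu^\sharp(\mathcal B)\big)=\Big[\min \widehat f\big(\gamma(\mathcal B)\big),\ \max \widehat f\big(\gamma(\mathcal B)\big)\Big]\cap\overline{\mathbb F}$$ for every abstract box $\mathcal B\in\mathbb I^d$ with $\gamma(\mathcal B)\subseteq[-1,1]^d$, where $\widehat f:\mathbb F^d\to\overline{\mathbb F}$ is the rounded target $\widehat f(\mathbf x)=\mathrm{rnd}(f(\mathbf x))$.
   Context: Floating point. Fix integers $E\ge 5$ and $M$ with $2^{E-1}\ge M\ge 3$; let $\mathfrak e_{\min}=-2^{E-1}+2$ and $\mathfrak e_{\max}=2^{E-1}-1$. The set of finite floats is $\mathbb F=\{(-1)^b(s_0.s_1\dots s_M)_2\cdot 2^e: b,s_i\in\{0,1\},\ e\in\{\mathfrak e_{\min},\dots,\mathfrak e_{\max}\}\}$ and $\overline{\mathbb F}=\mathbb F\cup\{-\infty,+\infty,\mathrm{NaN}\}$. Let $\omega=2^{\mathfrak e_{\min}-M}$, $\Omega=2^{\mathfrak e_{\max}}(2-2^{-M})$, $\varepsilon=2^{-M-1}$. For $x\in\mathbb F$, $x^+=\min\{y\in\overline{\mathbb F}\setminus\{\mathrm{NaN}\}:y>x\}$ and $x^-=\max\{y\in\overline{\mathbb F}\setminus\{\mathrm{NaN}\}:y<x\}$.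 The rounding $\mathrm{rnd}:\mathbb R\cup\{\pm\infty\}\to\overline{\mathbb F}$ is $\mathrm{rnd}(x)=-\infty$ if $x\le-\Omega-c$, $+\infty$ if $x\ge\Omega+c$ (with $c=2^{\mathfrak e_{\max}}\varepsilon$), and otherwise the element of $\mathbb F$ nearest to $x$, ties broken toward the float whose last significand bit is $0$. For $x,y\in\mathbb F$: $x\oplus y=\mathrm{rnd}(x+y)$, $x\ominus y=\mathrm{rnd}(x-y)$, $x\otimes y=\mathrm{rnd}(x y)$; on non-finite operands these follow IEEE-754. Iterated sums $\bigoplus_{i=1}^n y_i$ are evaluated left to right. Networks. For $W=(w_{ij})\in\mathbb F^{m\times n}$ and $\mathbf b\in\mathbb F^m$, $\mathrm{aff}_{W,\mathbf b}:\overline{\mathbb F}^n\to\overline{\mathbb F}^m$ is $\mathrm{aff}_{W,\mathbf b}(\mathbf x)_i=\big(\bigoplus_{j=1}^n x_j\otimes w_{ij}\big)\oplus b_i$. For $\sigma:\overline{\mathbb F}\to\overline{\mathbb F}$, a depth-$L$ $\sigma$-network is a map $\nu=\mathrm{aff}_{W_L,\mathbf b_L}\circ\tilde\sigma_{d_{L-1}}\circ\mathrm{aff}_{W_{L-1},\mathbf b_{L-1}}\circ\cdots\circ\tilde\sigma_{d_1}\circ\mathrm{aff}_{W_1,\mathbf b_1}:\overline{\mathbb F}^{d_0}\to\overline{\mathbb F}^{d_L}$ with $W_\ell\in\mathbb F^{d_\ell\times d_{\ell-1}}$, $\mathbf b_\ell\in\mathbb F^{d_\ell}$, and $\tilde\sigma_n$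 the coordinatewise application of $\sigma$. Intervals. $\mathbb I=\{\langle a,b\rangle: a,b\in\overline{\mathbb F}\setminus\{\mathrm{NaN}\},a\le b\}\cup\{\top\}$, with $\gamma(\langle a,b\rangle)=[a,b]\cap\overline{\mathbb F}$, $\gamma(\top)=\overline{\mathbb F}$, and for a box $\mathcal B=(\mathcal I_1,\dots,\mathcal I_d)\in\mathbb I^d$, $\gamma(\mathcal B)=\prod_i\gamma(\mathcal I_i)$. For $\phi:\overline{\mathbb F}^d\to\overline{\mathbb F}$, $\phi^\sharp(\mathcal B)=\langle\min S,\max S\rangle$ if $\mathrm{NaN}\notin S$ and $\top$ otherwise, where $S=\phi(\gamma(\mathcal B))$. For $\odot\in\{\oplus,\otimes\}$: $\langle a,b\rangle\odot^\sharp\langle c,d\rangle=\langle\min S,\max S\rangle$ with $S=\{a\odot c,a\odot d,b\odot c,b\odot d\}$ if $\mathrm{NaN}\notin S$, $\top$ if $\mathrm{NaN}\in S$ or an operand is $\top$. $\mathrm{aff}^\sharp_{W,\mathbf b}(\mathcal I_1,\dots,\mathcal I_n)_i=\big(\bigoplus^\sharp_{j}\mathcal I_j\otimes^\sharp\langle w_{ij},w_{ij}\rangle\big)\oplus^\sharp\langle b_i,b_i\rangle$ (left to right). The interval semantics of the network $\nu$ above is $\nu^\sharp=\mathrm{aff}^\sharp_{W_L,\mathbf b_L}\circ\tilde\sigma^\sharp\circ\cdots\circ\tilde\sigma^\sharp\circ\mathrm{aff}^\sharp_{W_1,\mathbf b_1}$, where $\tilde\sigma^\sharp$ applies $\sigma^\sharp$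 coordinatewise. Condition 1. $\sigma:\overline{\mathbb F}\to\overline{\mathbb F}$ satisfies: (C1) there exist $c_1,c_2\in\mathbb F$ with $\sigma(c_1)=0$, $|\sigma(c_2)|\in[\frac\varepsilon2+2\varepsilon^2,\frac54-2\varepsilon]$, $\max\{|c_1|,|c_2|\}\ge 2^{\mathfrak e_{\min}+1}$, and $\sigma(x)$ lies between $\sigma(c_1)$ and $\sigma(c_2)$ for all $x$ between $c_1$ and $c_2$; (C2) there exists $\eta\in\mathbb F$ with $|\eta|\in[2^{\mathfrak e_{\min}+5},4-8\varepsilon]$ and $|\sigma(\eta)|,|\sigma(\eta^+)|\in[2^{\mathfrak e_{\min}+5},2^{\mathfrak e_{\max}-6}|\eta|]$ such that for all $x,y\in\mathbb F$ with $x\le\eta<\eta^+\le y$, either $\sigma(x)\le\sigma(\eta)<\sigma(\eta^+)\le\sigma(y)$ or $\sigma(x)\ge\sigma(\eta)>\sigma(\eta^+)\ge\sigma(y)$; (C3) there exists $\lambda\in[0,2^{\mathfrak e_{\max}-7}\min\{|\sigma(\eta)|,2^{M+3}\}]$ such that for all $x,y\in\mathbb F$ with $x\le\eta<\eta^+\le y$: $|\sigma(x)-\sigma(\eta)|\le\lambda|x-\eta|$ and $|\sigma(y)-\sigma(\eta^+)|\le\lambda|y-\eta^+|$. *)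

theory Defs
  imports Complex_Main "HOL-Library.Extended_Real"
begin

section \<open>Floating point numbers with parameters E (exponent bits) and M (mantissa bits)\<close>

text \<open>Extended floats: finite values (as reals), +inf, -inf and NaN.
  A value Fin r is a legal element of the extended float set iff r lies in Fset E M.\<close>

datatype fl = Fin real | PInf | MInf | NaN

definition emin :: "nat \<Rightarrow> int" where
  "emin E = - (2 ^ (E - 1)) + 2"

definition emax :: "nat \<Rightarrow> int" where
  "emax E = 2 ^ (E - 1) - 1"

text \<open>The finite floats: (-1)^b (s0.s1...sM)_2 2^e, i.e. (-1)^b k 2^(e-M) with k < 2^(M+1).\<close>
definition Fset :: "nat \<Rightarrow> nat \<Rightarrow> real set" where
  "Fset E M = {(if b then -1 else 1) * real k * (2::real) powi (e - int M) | b k e.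
                 k < 2 ^ (M + 1) \<and> emin E \<le> e \<and> e \<le> emax E}"

definition fvalid :: "nat \<Rightarrow> nat \<Rightarrow> fl \<Rightarrow> bool" where
  "fvalid E M v = (case v of Fin r \<Rightarrow> r \<in> Fset E M | _ \<Rightarrow> True)"

definition feps :: "nat \<Rightarrow> real" where
  "feps M = 2 powi (- int M - 1)"

definition fOmega :: "nat \<Rightarrow> nat \<Rightarrow> real" where
  "fOmega E M = 2 powi (emax E) * (2 - 2 powi (- int M))"

text \<open>Embedding of the non-NaN values into the extended reals (gives the order on them).\<close>
fun ext :: "fl \<Rightarrow> ereal" where
  "ext (Fin r) = ereal r"
| "ext PInf = \<infinity>"
| "ext MInf = - \<infinity>"
| "ext NaN = 0"

definition of_ext :: "ereal \<Rightarrow> fl" where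
  "of_ext x = (if x = \<infinity> then PInf else if x = - \<infinity> then MInf else Fin (real_of_ereal x))"

fun fval :: "fl \<Rightarrow> real" where
  "fval (Fin r) = r"
| "fval _ = 0"

definition fle :: "fl \<Rightarrow> fl \<Rightarrow> bool" where
  "fle a b = (a \<noteq> NaN \<and> b \<noteq> NaN \<and> ext a \<le> ext b)"

definition fless :: "fl \<Rightarrow> fl \<Rightarrow> bool" where
  "fless a b = (a \<noteq> NaN \<and> b \<noteq> NaN \<and> ext a < ext b)"

definition fsucc :: "nat \<Rightarrow> nat \<Rightarrow> real \<Rightarrow> fl" where
  "fsucc E M x = (if \<exists>y\<in>Fset E M. x < y then Fin (Min {y \<in> Fset E M. x < y}) else PInf)"

text \<open>Representations |y| = k 2^(e-M); the significand's last bit is 0 in the normalised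
  representation (the one with the least admissible exponent).\<close>
definition frepr :: "nat \<Rightarrow> nat \<Rightarrow> real \<Rightarrow> int \<Rightarrow> nat \<Rightarrow> bool" where
  "frepr E M y e k = (emin E \<le> e \<and> e \<le> emax E \<and> k < 2 ^ (M + 1) \<and>
                       \<bar>y\<bar> = real k * (2::real) powi (e - int M))"

definition lastbit0 :: "nat \<Rightarrow> nat \<Rightarrow> real \<Rightarrow> bool" where
  "lastbit0 E M y = (\<exists>e k. frepr E M y e k \<and> even k \<and> (\<forall>e' k'. frepr E M y e' k' \<longrightarrow> e \<le> e'))"

definition rnd :: "nat \<Rightarrow> nat \<Rightarrow> real \<Rightarrow> fl" where
  "rnd E M x =
     (let c = 2 powi (emax E) * feps M in
      if x \<le> - fOmega E M - c then MInf
      else if x \<ge> fOmega E M + c then PInf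
      else Fin (THE y. y \<in> Fset E M \<and> (\<forall>z\<in>Fset E M. \<bar>x - y\<bar> \<le> \<bar>x - z\<bar>) \<and>
                       (\<forall>z\<in>Fset E M. z \<noteq> y \<and> \<bar>x - z\<bar> = \<bar>x - y\<bar> \<longrightarrow> lastbit0 E M y)))"

fun fadd :: "nat \<Rightarrow> nat \<Rightarrow> fl \<Rightarrow> fl \<Rightarrow> fl" where
  "fadd E M (Fin x) (Fin y) = rnd E M (x + y)"
| "fadd E M NaN _ = NaN"
| "fadd E M _ NaN = NaN"
| "fadd E M PInf MInf = NaN"
| "fadd E M MInf PInf = NaN"
| "fadd E M PInf _ = PInf"
| "fadd E M _ PInf = PInf"
| "fadd E M MInf _ = MInf"
| "fadd E M _ MInf = MInf"

fun fneg :: "fl \<Rightarrow> fl" where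
  "fneg PInf = MInf" | "fneg MInf = PInf" | "fneg v = v"

fun fmul :: "nat \<Rightarrow> nat \<Rightarrow> fl \<Rightarrow> fl \<Rightarrow> fl" where
  "fmul E M (Fin x) (Fin y) = rnd E M (x * y)"
| "fmul E M NaN _ = NaN"
| "fmul E M _ NaN = NaN"
| "fmul E M PInf PInf = PInf"
| "fmul E M MInf MInf = PInf"
| "fmul E M PInf MInf = MInf"
| "fmul E M MInf PInf = MInf"
| "fmul E M PInf (Fin y) = (if y = 0 then NaN else if y > 0 then PInf else MInf)"
| "fmul E M MInf (Fin y) = (if y = 0 then NaN else if y > 0 then MInf else PInf)"
| "fmul E M (Fin y) PInf = (if y = 0 then NaN else if y > 0 then PInf else MInf)"
| "fmul E M (Fin y) MInf = (if y = 0 then NaN else if y > 0 then MInf else PInf)"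

fun fsum :: "nat \<Rightarrow> nat \<Rightarrow> fl list \<Rightarrow> fl" where
  "fsum E M [] = Fin 0"
| "fsum E M (y # ys) = foldl (fadd E M) y ys"

text \<open>A layer is (W, b) with W given as the list of its rows.\<close>
type_synonym layer = "real list list \<times> real list"

definition aff :: "nat \<Rightarrow> nat \<Rightarrow> layer \<Rightarrow> fl list \<Rightarrow> fl list" where
  "aff E M l xs = map2 (\<lambda>row bi. fadd E M (fsum E M (map2 (\<lambda>x w. fmul E M x (Fin w)) xs row)) (Fin bi))
                       (fst l) (snd l)"

fun net :: "nat \<Rightarrow> nat \<Rightarrow> (fl \<Rightarrow> fl) \<Rightarrow> layer list \<Rightarrow> fl list \<Rightarrow> fl list" where
  "net E M \<sigma> [] xs = xs"
| "net E M \<sigma> [l] xs = aff E M l xs"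
| "net E M \<sigma> (l # ls) xs = net E M \<sigma> ls (map \<sigma> (aff E M l xs))"

definition wf_layer :: "nat \<Rightarrow> nat \<Rightarrow> nat \<Rightarrow> nat \<Rightarrow> layer \<Rightarrow> bool" where
  "wf_layer E M din dout l =
     (length (fst l) = dout \<and> length (snd l) = dout \<and>
      (\<forall>row\<in>set (fst l). length row = din \<and> set row \<subseteq> Fset E M) \<and> set (snd l) \<subseteq> Fset E M)"

fun wf_net :: "nat \<Rightarrow> nat \<Rightarrow> nat \<Rightarrow> nat \<Rightarrow> layer list \<Rightarrow> bool" where
  "wf_net E M din dout [] = False"
| "wf_net E M din dout [l] = wf_layer E M din dout l"
| "wf_net E M din dout (l # ls) = (wf_layer E M din (length (snd l)) l \<and> wf_net E M (length (snd l)) dout ls)"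

datatype ival = Iv fl fl | Top

definition wf_ival :: "nat \<Rightarrow> nat \<Rightarrow> ival \<Rightarrow> bool" where
  "wf_ival E M I = (case I of Top \<Rightarrow> True
      | Iv a b \<Rightarrow> fvalid E M a \<and> fvalid E M b \<and> a \<noteq> NaN \<and> b \<noteq> NaN \<and> ext a \<le> ext b)"

fun gamma :: "nat \<Rightarrow> nat \<Rightarrow> ival \<Rightarrow> fl set" where
  "gamma E M Top = {v. fvalid E M v}"
| "gamma E M (Iv a b) = {v. fvalid E M v \<and> v \<noteq> NaN \<and> ext a \<le> ext v \<and> ext v \<le> ext b}"

definition gamma_box :: "nat \<Rightarrow> nat \<Rightarrow> ival list \<Rightarrow> fl list set" where
  "gamma_box E M B = {xs. length xs = length B \<and> (\<forall>i<length B. xs ! i \<in> gamma E M (B ! i))}"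

definition fhull :: "fl set \<Rightarrow> ival" where
  "fhull S = (if NaN \<in> S then Top else Iv (of_ext (Min (ext ` S))) (of_ext (Max (ext ` S))))"

definition sigma_sharp :: "nat \<Rightarrow> nat \<Rightarrow> (fl \<Rightarrow> fl) \<Rightarrow> ival \<Rightarrow> ival" where
  "sigma_sharp E M \<sigma> I = fhull (\<sigma> ` gamma E M I)"

fun iop :: "(fl \<Rightarrow> fl \<Rightarrow> fl) \<Rightarrow> ival \<Rightarrow> ival \<Rightarrow> ival" where
  "iop f (Iv a b) (Iv c d) = fhull {f a c, f a d, f b c, f b d}"
| "iop f _ _ = Top"

fun isum :: "nat \<Rightarrow> nat \<Rightarrow> ival list \<Rightarrow> ival" where
  "isum E M [] = Iv (Fin 0) (Fin 0)"
| "isum E M (y # ys) = foldl (iop (fadd E M)) y ys"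

definition aff_sharp :: "nat \<Rightarrow> nat \<Rightarrow> layer \<Rightarrow> ival list \<Rightarrow> ival list" where
  "aff_sharp E M l Is = map2 (\<lambda>row bi.
       iop (fadd E M) (isum E M (map2 (\<lambda>I w. iop (fmul E M) I (Iv (Fin w) (Fin w))) Is row))
           (Iv (Fin bi) (Fin bi)))
     (fst l) (snd l)"

fun net_sharp :: "nat \<Rightarrow> nat \<Rightarrow> (fl \<Rightarrow> fl) \<Rightarrow> layer list \<Rightarrow> ival list \<Rightarrow> ival list" where
  "net_sharp E M \<sigma> [] Is = Is"
| "net_sharp E M \<sigma> [l] Is = aff_sharp E M l Is"
| "net_sharp E M \<sigma> (l # ls) Is = net_sharp E M \<sigma> ls (map (sigma_sharp E M \<sigma>) (aff_sharp E M l Is))"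

definition cond1 :: "nat \<Rightarrow> nat \<Rightarrow> (fl \<Rightarrow> fl) \<Rightarrow> bool" where
  "cond1 E M \<sigma> = (
     \<comment> \<open>(C1)\<close>
     (\<exists>c1\<in>Fset E M. \<exists>c2\<in>Fset E M. \<exists>s.
        \<sigma> (Fin c1) = Fin 0 \<and> \<sigma> (Fin c2) = Fin s \<and>
        feps M / 2 + 2 * feps M ^ 2 \<le> \<bar>s\<bar> \<and> \<bar>s\<bar> \<le> 5 / 4 - 2 * feps M \<and>
        max \<bar>c1\<bar> \<bar>c2\<bar> \<ge> 2 powi (emin E + 1) \<and>
        (\<forall>x\<in>Fset E M. min c1 c2 \<le> x \<and> x \<le> max c1 c2 \<longrightarrow>
           (\<exists>t. \<sigma> (Fin x) = Fin t \<and> min 0 s \<le> t \<and> t \<le> max 0 s)))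
   \<and>
     \<comment> \<open>(C2) and (C3), sharing the same \<eta>\<close>
     (\<exists>\<eta>\<in>Fset E M. \<exists>a a'.
        2 powi (emin E + 5) \<le> \<bar>\<eta>\<bar> \<and> \<bar>\<eta>\<bar> \<le> 4 - 8 * feps M \<and>
        \<sigma> (Fin \<eta>) = Fin a \<and> \<sigma> (fsucc E M \<eta>) = Fin a' \<and>
        2 powi (emin E + 5) \<le> \<bar>a\<bar> \<and> \<bar>a\<bar> \<le> 2 powi (emax E - 6) * \<bar>\<eta>\<bar> \<and>
        2 powi (emin E + 5) \<le> \<bar>a'\<bar> \<and> \<bar>a'\<bar> \<le> 2 powi (emax E - 6) * \<bar>\<eta>\<bar> \<and>
        (\<forall>x\<in>Fset E M. \<forall>y\<in>Fset E M. x \<le> \<eta> \<and> fle (fsucc E M \<eta>) (Fin y) \<longrightarrow>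
           (fle (\<sigma> (Fin x)) (\<sigma> (Fin \<eta>)) \<and> fless (\<sigma> (Fin \<eta>)) (\<sigma> (fsucc E M \<eta>)) \<and>
            fle (\<sigma> (fsucc E M \<eta>)) (\<sigma> (Fin y)))
         \<or> (fle (\<sigma> (Fin \<eta>)) (\<sigma> (Fin x)) \<and> fless (\<sigma> (fsucc E M \<eta>)) (\<sigma> (Fin \<eta>)) \<and>
            fle (\<sigma> (Fin y)) (\<sigma> (fsucc E M \<eta>)))) \<and>
        (\<exists>lam::real. 0 \<le> lam \<and> lam \<le> 2 powi (emax E - 7) * min \<bar>a\<bar> (2 ^ (M + 3)) \<and>
           (\<forall>x\<in>Fset E M. \<forall>y\<in>Fset E M. x \<le> \<eta> \<and> fle (fsucc E M \<eta>) (Fin y) \<longrightarrow>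
              (\<exists>t. \<sigma> (Fin x) = Fin t \<and> \<bar>t - a\<bar> \<le> lam * \<bar>x - \<eta>\<bar>) \<and>
              (\<exists>t. \<sigma> (Fin y) = Fin t \<and> \<bar>t - a'\<bar> \<le> lam * \<bar>y - fval (fsucc E M \<eta>)\<bar>)))))"

end

(* Interval arithmetic is followed at both ends of the intervals at once. A bit assigns to a box
   two truth values, one for the lower and one for the upper end, and a sum of products that is
   monotone in a bit has known ends once its values for the bit being off and on are known.

   A threshold on an input is moved by an affine map onto the jump of sigma between eta and its
   successor. The resulting pre-activations may be as far as 2^(emax+1) from eta, but by the
   Lipschitz condition one layer with a small weight halves this spread while the jump survives.
   Once the spread is a few units in the last place, adding and subtracting a large constant rounds
   it away, and the bit is carried by two fixed floats. Constants, which are rounded multiples of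
   sigma(c2), move these to c1 and c2, where the activations are exactly 0 and sigma(c2). From then
   on a bit contributes terms that are 0 or any rounded nonnegative multiple of |sigma(c2)|. If the
   distance of c1 and c2 overflows, eta lies between them and one of its activations replaces 0.

   Adding such terms to eta gives disjunctions; negation swaps the ends. The exact abstraction of a
   predicate Q is the disjunction, over all boxes C on which Q holds, of the threshold conditions
   that define C: the box B satisfies Q everywhere iff B is such a C, and somewhere iff it meets a
   one-point C.

   The output neuron starts at the least float. For each float y in increasing order the bit of
   {f >= y} adds a term t between half the gap below y and the whole gap, and rounding turns the
   sum into y. Terms at both ends that overflow produce the infinite values. *)

theory Submission
  imports Defs
begin

section \<open>Enumeration of the floats and rounding\<close>

text \<open>Interval sums lose nothing here because rounded addition is monotone: a summand that is
  monotone in its bit is added exactly at each end. The difficulty is the supply of summands. Each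
  constant or bit term is a single rounded product of an available height with a weight, so a target
  is approached from one float to the next by any summand between half a gap and a gap. The bounds
  of Condition 1 come from here. The height \<epsilon>/2 + 2\<epsilon>^2 is large enough that its
  product with the largest float, after rounding, passes half of the largest gap. The bounds on
  \<lambda> let a weight contract by the factor 3/16, if necessary the least positive weight
  \<open>om\<close>, and |\<sigma>(\<eta>)| \<ge> 2^(emin+5) keeps the values at \<eta> and its
  successor at least 16 * om apart. The exponents balance because emin + emax = 1. The arithmetic is
  developed for an abstract predicate on four bounds, so that the same programs serve a bit, its
  complement and mirrored targets.\<close>

locale fp =
  fixes E M :: nat
  assumes E5: "E \<ge> 5" and M3: "M \<ge> 3" and ME: "M \<le> 2 ^ (E - 1)"
begin

section \<open>Powers of two and the exponent range\<close>

definition p2 :: "int \<Rightarrow> real" where "p2 e = 2 powi e"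

abbreviation m :: int where "m \<equiv> int M"
abbreviation a :: int where "a \<equiv> emin E"
abbreviation b :: int where "b \<equiv> emax E"

definition om :: real where "om = p2 (a - m)"
definition Om :: real where "Om = fOmega E M"

lemma p2_pos [simp]: "p2 e > 0" and p2_nonneg [simp]: "p2 e \<ge> 0" and p2_neq [simp]: "p2 e \<noteq> 0"
  by (auto simp: p2_def)

lemma p2_add: "p2 (e + f) = p2 e * p2 f"
  by (simp add: p2_def power_int_add)

lemma p2_diff: "p2 (e - f) = p2 e / p2 f"
  by (simp add: p2_def power_int_diff)

lemma p2_minus: "p2 (- e) = 1 / p2 e"
  by (simp add: p2_def power_int_minus divide_inverse)

lemma p2_0 [simp]: "p2 0 = 1"
  by (simp add: p2_def)

lemma p2_nat: "p2 (int n) = 2 ^ n"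
  by (simp add: p2_def)

lemma p2_num [simp]: "p2 (numeral k) = 2 ^ numeral k" "p2 1 = 2"
  by (simp_all add: p2_def)

lemma p2_less [simp]: "p2 e < p2 f \<longleftrightarrow> e < f"
  using power_int_strict_increasing[of e f "2::real"] power_int_increasing[of f e "2::real"]
  by (auto simp: p2_def not_less[symmetric])

lemma p2_le [simp]: "p2 e \<le> p2 f \<longleftrightarrow> e \<le> f"
  by (meson p2_less linorder_not_less)

lemma p2_eq [simp]: "p2 e = p2 f \<longleftrightarrow> e = f"
  by (metis p2_le order_antisym order_refl)

lemma p2_Suc: "p2 (e + 1) = 2 * p2 e"
  by (simp add: p2_add)

lemma p2_ge_nat: "0 \<le> e \<Longrightarrow> p2 e = 2 ^ nat e"
  by (simp add: p2_def power_int_def)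

lemma p2_bracket:
  assumes "x > 0"
  obtains e where "p2 e \<le> x" "x < p2 (e + 1)"
proof
  have *: "p2 e = 2 powr (of_int e)" for e
    by (simp add: p2_def powr_real_of_int')
  show "p2 \<lfloor>log 2 x\<rfloor> \<le> x"
    unfolding * using assms by (simp add: powr_le_iff)
  show "x < p2 (\<lfloor>log 2 x\<rfloor> + 1)"
    unfolding * using assms by (simp add: less_powr_iff)
qed

lemma ab: "a + b = 1"
  by (simp add: emin_def emax_def)

lemma b15: "b \<ge> 15"
proof -
  have "(2::int) ^ 4 \<le> 2 ^ (E - 1)" using E5 by (intro power_increasing) auto
  then show ?thesis by (simp add: emax_def)
qed

lemma mb: "m \<le> b + 1"
proof -
  have "int M \<le> int (2 ^ (E - 1))" using ME by (simp only: of_nat_le_iff)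
  then show ?thesis by (simp add: emax_def)
qed

lemma m3: "m \<ge> 3"
  using M3 by simp

lemma om_pos [simp]: "om > 0"
  by (simp add: om_def)

lemma Om_eq: "Om = p2 b * (2 - p2 (- m))"
  by (simp add: Om_def fOmega_def p2_def)

lemma Om_p2: "Om = p2 (b + 1) - p2 (b - m)"
  by (simp add: Om_eq p2_add p2_diff p2_minus algebra_simps)

text \<open>The floats in increasing order, with \<open>fz 0 = 0\<close>. The exponent is not bounded above, so that
  \<open>rr\<close> below rounds without overflow; an index is even iff the last significand bit is 0.\<close>

definition gp :: "nat \<Rightarrow> real" where "gp n = om * 2 ^ (n div 2 ^ M - 1)"

fun fzn :: "nat \<Rightarrow> real" where
  "fzn 0 = 0"
| "fzn (Suc n) = fzn n + gp n"

definition fz :: "int \<Rightarrow> real" where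
  "fz i = (if i \<ge> 0 then fzn (nat i) else - fzn (nat (- i)))"

definition gap :: "int \<Rightarrow> real" where "gap i = fz (i + 1) - fz i"

lemma gp_pos: "gp n > 0"
  by (simp add: gp_def)

lemma fzn_mono: "i < j \<Longrightarrow> fzn i < fzn j"
  by (induction j) (use gp_pos in \<open>auto simp: less_Suc_eq intro: less_trans add_strict_increasing\<close>)

text \<open>The subtraction of 1 in \<open>gp\<close> is truncated, so block 0 (the subnormals) and
  block 1 (the first normal binade) share the gap \<open>om\<close>. From block 1 on, each block of
  2^M indices is one binade.\<close>

lemma fzn_block0: "r \<le> 2 ^ M \<Longrightarrow> fzn r = real r * om"
  by (induction r) (auto simp: gp_def algebra_simps)

lemma fzn_block: "r \<le> 2 ^ M \<Longrightarrow> fzn (Suc q * 2 ^ M + r) = real (2 ^ M + r) * 2 ^ q * om"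
proof (induction q arbitrary: r)
  case 0
  then show ?case
  proof (induction r)
    case 0 then show ?case using fzn_block0[of "2 ^ M"] by simp
  next
    case (Suc r)
    have "(2 ^ M + r) div 2 ^ M = Suc 0" using Suc.prems by (simp add: div_add_self1)
    then show ?case using Suc by (simp add: gp_def algebra_simps)
  qed
next
  case (Suc q)
  have base: "fzn (Suc (Suc q) * 2 ^ M) = real (2 ^ M) * 2 ^ Suc q * om"
    using Suc.IH[of "2 ^ M"] by (simp add: algebra_simps)
  from Suc.prems show ?case
  proof (induction r)
    case 0 then show ?case using base by simp
  next
    case (Suc r)
    have "(Suc (Suc q) * 2 ^ M + r) div 2 ^ M = Suc (Suc q)"
      using Suc.prems div_mult_self3[of "2 ^ M" "Suc (Suc q)" r] by (simp del: mult_Suc)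
    then have "gp (Suc (Suc q) * 2 ^ M + r) = om * 2 ^ Suc q" by (simp add: gp_def)
    then show ?case using Suc by (simp add: algebra_simps)
  qed
qed

lemma fz_mono: "i < j \<Longrightarrow> fz i < fz j"
proof -
  assume ij: "i < j"
  have pos: "fzn n > 0" if "n > 0" for n using fzn_mono[of 0 n] that by simp
  have nn: "fzn n \<ge> 0" for n using pos[of n] by (cases "n = 0") auto
  consider "i \<ge> 0" | "i < 0" "j \<ge> 0" | "j < 0" by linarith
  then show ?thesis
  proof cases
    case 1 then show ?thesis using ij fzn_mono[of "nat i" "nat j"] by (simp add: fz_def)
  next
    case 2 then show ?thesis using pos[of "nat (- i)"] nn[of "nat j"] by (simp add: fz_def)
  next
    case 3 then show ?thesis using ij fzn_mono[of "nat (- j)" "nat (- i)"] by (simp add: fz_def)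
  qed
qed

lemma fz_less [simp]: "fz i < fz j \<longleftrightarrow> i < j"
  by (metis fz_mono linorder_less_linear order_less_imp_not_less)

lemma fz_le [simp]: "fz i \<le> fz j \<longleftrightarrow> i \<le> j"
  by (meson fz_less linorder_not_less)

lemma fz_inj [simp]: "fz i = fz j \<longleftrightarrow> i = j"
  by (metis fz_less linorder_less_linear order_less_irrefl)

lemma fz_minus: "fz (- i) = - fz i"
  by (cases "i = 0") (auto simp: fz_def)

lemma fz_0 [simp]: "fz 0 = 0"
  by (simp add: fz_def)

lemma fz_int: "fz (int n) = fzn n"
  by (simp add: fz_def)

lemma gap_pos: "gap i > 0"
  by (simp add: gap_def)

lemma gap_nonneg: "i \<ge> 0 \<Longrightarrow> gap i = gp (nat i)"
  using fzn.simps(2)[of "nat i"] by (simp add: gap_def fz_def nat_add_distrib)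

lemma gap_minus: "gap (- i - 1) = gap i"
  using fz_minus[of i] fz_minus[of "i + 1"] by (simp add: gap_def)

lemma gap_zero: "gap 0 = om"
  by (simp add: gap_nonneg gp_def)

lemma fz_1: "fz 1 = om"
  using gap_zero by (simp add: gap_def)

section \<open>Which reals are floats, and the gaps between them\<close>

definition Fz :: "real set" where "Fz = range fz"

lemma fz_in [simp]: "fz i \<in> Fz"
  by (simp add: Fz_def)

lemma Fz_minus: "x \<in> Fz \<Longrightarrow> - x \<in> Fz"
  by (metis Fz_def fz_minus imageE rangeI)

lemma fzn_mem:
  assumes "k \<le> 2 ^ (M + 1)"
  shows "\<exists>n. real k * 2 ^ j * om = fzn n"
  using assms
proof (induction j arbitrary: k)
  case 0
  show ?case
  proof (cases "k \<le> 2 ^ M")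
    case True then show ?thesis using fzn_block0[of k] by (intro exI[of _ k]) simp
  next
    case False
    then show ?thesis using fzn_block[of "k - 2 ^ M" 0] 0
      by (intro exI[of _ "Suc 0 * 2 ^ M + (k - 2 ^ M)"]) (auto simp: of_nat_diff)
  qed
next
  case (Suc j)
  show ?case
  proof (cases "k \<le> 2 ^ M")
    case True then show ?thesis using Suc.IH[of "2 * k"] by (auto simp: mult.assoc mult.left_commute)
  next
    case False
    then show ?thesis using fzn_block[of "k - 2 ^ M" "Suc j"] Suc.prems
      by (intro exI[of _ "Suc (Suc j) * 2 ^ M + (k - 2 ^ M)"]) (auto simp: of_nat_diff)
  qed
qed

text \<open>The usual reason why an operation below is exact: its result is a multiple of a last
  place and does not exceed the top of the corresponding binade.\<close>

lemma Fz_mem: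
  assumes "\<bar>k\<bar> \<le> 2 ^ (M + 1)" "a \<le> e"
  shows "of_int k * p2 (e - m) \<in> Fz"
proof -
  have e: "p2 (e - m) = 2 ^ nat (e - a) * om"
    using assms(2) by (simp add: om_def p2_ge_nat[symmetric] p2_add[symmetric])
  have "nat \<bar>k\<bar> \<le> 2 ^ (M + 1)" using assms(1) by (simp add: nat_le_iff)
  from fzn_mem[OF this, of "nat (e - a)"] obtain n where n: "real (nat \<bar>k\<bar>) * p2 (e - m) = fzn n"
    by (auto simp: e mult.assoc)
  show ?thesis
  proof (cases "k \<ge> 0")
    case True then show ?thesis using n fz_int[of n] by (metis abs_of_nonneg fz_in nat_0_le of_int_of_nat_eq)
  next
    case False
    then have "of_int k * p2 (e - m) = - fz (int n)" using n by (simp add: fz_int)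
    then show ?thesis using Fz_minus by simp
  qed
qed

lemma Fz_real:
  assumes "x = of_int k * p2 (e - m)" "\<bar>x\<bar> \<le> p2 (e + 1)" "a \<le> e"
  shows "x \<in> Fz"
proof -
  have "p2 (e + 1) = 2 ^ (M + 1) * p2 (e - m)" 
    by (simp add: p2_add p2_diff p2_nat)
  then have "\<bar>of_int k\<bar> * p2 (e - m) \<le> 2 ^ (M + 1) * p2 (e - m)" using assms by (simp add: abs_mult)
  then have "\<bar>of_int k :: real\<bar> \<le> 2 ^ (M + 1)" by simp
  then have "\<bar>k\<bar> \<le> 2 ^ (M + 1)" by (metis of_int_abs of_int_le_iff of_int_numeral of_int_power)
  then show ?thesis using Fz_mem assms by simp
qed

lemma p2_Fz: "a - m \<le> e \<Longrightarrow> p2 e \<in> Fz"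
proof (cases "a \<le> e")
  case True
  then show ?thesis using Fz_mem[of "2 ^ M" e] by (simp add: p2_diff p2_nat)
next
  case False
  assume "a - m \<le> e"
  then have "p2 e = of_int (2 ^ nat (e - (a - m))) * p2 (a - m)"
    by (simp add: p2_ge_nat[symmetric] p2_add[symmetric])
  moreover have "\<bar>p2 e\<bar> \<le> p2 (a + 1)" using False by simp
  ultimately show ?thesis by (rule Fz_real) simp
qed

text \<open>The index of the float 2^e. It is a multiple of 2^M, hence even, so ties at a power of
  two go to the power.\<close>

definition idx :: "int \<Rightarrow> int" where "idx e = 2 ^ M * (e - a + 1)"

lemma fz_form:
  assumes "a \<le> e" "0 \<le> r" "r \<le> 2 ^ M"
  shows "fz (idx e + r) = of_int (2 ^ M + r) * p2 (e - m)"
proof -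
  define q r' where "q = nat (e - a)" and "r' = nat r"
  have e: "e = a + int q" and r: "r = int r'" using assms by (auto simp: q_def r'_def)
  have le: "r' \<le> 2 ^ M" using assms(3) unfolding r by (simp flip: of_nat_le_iff)
  have *: "idx e + r = int (Suc q * 2 ^ M + r')" unfolding idx_def e r by (simp add: algebra_simps)
  have "p2 (e - m) = 2 ^ q * om" by (simp add: e om_def p2_add p2_diff p2_nat)
  then show ?thesis unfolding * fz_int fzn_block[OF le] by (simp add: r)
qed

lemma fz_idx: "a \<le> e \<Longrightarrow> fz (idx e) = p2 e"
  using fz_form[of e 0] by (simp add: p2_diff p2_nat)

lemma even_idx: "even (idx e)"
  using M3 by (simp add: idx_def)

lemma idx_Suc: "idx (e + 1) = idx e + 2 ^ M"
  by (simp add: idx_def algebra_simps)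

lemma idx_pos: "a \<le> e \<Longrightarrow> idx e > 0"
  by (simp add: idx_def)

lemma gap_form:
  assumes "a \<le> e" "idx e \<le> i" "i < idx (e + 1)"
  shows "gap i = p2 (e - m)"
proof -
  have "i + 1 = idx e + (i - idx e + 1)" by simp
  then have "fz (i + 1) = of_int (2 ^ M + (i - idx e + 1)) * p2 (e - m)"
    using assms idx_Suc[of e] fz_form[of e "i - idx e + 1"] by simp
  then show ?thesis
    using assms idx_Suc[of e] fz_form[of e "i - idx e"] by (simp add: gap_def algebra_simps)
qed

lemma gap_range:
  assumes "a \<le> e" "p2 e \<le> fz i" "fz i < p2 (e + 1)"
  shows "gap i = p2 (e - m)"
proof (rule gap_form[OF assms(1)])
  show "idx e \<le> i" "i < idx (e + 1)"
    using assms fz_idx[of e] fz_idx[of "e + 1"] fz_le[of "idx e" i] fz_less[of i "idx (e + 1)"] by simp_all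
qed

lemma gap_low:
  assumes "0 \<le> i" "i < idx (a + 1)"
  shows "gap i = om"
proof (cases "i < idx a")
  case True
  then have "nat i div 2 ^ M = 0" using assms by (simp add: idx_def nat_less_iff)
  then show ?thesis using assms by (simp add: gap_nonneg gp_def)
next
  case False
  then show ?thesis using gap_form[of a i] assms by (simp add: om_def)
qed

text \<open>Here e is the binade of \<open>fz i\<close>, where the subnormals are counted in binade
  \<open>a\<close>; only there can the lower bound \<open>p2 e\<close> fail.\<close>

lemma gap_exp:
  assumes "0 \<le> i"
  obtains e where "a \<le> e" "gap i = p2 (e - m)" "e = a \<or> p2 e \<le> fz i" "fz (i + 1) \<le> p2 (e + 1)"
proof (cases "fz i < p2 (a + 1)")
  case True
  then have "i < idx (a + 1)" using fz_idx[of "a + 1"] fz_less[of i "idx (a + 1)"] by simp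
  moreover from this have "fz (i + 1) \<le> p2 (a + 1)" using fz_idx[of "a + 1"] fz_le[of "i + 1" "idx (a + 1)"] by simp
  ultimately show ?thesis using that[of a] gap_low[of i] assms by (simp add: om_def)
next
  case False
  then have "fz i > 0" using p2_pos[of "a + 1"] by linarith
  then obtain e where e: "p2 e \<le> fz i" "fz i < p2 (e + 1)" using p2_bracket by blast
  then have "p2 (a + 1) < p2 (e + 1)" using False by linarith
  then have ae: "a \<le> e" by simp
  then have "fz (i + 1) \<le> p2 (e + 1)" using fz_idx[of "e + 1"] e fz_less[of i "idx (e + 1)"] fz_le[of "i + 1" "idx (e + 1)"] by simp
  then show ?thesis using that[of e] gap_range[OF ae e] ae e by blast
qed

lemma fz_unbounded: "\<exists>i. x < fz i"
proof -
  have ge: "real n * om \<le> fzn n" for n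
  proof (induction n)
    case (Suc n)
    have "om * 1 \<le> om * 2 ^ (n div 2 ^ M - 1)" by (intro mult_left_mono) (auto simp: less_imp_le)
    then have "om \<le> gp n" by (simp add: gp_def)
    then show ?case using Suc by (simp add: algebra_simps)
  qed simp
  obtain n where "x < real n * om" using reals_Archimedean3[of om] by auto
  then show ?thesis using ge[of n] by (intro exI[of _ "int n"]) (simp add: fz_int)
qed

lemma fz_bracket: obtains i where "fz i \<le> x" "x < fz (i + 1)"
proof -
  obtain j where j: "x < fz j" using fz_unbounded by blast
  obtain k where k: "- x < fz k" using fz_unbounded by blast
  let ?S = "{i. i \<le> j \<and> - k \<le> i \<and> fz i \<le> x}"
  have fin: "finite ?S" by (rule finite_subset[of _ "{- k..j}"]) auto
  have "fz (- k) \<le> x" using k by (simp add: fz_minus)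
  then have "fz (- k) < fz j" using j by linarith
  then have ne: "- k \<in> ?S" using \<open>fz (- k) \<le> x\<close> by simp
  define i where "i = Max ?S"
  have i: "i \<in> ?S" unfolding i_def using fin ne Max_in by blast
  have "x < fz (i + 1)"
  proof (rule ccontr)
    assume "\<not> x < fz (i + 1)"
    moreover from this have "fz (i + 1) < fz j" using j by linarith
    ultimately have "i + 1 \<in> ?S" using i by simp
    then show False using Max_ge[OF fin, of "i + 1"] by (simp add: i_def)
  qed
  then show ?thesis using that i by blast
qed

section \<open>Rounding to nearest without overflow\<close>

definition mid :: "int \<Rightarrow> real" where "mid i = (fz i + fz (i + 1)) / 2"

text \<open>The reals that round to \<open>fz i\<close>: an even index owns both bordering
  midpoints, an odd index neither. This encodes the tie rule.\<close>

definition inr :: "real \<Rightarrow> int \<Rightarrow> bool" where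
  "inr x i \<longleftrightarrow> mid (i - 1) \<le> x \<and> x \<le> mid i \<and> (odd i \<longrightarrow> mid (i - 1) < x \<and> x < mid i)"

definition rr :: "real \<Rightarrow> real" where "rr x = fz (THE i. inr x i)"

lemma mid_less [simp]: "mid i < mid j \<longleftrightarrow> i < j"
proof -
  have mono: "mid i < mid j" if "i < j" for i j
    using that add_strict_mono[of "fz i" "fz j" "fz (i + 1)" "fz (j + 1)"] by (simp add: mid_def)
  then show ?thesis by (metis linorder_less_linear order_less_imp_not_less)
qed

lemma mid_le [simp]: "mid i \<le> mid j \<longleftrightarrow> i \<le> j"
  by (meson mid_less linorder_not_less)

lemma mid_minus: "mid (- i - 1) = - mid i"
proof -
  have "fz (- i - 1) = - fz (i + 1)" using fz_minus[of "i + 1"] by (metis diff_conv_add_uminus minus_add_distrib)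
  then show ?thesis using fz_minus[of i] unfolding mid_def by (simp add: field_simps)
qed

lemma mid_bounds: "fz i < mid i" "mid i < fz (i + 1)"
  by (auto simp: mid_def field_simps)

lemma mid_gap: "mid i = fz i + gap i / 2" "mid i = fz (i + 1) - gap i / 2"
  by (auto simp: mid_def gap_def field_simps)

lemma inr_unique: "inr x i \<Longrightarrow> inr x j \<Longrightarrow> i = j"
proof (induction i j rule: linorder_wlog)
  case (le i j)
  show ?case
  proof (rule ccontr)
    assume "i \<noteq> j"
    then have ij: "i \<le> j - 1" using le by simp
    have "mid (j - 1) \<le> x" "x \<le> mid i" using le by (simp_all only: inr_def)
    then have "mid (j - 1) \<le> mid i" by linarith
    then have "j - 1 = i" using ij by simp
    then have j: "j = i + 1" by simp
    then have x: "x = mid i" using le by (simp add: inr_def)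
    then have "even i" using le(2) by (auto simp: inr_def)
    then have "odd j" using j by simp
    then show False using le(3) x j by (auto simp: inr_def)
  qed
qed simp

lemma inr_ex: "\<exists>i. inr x i"
proof -
  obtain i where i: "fz i \<le> x" "x < fz (i + 1)" using fz_bracket by blast
  have "mid (i - 1) < x" "x < mid (i + 1)" 
    using i mid_bounds[of "i - 1"] mid_bounds[of "i + 1"] by auto
  then show ?thesis
    by (cases "x < mid i \<or> (x = mid i \<and> even i)")
      (intro exI[of _ i] exI[of _ "i + 1"]; auto simp: inr_def)+
qed

lemma rrI: "inr x i \<Longrightarrow> rr x = fz i"
  unfolding rr_def using inr_unique by (metis the_equality)

lemma rrE: obtains i where "inr x i" "rr x = fz i"
  using inr_ex rrI by blast

lemma rr_in [simp]: "rr x \<in> Fz"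
  using rrE[of x] by (metis fz_in)

lemma rr_fz [simp]: "rr (fz i) = fz i"
  using mid_bounds[of i] mid_bounds[of "i - 1"] by (intro rrI) (auto simp: inr_def)

lemma rr_Fz: "x \<in> Fz \<Longrightarrow> rr x = x"
  by (auto simp: Fz_def)

lemma rr_0 [simp]: "rr 0 = 0"
  using rr_fz[of 0] by simp

lemma rr_mono: "x \<le> y \<Longrightarrow> rr x \<le> rr y"
proof -
  assume xy: "x \<le> y"
  obtain i j where i: "inr x i" "rr x = fz i" and j: "inr y j" "rr y = fz j" using rrE by metis
  show ?thesis
  proof (rule ccontr)
    assume "\<not> rr x \<le> rr y"
    then have "j \<le> i - 1" using i j by simp
    then have "mid j \<le> mid (i - 1)" by simp
    then have "x = y" using i j xy unfolding inr_def by linarith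
    then show False using \<open>\<not> rr x \<le> rr y\<close> by simp
  qed
qed

lemma rr_minus: "rr (- x) = - rr x"
proof -
  obtain i where i: "inr x i" "rr x = fz i" using rrE by blast
  have "mid (- i - 1) = - mid i" "mid (- i) = - mid (i - 1)"
    using mid_minus[of i] mid_minus[of "i - 1"] by auto
  then have "inr (- x) (- i)" using i by (auto simp: inr_def)
  then show ?thesis using rrI i fz_minus by metis
qed

lemma rr_le: "x \<le> y \<Longrightarrow> y \<in> Fz \<Longrightarrow> rr x \<le> y"
  using rr_mono rr_Fz by metis

lemma rr_ge: "y \<le> x \<Longrightarrow> y \<in> Fz \<Longrightarrow> y \<le> rr x"
  using rr_mono rr_Fz by metis

lemma closer_than_beyond:
  fixes x p q r l :: real
  assumes "(l + p) / 2 \<le> x" "x \<le> (p + r) / 2" "l < p" "p < r" "q \<le> l \<or> r \<le> q"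
  shows "\<bar>x - p\<bar> \<le> \<bar>x - q\<bar>"
    and "(l + p) / 2 < x \<Longrightarrow> x < (p + r) / 2 \<Longrightarrow> \<bar>x - p\<bar> < \<bar>x - q\<bar>"
  using assms by (auto simp: abs_real_def field_simps)

text \<open>An odd index wins strictly. A tie with another float therefore forces an even index,
  which is the tie clause of \<open>rnd\<close>.\<close>

lemma inr_nearest:
  assumes "inr x i"
  shows "\<bar>x - fz i\<bar> \<le> \<bar>x - fz j\<bar>" and "odd i \<Longrightarrow> j \<noteq> i \<Longrightarrow> \<bar>x - fz i\<bar> < \<bar>x - fz j\<bar>"
proof -
  have i: "(fz (i - 1) + fz i) / 2 \<le> x" "x \<le> (fz i + fz (i + 1)) / 2" 
    "odd i \<Longrightarrow> (fz (i - 1) + fz i) / 2 < x" "odd i \<Longrightarrow> x < (fz i + fz (i + 1)) / 2"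
    using assms by (simp_all add: inr_def mid_def)
  have j: "fz j \<le> fz (i - 1) \<or> fz (i + 1) \<le> fz j" if "j \<noteq> i" using that by auto
  show "\<bar>x - fz i\<bar> \<le> \<bar>x - fz j\<bar>"
    using closer_than_beyond(1)[OF i(1,2) _ _ j] by (cases "j = i") auto
  show "odd i \<Longrightarrow> j \<noteq> i \<Longrightarrow> \<bar>x - fz i\<bar> < \<bar>x - fz j\<bar>"
    using closer_than_beyond(2)[OF i(1,2) _ _ j i(3,4)] by auto
qed

lemma rr_nearest: "z \<in> Fz \<Longrightarrow> \<bar>x - rr x\<bar> \<le> \<bar>x - z\<bar>"
  using inr_nearest rrE[of x] by (metis Fz_def imageE)

text \<open>All multiples of the last place up to the top of the binade are floats, and one of the
  two around x is at most half a place away.\<close>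

lemma rr_err:
  assumes "\<bar>x\<bar> \<le> p2 (e + 1)" "a \<le> e"
  shows "\<bar>x - rr x\<bar> \<le> p2 (e - m) / 2"
proof -
  define u where "u = p2 (e - m)"
  have u: "u > 0" by (simp add: u_def)
  have mult: "k = 2 ^ (M + 1) \<or> k < 2 ^ (M + 1)" if "of_int k * u \<le> 2 ^ (M + 1) * u" for k :: int
    using that u by (metis linorder_less_linear mult_le_cancel_right_pos of_int_le_iff of_int_numeral of_int_power not_less)
  have top: "p2 (e + 1) = 2 ^ (M + 1) * u" by (simp add: u_def p2_add p2_diff p2_nat)
  define k where "k = \<lfloor>x / u\<rfloor>"
  have k1: "of_int k * u \<le> x" "x < (of_int k + 1) * u"
    using pos_le_divide_eq[OF u, of "of_int k" x] pos_divide_less_eq[OF u, of x "of_int k + 1"]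
      floor_correct[of "x / u"] unfolding k_def by auto
  have "- (2 ^ (M + 1)) * u \<le> x" using assms(1) by (simp add: top abs_le_iff)
  then have "- (2 ^ (M + 1)) \<le> x / u" by (simp only: pos_le_divide_eq[OF u])
  then have kl: "- (2 ^ (M + 1)) \<le> k" unfolding k_def by (simp add: le_floor_iff)
  have "of_int k * u \<le> 2 ^ (M + 1) * u" using k1 assms(1) top by linarith
  then have ku: "k = 2 ^ (M + 1) \<or> k < 2 ^ (M + 1)" by (rule mult)
  have z1: "of_int k * u \<in> Fz" unfolding u_def using kl ku assms by (intro Fz_mem) auto
  show ?thesis
  \<comment> \<open>In this case x is the top of the binade, and the grid point above it need not be
    a float.\<close>
  proof (cases "k = 2 ^ (M + 1)")
    case True
    then have "x = of_int k * u" using k1 assms(1) top by simp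
    then show ?thesis using z1 by (simp add: rr_Fz)
  next
    case False
    then have "of_int (k + 1) * u \<in> Fz" unfolding u_def using kl ku assms by (intro Fz_mem) auto
    then show ?thesis using rr_nearest[OF z1, of x] rr_nearest[of "of_int (k + 1) * u" x] k1 
      by (simp add: u_def[symmetric] algebra_simps abs_if split: if_splits)
  qed
qed

section \<open>Overflow, and the agreement with \<open>Fset\<close> and \<open>rnd\<close>\<close>

definition N :: int where "N = idx (b + 1) - 1"

lemma a_le_b: "a \<le> b" 
  using ab b15 by simp

lemma N_nonneg: "N \<ge> 0"
  using idx_pos[of "b + 1"] a_le_b by (simp add: N_def)

text \<open>Hence the midpoint above \<open>Om\<close> does not round to \<open>Om\<close>, in
  agreement with the overflow bound in \<open>rnd\<close>, which includes that midpoint.\<close>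

lemma odd_N: "odd N"
  using even_idx by (simp add: N_def)

lemma fz_N: "fz N = Om"
proof -
  have "N = idx b + (2 ^ M - 1)" by (simp add: N_def idx_Suc)
  then have "fz N = of_int (2 ^ M + (2 ^ M - 1)) * p2 (b - m)"
    using fz_form[of b "2 ^ M - 1"] a_le_b by simp
  then show ?thesis by (simp add: Om_p2 p2_add p2_diff p2_nat algebra_simps)
qed

lemma fz_N1: "fz (N + 1) = p2 (b + 1)"
  using fz_idx[of "b + 1"] a_le_b by (simp add: N_def)

definition ok :: "real \<Rightarrow> bool" where "ok x \<longleftrightarrow> \<bar>rr x\<bar> \<le> Om"

lemma abs_fz_le: "\<bar>fz i\<bar> \<le> Om \<longleftrightarrow> \<bar>i\<bar> \<le> N"
  using fz_le[of i N] fz_le[of "- N" i] fz_minus[of N] unfolding fz_N by (auto simp: abs_le_iff)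

definition F :: "real set" where "F = Fset E M"

text \<open>The representation with the least exponent. The parities agree because a subnormal
  significand is the index itself and \<open>idx e\<close> is even otherwise.\<close>

lemma canonical_repr:
  assumes "0 \<le> i" "i \<le> N"
  obtains e k where "a \<le> e" "e \<le> b" "k < 2 ^ (M + 1)" "fz i = real k * p2 (e - m)"
    "even k \<longleftrightarrow> even i" "e = a \<or> 2 ^ M \<le> k"
proof (cases "i < idx a")
  case True
  then have "i < 2 ^ M" by (simp add: idx_def)
  then have lt: "nat i < 2 ^ M" using assms(1) by (simp add: nat_less_iff)
  then have "nat i < 2 ^ (M + 1)" by (rule less_le_trans) simp
  then show ?thesis using that[of a "nat i"] fzn_block0[of "nat i"] lt assms(1) a_le_b
    by (simp add: fz_def om_def even_nat_iff)
next
  case False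
  define e where "e = a + (i - idx a) div 2 ^ M"
  define r where "r = (i - idx a) mod 2 ^ M"
  have ae: "a \<le> e" using False by (simp add: e_def pos_imp_zdiv_nonneg_iff)
  have r: "0 \<le> r" "r < 2 ^ M" by (simp_all add: r_def)
  have "idx e = 2 ^ M * ((i - idx a) div 2 ^ M) + idx a" by (simp add: e_def idx_def algebra_simps)
  then have i: "i = idx e + r" using mult_div_mod_eq[of "2 ^ M" "i - idx a"] unfolding r_def by linarith
  have "idx e < idx (b + 1)" using i r assms(2) by (simp add: N_def)
  then have eb: "e \<le> b" by (simp add: idx_def)
  define k where "k = nat (2 ^ M + r)"
  have "even k \<longleftrightarrow> even i" using r M3 even_idx[of e] unfolding k_def i by (simp add: even_nat_iff)
  moreover have "2 ^ M \<le> k" using r unfolding k_def by (simp add: le_nat_iff)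
  moreover have "k < 2 ^ (M + 1)" using r unfolding k_def by (simp add: nat_less_iff)
  moreover have "fz i = real k * p2 (e - m)" using fz_form[OF ae, of r] r unfolding k_def i by simp
  ultimately show ?thesis using that[of e k] ae eb by blast
qed

lemma Om_ge: "k < 2 ^ (M + 1) \<Longrightarrow> e \<le> b \<Longrightarrow> real k * p2 (e - m) \<le> Om"
proof -
  assume k: "k < 2 ^ (M + 1)" and e: "e \<le> b"
  have "real (k + 1) \<le> real (2 ^ (M + 1))" using k by (simp only: of_nat_le_iff)
  then have "real k \<le> 2 ^ (M + 1) - 1" by simp
  then have "real k * p2 (e - m) \<le> (2 ^ (M + 1) - 1) * p2 (b - m)"
    using e by (intro mult_mono) (auto intro: order_trans[OF _ one_le_power])
  then show ?thesis by (simp add: Om_p2 p2_add p2_diff p2_nat algebra_simps)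
qed

lemma F_iff: "x \<in> F \<longleftrightarrow> x \<in> Fz \<and> \<bar>x\<bar> \<le> Om"
proof
  assume "x \<in> F"
  then obtain s :: bool and k e where x: "x = (if s then -1 else 1) * real k * p2 (e - m)"
    and k: "k < 2 ^ (M + 1)" and e: "a \<le> e" "e \<le> b"
    unfolding F_def Fset_def p2_def by auto
  have "int k < int (2 ^ (M + 1))" using k by (simp only: of_nat_less_iff)
  then have "of_int (int k) * p2 (e - m) \<in> Fz" using e by (intro Fz_mem) auto
  moreover have "real k * p2 (e - m) \<le> Om" using Om_ge k e by blast
  ultimately show "x \<in> Fz \<and> \<bar>x\<bar> \<le> Om" using x Fz_minus by (auto simp: abs_mult)
next
  assume x: "x \<in> Fz \<and> \<bar>x\<bar> \<le> Om"
  then obtain i where i: "x = fz i" "\<bar>i\<bar> \<le> N" by (auto simp: Fz_def abs_fz_le)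
  then obtain e k where "a \<le> e" "e \<le> b" "k < 2 ^ (M + 1)" "fz \<bar>i\<bar> = real k * p2 (e - m)"
    using canonical_repr[of "\<bar>i\<bar>"] by (metis abs_ge_zero)
  moreover have "x = (if i < 0 then -1 else 1) * fz \<bar>i\<bar>" using i fz_minus[of i] by auto
  ultimately show "x \<in> F" unfolding F_def Fset_def p2_def
    by (auto intro!: exI[of _ "i < 0"] exI[of _ k] exI[of _ e])
qed

lemma F_fz: "fz i \<in> F \<longleftrightarrow> \<bar>i\<bar> \<le> N"
  by (simp add: F_iff abs_fz_le)

lemma F_cases: "x \<in> F \<Longrightarrow> \<exists>i. x = fz i \<and> \<bar>i\<bar> \<le> N"
  by (auto simp: F_iff Fz_def abs_fz_le)

lemma lastbit0_fz:
  assumes "\<bar>i\<bar> \<le> N"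
  shows "lastbit0 E M (fz i) \<longleftrightarrow> even i"
proof -
  obtain e k where r: "a \<le> e" "e \<le> b" "k < 2 ^ (M + 1)" "fz \<bar>i\<bar> = real k * p2 (e - m)"
    and ev: "even k \<longleftrightarrow> even i" and can: "e = a \<or> 2 ^ M \<le> k"
    using canonical_repr[of "\<bar>i\<bar>"] assms by auto
  have "\<bar>fz i\<bar> = fz \<bar>i\<bar>" using fz_minus[of i] fz_le[of 0 i] fz_le[of i 0] by (cases "i \<ge> 0") auto
  then have abs: "\<bar>fz i\<bar> = real k * p2 (e - m)" using r by simp
  have rep: "frepr E M (fz i) e k" using r abs by (simp add: frepr_def p2_def)
  have least: "e \<le> e'" if "frepr E M (fz i) e' k'" for e' k'
  proof (rule ccontr)
    assume "\<not> e \<le> e'"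
    then have lt: "e' + 1 \<le> e" by simp
    have ae': "a \<le> e'" "k' < 2 ^ (M + 1)" "\<bar>fz i\<bar> = real k' * p2 (e' - m)" 
      using that by (auto simp: frepr_def p2_def)
    then have "2 ^ M \<le> k" using can lt by auto
    then have "(2::real) ^ M \<le> real k" by (metis of_nat_le_iff of_nat_numeral of_nat_power)
    then have "2 ^ M * p2 (e' + 1 - m) \<le> real k * p2 (e - m)" using lt by (intro mult_mono) auto
    also have "\<dots> = real k' * p2 (e' - m)" using abs ae' by simp
    also have "\<dots> < 2 ^ (M + 1) * p2 (e' - m)" 
      using ae' by (metis mult_strict_right_mono of_nat_less_iff of_nat_numeral of_nat_power p2_pos)
    finally show False by (simp add: p2_add p2_diff field_simps)
  qed
  have uniq: "e' = e \<and> k' = k" if "frepr E M (fz i) e' k'" "\<forall>e'' k''. frepr E M (fz i) e'' k'' \<longrightarrow> e' \<le> e''" for e' k'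
  proof -
    have "e' = e" using that rep least by (meson order_antisym)
    then show ?thesis using that(1) abs by (auto simp: frepr_def p2_def)
  qed
  show ?thesis unfolding lastbit0_def using rep least uniq ev by metis
qed

lemma ok_iff: "ok x \<longleftrightarrow> \<bar>x\<bar> < Om + p2 (b - m) / 2"
proof -
  have midN: "mid N = Om + p2 (b - m) / 2"
    unfolding mid_def fz_N fz_N1 Om_p2 by simp
  have mm: "mid (- N - 1) = - mid N" by (rule mid_minus)
  obtain i where i: "inr x i" "rr x = fz i" using rrE by blast
  have "\<bar>x\<bar> < mid N" if "\<bar>i\<bar> \<le> N"
  proof -
    have b: "mid (i - 1) \<le> x" "x \<le> mid i" using i by (simp_all add: inr_def)
    have l: "mid (- N - 1) \<le> mid (i - 1)" "mid i \<le> mid N" using that by auto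
    have "x < mid N"
    proof (cases "i = N")
      case True then show ?thesis using i odd_N by (simp add: inr_def)
    next
      case False then have "mid i < mid N" using that by simp
      then show ?thesis using b by linarith
    qed
    moreover have "mid (- N - 1) < x"
    proof (cases "i = - N")
      case True then show ?thesis using i odd_N by (simp add: inr_def)
    next
      case False then have "mid (- N - 1) < mid (i - 1)" using that by simp
      then show ?thesis using b by linarith
    qed
    ultimately show ?thesis using mm by linarith
  qed
  moreover have "\<bar>i\<bar> \<le> N" if x: "\<bar>x\<bar> < mid N"
  proof (rule ccontr)
    assume "\<not> \<bar>i\<bar> \<le> N"
    then have "N \<le> i - 1 \<or> i \<le> - N - 1" by linarith
    then have "mid N \<le> mid (i - 1) \<or> mid i \<le> mid (- N - 1)" by simp
    moreover have "mid (i - 1) \<le> x" "x \<le> mid i" using i by (simp_all add: inr_def)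
    ultimately show False using x mm by linarith
  qed
  ultimately show ?thesis unfolding ok_def i(2) abs_fz_le midN by blast
qed

lemma half_ulp: "2 powi (emax E) * feps M = p2 (b - m) / 2"
  by (simp add: p2_def feps_def power_int_diff power_int_minus divide_simps)

lemma rnd_ok:
  assumes "ok x"
  shows "rnd E M x = Fin (rr x)"
proof -
  obtain i where i: "inr x i" "rr x = fz i" using rrE by blast
  have iN: "\<bar>i\<bar> \<le> N" using assms unfolding ok_def i(2) abs_fz_le .
  let ?P = "\<lambda>y. y \<in> F \<and> (\<forall>z\<in>F. \<bar>x - y\<bar> \<le> \<bar>x - z\<bar>) \<and>
                       (\<forall>z\<in>F. z \<noteq> y \<and> \<bar>x - z\<bar> = \<bar>x - y\<bar> \<longrightarrow> lastbit0 E M y)"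
  have P: "?P (fz i)"
  proof (intro conjI ballI impI)
    show "fz i \<in> F" using iN F_fz by simp
    show "\<bar>x - fz i\<bar> \<le> \<bar>x - z\<bar>" if "z \<in> F" for z using that inr_nearest(1)[OF i(1)] F_cases by blast
    show "lastbit0 E M (fz i)" if z: "z \<in> F" "z \<noteq> fz i \<and> \<bar>x - z\<bar> = \<bar>x - fz i\<bar>" for z
    proof -
      obtain j where j: "z = fz j" using F_cases z(1) by blast
      then have "j \<noteq> i" using z by auto
      then have "even i" using inr_nearest(2)[OF i(1), of j] z j by auto
      then show ?thesis using lastbit0_fz iN by simp
    qed
  qed
  have uniq: "y = fz i" if y: "?P y" for y
  proof (rule ccontr)
    assume ne: "y \<noteq> fz i"
    obtain j where j: "y = fz j" "\<bar>j\<bar> \<le> N" using F_cases y by blast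
    have ji: "j \<noteq> i" using ne j by auto
    have eq: "\<bar>x - fz j\<bar> = \<bar>x - fz i\<bar>" using P y j by (meson order_antisym)
    then have "lastbit0 E M (fz j)" "lastbit0 E M (fz i)" using P y j ne by metis+
    then have ev: "even i" "even j" using lastbit0_fz iN j by auto
    \<comment> \<open>Between two equidistant floats of even index there is one of odd index, and it
      is strictly closer than both.\<close>
    define k where "k = (if i < j then i + 1 else j + 1)"
    have k: "min i j < k" "k < max i j" using ev ji unfolding k_def by (auto; presburger)+
    then have kF: "fz k \<in> F" using iN j by (auto simp: F_fz)
    have "fz (min i j) < fz k" "fz k < fz (max i j)" using k by simp_all
    then have "(fz i < fz k \<and> fz k < fz j) \<or> (fz j < fz k \<and> fz k < fz i)" by (auto simp: min_def max_def split: if_splits)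
    then have "\<bar>x - fz k\<bar> < \<bar>x - fz i\<bar>" using eq by linarith
    then show False using P kF by (meson not_less)
  qed
  have "(THE y. ?P y) = fz i" using P uniq by (rule the_equality)
  moreover have "\<not> x \<le> - Om - p2 (b - m) / 2" "\<not> x \<ge> Om + p2 (b - m) / 2"
    using assms unfolding ok_iff by linarith+
  ultimately show ?thesis
    unfolding rnd_def Let_def half_ulp by (simp add: i(2) Om_def[symmetric] F_def[symmetric])
qed

lemma rnd_PInf: "x \<ge> Om + p2 (b - m) / 2 \<Longrightarrow> rnd E M x = PInf"
proof -
  assume x: "x \<ge> Om + p2 (b - m) / 2"
  have "Om > 0" by (metis N_nonneg abs_fz_le abs_of_nonneg fz_0 fz_N fz_le fz_less order_le_less odd_N even_zero)
  then have "\<not> x \<le> - Om - p2 (b - m) / 2" using x p2_pos[of "b - m"] by linarith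
  then show ?thesis using x unfolding rnd_def Let_def half_ulp by (simp add: Om_def[symmetric])
qed

lemma rnd_MInf: "x \<le> - Om - p2 (b - m) / 2 \<Longrightarrow> rnd E M x = MInf"
  unfolding rnd_def Let_def half_ulp by (simp add: Om_def[symmetric])

lemma Om_pos: "Om > 0"
  by (metis N_nonneg fz_0 fz_N fz_less order_le_less odd_N even_zero)

lemma rr_F: "ok x \<Longrightarrow> rr x \<in> F"
  by (simp add: F_iff ok_def)

lemma F_ok: "x \<in> F \<Longrightarrow> ok x"
  by (simp add: F_iff ok_def rr_Fz)

lemma okI: "\<bar>x\<bar> \<le> Om \<Longrightarrow> ok x"
  unfolding ok_iff using p2_pos[of "b - m"] by linarith

lemma ok_minus: "ok (- x) = ok x"
  by (simp add: ok_def rr_minus)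

lemma F_minus: "x \<in> F \<Longrightarrow> - x \<in> F"
  by (simp add: F_iff Fz_minus)

lemma Om_F: "Om \<in> F"
  using F_fz[of N] N_nonneg by (simp add: fz_N)

lemma zero_F: "0 \<in> F"
  using F_fz[of 0] N_nonneg by simp

lemma p2b_le_Om: "p2 b \<le> Om"
proof -
  have "p2 (b - m) \<le> p2 b" using m3 by simp
  then show ?thesis by (simp add: Om_p2 p2_Suc)
qed

lemma p2_F: "a - m \<le> e \<Longrightarrow> e \<le> b \<Longrightarrow> p2 e \<in> F"
  using p2_Fz[of e] order_trans[OF iffD2[OF p2_le[of e b]] p2b_le_Om] by (simp add: F_iff)

lemma succ_fz: "\<bar>i\<bar> \<le> N \<Longrightarrow> i < N \<Longrightarrow> fsucc E M (fz i) = Fin (fz (i + 1))"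
proof -
  assume i: "\<bar>i\<bar> \<le> N" "i < N"
  have fin: "finite {y \<in> F. fz i < y}" 
    by (rule finite_subset[of _ "fz ` {-N..N}"]) (use F_cases in force, simp)
  have "Min {y \<in> F. fz i < y} = fz (i + 1)"
  proof (rule Min_eqI[OF fin])
    show "fz (i + 1) \<in> {y \<in> F. fz i < y}" using i F_fz by simp
    show "fz (i + 1) \<le> y" if "y \<in> {y \<in> F. fz i < y}" for y using that F_cases by fastforce
  qed
  moreover have "\<exists>y\<in>F. fz i < y" using i F_fz by (intro bexI[of _ "fz (i + 1)"]) auto
  ultimately show ?thesis by (simp add: fsucc_def F_def[symmetric])
qed

lemma rr_0_le: "0 \<le> x \<Longrightarrow> 0 \<le> rr x"
  using rr_mono[of 0 x] by simp

section \<open>Constants obtained by scaling an activation value\<close>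

lemma om_nonneg [simp]: "om \<ge> 0"
  using om_pos by linarith

lemma fz_small: "0 \<le> k \<Longrightarrow> k \<le> 2 ^ M \<Longrightarrow> fz k = of_int k * om"
proof -
  assume k: "0 \<le> k" "k \<le> 2 ^ M"
  then have "nat k \<le> 2 ^ M" by (simp add: nat_le_iff)
  then show ?thesis using fzn_block0[of "nat k"] k by (simp add: fz_def)
qed

lemma two_M: "(8::int) \<le> 2 ^ M"
  using power_increasing[of 3 M "2::int"] M3 by simp

lemma om_F: "k \<le> 8 \<Longrightarrow> real k * om \<in> F"
proof -
  assume k: "k \<le> 8"
  then have "fz (int k) = real k * om" using fz_small[of "int k"] order_trans[OF _ two_M, of "int k"] by simp
  moreover have "\<bar>int k\<bar> \<le> N"
  proof -
    have "2 ^ M * 2 \<le> idx (b + 1)" using a_le_b unfolding idx_def by (intro mult_left_mono) auto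
    then show ?thesis using k two_M unfolding N_def by simp
  qed
  ultimately show ?thesis using F_fz[of "int k"] by simp
qed

lemma om_p2: "p2 (a + k - m) = p2 k * om"
  by (simp add: om_def p2_add p2_diff)

lemma rr_om_err: "\<bar>x\<bar> \<le> 8 * om \<Longrightarrow> \<bar>x - rr x\<bar> \<le> om / 2"
proof -
  assume x: "\<bar>x\<bar> \<le> 8 * om"
  have "8 * om \<le> p2 (a + 1)" using om_p2[of 3] p2_le[of "a + 3 - m" "a + 1"] m3 by simp
  then show ?thesis using rr_err[of x a] x by (simp add: om_def)
qed

lemma rr_small:
  assumes "1 \<le> k" "k < 8" "(of_int k - 1/2) * om < x" "x < (of_int k + 1/2) * om \<or> (even k \<and> x \<le> (of_int k + 1/2) * om)"
  shows "rr x = of_int k * om"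
proof -
  have "fz (k - 1) = of_int (k - 1) * om" "fz k = of_int k * om" "fz (k + 1) = of_int (k + 1) * om"
    using assms two_M by (intro fz_small; simp)+
  then have "inr x k" using assms unfolding inr_def mid_def by (auto simp: algebra_simps)
  then show ?thesis using rrI \<open>fz k = of_int k * om\<close> by metis
qed

text \<open>Above the lowest binade a gap is at most 2^(-M) times the float, and M \<ge> 3.\<close>

lemma gap_le: "0 \<le> i \<Longrightarrow> gap i \<le> max om (fz i / 8)"
proof -
  assume "0 \<le> i"
  then obtain e where e: "a \<le> e" "gap i = p2 (e - m)" "e = a \<or> p2 e \<le> fz i" using gap_exp by metis
  show ?thesis
  proof (cases "e = a")
    case True then show ?thesis using e by (simp add: om_def)
  next
    case False
    have "p2 (e - m) \<le> p2 (e - 3)" using m3 by simp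
    also have "\<dots> = p2 e / 8" by (simp add: p2_diff)
    finally show ?thesis using e False by auto
  qed
qed

text \<open>The weight is the largest float with v * w \<le> H. The next float overshoots H, so the
  loss is below v times one gap, which \<open>gap_le\<close> bounds. The alternative w =
  \<open>Om\<close> occurs when even v * Om does not exceed H.\<close>

lemma scaled_hit:
  assumes "v > 0" "0 \<le> H"
  obtains w where "w \<in> F" "0 \<le> w" "v * w \<le> H" "w = Om \<or> H - max (v * om) (H / 8) < v * w"
proof (cases "v * Om \<le> H")
  case True then show ?thesis using that Om_F Om_pos by simp
next
  case False
  obtain i where i: "fz i \<le> H / v" "H / v < fz (i + 1)" using fz_bracket by blast
  have "0 \<le> H / v" using assms by simp
  then have "fz 0 < fz (i + 1)" using i by simp
  then have i0: "0 \<le> i" by (simp only: fz_less)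
  have "H / v < Om" using False assms by (simp add: field_simps)
  then have "fz i < fz N" using i fz_N by simp
  then have iF: "fz i \<in> F" using i0 F_fz by simp
  have le: "v * fz i \<le> H" using i(1) assms by (simp add: field_simps)
  have "H < v * (fz i + gap i)" using i(2) assms by (simp add: gap_def field_simps)
  also have "\<dots> \<le> v * fz i + max (v * om) (H / 8)"
  proof -
    have "v * gap i \<le> v * max om (fz i / 8)" using gap_le[OF i0] assms by simp
    also have "\<dots> = max (v * om) (v * fz i / 8)" using assms by (simp add: max_def)
    also have "\<dots> \<le> max (v * om) (H / 8)" using le by auto
    finally show ?thesis by (simp add: algebra_simps)
  qed
  finally have "H - max (v * om) (H / 8) < v * fz i" by simp
  moreover have "0 \<le> fz i" using i0 fz_le[of 0 i] by simp
  ultimately show ?thesis using that iF le by blast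
qed

lemma frac_Fz: "a \<le> e \<Longrightarrow> \<bar>k\<bar> \<le> 16 \<Longrightarrow> of_int k * p2 (e - m) \<in> Fz"
  by (rule Fz_mem) (use two_M in auto)

text \<open>An activation value \<open>v\<close> is strong enough for the binade \<open>e\<close> if multiples of it can exceed
  half a unit in the last place there.\<close>

definition strong :: "real \<Rightarrow> int \<Rightarrow> bool" where
  "strong v e \<longleftrightarrow> om \<le> v \<and> v \<le> 5 / 4 \<and> p2 (e - m) / 2 < rr (v * Om)"

lemma strong_mono: "strong v e \<Longrightarrow> e' \<le> e \<Longrightarrow> strong v e'"
proof -
  assume "strong v e" "e' \<le> e"
  moreover from this have "p2 (e' - m) \<le> p2 (e - m)" by simp
  ultimately show ?thesis unfolding strong_def by linarith
qed

lemma ok_scaled: "0 \<le> v * w \<Longrightarrow> v * w \<le> H \<Longrightarrow> H \<le> Om \<Longrightarrow> ok (v * w)"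
  by (intro okI) auto

lemma ulp_le_Om: "e \<le> b + 1 \<Longrightarrow> 2 * p2 (e - m) \<le> Om"
proof -
  assume "e \<le> b + 1"
  then have "p2 (e - m + 1) \<le> p2 b" using m3 by simp
  then show ?thesis using p2b_le_Om p2_Suc[of "e - m"] by linarith
qed

text \<open>The aim is 7/8 of the last place U. As 8 * om \<le> U and v \<le> 5/4, the loss is at
  most 5/32 U, so the product stays above 5/8 U; both fractions are floats and survive rounding.
  Strength covers the case w = \<open>Om\<close>. The bound strictly below U matters where a summand
  must be absorbed by a larger value.\<close>

lemma K78:
  assumes "strong v e" "a + 3 \<le> e" "e \<le> b"
  obtains w where "w \<in> F" "0 \<le> w" "ok (v * w)" "p2 (e - m) / 2 < rr (v * w)" "v * w \<le> 7 / 8 * p2 (e - m)"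
    "rr (v * w) \<le> 7 / 8 * p2 (e - m)"
proof -
  define U where "U = p2 (e - m)"
  have v: "0 < v" "v \<le> 5 / 4" using assms om_pos unfolding strong_def by linarith+
  have U8: "8 * om \<le> U" using om_p2[of 3] p2_le[of "a + 3 - m" "e - m"] assms by (simp add: U_def)
  then have U0: "U > 0" using om_pos by linarith
  obtain w where w: "w \<in> F" "0 \<le> w" "v * w \<le> 7 / 8 * U" "w = Om \<or> 7 / 8 * U - max (v * om) (7 / 8 * U / 8) < v * w"
    using scaled_hit[of v "7 / 8 * U"] v U0 by auto
  have U': "U = 8 * p2 (e - 3 - m)" by (simp add: U_def p2_diff)
  have "7 / 8 * U \<in> Fz" "5 / 8 * U \<in> Fz" using frac_Fz[of "e - 3" 7] frac_Fz[of "e - 3" 5] assms by (simp_all add: U')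
  then have hi: "rr (v * w) \<le> 7 / 8 * U" using w rr_le by blast
  have lo: "U / 2 < rr (v * w)"
  proof (cases "w = Om")
    case True then show ?thesis using assms by (simp add: strong_def U_def)
  next
    case False
    have h: "v * om \<le> 5 / 4 * om" using v by simp
    have "max (v * om) (7 / 8 * U / 8) \<le> 5 / 32 * U" by (rule max.boundedI) (use h U8 U0 in linarith)+
    then have "5 / 8 * U \<le> v * w" using w(4) False U0 by linarith
    then have "5 / 8 * U \<le> rr (v * w)" using rr_ge \<open>5 / 8 * U \<in> Fz\<close> by blast
    then show ?thesis using U0 by linarith
  qed
  have "2 * U \<le> Om" using ulp_le_Om[of e] assms(3) by (simp add: U_def)
  then have "7 / 8 * U \<le> Om" using U0 by linarith
  then have "ok (v * w)" using ok_scaled[of v w "7 / 8 * U"] w(2,3) v by simp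
  then show ?thesis using that w hi lo by (simp add: U_def)
qed

text \<open>These summands carry a value across a gap of size \<open>p2 (e - m)\<close>. In the
  three lowest binades the products are too coarse for \<open>K78\<close>, and the few possible
  multiples of \<open>om\<close> are inspected one by one.\<close>

lemma K:
  assumes "strong v e" "a \<le> e" "e \<le> b"
  obtains w where "w \<in> F" "0 \<le> w" "ok (v * w)" "p2 (e - m) / 2 < rr (v * w)" "rr (v * w) \<le> p2 (e - m)"
proof -
  have v: "0 < v" "v \<le> 5 / 4" using assms om_pos unfolding strong_def by linarith+
  have big: "8 * om \<le> Om" using om_F[of 8] by (simp add: F_iff abs_le_iff)
  have okx: "ok (v * w)" if "0 \<le> v * w" "v * w \<le> 8 * om" for w
    using that big by (intro okI) auto
  consider "a + 3 \<le> e" | "e = a" | "e = a + 1" | "e = a + 2" using assms by linarith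
  then show ?thesis
  proof cases
    case 1
    obtain w where w: "w \<in> F" "0 \<le> w" "ok (v * w)" "p2 (e - m) / 2 < rr (v * w)" "rr (v * w) \<le> 7 / 8 * p2 (e - m)"
      using K78[OF assms(1) 1 assms(3)] by blast
    moreover have "7 / 8 * p2 (e - m) \<le> p2 (e - m)" by simp
    ultimately show ?thesis using that by (meson order_trans)
  next
    case 2
    then have U: "p2 (e - m) = om" by (simp add: om_def)
    show ?thesis
    proof (cases "v > 1/2")
      case True
      have "rr (v * om) = of_int 1 * om" by (rule rr_small) (use True v om_pos in \<open>auto simp: algebra_simps\<close>)
      then show ?thesis using that[of om] om_F[of 1] okx[of om] v U True om_pos by (simp add: mult_le_cancel_right)
    next
      case False
      obtain w where w: "w \<in> F" "0 \<le> w" "v * w \<le> om" "w = Om \<or> om - max (v * om) (om / 8) < v * w"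
        using scaled_hit[of v om] v by auto
      have "om / 2 < rr (v * w)"
      proof (cases "w = Om")
        case True then show ?thesis using assms U by (simp add: strong_def)
      next
        case notOm: False
        have h: "v * om \<le> 1/2 * om" using False by (intro mult_right_mono) auto
        have "max (v * om) (om / 8) \<le> max (1/2 * om) (om / 8)" using h by (intro max.mono) auto
        also have "\<dots> \<le> 1/2 * om" using om_pos by simp
        finally have "om / 2 < v * w" using w(4) notOm by linarith
        then have "rr (v * w) = of_int 1 * om" using w(3) om_pos by (intro rr_small) auto
        then show ?thesis by simp
      qed
      moreover have "rr (v * w) \<le> om" using w rr_le om_F[of 1] by (simp add: F_iff)
      ultimately show ?thesis using that[of w] w U okx[of w] v om_pos by simp
    qed
  next
    case 3
    then have U: "p2 (e - m) = 2 * om" using om_p2[of 1] by simp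
    have two: "rr (v * w) = 2 * om" if "3 / 2 * om < v * w" "v * w \<le> 5 / 2 * om" for w
      using rr_small[of 2 "v * w"] that by simp
    consider "v > 3 / 4" | "1/2 < v" "v \<le> 3 / 4" | "v \<le> 1/2" by linarith
    then show ?thesis
    proof cases
      case 1
      then have "rr (v * (2 * om)) = 2 * om" using v om_pos by (intro two) (auto simp: algebra_simps)
      then show ?thesis using that[of "2 * om"] om_F[of 2] okx[of "2 * om"] v U om_pos by (simp add: mult_le_cancel_right)
    next
      case 2
      then have "rr (v * (3 * om)) = 2 * om" using v om_pos by (intro two) (auto simp: algebra_simps)
      then show ?thesis using that[of "3 * om"] om_F[of 3] okx[of "3 * om"] v U om_pos by (simp add: mult_le_cancel_right)
    next
      case 3
      obtain w where w: "w \<in> F" "0 \<le> w" "v * w \<le> 2 * om" "w = Om \<or> 2 * om - max (v * om) (2 * om / 8) < v * w"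
        using scaled_hit[of v "2 * om"] v by auto
      have "om < rr (v * w)"
      proof (cases "w = Om")
        case True then show ?thesis using assms U by (simp add: strong_def)
      next
        case notOm: False
        have h: "v * om \<le> 1/2 * om" using 3 by (intro mult_right_mono) auto
        have "max (v * om) (2 * om / 8) \<le> max (1/2 * om) (2 * om / 8)" using h by (intro max.mono) auto
        also have "\<dots> \<le> 1/2 * om" using om_pos by simp
        finally have "3 / 2 * om < v * w" using w(4) notOm by linarith
        then have "rr (v * w) = 2 * om" using w(3) om_pos by (intro two) auto
        then show ?thesis by simp
      qed
      moreover have "rr (v * w) \<le> 2 * om" using w rr_le om_F[of 2] by (simp add: F_iff)
      ultimately show ?thesis using that[of w] w U okx[of w] v om_pos by simp
    qed
  next
    case 4
    then have U: "p2 (e - m) = 4 * om" using om_p2[of 2] by simp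
    obtain w where w: "w \<in> F" "0 \<le> w" "v * w \<le> 4 * om" "w = Om \<or> 4 * om - max (v * om) (4 * om / 8) < v * w"
      using scaled_hit[of v "4 * om"] v by auto
    have "2 * om < rr (v * w)"
    proof (cases "w = Om")
      case True then show ?thesis using assms U by (simp add: strong_def)
    next
      case notOm: False
      have h: "v * om \<le> 5/4 * om" using v by (intro mult_right_mono) auto
      have "max (v * om) (4 * om / 8) \<le> max (5/4 * om) (4 * om / 8)" using h by (intro max.mono) auto
      also have "\<dots> \<le> 5/4 * om" using om_pos by simp
      finally have "11 / 4 * om < v * w" using w(4) notOm by linarith
      moreover from this have "\<bar>v * w\<bar> \<le> 8 * om" using w(3) om_pos by linarith
      ultimately show ?thesis using rr_om_err[of "v * w"] om_pos by linarith
    qed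
    moreover have "rr (v * w) \<le> 4 * om" using w rr_le om_F[of 4] by (simp add: F_iff)
    ultimately show ?thesis using that[of w] w U okx[of w] v om_pos by simp
  qed
qed

lemma Fz_pos_ge: "x \<in> Fz \<Longrightarrow> 0 < x \<Longrightarrow> om \<le> x"
proof -
  assume "x \<in> Fz" "0 < x"
  then obtain i where i: "x = fz i" "fz 0 < fz i" by (auto simp: Fz_def)
  then have "1 \<le> i" by (simp only: fz_less)
  then have "fz 1 \<le> fz i" by simp
  then show ?thesis using i fz_1 by simp
qed

text \<open>Moving two adjacent floats downwards together takes a summand of at least the whole
  lower gap, see \<open>adjacent_down\<close>. Strength one binade higher is what lets the product
  with \<open>Om\<close> exceed the whole U instead of half of it.\<close>

lemma K1:
  assumes "strong v (e + 1)" "a \<le> e" "e < b"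
  obtains w where "w \<in> F" "0 \<le> w" "ok (v * w)" "p2 (e - m) \<le> rr (v * w)" "rr (v * w) \<le> 5 / 4 * p2 (e - m)"
proof -
  define U where "U = p2 (e - m)"
  have U0: "U > 0" by (simp add: U_def)
  have v: "0 < v" "v \<le> 5 / 4" using assms om_pos unfolding strong_def by linarith+
  have sOm: "U < rr (v * Om)" using assms p2_Suc[of "e - m"] unfolding strong_def U_def by (simp add: algebra_simps)
  have UOm: "2 * U \<le> Om" using ulp_le_Om[of e] assms by (simp add: U_def)
  have se: "strong v e" using strong_mono assms(1) by simp
  consider "a + 3 \<le> e" | "e = a" | "e = a + 1" | "e = a + 2" using assms by linarith
  then show ?thesis
  proof cases
    case 1
    have U8: "8 * om \<le> U" using om_p2[of 3] p2_le[of "a + 3 - m" "e - m"] 1 by (simp add: U_def)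
    obtain w where w: "w \<in> F" "0 \<le> w" "v * w \<le> 5 / 4 * U" "w = Om \<or> 5 / 4 * U - max (v * om) (5 / 4 * U / 8) < v * w"
      using scaled_hit[of v "5 / 4 * U"] v U0 by auto
    have U': "U = 8 * p2 (e - 3 - m)" by (simp add: U_def p2_diff)
    have "5 / 4 * U \<in> Fz" "U \<in> Fz" using frac_Fz[of "e - 3" 10] frac_Fz[of "e - 3" 8] 1 by (simp_all add: U')
    then have hi: "rr (v * w) \<le> 5 / 4 * U" using w rr_le by blast
    have lo: "U \<le> rr (v * w)"
    proof (cases "w = Om")
      case True then show ?thesis using sOm by simp
    next
      case False
      have h: "v * om \<le> 5 / 4 * om" using v by simp
      have "max (v * om) (5 / 4 * U / 8) \<le> 5 / 32 * U" by (rule max.boundedI) (use h U8 U0 in linarith)+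
      then have "U \<le> v * w" using w(4) False U0 by linarith
      then show ?thesis using rr_ge \<open>U \<in> Fz\<close> by blast
    qed
    have "5 / 4 * U \<le> Om" using UOm U0 by linarith
    then have "ok (v * w)" using ok_scaled[of v w "5 / 4 * U"] w(2,3) v by simp
    then show ?thesis using that w hi lo by (simp add: U_def)
  next
    case 2
    then obtain w where w: "w \<in> F" "0 \<le> w" "ok (v * w)" "om / 2 < rr (v * w)" "rr (v * w) \<le> om"
      using K[OF se] assms(3) by (auto simp: om_def)
    then have "om \<le> rr (v * w)" using om_pos by (intro Fz_pos_ge) (auto intro: less_trans[rotated])
    then show ?thesis using that[of w] w 2 om_pos by (simp add: om_def)
  next
    case 3
    then have Ue: "p2 (e - m) = 2 * om" using om_p2[of 1] by simp
    obtain w where w: "w \<in> F" "0 \<le> w" "ok (v * w)" "om < rr (v * w)" "rr (v * w) \<le> 2 * om"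
      using K[OF se assms(2)] assms(3) unfolding Ue by auto
    obtain i where i: "rr (v * w) = fz i" using rr_in[of "v * w"] unfolding Fz_def by blast
    have "fz 1 < fz i" using w i fz_1 by simp
    then have "fz 2 \<le> fz i" by simp
    then have "2 * om \<le> rr (v * w)" using i fz_small[of 2] two_M by simp
    then show ?thesis using that[of w] w Ue om_pos by simp
  next
    case 4
    then have Ue: "U = 4 * om" using om_p2[of 2] by (simp add: U_def)
    obtain w where w: "w \<in> F" "0 \<le> w" "v * w \<le> 5 * om" "w = Om \<or> 5 * om - max (v * om) (5 * om / 8) < v * w"
      using scaled_hit[of v "5 * om"] v by auto
    have "4 * om \<le> rr (v * w)"
    proof (cases "w = Om")
      case True then show ?thesis using sOm Ue by simp
    next
      case notOm: False
      have h: "v * om \<le> 5/4 * om" using v by (intro mult_right_mono) auto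
      have "max (v * om) (5 * om / 8) \<le> max (5/4 * om) (5 * om / 8)" using h by (intro max.mono) auto
      also have "\<dots> \<le> 5/4 * om" using om_pos by simp
      finally have "15 / 4 * om < v * w" using w(4) notOm by linarith
      then have "rr (15 / 4 * om) \<le> rr (v * w)" by (intro rr_mono) simp
      moreover have "rr (15 / 4 * om) = 4 * om" using rr_small[of 4 "15 / 4 * om"] om_pos by simp
      ultimately show ?thesis by simp
    qed
    moreover have "rr (v * w) \<le> 5 * om" using w rr_le om_F[of 5] by (simp add: F_iff)
    moreover have "ok (v * w)" using ok_scaled[of v w "5 * om"] w v UOm Ue om_pos by simp
    ultimately show ?thesis using that[of w] w Ue by (simp add: U_def)
  qed
qed

text \<open>The factor 3/2 keeps the base in the lower half of its binade, so that the floats just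
  above it are evenly spaced.\<close>

lemma base_constant:
  assumes "0 < v" "v * om \<le> p2 e / 8" "p2 e \<le> rr (v * Om)" "a \<le> e" "e < b"
  obtains w where "w \<in> F" "0 \<le> w" "ok (v * w)" "p2 e \<le> rr (v * w)" "rr (v * w) \<le> 3 / 2 * p2 e"
proof -
  have pe: "p2 e > 0" by simp
  obtain w where w: "w \<in> F" "0 \<le> w" "v * w \<le> 3 / 2 * p2 e" "w = Om \<or> 3 / 2 * p2 e - max (v * om) (3 / 2 * p2 e / 8) < v * w"
    using scaled_hit[of v "3 / 2 * p2 e"] assms(1) pe by auto
  have "(2::real) ^ M = 2 * 2 ^ (M - 1)" using M3 by (cases M) auto
  then have "p2 e = 2 * 2 ^ (M - 1) * p2 (e - m)" by (simp add: p2_diff p2_nat)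
  then have "3 / 2 * p2 e = of_int (3 * 2 ^ (M - 1)) * p2 (e - m)" by simp
  moreover have "(2::int) ^ (M + 1) = 4 * 2 ^ (M - 1)" using M3 by (cases M) auto
  ultimately have "3 / 2 * p2 e \<in> Fz" using Fz_mem[of "3 * 2 ^ (M - 1)" e] assms(4) by (simp add: ac_simps)
  then have hi: "rr (v * w) \<le> 3 / 2 * p2 e" using w rr_le by blast
  have "p2 e \<le> rr (v * w)"
  proof (cases "w = Om")
    case False
    moreover have "max (v * om) (3 / 2 * p2 e / 8) \<le> 1/2 * p2 e" by (rule max.boundedI) (use assms(2) pe in linarith)+
    ultimately have "p2 e \<le> v * w" using w(4) by linarith
    then show ?thesis using rr_ge p2_Fz[of e] assms(4) m3 by simp
  qed (use assms in simp)
  moreover have "3 / 2 * p2 e \<le> Om"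
    using p2_le[of "e + 1" b] p2_Suc[of e] p2b_le_Om assms(5) pe by linarith
  then have "ok (v * w)" using w assms(1) by (intro ok_scaled[of v w "3 / 2 * p2 e"]) auto
  ultimately show ?thesis using that w hi by blast
qed

section \<open>Addition programs and the collapse of a noisy bit\<close>

text \<open>\<open>P l0 u0 l1 u1\<close> stands for: some partial sum has its value in \<open>[l0, u0]\<close> when a given bit is
  off and in \<open>[l1, u1]\<close> when it is on. Each pair \<open>(c0, c1)\<close> in \<open>T\<close> is a summand with value \<open>c0\<close>
  when the bit is off and \<open>c1\<close> when it is on.\<close>

definition prog :: "(real \<times> real) set \<Rightarrow> (real \<Rightarrow> real \<Rightarrow> real \<Rightarrow> real \<Rightarrow> bool) \<Rightarrow> bool" where
  "prog T P \<longleftrightarrow>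
     (\<forall>l0 u0 l1 u1 l0' u0' l1' u1'. P l0 u0 l1 u1 \<longrightarrow> l0' \<le> l0 \<longrightarrow> u0 \<le> u0' \<longrightarrow> l1' \<le> l1 \<longrightarrow> u1 \<le> u1' \<longrightarrow> P l0' u0' l1' u1') \<and>
     (\<forall>l0 u0 l1 u1 c0 c1. P l0 u0 l1 u1 \<longrightarrow> (c0, c1) \<in> T \<longrightarrow>
        ok (l0 + c0) \<longrightarrow> ok (u0 + c0) \<longrightarrow> ok (l1 + c1) \<longrightarrow> ok (u1 + c1) \<longrightarrow>
        P (rr (l0 + c0)) (rr (u0 + c0)) (rr (l1 + c1)) (rr (u1 + c1)))"

lemma prog_weaken:
  "prog T P \<Longrightarrow> P l0 u0 l1 u1 \<Longrightarrow> l0' \<le> l0 \<Longrightarrow> u0 \<le> u0' \<Longrightarrow> l1' \<le> l1 \<Longrightarrow> u1 \<le> u1' \<Longrightarrow> P l0' u0' l1' u1'"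
  unfolding prog_def by blast

lemma prog_step:
  assumes "prog T P" "(c0, c1) \<in> T" "P l0 u0 l1 u1"
    and "\<bar>l0 + c0\<bar> \<le> Om" "\<bar>u0 + c0\<bar> \<le> Om" "\<bar>l1 + c1\<bar> \<le> Om" "\<bar>u1 + c1\<bar> \<le> Om"
    and "l0' \<le> rr (l0 + c0)" "rr (u0 + c0) \<le> u0'" "l1' \<le> rr (l1 + c1)" "rr (u1 + c1) \<le> u1'"
  shows "P l0' u0' l1' u1'"
proof -
  have "P (rr (l0 + c0)) (rr (u0 + c0)) (rr (l1 + c1)) (rr (u1 + c1))"
    using assms(1)[unfolded prog_def, THEN conjunct2, rule_format, OF assms(3,2)] okI assms(4-7) by blast
  then show ?thesis using prog_weaken[OF assms(1)] assms(8-) by blast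
qed

section \<open>Rounding next to a large base\<close>

lemma rr_gt:
  assumes "x \<in> Fz" "0 \<le> x" "om \<le> d" "x / 8 \<le> d"
  shows "x < rr (x + d)"
proof -
  obtain i where i: "x = fz i" using assms by (auto simp: Fz_def)
  then have "0 \<le> i" using assms(2) fz_le[of 0 i] by simp
  then have "gap i \<le> d" using gap_le[of i] assms i by simp
  then have "fz (i + 1) \<le> rr (x + d)" using i by (intro rr_ge) (auto simp: gap_def)
  moreover have "fz i < fz (i + 1)" by simp
  ultimately show ?thesis using i by linarith
qed

lemma rr_near:
  assumes "fz i - gap (i - 1) / 2 \<le> x" "x \<le> fz i + gap i / 2" "even i"
  shows "rr x = fz i"
  using assms mid_gap[of i] mid_gap(2)[of "i - 1"] by (intro rrI) (auto simp: inr_def)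

lemma rr_near_strict:
  assumes "fz i - gap (i - 1) / 2 < x" "x < fz i + gap i / 2"
  shows "rr x = fz i"
  using assms mid_gap[of i] mid_gap(2)[of "i - 1"] by (intro rrI) (auto simp: inr_def)

lemma gap_idx: "a \<le> e \<Longrightarrow> gap (idx e) = p2 (e - m)"
  by (rule gap_form) (auto simp: idx_Suc)

lemma gap_below_idx: "a < e \<Longrightarrow> gap (idx e - 1) = p2 (e - 1 - m)"
  using idx_Suc[of "e - 1"] by (intro gap_form) auto

lemma rr_p2_up: "a \<le> e \<Longrightarrow> 0 \<le> d \<Longrightarrow> d \<le> p2 (e - m) / 2 \<Longrightarrow> rr (p2 e + d) = p2 e"
  using rr_near[of "idx e" "p2 e + d"] gap_idx[of e] fz_idx[of e] even_idx gap_pos[of "idx e - 1"] by simp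

lemma rr_up_le: "a \<le> e \<Longrightarrow> x \<le> p2 e + p2 (e - m) / 2 \<Longrightarrow> rr x \<le> p2 e"
  using rr_mono[of x "p2 e + p2 (e - m) / 2"] rr_p2_up[of e "p2 (e - m) / 2"] by simp

lemma rr_down_ge: "a \<le> e \<Longrightarrow> - (p2 e + p2 (e - m) / 2) \<le> x \<Longrightarrow> - p2 e \<le> rr x"
  using rr_up_le[of e "- x"] by (simp add: rr_minus)

text \<open>A base in the lower half of its binade is followed by at least 2^(M-1) \<ge> 4 further
  floats with the gap of that binade.\<close>

lemma base_grid:
  assumes "a \<le> e" "p2 e \<le> B" "B \<le> 3 / 2 * p2 e" "B \<in> Fz"
  obtains i r where "B = fz i" "\<And>k. 0 \<le> k \<Longrightarrow> k \<le> 4 \<Longrightarrow> fz (i + k) = B + of_int k * p2 (e - m)"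
    "i = idx e + r" "0 \<le> r" "r \<le> 2 ^ (M - 1)" "B = of_int (2 ^ M + r) * p2 (e - m)"
proof -
  obtain i where i: "B = fz i" using assms by (auto simp: Fz_def)
  define r where "r = i - idx e"
  have h: "(2::real) ^ M = 2 * 2 ^ (M - 1)" "(2::int) ^ M = 2 * 2 ^ (M - 1)" using M3 by (cases M; simp)+
  have pe: "p2 e = 2 ^ M * p2 (e - m)" by (simp add: p2_diff p2_nat)
  have "fz (idx e + 2 ^ (M - 1)) = of_int (2 ^ M + 2 ^ (M - 1)) * p2 (e - m)"
    using assms h by (intro fz_form) auto
  also have "\<dots> = 3 / 2 * p2 e" by (simp add: pe h)
  finally have "fz i \<le> fz (idx e + 2 ^ (M - 1))" using assms(3) i by linarith
  then have r1: "r \<le> 2 ^ (M - 1)" by (simp add: r_def)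
  have "fz (idx e) \<le> fz i" using assms i fz_idx[of e] by simp
  then have r0: "0 \<le> r" by (simp add: r_def)
  have four: "(4::int) \<le> 2 ^ (M - 1)" using power_increasing[of 2 "M - 1" "2::int"] M3 by simp
  have form: "fz (idx e + (r + k)) = of_int (2 ^ M + (r + k)) * p2 (e - m)" if "0 \<le> k" "k \<le> 4" for k
    using that assms r0 r1 four h by (intro fz_form) auto
  have B: "B = of_int (2 ^ M + r) * p2 (e - m)" using form[of 0] i by (simp add: r_def)
  have g: "fz (i + k) = B + of_int k * p2 (e - m)" if "0 \<le> k" "k \<le> 4" for k
    using form[OF that] B by (simp add: r_def algebra_simps)
  have ir: "i = idx e + r" by (simp add: r_def)
  show ?thesis by (rule that[OF i g ir r0 r1 B])
qed

text \<open>What remains of a small x after it is added to a base B with last place U. The bounds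
  for negative x are weaker than those for positive x since B may be a power of two, where the gap
  below can be only U / 2.\<close>

lemma base_round:
  assumes "a \<le> e" "p2 e \<le> B" "B \<le> 3 / 2 * p2 e" "B \<in> Fz"
  shows "\<And>x k. 0 \<le> k \<Longrightarrow> k \<le> 3 \<Longrightarrow> x < (of_int k + 1/2) * p2 (e - m) \<Longrightarrow> rr (B + x) \<le> B + of_int k * p2 (e - m)"
    and "\<And>x. p2 (e - m) / 2 < x \<Longrightarrow> B + p2 (e - m) \<le> rr (B + x)"
    and "\<And>x. - p2 (e - m) / 4 \<le> x \<Longrightarrow> B \<le> rr (B + x)"
    and "\<And>x. - p2 (e - m) / 2 < x \<Longrightarrow> B - p2 (e - m) / 2 \<le> rr (B + x)"
    and "B - p2 (e - m) \<in> Fz"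
proof -
  define U where "U = p2 (e - m)"
  have U0: "U > 0" by (simp add: U_def)
  obtain i r where B: "B = fz i" and g: "\<And>k. 0 \<le> k \<Longrightarrow> k \<le> 4 \<Longrightarrow> fz (i + k) = B + of_int k * U"
    and r: "i = idx e + r" "0 \<le> r" "r \<le> 2 ^ (M - 1)" and Br: "B = of_int (2 ^ M + r) * U"
    using base_grid[OF assms] unfolding U_def by metis
  have up: "gap (i + k) = U" if "0 \<le> k" "k \<le> 3" for k
    using g[of k] g[of "k + 1"] that by (simp add: gap_def add.assoc) (simp add: algebra_simps)
  show le: "rr (B + x) \<le> B + of_int k * p2 (e - m)" if "0 \<le> k" "k \<le> 3" "x < (of_int k + 1/2) * p2 (e - m)" for x k
  proof -
    define x' where "x' = max x (of_int k * U)"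
    have "rr (B + x') = fz (i + k)"
      by (rule rr_near_strict) (use that g[of k] up[of k] gap_pos[of "i + k - 1"] U0 in \<open>auto simp: x'_def U_def[symmetric] algebra_simps max_def\<close>)
    moreover have "rr (B + x) \<le> rr (B + x')" by (rule rr_mono) (simp add: x'_def)
    ultimately show ?thesis using g[of k] that by (simp add: U_def)
  qed
  show "B + p2 (e - m) \<le> rr (B + x)" if "p2 (e - m) / 2 < x" for x
  proof -
    define x' where "x' = min x U"
    have "rr (B + x') = fz (i + 1)"
      by (rule rr_near_strict) (use that g[of 1] up[of 0] up[of 1] U0 in \<open>auto simp: x'_def U_def[symmetric] min_def\<close>)
    moreover have "rr (B + x') \<le> rr (B + x)" by (rule rr_mono) (simp add: x'_def)
    ultimately show ?thesis using g[of 1] by (simp add: U_def)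
  qed
  have below: "(r = 0 \<and> (gap (i - 1) = U / 2 \<or> gap (i - 1) = U)) \<or> gap (i - 1) = U"
  proof (cases "r = 0")
    case True
    show ?thesis
    proof (cases "e = a")
      case True
      then have "gap (i - 1) = om" using \<open>r = 0\<close> r idx_pos[of a] idx_Suc[of a] \<open>e = a\<close> two_M by (intro gap_low) simp_all
      then show ?thesis using True \<open>r = 0\<close> by (simp add: om_def U_def)
    next
      case False
      then have "gap (i - 1) = U / 2" using gap_below_idx[of e] assms True r by (simp add: U_def p2_diff)
      then show ?thesis using True by simp
    qed
  next
    case False
    have "2 ^ (M - 1) \<le> (2::int) ^ M" by simp
    then have "r - 1 < 2 ^ M" using r by linarith
    then have "gap (i - 1) = U" unfolding U_def using False r assms by (intro gap_form) (auto simp: idx_Suc)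
    then show ?thesis by simp
  qed
  show "B \<le> rr (B + x)" if "- p2 (e - m) / 4 \<le> x" for x
  proof -
    define x' where "x' = min x 0"
    have x': "- U / 4 \<le> x'" "x' \<le> 0" using that U0 by (auto simp: x'_def U_def)
    \<comment> \<open>If B is a power of two, - U / 4 may be the midpoint of the halved gap below;
      its even index wins the tie.\<close>
    have "rr (B + x') = fz i"
    proof (cases "r = 0")
      case True
      then show ?thesis using x' below B even_idx[of e] r up[of 0] U0 by (intro rr_near) auto
    next
      case False
      then show ?thesis using x' below B up[of 0] U0 by (intro rr_near_strict) auto
    qed
    moreover have "rr (B + x') \<le> rr (B + x)" by (rule rr_mono) (simp add: x'_def)
    ultimately show ?thesis using B by simp
  qed
  show "B - p2 (e - m) / 2 \<le> rr (B + x)" if "- p2 (e - m) / 2 < x" for x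
  proof (cases "gap (i - 1) = U")
    case True
    define x' where "x' = min x 0"
    have "- U / 2 < x'" "x' \<le> 0" using that U0 by (auto simp: x'_def U_def)
    then have "rr (B + x') = fz i" using True B up[of 0] U0 by (intro rr_near_strict) auto
    moreover have "rr (B + x') \<le> rr (B + x)" by (rule rr_mono) (simp add: x'_def)
    ultimately show ?thesis using B U0 unfolding U_def by linarith
  next
    case False
    then have "gap (i - 1) = U / 2" using below by auto
    then have "fz (i - 1) = B - U / 2" using B by (simp add: gap_def)
    then have "B - U / 2 \<in> Fz" by (metis fz_in)
    then show ?thesis using rr_ge[of "B - U / 2" "B + x"] that by (simp add: U_def)
  qed
  have "B - U = of_int (2 ^ M + r - 1) * p2 (e - m)" using Br by (simp add: U_def algebra_simps)
  moreover have "2 ^ (M - 1) \<le> (2::int) ^ M" by simp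
  then have "0 \<le> 2 ^ M + r - 1" "2 ^ M + r - 1 \<le> 2 * 2 ^ M" using r two_M by linarith+
  then have "\<bar>2 ^ M + r - 1\<bar> \<le> (2::int) ^ (M + 1)" by simp
  ultimately show "B - p2 (e - m) \<in> Fz" using Fz_mem[of "2 ^ M + r - 1" e] assms(1) by (simp add: U_def)
qed

section \<open>Doubling a threshold\<close>

definition amp :: "(real \<times> real) set \<Rightarrow> bool" where
  "amp T \<longleftrightarrow> (\<forall>e. a + 2 \<le> e \<and> e \<le> 6 \<longrightarrow> (\<exists>B\<in>Fz. p2 e \<le> B \<and> B \<le> 3 / 2 * p2 e \<and> (B, B) \<in> T \<and> (- B, - B) \<in> T)) \<and>
     (\<forall>e. a \<le> e \<and> e \<le> 6 \<longrightarrow> (\<exists>d\<in>Fz. p2 (e - m) / 2 < d \<and> d \<le> p2 (e - m) \<and> (d, d) \<in> T))"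

text \<open>The summand d is taken two binades below the base: it is then at most U / 4, too small
  to lift an off value, but large enough to push U / 2 off the tie.\<close>

lemma amp_obtain:
  assumes "amp T" "a + 2 \<le> e" "e \<le> 6"
  obtains B d where "B \<in> Fz" "p2 e \<le> B" "B \<le> 3 / 2 * p2 e" "(B, B) \<in> T" "(- B, - B) \<in> T"
    "d \<in> Fz" "p2 (e - m) / 8 < d" "d \<le> p2 (e - m) / 4" "(d, d) \<in> T" "om \<le> d"
proof -
  obtain B where B: "B \<in> Fz" "p2 e \<le> B" "B \<le> 3 / 2 * p2 e" "(B, B) \<in> T" "(- B, - B) \<in> T"
    using assms unfolding amp_def by blast
  have "a \<le> e - 2" "e - 2 \<le> 6" using assms by auto
  then obtain d where d: "d \<in> Fz" "p2 (e - 2 - m) / 2 < d" "d \<le> p2 (e - 2 - m)" "(d, d) \<in> T"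
    using assms unfolding amp_def by blast
  have q: "p2 (e - 2 - m) = p2 (e - m) / 4" by (simp add: p2_diff)
  then have "0 < d" using d p2_pos[of "e - m"] by linarith
  then have "om \<le> d" using Fz_pos_ge d by blast
  moreover have "p2 (e - m) / 8 < d" "d \<le> p2 (e - m) / 4" using d(2,3) unfolding q by auto
  ultimately show ?thesis using that B d(1,4) by blast
qed

text \<open>Adding \<open>d\<close>, adding \<open>B\<close> and subtracting \<open>B\<close> rounds to multiples of the last place \<open>U\<close> of \<open>B\<close>
  while moving a threshold between \<open>0\<close> and \<open>U / 2\<close> to one between \<open>0\<close> and \<open>U\<close>.\<close>

lemma double_far:
  assumes P: "prog T P" "amp T" and e: "a + 2 \<le> e" "e \<le> 6" "e + 1 \<le> y" "y < b"
    and st: "P (- p2 y) 0 (p2 (e - m) / 2) (p2 y)"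
  shows "P (- p2 y) 0 (p2 (e - m)) (p2 y)"
proof -
  define U Y where "U = p2 (e - m)" and "Y = p2 y"
  obtain B d where B: "B \<in> Fz" "p2 e \<le> B" "B \<le> 3 / 2 * p2 e" "(B, B) \<in> T" "(- B, - B) \<in> T"
    and d: "d \<in> Fz" "U / 8 < d" "d \<le> U / 4" "(d, d) \<in> T" "om \<le> d"
    using amp_obtain[OF P(2) e(1,2)] unfolding U_def by metis
  have ae: "a \<le> e" "a \<le> y" using e by auto
  note br = base_round[OF ae(1) B(2,3,1), folded U_def]
  have U0: "U > 0" by (simp add: U_def)
  have "2 * p2 e \<le> Y" using e p2_le[of "e + 1" y] p2_Suc[of e] by (simp add: Y_def)
  then have BY: "B \<le> 3 / 4 * Y" "0 \<le> B" using B p2_pos[of e] by linarith+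
  have UY: "U \<le> Y / 16" using p2_le[of "e - m" "y - 4"] e m3 p2_diff[of y 4] by (simp add: U_def Y_def) 
  have Y0: "Y > 0" by (simp add: Y_def)
  define V where "V = p2 (y - m)"
  have V: "2 * U \<le> V" using p2_le[of "e - m + 1" "y - m"] p2_Suc[of "e - m"] e by (simp add: U_def V_def)
  have YOm: "2 * Y \<le> Om" using p2_le[of "y + 1" b] p2_Suc[of y] p2b_le_Om e by (simp add: Y_def)
  have FzY: "Y \<in> Fz" "- Y \<in> Fz" using p2_Fz[of y] Fz_minus ae m3 by (auto simp: Y_def)
  have Uh: "U / 2 \<in> Fz" "U \<in> Fz" using p2_Fz[of "e - m - 1"] p2_Fz[of "e - m"] e by (simp_all add: U_def p2_diff)
  \<comment> \<open>At B the value U / 2 would be a tie; after the addition of d it lies strictly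
    above.\<close>
  obtain x where x: "U / 2 < x" "x \<le> U" "x = rr (U / 2 + d)"
    using rr_gt[OF Uh(1) _ d(5)] d U0 rr_le[of "U / 2 + d" U] Uh by auto
  have s1: "P (- Y) (U / 4) x Y"
  proof (rule prog_step[OF P(1) d(4) st[folded U_def Y_def]])
    show "rr (Y + d) \<le> Y" using rr_up_le[of y "Y + d"] ae d V by (simp add: Y_def V_def)
    show "- Y \<le> rr (- Y + d)" using FzY d U0 by (intro rr_ge) auto
    show "rr (0 + d) \<le> U / 4" using d by (simp add: rr_Fz)
    show "x \<le> rr (U / 2 + d)" using x by simp
  qed (use d U0 UY YOm Y0 in \<open>simp_all add: abs_le_iff\<close>)
  \<comment> \<open>Next to B the off values, at most U / 4, disappear, and the on values, above U /
    2, become at least one full place.\<close>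
  have s2: "P (B - Y - V / 4) B (B + U) (B + Y + V / 2)"
  proof (rule prog_step[OF P(1) B(4) s1])
    have "\<bar>- Y + B\<bar> \<le> p2 (y - 1 + 1)" using BY by (simp add: Y_def abs_le_iff)
    then have "\<bar>- Y + B - rr (- Y + B)\<bar> \<le> p2 (y - 1 - m) / 2" by (rule rr_err) (use e in simp)
    then show "B - Y - V / 4 \<le> rr (- Y + B)" by (simp add: V_def p2_diff)
    have "\<bar>Y + B\<bar> \<le> p2 (y + 1)" using BY p2_Suc[of y] by (simp add: Y_def)
    from rr_err[OF this ae(2)] show "rr (Y + B) \<le> B + Y + V / 2" unfolding V_def by linarith
    show "rr (U / 4 + B) \<le> B" using br(1)[of 0 "U / 4"] U0 by (simp add: add.commute)
    show "B + U \<le> rr (x + B)" using br(2)[of x] x by (simp add: add.commute)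
  qed (use x U0 UY YOm BY Y0 in \<open>simp_all add: abs_le_iff\<close>)
  have VY: "V \<le> Y / 8" using p2_le[of "y - m" "y - 3"] m3 p2_diff[of y 3] by (simp add: V_def Y_def)
  have "P (- Y) 0 U Y"
  proof (rule prog_step[OF P(1) B(5) s2])
    show "- Y \<le> rr (B - Y - V / 4 + - B)" using rr_down_ge[of y "- Y - V / 4"] ae by (simp add: Y_def V_def)
    show "rr (B + Y + V / 2 + - B) \<le> Y" using rr_up_le[of y "Y + V / 2"] ae by (simp add: Y_def V_def)
    show "U \<le> rr (B + U + - B)" using Uh by (simp add: rr_Fz)
  qed (use U0 UY YOm Y0 VY V in \<open>simp_all add: abs_le_iff\<close>)
  then show ?thesis by (simp add: U_def Y_def)
qed

text \<open>Beyond 2^(M+1) the even multiples are still floats, so rounding up costs at most one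
  unit.\<close>

lemma rr_mult_le:
  assumes "a \<le> e" "0 \<le> n" "n < 2 ^ (M + 2)"
  shows "rr (of_int n * p2 (e - m)) \<le> of_int (n + 1) * p2 (e - m)"
proof (cases "n \<le> 2 ^ (M + 1)")
  case True
  then have "of_int n * p2 (e - m) \<in> Fz" using assms by (intro Fz_mem) auto
  then show ?thesis by (simp add: rr_Fz)
next
  case False
  define k where "k = (n + 1) div 2"
  have k: "n \<le> 2 * k" "2 * k \<le> n + 1" by (simp_all add: k_def)
  have "k \<le> 2 ^ (M + 1)" using k assms(3) by simp
  then have "of_int k * p2 (e + 1 - m) \<in> Fz" using assms k by (intro Fz_mem) auto
  moreover have "of_int k * p2 (e + 1 - m) = of_int (2 * k) * p2 (e - m)" using p2_Suc[of "e - m"] by (simp add: algebra_simps)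
  moreover have "of_int n * p2 (e - m) \<le> of_int (2 * k) * p2 (e - m)" using k by (intro mult_right_mono) (simp_all only: of_int_le_iff p2_nonneg)
  moreover have "of_int (2 * k) * p2 (e - m) \<le> of_int (n + 1) * p2 (e - m)" using k by (intro mult_right_mono) (simp_all only: of_int_le_iff p2_nonneg)
  ultimately show ?thesis using rr_le by (metis order_trans)
qed

lemma p2_le_Om: "e \<le> b \<Longrightarrow> p2 e \<le> Om"
  using p2b_le_Om p2_le[of e b] by linarith

text \<open>The same doubling once the outer bound \<open>p2 y\<close> is no longer above the base.
  Here the bounds are followed on the grid of multiples of U, where every addition increases the
  spread by at most one U.\<close>

lemma double_near:
  assumes P: "prog T P" "amp T" and e: "a + 2 \<le> e" "e \<le> 6" "y \<le> e" "e - m \<le> y"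
    and st: "P (- (p2 y + p2 (e - m) / 2)) 0 (p2 (e - m) / 2) (p2 y + 2 * p2 (e - m))"
  shows "P (- (p2 y + p2 (e - m))) 0 (p2 (e - m)) (p2 y + 4 * p2 (e - m))"
proof -
  define U Y where "U = p2 (e - m)" and "Y = p2 y"
  obtain B d where B: "B \<in> Fz" "p2 e \<le> B" "B \<le> 3 / 2 * p2 e" "(B, B) \<in> T" "(- B, - B) \<in> T"
    and d: "d \<in> Fz" "U / 8 < d" "d \<le> U / 4" "(d, d) \<in> T" "om \<le> d"
    using amp_obtain[OF P(2) e(1,2)] unfolding U_def by metis
  have ae: "a \<le> e" using e by auto
  note br = base_round[OF ae(1) B(2,3,1), folded U_def]
  have U0: "U > 0" by (simp add: U_def)
  have pe: "p2 e = 2 ^ M * U" by (simp add: U_def p2_diff p2_nat)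
  obtain j where j: "B = of_int j * U" "2 ^ M \<le> j"
    using base_grid[OF ae(1) B(2,3,1)] unfolding U_def by (metis add.commute le_add_same_cancel2)
  have "of_int (2 * j) * U \<le> of_int (3 * 2 ^ M) * U" using B(3) by (simp add: j pe)
  then have j2: "2 * j \<le> 3 * 2 ^ M" using U0 by (simp only: mult_le_cancel_right_pos of_int_le_iff)
  define k :: int where "k = 2 ^ nat (y - e + m)"
  have k: "Y = of_int k * U" "1 \<le> k" "k \<le> 2 ^ M"
  proof -
    show "Y = of_int k * U" using e by (simp add: k_def U_def Y_def p2_ge_nat[symmetric] p2_add[symmetric])
    show "1 \<le> k" by (simp add: k_def)
    have "nat (y - e + m) \<le> M" using e by simp
    then show "k \<le> 2 ^ M" unfolding k_def by (intro power_increasing) auto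
  qed
  have grid: "of_int n * U \<in> Fz" if "\<bar>n\<bar> \<le> 2 ^ (M + 1)" for n
    using Fz_mem[OF that ae] by (simp add: U_def)
  have Pk: "(2::int) ^ (M + 1) = 2 * 2 ^ M" "(2::int) ^ (M + 2) = 4 * 2 ^ M" by simp_all
  have Fz1: "Y + 3 * U \<in> Fz" "Y + 4 * U \<in> Fz" "- (Y + U) \<in> Fz" "B - Y - U \<in> Fz" "U \<in> Fz"
    using grid[of "k + 3"] grid[of "k + 4"] grid[of "- (k + 1)"] grid[of "j - k - 1"] grid[of 1] k j j2 two_M Pk
    by (simp_all add: algebra_simps)
  have big: "8 * p2 e \<le> Om" using p2_le_Om[of "e + 3"] e b15 by (simp add: p2_add)
  have Ye: "Y \<le> p2 e" using e by (simp add: Y_def)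
  have Y0: "0 < Y" by (simp add: Y_def)
  have "8 * U \<le> p2 e" using p2_le[of "e - m + 3" e] m3 by (simp add: U_def p2_add)
  note sz = this big Ye Y0 U0 B(2,3)
  have Uh: "U / 2 \<in> Fz" using p2_Fz[of "e - m - 1"] e by (simp_all add: U_def p2_diff)
  obtain x where x: "U / 2 < x" "x \<le> U" "x = rr (U / 2 + d)"
    using rr_gt[OF Uh(1) _ d(5)] d U0 rr_le[of "U / 2 + d" U] Fz1(5) by auto
  have s1: "P (- (Y + U)) (U / 4) x (Y + 3 * U)"
  proof (rule prog_step[OF P(1) d(4) st[folded U_def Y_def]])
    show "- (Y + U) \<le> rr (- (Y + U / 2) + d)" using Fz1 d U0 by (intro rr_ge) auto
    show "rr (0 + d) \<le> U / 4" using d by (simp add: rr_Fz)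
    show "x \<le> rr (U / 2 + d)" using x by simp
    show "rr (Y + 2 * U + d) \<le> Y + 3 * U" using Fz1 d U0 by (intro rr_le) auto
  qed (use d sz in \<open>linarith\<close>)+
  have s2: "P (B - Y - U) B (B + U) (B + Y + 4 * U)"
  proof (rule prog_step[OF P(1) B(4) s1])
    show "B - Y - U \<le> rr (- (Y + U) + B)" using Fz1 by (intro rr_ge) auto
    show "rr (U / 4 + B) \<le> B" using br(1)[of 0 "U / 4"] U0 by (simp add: add.commute)
    show "B + U \<le> rr (x + B)" using br(2)[of x] x by (simp add: add.commute)
    have "Y + 3 * U + B = of_int (j + k + 3) * U" by (simp add: j k algebra_simps)
    moreover have "rr (of_int (j + k + 3) * U) \<le> of_int (j + k + 3 + 1) * U"
      unfolding U_def using ae k j j2 Pk two_M by (intro rr_mult_le) auto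
    ultimately show "rr (Y + 3 * U + B) \<le> B + Y + 4 * U" by (simp add: j k algebra_simps)
  qed (use x sz in \<open>linarith\<close>)+
  have "P (- (Y + U)) 0 U (Y + 4 * U)"
  proof (rule prog_step[OF P(1) B(5) s2])
    show "- (Y + U) \<le> rr (B - Y - U + - B)" using Fz1 by (intro rr_ge) auto
    show "rr (B + Y + 4 * U + - B) \<le> Y + 4 * U" using Fz1 by (intro rr_le) auto
    show "U \<le> rr (B + U + - B)" using Fz1 by (intro rr_ge) auto
    show "rr (B + - B) \<le> 0" by simp
  qed (use sz in \<open>linarith\<close>)+
  then show ?thesis by (simp add: U_def Y_def)
qed

lemma doubling:
  assumes P: "prog T P" "amp T" and y: "y < b" and st: "P (- p2 y) 0 (2 * om) (p2 y)"
    and e: "a + 2 \<le> e" "e \<le> 6" "e - m \<le> y"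
  shows "P (- (p2 y + p2 (e - m))) 0 (p2 (e - m)) (p2 y + 4 * p2 (e - m))"
proof -
  \<comment> \<open>The outer bounds do not grow while the base stays below \<open>p2 y\<close>;
    afterwards the growth is tied to the current last place and does not accumulate.\<close>
  define S where "S e = (if e + 1 \<le> y then P (- p2 y) 0 (p2 (e - m)) (p2 y)
    else P (- (p2 y + p2 (e - m))) 0 (p2 (e - m)) (p2 y + 4 * p2 (e - m)))" for e
  have weak: "P (- (p2 y + p2 (e - m))) 0 (p2 (e - m)) (p2 y + 4 * p2 (e - m))" if "S e" for e
    using that prog_weaken[OF P(1), of "- p2 y" 0 "p2 (e - m)" "p2 y"] by (auto simp: S_def split: if_splits)
  have "S (a + 1 + int n)" if "a + 1 + int n \<le> e" for n
    using that
  proof (induction n)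
    case 0
    have "p2 (a + 1 - m) = 2 * om" using om_p2[of 1] by simp
    then show ?case using st prog_weaken[OF P(1) st, of "- (p2 y + p2 (a + 1 - m))" 0 "2 * om" "p2 y + 4 * p2 (a + 1 - m)"]
      by (simp add: S_def)
  next
    case (Suc n)
    define e' where "e' = a + 1 + int (Suc n)"
    have "e' - 1 = a + 1 + int n" by (simp add: e'_def)
    moreover have "S (a + 1 + int n)" using Suc.IH Suc.prems by simp
    ultimately have IH: "S (e' - 1)" by (simp only:)
    have e': "a + 2 \<le> e'" "e' \<le> 6" "e' - m \<le> y" using Suc.prems e by (auto simp: e'_def)
    have h: "p2 (e' - 1 - m) = p2 (e' - m) / 2" by (simp add: p2_diff)
    show ?case
    proof (cases "e' + 1 \<le> y")
      case True
      then have "P (- p2 y) 0 (p2 (e' - m) / 2) (p2 y)" using IH by (simp add: S_def h)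
      then show ?thesis using double_far[OF P e'(1,2) True y] True by (simp add: S_def e'_def)
    next
      case False
      have "P (- (p2 y + p2 (e' - m) / 2)) 0 (p2 (e' - m) / 2) (p2 y + 2 * p2 (e' - m))" using weak[OF IH] by (simp add: h)
      then have "P (- (p2 y + p2 (e' - m))) 0 (p2 (e' - m)) (p2 y + 4 * p2 (e' - m))"
        using double_near[OF P e'(1,2) _ e'(3)] False by simp
      then show ?thesis using False by (simp add: S_def e'_def)
    qed
  qed
  from this[of "nat (e - (a + 1))"] have "S e" using e by simp
  then show ?thesis by (rule weak)
qed

section \<open>Reducing the spread of a noisy bit\<close>

lemma rr_rel: "\<bar>x - rr x\<bar> \<le> max (om / 2) (\<bar>x\<bar> * p2 (- m) / 2)"
proof (cases "p2 a \<le> \<bar>x\<bar>")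
  case True
  then have "\<bar>x\<bar> > 0" using p2_pos[of a] by linarith
  then obtain e where e: "p2 e \<le> \<bar>x\<bar>" "\<bar>x\<bar> < p2 (e + 1)" using p2_bracket by blast
  then have "p2 a < p2 (e + 1)" using True by linarith
  then have "\<bar>x - rr x\<bar> \<le> p2 (e - m) / 2" using rr_err[of x e] e by simp
  also have "\<dots> = p2 e * p2 (- m) / 2" by (simp add: p2_add[symmetric])
  also have "\<dots> \<le> \<bar>x\<bar> * p2 (- m) / 2" using e by simp
  finally show ?thesis by (rule max.coboundedI2)
next
  case False
  then have "\<bar>x\<bar> \<le> p2 (a + 1)" using p2_Suc[of a] by simp
  then have "\<bar>x - rr x\<bar> \<le> om / 2" using rr_err[of x a] by (simp add: om_def)
  then show ?thesis by (rule max.coboundedI1)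
qed

lemma p2_m8: "p2 (- m) \<le> 1 / 8"
proof -
  have "p2 (- m) \<le> p2 (- 3)" using m3 by (simp del: p2_num)
  then show ?thesis using p2_minus[of 3] by simp
qed

lemma rr_above_mid: "mid i < x \<Longrightarrow> fz (i + 1) \<le> rr x"
proof -
  assume x: "mid i < x"
  obtain j where j: "inr x j" "rr x = fz j" using rrE by blast
  have "x \<le> mid j" using j by (simp only: inr_def)
  then have "mid i < mid j" using x by linarith
  then show ?thesis using j by simp
qed

lemma rr_below_mid: "x < mid i \<Longrightarrow> rr x \<le> fz i"
proof -
  assume x: "x < mid i"
  obtain j where j: "inr x j" "rr x = fz j" using rrE by blast
  have "mid (j - 1) \<le> x" using j by (simp only: inr_def)
  then have "mid (j - 1) < mid i" using x by linarith
  then show ?thesis using j by simp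
qed

text \<open>With h the gap above \<eta>, the threshold is amplified to h / 2 and then shifted by d:
  off values stay at most h / 4 and on values exceed h / 2, so the addition of \<eta> separates them
  at the midpoint between \<eta> and its successor. The rounding errors are small enough for the
  outer bound Y to become at most 2 * Y. As Y is a quarter of the previous spread, this is a
  halving.\<close>

lemma halve:
  assumes P: "prog T P" "amp T" and y: "y < b" "x + 2 \<le> y" and x: "a + 4 - m \<le> x" "x \<le> 1 - m"
    and \<eta>: "\<eta> = fz i" "gap i = p2 x" "\<bar>\<eta>\<bar> * p2 (- m) \<le> 2 * p2 x"
    and st: "P (- p2 y) 0 (2 * om) (p2 y)"
  obtains l0 u0 l1 u1 where "P l0 u0 l1 u1"
    "\<eta> - 2 * p2 y \<le> rr (l0 + \<eta>)" "rr (u0 + \<eta>) \<le> \<eta>"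
    "fz (i + 1) \<le> rr (l1 + \<eta>)" "rr (u1 + \<eta>) \<le> fz (i + 1) + 2 * p2 y"
proof -
  define h Y where "h = p2 x" and "Y = p2 y"
  have h0: "h > 0" by (simp add: h_def)
  have Yh: "4 * h \<le> Y" using p2_le[of "x + 2" y] y by (simp add: h_def Y_def p2_add)
  have YOm: "2 * Y \<le> Om" using p2_le_Om[of "y + 1"] y p2_Suc[of y] by (simp add: Y_def)
  have omh: "16 * om \<le> h" using om_p2[of 4] p2_le[of "a + 4 - m" x] x by (simp add: h_def)
  have s0: "P (- (Y + h / 2)) 0 (h / 2) (Y + 2 * h)"
    using doubling[OF P y(1) st, of "x - 1 + m"] x y by (simp add: h_def Y_def p2_diff)
  have "a \<le> x - 2 + m" "x - 2 + m \<le> 6" using x by auto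
  then obtain d where d: "d \<in> Fz" "p2 (x - 2) / 2 < d" "d \<le> p2 (x - 2)" "(d, d) \<in> T"
    using P(2) unfolding amp_def by force
  have d': "h / 8 < d" "d \<le> h / 4" using d by (simp_all add: h_def p2_diff)
  define l0 u1 where "l0 = rr (- (Y + h / 2) + d)" and "u1 = rr (Y + 2 * h + d)"
  have "p2 (x - 1) \<in> Fz" using x by (intro p2_Fz) auto
  then have hF: "h / 2 \<in> Fz" by (simp add: h_def p2_diff)
  have "P l0 d (h / 2 ) u1"
  proof (rule prog_step[OF P(1) d(4) s0])
    show "h / 2 \<le> rr (h / 2 + d)" using hF d' h0 by (intro rr_ge) auto
    show "rr (0 + d) \<le> d" using d by (simp add: rr_Fz)
  qed (use d' h0 Yh YOm in \<open>simp_all add: l0_def u1_def abs_le_iff\<close>)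
  define l1 where "l1 = rr (h / 2 + d)"
  have l1: "h / 2 < l1" unfolding l1_def using hF h0 d' omh Fz_pos_ge[of d] d by (intro rr_gt) auto
  have "P l0 d l1 u1"
  proof (rule prog_step[OF P(1) d(4) s0])
  qed (use d' h0 Yh YOm d in \<open>simp_all add: l0_def u1_def l1_def abs_le_iff rr_Fz\<close>)
  have p: "0 \<le> p2 (- m)" "p2 (- m) \<le> 1 / 8" using p2_m8 by auto
  have err: "\<bar>z - rr z\<bar> \<le> \<bar>z\<bar> / 16" if "h / 2 \<le> \<bar>z\<bar>" for z
  proof -
    have "\<bar>z\<bar> * p2 (- m) \<le> \<bar>z\<bar> * (1 / 8)" using p by (intro mult_left_mono) auto
    moreover have "om / 2 \<le> \<bar>z\<bar> / 16" using omh that by linarith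
    ultimately show ?thesis using rr_rel[of z] unfolding le_max_iff_disj by linarith
  qed
  \<comment> \<open>The factor 17/16 is the rounding error, applied to the bounds Y + h / 2 and Y +
    9/4 h.\<close>
  define L R where "L = - (17 / 16 * Y + 17 / 32 * h)" and "R = 17 / 16 * Y + 153 / 64 * h"
  have l0: "L \<le> l0"
  proof -
    define z where "z = - (Y + h / 2) + d"
    have "h / 2 \<le> \<bar>z\<bar>" "z < 0" using d' Yh h0 unfolding z_def by linarith+
    then have "z - rr z \<le> - z / 16" using err[of z] by linarith
    moreover have "- (Y + h / 2) \<le> z" using d' h0 unfolding z_def by linarith
    ultimately show ?thesis unfolding l0_def z_def[symmetric] L_def by linarith
  qed
  have u1: "u1 \<le> R"
  proof -
    define z where "z = Y + 2 * h + d"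
    have "h / 2 \<le> \<bar>z\<bar>" "0 < z" using d' Yh h0 unfolding z_def by linarith+
    then have "rr z - z \<le> z / 16" using err[of z] by linarith
    moreover have "z \<le> Y + 9 / 4 * h" using d' unfolding z_def by linarith
    ultimately show ?thesis unfolding u1_def z_def[symmetric] R_def by linarith
  qed
  have err2: "\<bar>z + \<eta> - rr (z + \<eta>)\<bar> \<le> h + \<bar>z\<bar> / 16 + h / 32" for z
  proof -
    have "\<bar>z + \<eta>\<bar> * p2 (- m) \<le> (\<bar>z\<bar> + \<bar>\<eta>\<bar>) * p2 (- m)" using p by (intro mult_right_mono) auto
    also have "\<dots> \<le> \<bar>z\<bar> * (1 / 8) + 2 * h" using p \<eta>(3) mult_left_mono[OF p(2), of "\<bar>z\<bar>"] by (simp add: h_def distrib_right)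
    finally show ?thesis using rr_rel[of "z + \<eta>"] omh h0 unfolding le_max_iff_disj by linarith
  qed
  have "rr (L + \<eta>) \<le> rr (l0 + \<eta>)" using l0 by (intro rr_mono) auto
  then have c1: "\<eta> - 2 * Y \<le> rr (l0 + \<eta>)"
    using err2[of L] Yh h0 L_def by linarith
  have c2: "rr (d + \<eta>) \<le> \<eta>" unfolding \<eta>(1) using d' \<eta>(2) h0 mid_gap(1)[of i] by (intro rr_below_mid) (simp add: h_def)
  have c3: "fz (i + 1) \<le> rr (l1 + \<eta>)" using l1 \<eta>(1,2) mid_gap(1)[of i] by (intro rr_above_mid) (simp add: h_def)
  have "rr (u1 + \<eta>) \<le> rr (R + \<eta>)" using u1 by (intro rr_mono) auto
  moreover have "fz (i + 1) = \<eta> + h" using \<eta>(1,2) by (simp add: gap_def h_def)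
  ultimately have c4: "rr (u1 + \<eta>) \<le> fz (i + 1) + 2 * Y"
    using err2[of R] Yh h0 R_def by linarith
  show ?thesis using that[OF \<open>P l0 d l1 u1\<close>] c1 c2 c3 c4 by (simp add: Y_def)
qed

text \<open>The threshold is amplified further while the lower bound stays at - 4 h. Once the place
  is U = 16 h, this bound equals - U / 4 and is rounded away at the base, while the upper bound is
  rounded to one place; both states are then exact.\<close>

lemma settle:
  assumes P: "prog T P" "amp T" and x: "a + 4 - m \<le> x" "x \<le> 1 - m"
    and st: "P (- (2 * p2 x)) 0 (2 * om) (2 * p2 x)"
  shows "P 0 0 (16 * p2 x) (16 * p2 x)"
proof -
  define h where "h = p2 x"
  have h0: "h > 0" by (simp add: h_def)
  have step: "P l 0 U r"
    if e: "e = x + m + int n" "2 \<le> n" "n \<le> 4" and U: "U = p2 (e - m)" and st: "P l0 0 (U / 2) u1"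
      and q: "\<And>d. U / 8 < d \<Longrightarrow> d \<le> U / 4 \<Longrightarrow> q \<le> rr (l0 + d)" "- U \<le> l0" "\<And>B. B \<in> Fz \<Longrightarrow> p2 e \<le> B \<Longrightarrow> B \<le> 3 / 2 * p2 e \<Longrightarrow> B + l \<le> rr (B + q)" "l \<in> Fz" "- U \<le> l" "- U \<le> q" "q \<le> 0" "l \<le> 0" "l0 \<le> 0"
      and k: "rr (u1 + U / 4) < (of_int k + 1/2) * U" "0 \<le> u1" "u1 \<le> 3 * U" "1 \<le> k" "k \<le> 3" "r = of_int k * U"
    for e n U l0 u1 q l k r
  proof -
    have e6: "a + 2 \<le> e" "e \<le> 6" "a \<le> e" using e x by auto
    obtain B d where B: "B \<in> Fz" "p2 e \<le> B" "B \<le> 3 / 2 * p2 e" "(B, B) \<in> T" "(- B, - B) \<in> T"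
      and d: "d \<in> Fz" "U / 8 < d" "d \<le> U / 4" "(d, d) \<in> T" "om \<le> d"
      using amp_obtain[OF P(2) e6(1,2)] unfolding U by metis
    note br = base_round[OF e6(3) B(2,3,1), folded U]
    have U0: "U > 0" by (simp add: U)
    have big: "8 * p2 e \<le> Om" using p2_le_Om[of "e + 3"] e6 b15 by (simp add: p2_add)
    have "8 * U \<le> p2 e" using p2_le[of "e - m + 3" e] m3 by (simp add: U p2_add)
    note sz = this big U0 B(2,3)
    have Fz1: "U \<in> Fz" "of_int k * U \<in> Fz" using frac_Fz[OF e6(3), of 1] frac_Fz[OF e6(3), of k] k unfolding U by auto
    have Uh: "U / 2 \<in> Fz" using p2_Fz[of "e - m - 1"] e6 by (simp_all add: U p2_diff)
    obtain x where x: "U / 2 < x" "x \<le> U" "x = rr (U / 2 + d)"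
      using rr_gt[OF Uh(1) _ d(5)] d U0 rr_le[of "U / 2 + d" U] Fz1 by auto
    have "rr (u1 + U / 4) \<le> 4 * U" using k frac_Fz[OF e6(3), of 4] by (intro rr_le) (auto simp: U)
    moreover have "0 \<le> rr (u1 + U / 4)" using k U0 by (intro rr_0_le) auto
    moreover have "rr (u1 + d) \<le> rr (u1 + U / 4)" using d by (intro rr_mono) auto
    ultimately have u4: "rr (u1 + U / 4) \<le> 4 * U" "0 \<le> rr (u1 + U / 4)" "rr (u1 + d) \<le> rr (u1 + U / 4)" by blast+
    have s1: "P q (U / 4) x (rr (u1 + U / 4))"
    proof (rule prog_step[OF P(1) d(4) st])
      show "q \<le> rr (l0 + d)" using q(1) d by blast
      show "rr (0 + d) \<le> U / 4" using d by (simp add: rr_Fz)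
      show "x \<le> rr (U / 2 + d)" using x by simp
    qed (use d sz k(2,3) q(2,9) u4 in \<open>linarith\<close>)+
    have Bk: "of_int k * U \<le> 3 * U" using k U0 by simp
    have kU: "0 \<le> of_int k * U" using k U0 by simp
    have s2: "P (B + l) B (B + U) (B + of_int k * U)"
    proof (rule prog_step[OF P(1) B(4) s1])
      show "B + l \<le> rr (q + B)" using q(3)[OF B(1,2,3)] by (simp add: add.commute)
      show "rr (U / 4 + B) \<le> B" using br(1)[of 0 "U / 4"] U0 by (simp add: add.commute)
      show "B + U \<le> rr (x + B)" using br(2)[of x] x by (simp add: add.commute)
      show "rr (rr (u1 + U / 4) + B) \<le> B + of_int k * U" using br(1)[of k "rr (u1 + U / 4)"] k by (simp add: add.commute)
    qed (use x sz q(5-8) u4 in \<open>linarith\<close>)+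
    show "P l 0 U r" unfolding k(6)
    proof (rule prog_step[OF P(1) B(5) s2])
      show "l \<le> rr (B + l + - B)" using q by (intro rr_ge) auto
      show "rr (B + of_int k * U + - B) \<le> of_int k * U" using Fz1 by (intro rr_le) auto
      show "U \<le> rr (B + U + - B)" using Fz1 by (intro rr_ge) auto
      show "rr (B + - B) \<le> 0" by simp
    qed (use sz q(5-8) Bk kU U0 in \<open>linarith\<close>)+
  qed
  have grid: "of_int k * h \<in> Fz" if "\<bar>k\<bar> \<le> 16" for k using frac_Fz[of "x + m" k] that x by (simp add: h_def)
  have grid4: "of_int k * (4 * h) \<in> Fz" if "\<bar>k\<bar> \<le> 16" for k
    using frac_Fz[of "x + m + 2" k] that x p2_add[of x 2] by (simp add: h_def algebra_simps)
  \<comment> \<open>This is \<open>doubling\<close> with outer bound 2 h and place 2 h: the bounds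
    become 2 h + 2 h and 2 h + 8 h.\<close>
  have s0: "P (- (4 * h)) 0 (2 * h) (10 * h)"
    using doubling[OF P, of "x + 1" "x + 1 + m"] st x b15 p2_Suc[of x] by (simp add: h_def)
  have pw: "p2 (x + 2) = 4 * h" "p2 (x + 3) = 8 * h" "p2 (x + 4) = 16 * h" by (simp_all add: h_def p2_add)
  have s1: "P (- (4 * h)) 0 (4 * h) (12 * h)"
  proof (rule step[where n = 2 and e = "x + m + 2" and k = 3 and q = "- (4 * h)"])
    show "- (4 * h) \<le> rr (- (4 * h) + d)" if "4 * h / 8 < d" "d \<le> 4 * h / 4" for d
      using that grid[of "- 4"] h0 by (intro rr_ge) auto
    show "B + - (4 * h) \<le> rr (B + - (4 * h))" if "B \<in> Fz" "p2 (x + m + 2) \<le> B" "B \<le> 3 / 2 * p2 (x + m + 2)" for B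
      using base_round(5)[of "x + m + 2" B] that x pw by (simp add: rr_Fz)
    have "rr (10 * h + 4 * h / 4) \<le> 11 * h" using grid[of 11] by (intro rr_le) auto
    then show "rr (10 * h + 4 * h / 4) < (of_int 3 + 1 / 2) * (4 * h)" using h0 by simp
    show "- (4 * h) \<in> Fz" using grid[of "- 4"] by simp
  qed (use s0 pw h0 in \<open>simp_all\<close>)
  have s2: "P (- (4 * h)) 0 (8 * h) (16 * h)"
  proof (rule step[where n = 3 and e = "x + m + 3" and k = 2 and q = "- (3 * h)"])
    \<comment> \<open>The summand exceeds U / 8 = h and brings the lower bound strictly above - U /
      2 = - 4 h, where the base loses at most U / 2.\<close>
    show "- (3 * h) \<le> rr (- (4 * h) + d)" if "8 * h / 8 < d" "d \<le> 8 * h / 4" for d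
      using that grid[of "- 3"] h0 by (intro rr_ge) auto
    show "B + - (4 * h) \<le> rr (B + - (3 * h))" if "B \<in> Fz" "p2 (x + m + 3) \<le> B" "B \<le> 3 / 2 * p2 (x + m + 3)" for B
      using base_round(4)[of "x + m + 3" B "- (3 * h)"] that x pw h0 by simp
    have "rr (12 * h + 8 * h / 4) \<le> 14 * h" using grid[of 14] by (intro rr_le) auto
    then show "rr (12 * h + 8 * h / 4) < (of_int 2 + 1 / 2) * (8 * h)" using h0 by simp
    show "- (4 * h) \<in> Fz" using grid[of "- 4"] by simp
  qed (use s1 pw h0 in \<open>simp_all\<close>)
  have "P 0 0 (16 * h) (16 * h)"
  proof (rule step[where n = 4 and e = "x + m + 4" and k = 1 and q = "- (4 * h)"])
    show "- (4 * h) \<le> rr (- (4 * h) + d)" if "16 * h / 8 < d" "d \<le> 16 * h / 4" for d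
      using that grid[of "- 4"] h0 by (intro rr_ge) auto
    show "B + 0 \<le> rr (B + - (4 * h))" if "B \<in> Fz" "p2 (x + m + 4) \<le> B" "B \<le> 3 / 2 * p2 (x + m + 4)" for B
      using base_round(3)[of "x + m + 4" B "- (4 * h)"] that x pw h0 by simp
    have "rr (16 * h + 16 * h / 4) \<le> 20 * h" using grid4[of 5] by (intro rr_le) auto
    then show "rr (16 * h + 16 * h / 4) < (of_int 1 + 1 / 2) * (16 * h)" using h0 by simp
    show "0 \<in> Fz" using fz_in[of 0] by simp
  qed (use s2 pw h0 in \<open>simp_all\<close>)
  then show ?thesis by (simp add: h_def)
qed

section \<open>Moving pairs of exact values\<close>

definition csteps :: "real \<Rightarrow> (real \<times> real) set" where
  "csteps v = {(rr (v * w), rr (v * w)) |w. w \<in> F \<and> ok (v * w)}"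

definition bsteps :: "real \<Rightarrow> (real \<times> real) set" where
  "bsteps v = {(0, rr (v * w)) |w. w \<in> F \<and> 0 \<le> w \<and> ok (v * w)}"

lemma csteps_minus: "(c, c) \<in> csteps v \<Longrightarrow> (- c, - c) \<in> csteps v"
proof -
  assume "(c, c) \<in> csteps v"
  then obtain w where "w \<in> F" "ok (v * w)" "c = rr (v * w)" unfolding csteps_def by blast
  then have "- w \<in> F" "ok (v * - w)" "- c = rr (v * - w)" using F_minus by (simp_all add: rr_minus ok_minus)
  then show ?thesis unfolding csteps_def by blast
qed

lemma step_up_index:
  assumes "\<And>k. i \<le> k \<Longrightarrow> k < j \<Longrightarrow> R k \<Longrightarrow> R (k + 1)" "R (i::int)" "i \<le> j"
  shows "R j"
  using assms(3,1)
proof (induction j rule: int_ge_induct)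
  case (step k)
  then show ?case by simp
qed (use assms(2) in simp)

lemma step_down_index:
  assumes "\<And>k. j \<le> k \<Longrightarrow> k < i \<Longrightarrow> R (k + 1) \<Longrightarrow> R k" "R (i::int)" "j \<le> i"
  shows "R j"
proof -
  have "R (- (- j))"
    using assms(1)[of "- _ - 1"] assms(2,3)
    by (intro step_up_index[of "- i" "- j" "\<lambda>k. R (- k)"]) auto
  then show ?thesis by simp
qed

lemma gap_exp_bounded:
  assumes "- N \<le> i" "i < N"
  obtains e where "a \<le> e" "e \<le> b" "gap i = p2 (e - m)"
proof -
  have pos: "\<exists>e. a \<le> e \<and> e \<le> b \<and> gap i = p2 (e - m)" if i: "0 \<le> i" "i < N" for i
  proof -
    obtain e where e: "a \<le> e" "gap i = p2 (e - m)" "e = a \<or> p2 e \<le> fz i" using gap_exp[OF i(1)] by metis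
    have "fz i < fz (N + 1)" using i by simp
    then have "p2 e \<le> fz i \<Longrightarrow> p2 e < p2 (b + 1)" unfolding fz_N1 by linarith
    then have "e \<le> b" using e(3) a_le_b by auto
    then show ?thesis using e by blast
  qed
  show ?thesis
  proof (cases "0 \<le> i")
    case True then show ?thesis using pos[of i] assms that by blast
  next
    case False then show ?thesis using pos[of "- i - 1"] assms that gap_minus[of i] by auto
  qed
qed

section \<open>Moving to neighbouring floats\<close>

lemma K_gap:
  assumes "strong v b" "- N \<le> i" "i < N"
  obtains c w where "gap i / 2 < c" "c \<le> gap i" "w \<in> F" "0 \<le> w" "ok (v * w)" "c = rr (v * w)"
proof -
  obtain e where e: "a \<le> e" "e \<le> b" "gap i = p2 (e - m)" using gap_exp_bounded assms by blast
  show ?thesis using K[OF strong_mono[OF assms(1) e(2)] e(1,2)] that unfolding e(3) by metis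
qed

lemma K_gap_cstep:
  assumes "strong v b" "csteps v \<subseteq> T" "- N \<le> i" "i < N"
  obtains c where "gap i / 2 < c" "c \<le> gap i" "(c, c) \<in> T" "(- c, - c) \<in> T"
proof -
  obtain c w where c: "gap i / 2 < c" "c \<le> gap i" "w \<in> F" "ok (v * w)" "c = rr (v * w)"
    using K_gap[OF assms(1,3,4)] by metis
  then have "(c, c) \<in> csteps v" unfolding csteps_def by blast
  then show ?thesis using that c csteps_minus assms(2) by blast
qed

text \<open>Seen from either end of the gap, such a summand passes the midpoint but not the other
  end.\<close>

lemma rr_step_up:
  assumes "gap i / 2 < c" "c \<le> gap i"
  shows "rr (fz i + c) = fz (i + 1)" "rr (fz (i + 1) - c) = fz i"
proof -
  have g: "fz (i + 1) = fz i + gap i" by (simp add: gap_def)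
  have "fz (i + 1) \<le> rr (fz i + c)" using assms mid_gap(1)[of i] by (intro rr_above_mid) auto
  moreover have "rr (fz i + c) \<le> fz (i + 1)" using assms g by (intro rr_le fz_in) linarith
  ultimately show "rr (fz i + c) = fz (i + 1)" by simp
  have "rr (fz (i + 1) - c) \<le> fz i" using assms mid_gap(2)[of i] by (intro rr_below_mid) auto
  moreover have "fz i \<le> rr (fz (i + 1) - c)" using assms g by (intro rr_ge) auto
  ultimately show "rr (fz (i + 1) - c) = fz i" by simp
qed

definition pair :: "(real \<Rightarrow> real \<Rightarrow> real \<Rightarrow> real \<Rightarrow> bool) \<Rightarrow> real \<Rightarrow> real \<Rightarrow> bool" where
  "pair P x y \<longleftrightarrow> P x x y y"

lemma pair_step:
  assumes "prog T P" "(c0, c1) \<in> T" "pair P x y" "x' = rr (x + c0)" "y' = rr (y + c1)" "\<bar>x'\<bar> \<le> Om" "\<bar>y'\<bar> \<le> Om"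
  shows "pair P x' y'"
  using assms unfolding prog_def pair_def ok_def by blast

lemma fz_Om: "- N \<le> i \<Longrightarrow> i \<le> N \<Longrightarrow> \<bar>fz i\<bar> \<le> Om"
proof -
  assume "- N \<le> i" "i \<le> N"
  then have "\<bar>i\<bar> \<le> N" by linarith
  then show ?thesis by (simp only: abs_fz_le)
qed

lemma const_walk:
  assumes P: "prog T P" "strong s b" "csteps s \<subseteq> T" and st: "pair P (fz i) (fz i)"
    and ij: "\<bar>i\<bar> \<le> N" "\<bar>j\<bar> \<le> N"
  shows "pair P (fz j) (fz j)"
proof -
  have up: "pair P (fz (k + 1)) (fz (k + 1))" if k: "- N \<le> k" "k < N" "pair P (fz k) (fz k)" for k
  proof -
    obtain c where c: "gap k / 2 < c" "c \<le> gap k" "(c, c) \<in> T" using K_gap_cstep[OF P(2,3) k(1,2)] by metis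
    show ?thesis using pair_step[OF P(1) c(3) k(3)] rr_step_up(1)[OF c(1,2)] fz_Om[of "k + 1"] k by simp
  qed
  have down: "pair P (fz k) (fz k)" if k: "- N \<le> k" "k < N" "pair P (fz (k + 1)) (fz (k + 1))" for k
  proof -
    obtain c where c: "gap k / 2 < c" "c \<le> gap k" "(- c, - c) \<in> T" using K_gap_cstep[OF P(2,3) k(1,2)] by metis
    show ?thesis using pair_step[OF P(1) c(3) k(3)] rr_step_up(2)[OF c(1,2)] fz_Om[of k] k by simp
  qed
  show ?thesis
  proof (cases "i \<le> j")
    case True then show ?thesis using step_up_index[of i j "\<lambda>k. pair P (fz k) (fz k)"] up st ij by auto
  next
    case False then show ?thesis using step_down_index[of j i "\<lambda>k. pair P (fz k) (fz k)"] down st ij by auto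
  qed
qed

lemma on_walk:
  assumes P: "prog T P" "strong v e" "bsteps v \<subseteq> T" and st: "pair P x (fz i)"
    and ij: "- N \<le> i" "i \<le> j" "j \<le> N" "x \<in> Fz" "\<bar>x\<bar> \<le> Om" "e \<le> b"
    and g: "\<And>k. i \<le> k \<Longrightarrow> k < j \<Longrightarrow> gap k \<le> p2 (e - m)"
  shows "pair P x (fz j)"
proof (rule step_up_index[of i j "\<lambda>k. pair P x (fz k)"])
  fix k assume k: "i \<le> k" "k < j" "pair P x (fz k)"
  obtain e' where e': "a \<le> e'" "e' \<le> b" "gap k = p2 (e' - m)" using gap_exp_bounded[of k] ij k by auto
  then have "p2 (e' - m) \<le> p2 (e - m)" using g[OF k(1,2)] by simp
  then have "e' \<le> e" by simp
  then obtain w where w: "w \<in> F" "0 \<le> w" "ok (v * w)" "gap k / 2 < rr (v * w)" "rr (v * w) \<le> gap k"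
    using K[OF strong_mono[OF P(2)] e'(1,2)] unfolding e'(3) by metis
  then have "(0, rr (v * w)) \<in> T" using P(3) unfolding bsteps_def by blast
  then show "pair P x (fz (k + 1))"
    using pair_step[OF P(1) _ k(3), of 0 "rr (v * w)" x "fz (k + 1)"] rr_step_up(1)[OF w(4,5)] fz_Om[of "k + 1"] k ij
    by (simp add: rr_Fz)
qed (use st ij in auto)

section \<open>Moving two adjacent floats together\<close>

lemma gap_next: "0 \<le> i \<Longrightarrow> gap (i + 1) = gap i \<or> (gap (i + 1) = 2 * gap i \<and> even (i + 1))"
proof -
  assume i: "0 \<le> i"
  define n where "n = nat i"
  have n: "nat (i + 1) = Suc n" "i = int n" using i by (auto simp: n_def)
  have "Suc n div 2 ^ M = (if 2 ^ M dvd Suc n then Suc (n div 2 ^ M) else n div 2 ^ M)"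
    by (simp add: div_Suc dvd_eq_mod_eq_0)
  moreover have "2 ^ M dvd Suc n \<Longrightarrow> even (i + 1)"
  proof -
    assume "2 ^ M dvd Suc n"
    moreover have "(2::nat) dvd 2 ^ M" using M3 by simp
    ultimately have "even (Suc n)" by (rule dvd_trans[rotated])
    then show "even (i + 1)" by (simp add: n(2))
  qed
  moreover have "gap i = gp n" "gap (i + 1) = gp (Suc n)" using gap_nonneg[of i] gap_nonneg[of "i + 1"] i n by auto
  ultimately show ?thesis by (cases "n div 2 ^ M") (auto simp: gp_def)
qed

text \<open>If the gap doubles at \<open>i + 1\<close>, the lower value overshoots its neighbour by
  at most half of the doubled gap, and a tie goes to the even index \<open>i + 1\<close>. One
  summand thus moves both floats by exactly one place in the enumeration.\<close>

lemma adjacent_up: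
  assumes "0 \<le> i" "gap (i + 1) / 2 < c" "c \<le> gap (i + 1)"
  shows "rr (fz i + c) = fz (i + 1)" "rr (fz (i + 1) + c) = fz (i + 2)"
proof -
  have g: "fz (i + 1) = fz i + gap i" by (simp add: gap_def)
  show "rr (fz i + c) = fz (i + 1)"
  proof (cases "gap (i + 1) = gap i")
    case True then show ?thesis using rr_step_up(1)[of i c] assms by simp
  next
    case False
    then have "gap (i + 1) = 2 * gap i" "even (i + 1)" using gap_next[OF assms(1)] by auto
    then show ?thesis using assms g gap_pos[of i] by (intro rr_near) auto
  qed
  show "rr (fz (i + 1) + c) = fz (i + 2)" using rr_step_up(1)[of "i + 1" c] assms by (simp add: add.assoc)
qed

text \<open>Let g be the lower gap. The lower value overshoots \<open>fz i\<close> by at most g / 4,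
  half of a possibly halved gap, and the upper value comes within g of \<open>fz (i + 1)\<close>,
  half of a possibly doubled gap. Both possible ties fall on even indices.\<close>

lemma adjacent_down:
  assumes "0 \<le> i" "gap i \<le> c" "c \<le> 5 / 4 * gap i"
  shows "rr (fz (i + 1) - c) = fz i" "rr (fz (i + 2) - c) = fz (i + 1)"
proof -
  have g: "fz (i + 1) = fz i + gap i" "fz (i + 2) = fz (i + 1) + gap (i + 1)" by (simp_all add: gap_def add.assoc)
  have gp: "gap i > 0" "gap (i - 1) > 0" by (rule gap_pos)+
  show "rr (fz (i + 1) - c) = fz i"
  proof (cases "gap (i - 1) = gap i")
    case True then show ?thesis using g assms gp by (intro rr_near_strict) auto
  next
    case False
    moreover have "gap (- 1) = gap 0" using gap_minus[of 0] by simp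
    ultimately have "1 \<le> i" using assms(1) by (cases "i = 0") auto
    then have "gap i = 2 * gap (i - 1)" "even i" using gap_next[of "i - 1"] False by auto
    then show ?thesis using g assms gp by (intro rr_near) auto
  qed
  show "rr (fz (i + 2) - c) = fz (i + 1)"
  proof (cases "gap (i + 1) = gap i")
    case True then show ?thesis using g assms gp by (intro rr_near_strict) auto
  next
    case False
    then have "gap (i + 1) = 2 * gap i" "even (i + 1)" using gap_next[OF assms(1)] by auto
    then show ?thesis using g assms gp by (intro rr_near) auto
  qed
qed

text \<open>Moves that reduce the magnitude are made only on the way to 0, where the gaps are small
  enough for \<open>K1\<close>. From 0 outwards the moves increase the magnitude, and the negative
  side mirrors the positive one.\<close>

lemma adjacent_walk:
  assumes P: "prog T P" "strong s b" "csteps s \<subseteq> T" and st: "pair P (fz i) (fz (i + 1))"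
    and i: "0 \<le> i" "fz i < p2 10" and j: "- N \<le> j" "j < N"
  shows "pair P (fz j) (fz (j + 1))"
proof -
  let ?A = "\<lambda>k. pair P (fz k) (fz (k + 1))"
  have "p2 10 \<le> p2 b" using b15 by (simp del: p2_num)
  then have "fz i < fz N" using i p2b_le_Om fz_N by linarith
  then have iN: "i < N" by simp
  have up: "?A (k + 1)" if k: "0 \<le> k" "k + 1 < N" "?A k" for k
  proof -
    obtain c where c: "gap (k + 1) / 2 < c" "c \<le> gap (k + 1)" "(c, c) \<in> T"
      using K_gap_cstep[OF P(2,3), of "k + 1"] k N_nonneg by auto
    show ?thesis using pair_step[OF P(1) c(3) k(3)] adjacent_up[OF k(1) c(1,2)] fz_Om[of "k + 1"] fz_Om[of "k + 2"] k
      by (simp add: add.assoc)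
  qed
  have down: "?A k" if k: "0 \<le> k" "k < i" "?A (k + 1)" for k
  proof -
    obtain e where e: "a \<le> e" "gap k = p2 (e - m)" "e = a \<or> p2 e \<le> fz k" using gap_exp[OF k(1)] by metis
    have "fz k < fz i" using k by simp
    then have "p2 e \<le> fz k \<Longrightarrow> p2 e < p2 10" using i by linarith
    then have "p2 e \<le> fz k \<Longrightarrow> e < 10" by (simp only: p2_less)
    then have eb: "e < b" using e(3) b15 ab by auto
    have "strong s (e + 1)" using strong_mono[OF P(2)] eb by simp
    from K1[OF this e(1) eb] obtain w where w: "w \<in> F" "ok (s * w)" "gap k \<le> rr (s * w)" "rr (s * w) \<le> 5 / 4 * gap k"
      unfolding e(2) by metis
    have "(- rr (s * w), - rr (s * w)) \<in> T" using w csteps_minus P(3) unfolding csteps_def by blast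
    then show ?thesis
      using pair_step[OF P(1) _ k(3), of "- rr (s * w)" "- rr (s * w)"] adjacent_down[OF k(1) w(3,4)] fz_Om[of k] fz_Om[of "k + 1"] k iN N_nonneg
      by (simp add: add.assoc)
  qed
  have A0: "?A 0" using step_down_index[of 0 i ?A] down st i by auto
  show ?thesis
  proof (cases "0 \<le> j")
    case True then show ?thesis using step_up_index[of 0 j ?A] up A0 j by auto
  next
    case False
    have N1: "1 \<le> N" using N_nonneg odd_N by (metis add.commute add_0 even_zero int_one_le_iff_zero_less order_le_less)
    obtain c where c: "gap 0 / 2 < c" "c \<le> gap 0" "(- c, - c) \<in> T"
      using K_gap_cstep[OF P(2,3), of 0] N1 by auto
    \<comment> \<open>Crossing zero: the pair of 0 and \<open>om\<close> becomes the pair of -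
      \<open>om\<close> and 0.\<close>
    have "rr (0 - c) = fz (- 1)" using rr_step_up(1)[of 0 c] c fz_minus[of 1] by (simp add: rr_minus)
    moreover have "rr (fz 1 - c) = 0" using rr_step_up(2)[of 0 c] c by simp
    ultimately have Am: "?A (- 1)" using pair_step[OF P(1) c(3) A0] fz_Om[of "- 1"] N1 Om_pos by simp
    have neg: "?A (- k - 2)" if k: "0 \<le> k" "k + 1 < N" "?A (- k - 1)" for k
    proof -
      obtain c where c: "gap (k + 1) / 2 < c" "c \<le> gap (k + 1)" "(- c, - c) \<in> T"
        using K_gap_cstep[OF P(2,3), of "k + 1"] k N_nonneg by auto
      have "- k - 1 = - (k + 1)" "- k - 1 + 1 = - k" "- k - 2 = - (k + 2)" "- k - 2 + 1 = - (k + 1)" by simp_all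
      then have f: "fz (- k - 1) = - fz (k + 1)" "fz (- k - 1 + 1) = - fz k" "fz (- k - 2) = - fz (k + 2)" "fz (- k - 2 + 1) = - fz (k + 1)"
        using fz_minus by metis+
      have r: "rr (- fz (k + 1) + - c) = - fz (k + 2)" "rr (- fz k + - c) = - fz (k + 1)"
        using adjacent_up[OF k(1) c(1,2)] rr_minus[of "fz (k + 1) + c"] rr_minus[of "fz k + c"] by simp_all
      show ?thesis using pair_step[OF P(1) c(3) k(3)] r fz_Om[of "k + 1"] fz_Om[of "k + 2"] k unfolding f by simp
    qed
    have "?A (- (- j - 1) - 1)"
    proof (rule step_up_index[of 0 "- j - 1" "\<lambda>k. ?A (- k - 1)"])
      fix k assume k: "0 \<le> k" "k < - j - 1" "?A (- k - 1)"
      have "- (k + 1) - 1 = - k - 2" by simp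
      moreover have "?A (- k - 2)" using neg[OF k(1) _ k(3)] k j by linarith
      ultimately show "?A (- (k + 1) - 1)" by (simp only:)
    qed (use Am False in auto)
    then show ?thesis by simp
  qed
qed

text \<open>The summands are too small to move \<open>fz k\<close>.\<close>

lemma absorb_walk:
  assumes P: "prog T P" "strong s b" "csteps s \<subseteq> T" and st: "pair P (fz i) (fz k)"
    and ij: "\<bar>i\<bar> \<le> N" "\<bar>j\<bar> \<le> N" "\<bar>k\<bar> \<le> N"
    and D: "16 * om \<le> D" "D \<le> gap k" "D \<le> gap (k - 1)"
    and g: "\<And>l. min i j \<le> l \<Longrightarrow> l < max i j \<Longrightarrow> gap l \<le> D / 2"
  shows "pair P (fz j) (fz k)"
proof -
  \<comment> \<open>A summand equal to D / 2 could tie at \<open>fz k\<close>. The bound of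
    \<open>K78\<close> stays strictly below it, and in the lowest binades 16 * om \<le> D leaves
    enough room.\<close>
  have const: "\<exists>c. gap l / 2 < c \<and> c \<le> gap l \<and> c < D / 2 \<and> (c, c) \<in> T \<and> (- c, - c) \<in> T"
    if l: "min i j \<le> l" "l < max i j" for l
  proof -
    have lN: "- N \<le> l" "l < N" using l ij by auto
    obtain e where e: "a \<le> e" "e \<le> b" "gap l = p2 (e - m)" using gap_exp_bounded[OF lN] by blast
    show ?thesis
    proof (cases "a + 3 \<le> e")
      case True
      obtain w where w: "w \<in> F" "0 \<le> w" "ok (s * w)" "gap l / 2 < rr (s * w)" "rr (s * w) \<le> 7 / 8 * gap l"
        using K78[OF strong_mono[OF P(2) e(2)] True e(2)] unfolding e(3) by metis
      then have "(rr (s * w), rr (s * w)) \<in> csteps s" unfolding csteps_def by blast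
      moreover have "7 / 8 * gap l < gap l" using gap_pos[of l] by simp
      ultimately show ?thesis using w g[OF l] csteps_minus P(3)
        by (intro exI[of _ "rr (s * w)"]) (auto intro: le_less_trans)
    next
      case False
      then have "gap l \<le> p2 (a + 2 - m)" using e by simp
      then have "gap l \<le> 4 * om" using om_p2[of 2] by simp
      then have "gap l < D / 2" using D(1) om_pos by linarith
      moreover obtain c where c: "gap l / 2 < c" "c \<le> gap l" "(c, c) \<in> T" "(- c, - c) \<in> T"
        using K_gap_cstep[OF P(2,3) lN] by blast
      ultimately show ?thesis by force
    qed
  qed
  have ab: "rr (fz k + c) = fz k" "rr (fz k - c) = fz k" if "c < D / 2" "0 < c" for c
    using that D by (auto intro!: rr_near_strict)
  have kO: "\<bar>fz k\<bar> \<le> Om" using ij abs_fz_le by simp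
  show ?thesis
  proof (cases "i \<le> j")
    case True
    show ?thesis
    proof (rule step_up_index[of i j "\<lambda>l. pair P (fz l) (fz k)"])
      fix l assume l: "i \<le> l" "l < j" "pair P (fz l) (fz k)"
      obtain c where c: "gap l / 2 < c" "c \<le> gap l" "c < D / 2" "(c, c) \<in> T" using const[of l] l True by auto
      have "0 < c" using c(1) gap_pos[of l] by linarith
      then show "pair P (fz (l + 1)) (fz k)"
        using pair_step[OF P(1) c(4) l(3)] rr_step_up(1)[OF c(1,2)] ab[OF c(3)] kO fz_Om[of "l + 1"] l ij by simp
    qed (use st True in auto)
  next
    case False
    show ?thesis
    proof (rule step_down_index[of j i "\<lambda>l. pair P (fz l) (fz k)"])
      fix l assume l: "j \<le> l" "l < i" "pair P (fz (l + 1)) (fz k)"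
      obtain c where c: "gap l / 2 < c" "c \<le> gap l" "c < D / 2" "(- c, - c) \<in> T" using const[of l] l False by auto
      have "0 < c" using c(1) gap_pos[of l] by linarith
      then show "pair P (fz l) (fz k)"
        using pair_step[OF P(1) c(4) l(3)] rr_step_up(2)[OF c(1,2)] ab[OF c(3)] kO fz_Om[of l] l ij by simp
    qed (use st False in auto)
  qed
qed

lemma fz_nonneg [simp]: "0 \<le> fz i \<longleftrightarrow> 0 \<le> i"
  using fz_le[of 0 i] by (simp del: fz_le)

lemma fz_pos [simp]: "0 < fz i \<longleftrightarrow> 0 < i"
  using fz_less[of 0 i] by (simp del: fz_less)

section \<open>Pairs of distant values\<close>

lemma gap_symm_le:
  assumes "a \<le> e" "- idx (e + 1) \<le> l" "l < idx (e + 1)"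
  shows "gap l \<le> p2 (e - m)"
proof -
  have pos: "gap k \<le> p2 (e - m)" if k: "0 \<le> k" "k < idx (e + 1)" for k
  proof -
    obtain e' where e': "a \<le> e'" "gap k = p2 (e' - m)" "e' = a \<or> p2 e' \<le> fz k" using gap_exp[OF k(1)] by metis
    have "fz k < fz (idx (e + 1))" using k by simp
    then have "fz k < p2 (e + 1)" using fz_idx[of "e + 1"] assms(1) by simp
    then have "p2 e' \<le> fz k \<Longrightarrow> p2 e' < p2 (e + 1)" by linarith
    then have "e' \<le> e" using e'(3) assms(1) by (auto simp: p2_less)
    then show ?thesis using e' by simp
  qed
  show ?thesis
  proof (cases "0 \<le> l")
    case True then show ?thesis using pos[of l] assms by blast
  next
    case False then show ?thesis using pos[of "- l - 1"] assms gap_minus[of l] by auto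
  qed
qed

lemma gap_between_le:
  assumes "a \<le> e" "fz i \<le> p2 (e + 1)" "- p2 (e + 1) \<le> fz i" "fz j \<le> p2 (e + 1)" "- p2 (e + 1) \<le> fz j"
    "min i j \<le> l" "l < max i j"
  shows "gap l \<le> p2 (e - m)"
proof -
  have "p2 (e + 1) = fz (idx (e + 1))" using fz_idx[of "e + 1"] assms(1) by simp
  then have "fz i \<le> fz (idx (e + 1))" "fz (- idx (e + 1)) \<le> fz i" "fz j \<le> fz (idx (e + 1))" "fz (- idx (e + 1)) \<le> fz j"
    using assms fz_minus[of "idx (e + 1)"] by auto
  then show ?thesis using assms by (intro gap_symm_le) auto
qed

lemma gap_ge:
  assumes "a \<le> e" "p2 e \<le> fz i"
  shows "p2 (e - m) \<le> gap i"
proof -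
  have "fz i > 0" using assms p2_pos[of e] by linarith
  then have "0 \<le> i" using fz_le[of 0 i] by simp
  then obtain e' where e': "a \<le> e'" "gap i = p2 (e' - m)" "fz (i + 1) \<le> p2 (e' + 1)" using gap_exp by metis
  have "fz i < fz (i + 1)" by simp
  then have "p2 e < p2 (e' + 1)" using e' assms by linarith
  then show ?thesis using e' by simp
qed

lemma gap_pred_ge:
  assumes "a \<le> e" "p2 e < fz i"
  shows "p2 (e - m) \<le> gap (i - 1)"
proof -
  have "fz (idx e) < fz i" using assms fz_idx[of e] by simp
  then have "fz (idx e) \<le> fz (i - 1)" by simp
  then show ?thesis using gap_ge[of e "i - 1"] assms fz_idx[of e] by simp
qed

text \<open>Even the least positive height suffices for numbers up to 8: since emin + emax = 1, the
  product \<open>om * Om\<close> is almost 2^(2-M), the last place of binade 2, and only half of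
  that is required.\<close>

lemma strong_tiny: "om \<le> v \<Longrightarrow> v \<le> 5 / 4 \<Longrightarrow> strong v 2"
proof -
  assume v: "om \<le> v" "v \<le> 5 / 4"
  have "of_int 3 * p2 (0 - m) \<in> Fz" using ab b15 two_M by (intro Fz_mem) auto
  moreover have "of_int 3 * p2 (0 - m) \<le> v * Om"
  proof -
    have "om * Om \<le> v * Om" using v Om_pos by simp
    moreover have "om * Om = p2 (a - m + (b + 1)) - p2 (a - m + (b - m))" unfolding om_def Om_p2 by (simp only: p2_add right_diff_distrib)
    moreover have "a - m + (b + 1) = 2 - m" "a - m + (b - m) = 1 - m - m" using ab by auto
    ultimately have "p2 (2 - m) - p2 (1 - m - m) \<le> v * Om" by (simp only:)
    moreover have "p2 (1 - m - m) \<le> p2 (- m)" using m3 by simp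
    moreover have "p2 (2 - m) = 4 * p2 (- m)" by (simp add: p2_diff p2_minus)
    ultimately have "3 * p2 (- m) \<le> v * Om" by linarith
    then show ?thesis by simp
  qed
  ultimately have "3 * p2 (- m) \<le> rr (v * Om)" using rr_ge by simp
  moreover have "p2 (2 - m) / 2 = 2 * p2 (- m)" by (simp add: p2_diff p2_minus)
  ultimately show ?thesis using v p2_pos[of "- m"] unfolding strong_def by linarith
qed

lemma small_pair:
  assumes P: "prog T P" "strong s b" "csteps s \<subseteq> T" "strong v 2" "bsteps v \<subseteq> T" "pair P 0 0"
    and ij: "i \<le> j" "\<bar>fz i\<bar> \<le> 8" "\<bar>fz j\<bar> \<le> 8"
  shows "pair P (fz i) (fz j)"
proof -
  have e8: "p2 (2 + 1) = 8" by simp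
  have N8: "8 \<le> Om" using p2_le_Om[of 3] b15 by simp
  have N: "\<bar>i\<bar> \<le> N" "\<bar>j\<bar> \<le> N" using ij N8 abs_fz_le[of i] abs_fz_le[of j] by linarith+
  have "pair P (fz i) (fz i)" using const_walk[OF P(1-3), of 0 i] P(6) N N_nonneg by simp
  then show ?thesis
  proof (rule on_walk[OF P(1,4,5)])
    show "gap k \<le> p2 (2 - m)" if "i \<le> k" "k < j" for k
      using gap_between_le[of 2 i j k] ij that ab b15 unfolding e8 by auto
  qed (use ij N b15 abs_fz_le[of i] in auto)
qed

text \<open>Above 8 a constant lifts both values, the on value to its successor and the off value to
  at most one gap of the on value. Then the off value returns to 0 by constants too small to move
  the on value.\<close>

lemma zero_pair:
  assumes P: "prog T P" "strong s b" "csteps s \<subseteq> T" "strong v 2" "bsteps v \<subseteq> T" "pair P 0 0"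
    and j: "0 \<le> j" "j \<le> N"
  shows "pair P 0 (fz j)"
proof -
  have i8: "fz (idx 3) = 8" using fz_idx[of 3] ab b15 by simp
  have base: "pair P 0 (fz j)" if "0 \<le> j" "j \<le> idx 3" for j
  proof -
    have "fz j \<le> fz (idx 3)" "0 \<le> fz j" using that by simp_all
    then show ?thesis using small_pair[OF P, of 0 j] that(1) i8 by simp
  qed
  have i0: "0 \<le> idx 3" using idx_pos[of 3] ab b15 by simp
  show ?thesis
  proof (cases "j \<le> idx 3")
    case True then show ?thesis using base j by blast
  next
    case False
    show ?thesis
    proof (rule step_up_index[of "idx 3" j "\<lambda>k. pair P 0 (fz k)"])
      fix k assume k: "idx 3 \<le> k" "k < j" "pair P 0 (fz k)"
      have k0: "0 \<le> k" using k idx_pos[of 3] ab b15 by simp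
      obtain c where c: "gap k / 2 < c" "c \<le> gap k" "(c, c) \<in> T" 
        using K_gap_cstep[OF P(2,3), of k] k k0 j N_nonneg by auto
      have big: "p2 (3 - m) \<le> gap k" using gap_ge[of 3 k] k i8 ab b15 fz_le[of "idx 3" k] by simp
      have "16 * om \<le> p2 (3 - m)" using om_p2[of 4] p2_le[of "a + 4 - m" "3 - m"] ab b15 by simp
      then have D: "16 * om \<le> gap k" using big by linarith
      obtain i where i: "gap k = fz i" 
      proof -
        obtain e where "a \<le> e" "gap k = p2 (e - m)" using gap_exp[OF k0] by metis
        then have "gap k \<in> Fz" using p2_Fz[of "e - m"] by simp
        then show ?thesis using that by (auto simp: Fz_def)
      qed
      have cF: "rr c \<in> Fz" by simp
      obtain l where l: "rr c = fz l" using rr_in[of c] by (auto simp: Fz_def)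
      have gk: "gap k > 0" by (rule gap_pos)
      have "fz 0 \<le> fz l" using rr_0_le[of c] c gk l by simp
      then have l0: "0 \<le> l" by (simp only: fz_le)
      have "fz l \<le> fz i" using rr_le[of c "gap k"] c l i by simp
      then have lk: "fz l \<le> gap k" using i by simp
      have "gap k \<le> Om"
      proof -
        have "gap k \<le> fz (k + 1)" using k0 fz_le[of 0 k] by (simp add: gap_def)
        then show ?thesis using fz_Om[of "k + 1"] k k0 j by simp
      qed
      then have lN: "\<bar>l\<bar> \<le> N" using lk l0 fz_le[of 0 l] abs_fz_le[of l] by auto
      have s1: "pair P (fz l) (fz (k + 1))"
        using pair_step[OF P(1) c(3) k(3)] rr_step_up(1)[OF c(1,2)] fz_Om[of "k + 1"] lN k k0 j abs_fz_le[of l] l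
        by simp
      have "pair P (fz 0) (fz (k + 1))"
      proof (rule absorb_walk[OF P(1-3) s1, of 0 "gap k"])
        show "gap k \<le> gap (k + 1)" using gap_next[OF k0] gk by auto
        show "gap r \<le> gap k / 2" if r: "min l 0 \<le> r" "r < max l 0" for r
        proof -
          have r0: "0 \<le> r" "r < l" using r l0 by auto
          then have "fz r < fz l" by simp
          then have "fz r \<le> gap k" using lk by linarith
          then show ?thesis using gap_le[OF r0(1)] D gk unfolding le_max_iff_disj by linarith
        qed
      qed (use D lN k k0 j N_nonneg in auto)
      then show "pair P 0 (fz (k + 1))" by simp
    qed (use base i0 False in auto)
  qed
qed

text \<open>Every gap that the off value crosses within 2^d is at most half of the gaps at
  \<open>fz k\<close>, so it walks from 0 to its target while the on value absorbs all
  summands.\<close>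

lemma low_pair:
  assumes P: "prog T P" "strong s b" "csteps s \<subseteq> T" "strong v 2" "bsteps v \<subseteq> T" "pair P 0 0"
    and d: "3 \<le> d" "p2 d < fz k" "fz k \<le> Om" "\<bar>fz i\<bar> \<le> p2 d"
  shows "pair P (fz i) (fz k)"
proof -
  have kpos: "0 < fz k" using d p2_pos[of d] by linarith
  then have k0: "0 \<le> k" using fz_le[of 0 k] by simp
  have kN: "\<bar>k\<bar> \<le> N" using d kpos abs_fz_le[of k] by simp
  have iN: "\<bar>i\<bar> \<le> N" using d abs_fz_le[of i] by linarith
  have "pair P (fz 0) (fz k)" using zero_pair[OF P] k0 kN by simp
  then show ?thesis
  proof (rule absorb_walk[OF P(1-3)])
    show "16 * om \<le> p2 (d - m)" using om_p2[of 4] p2_le[of "a + 4 - m" "d - m"] ab b15 d by simp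
    show "p2 (d - m) \<le> gap k" using gap_ge[of d k] d ab b15 by simp
    show "p2 (d - m) \<le> gap (k - 1)" using gap_pred_ge[of d k] d ab b15 by simp
    show "gap l \<le> p2 (d - m) / 2" if "min 0 i \<le> l" "l < max 0 i" for l
    proof -
      have "gap l \<le> p2 (d - 1 - m)" using gap_between_le[of "d - 1" 0 i l] that d ab b15 by (auto simp: abs_le_iff)
      then show ?thesis by (simp add: p2_diff)
    qed
  qed (use kN iN N_nonneg in auto)
qed

lemma binade_multiple:
  assumes "a \<le> d" "p2 d \<le> fz i" "fz i \<le> p2 (d + 1)"
  obtains n where "fz i = of_int n * p2 (d - m)" "2 ^ M \<le> n" "n \<le> 2 ^ (M + 1)"
proof -
  have "fz (idx d) \<le> fz i" "fz i \<le> fz (idx (d + 1))" using assms fz_idx[of d] fz_idx[of "d + 1"] by auto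
  then have i: "0 \<le> i - idx d" "i - idx d \<le> 2 ^ M" using idx_Suc[of d] by auto
  have "fz (idx d + (i - idx d)) = of_int (2 ^ M + (i - idx d)) * p2 (d - m)" by (rule fz_form[OF assms(1) i])
  then show ?thesis using that[of "2 ^ M + (i - idx d)"] i by simp
qed

lemma half_open_bracket:
  assumes "x > 0"
  obtains d where "p2 d < x" "x \<le> p2 (d + 1)"
proof -
  obtain e where e: "p2 e \<le> x" "x < p2 (e + 1)" using p2_bracket assms by blast
  show ?thesis
  proof (cases "x = p2 e")
    case True then show ?thesis using that[of "e - 1"] by simp
  next
    case False then show ?thesis using that[of e] e by simp
  qed
qed

text \<open>If both targets have the magnitude of the top binade, a pair near 0 with the right
  distance is prepared and the bias c shifts it without error. For opposite signs the distance needs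
  the next binade; the excluded case is the one in which that binade could overflow.\<close>

lemma widen:
  assumes P: "prog T P" "strong s b" "csteps s \<subseteq> T" "strong v 2" "bsteps v \<subseteq> T" "pair P 0 0"
    and ij: "i < j" "\<bar>fz i\<bar> \<le> fz j" "fz j \<le> Om" and nex: "\<not> (fz i < - p2 (b - 1) \<and> p2 (b - 1) < fz j)"
  obtains x y c where "pair P x y" "c \<in> F" "rr (x + c) = fz i" "rr (y + c) = fz j"
proof (cases "fz j \<le> 8")
  case True
  have "pair P (fz i) (fz j)" using small_pair[OF P, of i j] ij True by auto
  then show ?thesis using that[of "fz i" "fz j" 0] zero_F by simp
next
  case False
  then have "fz j > 0" by linarith
  then obtain d where d: "p2 d < fz j" "fz j \<le> p2 (d + 1)" using half_open_bracket by blast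
  have "p2 3 < p2 (d + 1)" using False d by simp
  then have d3: "3 \<le> d" by (simp only: p2_less)
  have ad: "a \<le> d" using d3 ab b15 by simp
  define D where "D = p2 (d - m)"
  have D0: "D > 0" by (simp add: D_def)
  obtain n where n: "fz j = of_int n * D" "2 ^ M \<le> n" "n \<le> 2 ^ (M + 1)"
    using binade_multiple[OF ad less_imp_le[OF d(1)] d(2)] unfolding D_def by blast
  have pd: "p2 d = 2 ^ M * D" by (simp add: D_def p2_diff p2_nat)
  consider "\<bar>fz i\<bar> \<le> p2 d" | "p2 d < fz i" | "fz i < - p2 d" by linarith
  then show ?thesis
  proof cases
    case 1
    have "pair P (fz i) (fz j)" using low_pair[OF P d3 d(1) ij(3) 1] .
    then show ?thesis using that[of "fz i" "fz j" 0] zero_F by simp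
  next
    case 2
    have "fz i \<le> p2 (d + 1)" using ij(2) d(2) by linarith
    then obtain k where k: "fz i = of_int k * D" "2 ^ M \<le> k" "k \<le> 2 ^ (M + 1)"
      using binade_multiple[OF ad less_imp_le[OF 2]] unfolding D_def by blast
    have nk: "fz j - fz i = of_int (n - k) * D" by (simp add: n k algebra_simps)
    have "\<bar>n - k\<bar> \<le> 2 ^ (M + 1)" using n k by simp
    then have "fz j - fz i \<in> Fz" unfolding nk D_def using ad by (intro Fz_mem) auto
    then obtain r where r: "fz j - fz i = fz r" by (auto simp: Fz_def)
    have "fz i < fz j" using ij by simp
    then have "0 \<le> fz r" "fz r \<le> fz N" using r 2 ij p2_pos[of d] fz_N by linarith+
    then have "0 \<le> r" "r \<le> N" by simp_all
    then have pr: "pair P 0 (fz r)" using zero_pair[OF P] by blast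
    have iF: "fz i \<in> F" using ij by (auto simp: F_iff)
    have "rr (0 + fz i) = fz i" "rr (fz r + fz i) = fz j" using r[symmetric] by simp_all
    then show ?thesis using that[OF pr iF] by blast
  next
    case 3
    have mi: "fz (- i) = - fz i" by (rule fz_minus)
    have "p2 d \<le> fz (- i)" "fz (- i) \<le> p2 (d + 1)" using mi 3 ij(2) d(2) by linarith+
    then obtain k where "fz (- i) = of_int k * D" and k': "2 ^ M \<le> k" "k \<le> 2 ^ (M + 1)"
      using binade_multiple[OF ad] unfolding D_def by blast
    then have k: "- fz i = of_int k * D" "2 ^ M \<le> k" "k \<le> 2 ^ (M + 1)" using mi by simp_all
    have "of_int k * D \<le> of_int n * D" using k(1) n(1) ij by linarith
    then have kn: "k \<le> n" using D0 by simp
    have "of_int (2 ^ M) * D < of_int k * D" using 3 k(1) pd by simp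
    then have k2: "2 ^ M < k" using D0 by (simp only: mult_less_cancel_right_pos of_int_less_iff)
    have "p2 d < p2 (b - 1)" using nex 3 d by linarith
    then have db: "d + 2 \<le> b" by simp
    \<comment> \<open>In the next binade only even multiples of D are available. The correction z is
      part of both values and is taken back by c.\<close>
    define z where "z = (if even (n + k) then 0 else 1 :: int)"
    have z: "even (n + k + z)" "0 \<le> z" "z \<le> 1" by (auto simp: z_def)
    define h where "h = (n + k + z) div 2"
    have h: "n + k + z = 2 * h" using z unfolding h_def by auto
    have nkz: "k + z \<le> 2 ^ (M + 1)"
    proof (cases "even (n + k)")
      case True then show ?thesis using k by (simp add: z_def)
    next
      case False then have "k \<noteq> n" by auto
      then show ?thesis using kn n z by linarith
    qed
    have Q: "of_int (n + k + z) * D = of_int h * p2 (d + 1 - m)" using p2_Suc[of "d - m"] unfolding h D_def by (simp add: algebra_simps)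
    have h2: "2 ^ M < h" "h \<le> 2 ^ (M + 1)" using h kn k2 nkz n z by linarith+
    have QF: "of_int h * p2 (d + 1 - m) \<in> Fz" using h2 ad two_M by (intro Fz_mem) auto
    have "of_int h * p2 (d + 1 - m) \<le> of_int (2 ^ (M + 1)) * p2 (d + 1 - m)" using h2(2) by (intro mult_right_mono) (simp_all only: of_int_le_iff p2_nonneg)
    also have "\<dots> = p2 (d + 2)" by (simp add: p2_add p2_diff p2_nat)
    also have "\<dots> \<le> Om" using p2_le_Om db by blast
    finally have QOm: "of_int h * p2 (d + 1 - m) \<le> Om" .
    have "of_int (2 ^ M) * p2 (d + 1 - m) < of_int h * p2 (d + 1 - m)" using h2(1) by (intro mult_strict_right_mono) (simp_all only: of_int_less_iff p2_pos)
    then have Qd: "p2 (d + 1) < of_int h * p2 (d + 1 - m)" by (simp add: p2_add p2_diff p2_nat)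
    obtain r where r: "of_int h * p2 (d + 1 - m) = fz r" using QF by (auto simp: Fz_def)
    have zF: "of_int z * D \<in> Fz" unfolding D_def using ad z two_M by (intro Fz_mem) auto
    then obtain r' where r': "of_int z * D = fz r'" by (auto simp: Fz_def)
    have "\<bar>fz r'\<bar> \<le> p2 (d + 1)"
    proof -
      have "\<bar>of_int z * D\<bar> \<le> D" using D0 by (auto simp: z_def)
      also have "D \<le> p2 (d + 1)" unfolding D_def using m3 by simp
      finally show ?thesis using r' by simp
    qed
    then have pr: "pair P (of_int z * D) (of_int (n + k + z) * D)"
      using low_pair[OF P, of "d + 1" r r'] d3 Qd QOm unfolding Q r r' by simp
    define c where "c = of_int (- (k + z)) * D"
    have "c \<in> Fz" unfolding c_def D_def using ad nkz k z two_M by (intro Fz_mem) auto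
    moreover have "\<bar>c\<bar> \<le> Om"
    proof -
      have "of_int (k + z) * D \<le> of_int (n + k + z) * D" using n D0 two_M by (intro mult_right_mono) simp_all
      moreover have "0 \<le> of_int (k + z) * D" using k z D0 two_M by simp
      moreover have "\<bar>c\<bar> = \<bar>of_int (k + z) * D\<bar>" unfolding c_def by (simp only: of_int_minus mult_minus_left abs_minus_cancel)
      ultimately show ?thesis using QOm unfolding Q by linarith
    qed
    ultimately have cF: "c \<in> F" by (simp add: F_iff)
    have "of_int z * D + c = fz i" "of_int (n + k + z) * D + c = fz j" using k(1) n(1) by (simp_all add: c_def algebra_simps)
    then show ?thesis using that[OF pr cF] by simp
  qed
qed

section \<open>Pairs whose distance may overflow\<close>

lemma gap_mono: "0 \<le> l \<Longrightarrow> l \<le> k \<Longrightarrow> gap l \<le> gap k"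
proof -
  assume l: "0 \<le> l" "l \<le> k"
  have "nat l div 2 ^ M - 1 \<le> nat k div 2 ^ M - 1" using l by (intro diff_le_mono div_le_mono nat_mono)
  then show ?thesis using l by (simp add: gap_nonneg gp_def)
qed

text \<open>The assumed height is \<epsilon>/2 + 2\<epsilon>^2. Its second term outweighs the
  deficit of \<open>Om\<close> against 2^(emax+1), so the product passes half of the largest gap by
  a full last place and remains above it after rounding.\<close>

lemma good_bound:
  assumes "p2 (- m - 2) + p2 (- 2 * m - 1) \<le> v"
  shows "p2 (b - m - 1) + p2 (b - 2 * m - 1) \<le> v * Om"
proof -
  have "(p2 (- m - 2) + p2 (- 2 * m - 1)) * Om \<le> v * Om" using assms Om_pos by simp
  moreover have "(p2 (- m - 2) + p2 (- 2 * m - 1)) * Om =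
    p2 (- m - 2 + (b + 1)) - p2 (- m - 2 + (b - m)) + (p2 (- 2 * m - 1 + (b + 1)) - p2 (- 2 * m - 1 + (b - m)))"
    unfolding Om_p2 by (simp only: p2_add distrib_right right_diff_distrib)
  moreover have e: "- m - 2 + (b + 1) = b - m - 1" "- m - 2 + (b - m) = (b - 2 * m) - 2" "- 2 * m - 1 + (b + 1) = b - 2 * m"
    by simp_all
  ultimately have "p2 (b - m - 1) - p2 (b - 2 * m - 2) + (p2 (b - 2 * m) - p2 (- 2 * m - 1 + (b - m))) \<le> v * Om"
    by (simp only: e)
  moreover have "p2 (b - 2 * m - 2) = p2 (b - 2 * m) / 4" "p2 (b - 2 * m - 1) = p2 (b - 2 * m) / 2" by (simp_all add: p2_diff)
  moreover have "p2 (- 2 * m - 1 + (b - m)) \<le> p2 (b - 2 * m - 2)" using m3 by simp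
  ultimately show ?thesis by linarith
qed

lemma good_multiple: "p2 (x - m) + p2 (x - 2 * m) = of_int (2 ^ M + 1) * p2 (x - m - m)"
proof -
  have "p2 (x - m) = 2 ^ M * p2 (x - m - m)" using p2_diff[of "x - m" m] by (simp add: p2_nat)
  moreover have "x - 2 * m = x - m - m" by simp
  ultimately show ?thesis by (simp only: of_int_add of_int_1 of_int_power of_int_numeral distrib_right mult_1)
qed

lemma good_strong:
  assumes "p2 (- m - 2) + p2 (- 2 * m - 1) \<le> v" "v \<le> 5 / 4" "v \<in> Fz"
  shows "strong v b"
proof -
  have "0 < v" using assms(1) p2_pos[of "- m - 2"] p2_pos[of "- 2 * m - 1"] by linarith
  then have "om \<le> v" using Fz_pos_ge assms by blast
  have X: "p2 (b - m - 1) + p2 (b - 2 * m - 1) = of_int (2 ^ M + 1) * p2 (b - 1 - m - m)"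
    using good_multiple[of "b - 1"] by (simp add: algebra_simps)
  have "of_int (2 ^ M + 1) * p2 (b - 1 - m - m) \<in> Fz" using two_M mb ab b15 by (intro Fz_mem) auto
  then have "p2 (b - m - 1) + p2 (b - 2 * m - 1) \<le> rr (v * Om)" using rr_ge good_bound[OF assms(1)] X by simp
  moreover have "p2 (b - m) / 2 = p2 (b - m - 1)" by (simp add: p2_diff)
  ultimately show ?thesis unfolding strong_def using \<open>om \<le> v\<close> assms(2) p2_pos[of "b - 2 * m - 1"] by linarith
qed

text \<open>The pair is reached from its left end by summands \<open>(rr (t * w), rr (s * w))\<close> whose first
  component is absorbed there.\<close>

lemma wide_pair:
  assumes P: "prog T P" "csteps s \<subseteq> T" "pair P 0 0" "\<And>w. w \<in> F \<Longrightarrow> 0 \<le> w \<Longrightarrow> ok (s * w) \<Longrightarrow> (rr (t * w), rr (s * w)) \<in> T"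
    and s: "p2 (- m - 2) + p2 (- 2 * m - 1) \<le> s" "s \<le> 5 / 4" "s \<in> Fz" and t: "0 \<le> t" "t \<le> p2 (- m - 2)"
    and ij: "i \<le> j" "fz i < - p2 (b - 1)" "fz j \<le> - fz i" "- N \<le> i"
  shows "pair P (fz i) (fz j)"
proof -
  have st: "strong s b" using good_strong s by blast
  have ts: "t \<le> s" using s t p2_pos[of "- 2 * m - 1"] by linarith
  define k where "k = - i - 1"
  have gk: "gap k = gap i" by (simp add: k_def gap_minus)
  have mi: "fz (k + 1) = - fz i" using fz_minus[of i] by (simp add: k_def)
  have ab1: "a \<le> b - 1" using ab b15 by simp
  have "fz (idx (b - 1)) < fz (k + 1)" using ij mi fz_idx[OF ab1] by simp
  then have kb: "fz (idx (b - 1)) \<le> fz k" by simp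
  then have kp: "p2 (b - 1) \<le> fz k" using fz_idx[OF ab1] by simp
  then have "0 \<le> fz k" using p2_pos[of "b - 1"] by linarith
  then have k0: "0 \<le> k" by simp
  have iN: "i < N" using k0 N_nonneg by (simp add: k_def)
  obtain e where e: "a \<le> e" "e \<le> b" "gap i = p2 (e - m)" using gap_exp_bounded ij(4) iN by blast
  have "p2 (b - 1 - m) \<le> p2 (e - m)" using gap_ge[OF ab1 kp] gk e by simp
  then have eb: "b - 1 \<le> e" by simp
  have "fz j \<le> fz (k + 1)" using ij mi by simp
  then have jk: "j \<le> k + 1" by simp
  have jN: "j \<le> N" using jk ij by (simp add: k_def)
  have gi: "32 * om \<le> gap i" using om_p2[of 5] p2_le[of "a + 5 - m" "e - m"] eb ab b15 e by simp
  have choice: "\<exists>w. w \<in> F \<and> 0 \<le> w \<and> ok (s * w) \<and> gap l / 2 < rr (s * w) \<and> rr (s * w) \<le> gap l \<and> rr (t * w) < gap i / 2"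
    if l: "i \<le> l" "l < j" for l
  proof -
    obtain e' where e': "a \<le> e'" "e' \<le> b" "gap l = p2 (e' - m)" using gap_exp_bounded[of l] l ij jN by auto
    have "gap l \<le> gap k"
    proof (cases "0 \<le> l")
      case True then show ?thesis using gap_mono[of l k] l jk by simp
    next
      case False then show ?thesis using gap_mono[of "- l - 1" k] gap_minus[of l] l by (simp add: k_def)
    qed
    then have "e' \<le> e" using gk e e' by simp
    have tw: "rr (t * w) \<le> rr (s * w)" if "0 \<le> w" for w using ts that by (intro rr_mono mult_right_mono)
    show ?thesis
    proof (cases "e' < e")
      case True
      then have half: "gap l \<le> gap i / 2" using p2_le[of "e' - m" "e - m - 1"] e e' by (simp add: p2_diff)
      show ?thesis
      proof (cases "a + 3 \<le> e'")
        case a3: True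
        obtain w where w: "w \<in> F" "0 \<le> w" "ok (s * w)" "gap l / 2 < rr (s * w)" "rr (s * w) \<le> 7 / 8 * gap l"
          using K78[OF strong_mono[OF st e'(2)] a3 e'(2)] unfolding e'(3) by metis
        then have "rr (s * w) \<le> gap l" "rr (t * w) < gap i / 2" using tw[OF w(2)] half gap_pos[of l] by linarith+
        then show ?thesis using w by blast
      next
        case False
        obtain w where w: "w \<in> F" "0 \<le> w" "ok (s * w)" "gap l / 2 < rr (s * w)" "rr (s * w) \<le> gap l"
          using K[OF strong_mono[OF st e'(2)] e'(1,2)] unfolding e'(3) by metis
        have "gap l \<le> 4 * om" using False om_p2[of 2] p2_le[of "e' - m" "a + 2 - m"] e' by simp
        then have "rr (t * w) < gap i / 2" using w tw[OF w(2)] gi om_pos by linarith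
        then show ?thesis using w by blast
      qed
    next
      case False
      then have ee: "e' = e" "gap l = gap i" using \<open>e' \<le> e\<close> e e' by auto
      have a3: "a + 4 \<le> e" "a + 3 \<le> e" using eb ab b15 by simp_all
      show ?thesis
      \<comment> \<open>If t is at most half of s, a product of at most 7/8 of the gap for s comes
        with one of at most 7/16 for t.\<close>
      proof (cases "2 * t \<le> s")
        case True
        obtain w where w: "w \<in> F" "0 \<le> w" "ok (s * w)" "gap l / 2 < rr (s * w)" "s * w \<le> 7 / 8 * gap l" "rr (s * w) \<le> 7 / 8 * gap l"
          using K78[OF strong_mono[OF st e(2)] a3(2) e(2)] unfolding e'(3) ee(1) by metis
        have "2 * t * w \<le> s * w" using True w by (intro mult_right_mono)
        then have "t * w \<le> 7 / 16 * gap i" using w(5) ee by simp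
        moreover have "7 / 16 * gap i \<in> Fz" using frac_Fz[of "e - 4" 7] a3 e by (simp add: p2_diff)
        ultimately have "rr (t * w) \<le> 7 / 16 * gap i" by (rule rr_le)
        then have "rr (t * w) < gap i / 2" "rr (s * w) \<le> gap l" using gap_pos[of i] w(6) ee by linarith+
        then show ?thesis using w by blast
      next
        case False
        \<comment> \<open>A significand of ones only separates s from t: s * w exceeds half of the
          gap by \<open>good_bound\<close>, while t * w is at most 2^(-M-2) * w, just below
          it.\<close>
        define w where "w = p2 (e - b) * Om"
        have wm: "w = of_int (2 ^ (M + 1) - 1) * p2 (e - m)"
          unfolding w_def Om_p2 by (simp add: p2_add p2_diff p2_nat field_simps)
        have w0: "0 \<le> w" unfolding w_def using Om_pos by simp
        have "p2 (e - b) * Om \<le> 1 * Om" using e Om_pos p2_le[of "e - b" 0] by (intro mult_right_mono) auto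
        moreover have "w \<in> Fz" unfolding wm using e by (intro Fz_mem) auto
        ultimately have wF: "w \<in> F" using w0 by (simp add: F_iff w_def)
        have wle: "w \<le> p2 (e + 1)" using Om_p2 p2_pos[of "b - m"] mult_left_mono[of Om "p2 (b + 1)" "p2 (e - b)"]
          by (simp add: w_def p2_add[symmetric] add.commute)
        have "s * w \<le> (2 * p2 (- m - 2)) * p2 (e + 1)" using False t s ts wle w0 by (intro mult_mono) auto
        also have "\<dots> = gap i" unfolding e by (simp add: p2_add p2_diff p2_minus)
        finally have sg: "s * w \<le> gap i" .
        have "(p2 (b - m - 1) + p2 (b - 2 * m - 1)) * p2 (e - b) \<le> s * Om * p2 (e - b)" 
          using good_bound[OF s(1)] by (intro mult_right_mono) auto
        moreover have "(p2 (b - m - 1) + p2 (b - 2 * m - 1)) * p2 (e - b) = p2 (e - 1 - m) + p2 (e - 1 - 2 * m)"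
          unfolding distrib_right p2_add[symmetric] by (simp add: algebra_simps)
        moreover have "s * Om * p2 (e - b) = s * w" by (simp add: w_def)
        ultimately have lo: "p2 (e - 1 - m) + p2 (e - 1 - 2 * m) \<le> s * w" by linarith
        have "p2 (e - 1 - m) + p2 (e - 1 - 2 * m) \<in> Fz" unfolding good_multiple using two_M mb ab b15 eb by (intro Fz_mem) auto
        then have "p2 (e - 1 - m) + p2 (e - 1 - 2 * m) \<le> rr (s * w)" using lo rr_ge by blast
        moreover have "gap i / 2 = p2 (e - 1 - m)" unfolding e by (simp add: p2_diff)
        ultimately have r1: "gap i / 2 < rr (s * w)" using p2_pos[of "e - 1 - 2 * m"] by linarith
        have giF: "gap i \<in> Fz" using e p2_Fz[of "e - m"] by simp
        have r2: "rr (s * w) \<le> gap i" using rr_le[OF sg giF] .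
        have "t * w \<le> p2 (- m - 2) * w" using t w0 by (intro mult_right_mono)
        also have "\<dots> = of_int (2 ^ (M + 1) - 1) * p2 (e - m - 2 - m)"
        proof -
          have "e - m - 2 - m = (- m - 2) + (e - m)" by simp
          then have "p2 (e - m - 2 - m) = p2 (- m - 2) * p2 (e - m)" by (simp only: p2_add)
          then show ?thesis unfolding wm by (simp only: mult_ac)
        qed
        finally have tw2: "t * w \<le> of_int (2 ^ (M + 1) - 1) * p2 (e - m - 2 - m)" .
        have "of_int (2 ^ (M + 1) - 1) * p2 (e - m - 2 - m) \<in> Fz" using mb ab b15 eb by (intro Fz_mem) auto
        then have "rr (t * w) \<le> of_int (2 ^ (M + 1) - 1) * p2 (e - m - 2 - m)" using rr_le tw2 by blast
        also have "\<dots> < 2 ^ (M + 1) * p2 (e - m - 2 - m)" by (simp add: left_diff_distrib)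
        also have "\<dots> = gap i / 2"
        proof -
          have "p2 (e - m - 2 - m) = p2 (e - m - 2) / 2 ^ M" using p2_diff[of "e - m - 2" m] by (simp only: p2_nat)
          moreover have "p2 (e - m - 2) = gap i / 4" using p2_diff[of "e - m" 2] e by simp
          ultimately show ?thesis by (simp only:) simp
        qed
        finally have r3: "rr (t * w) < gap i / 2" .
        have "gap i \<le> Om" using ulp_le_Om[of e] e p2_pos[of "e - m"] by linarith
        moreover have "0 \<le> s * w" using w0 ts t by simp
        ultimately have "ok (s * w)" using ok_scaled[of s w "gap i"] sg by blast
        then show ?thesis using wF w0 r1 r2 r3 ee by metis
      qed
    qed
  qed
  have iO: "\<bar>fz i\<bar> \<le> Om" using fz_Om ij iN by simp
  have st0: "pair P (fz i) (fz i)" using const_walk[OF P(1) st P(2), of 0 i] P(3) ij iN N_nonneg by simp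
  show ?thesis
  proof (rule step_up_index[of i j "\<lambda>l. pair P (fz i) (fz l)"])
    fix l assume l: "i \<le> l" "l < j" "pair P (fz i) (fz l)"
    obtain w where w: "w \<in> F" "0 \<le> w" "ok (s * w)" "gap l / 2 < rr (s * w)" "rr (s * w) \<le> gap l" "rr (t * w) < gap i / 2"
      using choice[OF l(1,2)] by blast
    have "0 \<le> rr (t * w)" using t w by (intro rr_0_le) simp
    then have "rr (fz i + rr (t * w)) = fz i" using w(6) gap_pos[of "i - 1"] by (intro rr_near_strict) linarith+
    then show "pair P (fz i) (fz (l + 1))"
      using pair_step[OF P(1) P(4)[OF w(1-3)] l(3)] rr_step_up(1)[OF w(4,5)] fz_Om[of "l + 1"] l ij jN iO by simp
  qed (use ij st0 in auto)
qed

end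

section \<open>Networks as sums of neurons\<close>

text \<open>One network has to serve all boxes, so every statement below is made for the whole
  family \<open>BB\<close> of admissible boxes.\<close>

locale nets = fp +
  fixes \<sigma> :: "fl \<Rightarrow> fl" and d :: nat and BB :: "ival list set"
  assumes valid: "fvalid E M v \<Longrightarrow> fvalid E M (\<sigma> v)"
    and BB: "B \<in> BB \<Longrightarrow> length B = d \<and> (\<forall>I\<in>set B. \<exists>l u. I = Iv (Fin l) (Fin u) \<and> l \<in> F \<and> u \<in> F \<and> - 1 \<le> l \<and> l \<le> u \<and> u \<le> 1)"
begin

abbreviation imul :: "ival \<Rightarrow> real \<Rightarrow> ival" where "imul I w \<equiv> iop (fmul E M) I (Iv (Fin w) (Fin w))"
abbreviation iadd :: "ival \<Rightarrow> ival \<Rightarrow> ival" where "iadd \<equiv> iop (fadd E M)"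
abbreviation pt :: "real \<Rightarrow> ival" where "pt c \<equiv> Iv (Fin c) (Fin c)"
abbreviation act :: "ival \<Rightarrow> ival" where "act \<equiv> sigma_sharp E M \<sigma>"
abbreviation wf :: "ival \<Rightarrow> bool" where "wf \<equiv> wf_ival E M"

section \<open>Interval sums and products of floats\<close>

lemma of_ext_ext: "v \<noteq> NaN \<Longrightarrow> of_ext (ext v) = v"
  by (cases v) (auto simp: of_ext_def)

lemma ext_inj: "u \<noteq> NaN \<Longrightarrow> v \<noteq> NaN \<Longrightarrow> ext u = ext v \<Longrightarrow> u = v"
  using of_ext_ext by metis

lemma fvalid_Fin [simp]: "fvalid E M (Fin r) \<longleftrightarrow> r \<in> F"
  by (simp add: fvalid_def F_def)

lemma fvalid_inf [simp]: "fvalid E M PInf" "fvalid E M MInf" "fvalid E M NaN"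
  by (simp_all add: fvalid_def)

lemma fvalid_rnd: "fvalid E M (rnd E M x)"
proof (cases "ok x")
  case True then show ?thesis by (simp add: rnd_ok rr_F)
next
  case False
  then have "x \<ge> Om + p2 (b - m) / 2 \<or> x \<le> - Om - p2 (b - m) / 2" unfolding ok_iff by linarith
  then show ?thesis using rnd_PInf rnd_MInf by auto
qed

lemma fvalid_fadd: "fvalid E M u \<Longrightarrow> fvalid E M v \<Longrightarrow> fvalid E M (fadd E M u v)"
  by (cases u; cases v) (simp_all add: fvalid_rnd)

lemma fvalid_fmul: "fvalid E M u \<Longrightarrow> fvalid E M v \<Longrightarrow> fvalid E M (fmul E M u v)"
  by (cases u; cases v) (simp_all add: fvalid_rnd)

lemma fhull_cases:
  assumes "finite S" "S \<noteq> {}" "NaN \<notin> S"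
  obtains x y where "x \<in> S" "y \<in> S" "fhull S = Iv x y" "\<And>z. z \<in> S \<Longrightarrow> ext x \<le> ext z \<and> ext z \<le> ext y"
proof -
  have "Min (ext ` S) \<in> ext ` S" "Max (ext ` S) \<in> ext ` S" using assms by (auto intro!: Min_in Max_in)
  then obtain x y where xy: "x \<in> S" "Min (ext ` S) = ext x" "y \<in> S" "Max (ext ` S) = ext y" by blast
  have "x \<noteq> NaN" "y \<noteq> NaN" using xy assms by auto
  then have "fhull S = Iv x y" using xy assms by (simp add: fhull_def of_ext_ext)
  moreover have "ext x \<le> ext z \<and> ext z \<le> ext y" if "z \<in> S" for z
    using that assms xy Min_le[of "ext ` S" "ext z"] Max_ge[of "ext ` S" "ext z"] by auto
  ultimately show ?thesis using that xy by blast
qed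

lemma fhullI:
  assumes "x \<in> S" "y \<in> S" "NaN \<notin> S" "finite S" "\<And>z. z \<in> S \<Longrightarrow> ext x \<le> ext z \<and> ext z \<le> ext y"
  shows "fhull S = Iv x y"
proof -
  obtain x' y' where h: "x' \<in> S" "y' \<in> S" "fhull S = Iv x' y'" "\<And>z. z \<in> S \<Longrightarrow> ext x' \<le> ext z \<and> ext z \<le> ext y'"
    using fhull_cases[of S] assms by blast
  then have "ext x' = ext x" "ext y' = ext y" using assms by (meson order_antisym)+
  then show ?thesis using h assms ext_inj by metis
qed

lemma wf_fhull:
  assumes "finite S" "S \<noteq> {}" "\<And>v. v \<in> S \<Longrightarrow> fvalid E M v"
  shows "wf (fhull S)"
proof (cases "NaN \<in> S")
  case True then show ?thesis by (simp add: fhull_def wf_ival_def)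
next
  case False
  obtain x y where h: "x \<in> S" "y \<in> S" "fhull S = Iv x y" "\<And>z. z \<in> S \<Longrightarrow> ext x \<le> ext z \<and> ext z \<le> ext y"
    using fhull_cases[OF assms(1,2) False] by blast
  then show ?thesis using assms(3) False by (auto simp: wf_ival_def)
qed

lemma wf_iop:
  assumes "wf I" "wf J" "\<And>u v. fvalid E M u \<Longrightarrow> fvalid E M v \<Longrightarrow> fvalid E M (f u v)"
  shows "wf (iop f I J)"
proof (cases "\<exists>x y x' y'. I = Iv x y \<and> J = Iv x' y'")
  case True
  then obtain x y x' y' where "I = Iv x y" "J = Iv x' y'" by blast
  moreover from this have "fvalid E M x" "fvalid E M y" "fvalid E M x'" "fvalid E M y'"
    using assms by (auto simp: wf_ival_def)
  ultimately show ?thesis using assms(3) by (auto intro!: wf_fhull)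
next
  case False
  then have "iop f I J = Top" by (cases I; cases J) auto
  then show ?thesis by (simp add: wf_ival_def)
qed

lemma wf_iadd: "wf I \<Longrightarrow> wf J \<Longrightarrow> wf (iadd I J)"
  by (rule wf_iop) (auto intro: fvalid_fadd)

lemma wf_imul: "wf I \<Longrightarrow> w \<in> F \<Longrightarrow> wf (imul I w)"
  by (rule wf_iop) (auto intro: fvalid_fmul simp: wf_ival_def)

lemma wf_Fin: "wf (Iv (Fin l) (Fin u)) \<longleftrightarrow> l \<in> F \<and> u \<in> F \<and> l \<le> u"
  by (auto simp: wf_ival_def)

lemma fadd_0: "fvalid E M v \<Longrightarrow> v \<noteq> NaN \<Longrightarrow> fadd E M v (Fin 0) = v \<and> fadd E M (Fin 0) v = v"
  by (cases v) (auto simp: rnd_ok F_ok rr_Fz F_iff)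

lemma iadd_0: assumes "wf I" shows "iadd I (pt 0) = I" "iadd (pt 0) I = I"
proof -
  have "iadd I (pt 0) = I \<and> iadd (pt 0) I = I"
  proof (cases I)
    case (Iv x y)
    then have v: "fvalid E M x" "fvalid E M y" "x \<noteq> NaN" "y \<noteq> NaN" "ext x \<le> ext y" using assms by (auto simp: wf_ival_def)
    then have "fhull {x, y} = Iv x y" by (intro fhullI) auto
    then show ?thesis using v Iv by (simp add: fadd_0 insert_commute)
  qed simp
  then show "iadd I (pt 0) = I" "iadd (pt 0) I = I" by auto
qed

lemma isum_foldl: "(\<And>I. I \<in> set xs \<Longrightarrow> wf I) \<Longrightarrow> isum E M xs = foldl iadd (pt 0) xs"
  by (cases xs) (auto simp: iadd_0)

lemma wf_pt0: "wf (pt 0)"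
  by (simp add: wf_Fin zero_F)

lemma wf_foldl: "wf I \<Longrightarrow> (\<And>J. J \<in> set xs \<Longrightarrow> wf J) \<Longrightarrow> wf (foldl iadd I xs)"
  by (induction xs arbitrary: I) (auto intro: wf_iadd)

lemma foldl_zeros: "wf I \<Longrightarrow> set xs \<subseteq> {pt 0} \<Longrightarrow> foldl iadd I xs = I"
  by (induction xs arbitrary: I) (auto simp: iadd_0)

lemma isum_padded:
  assumes "set zs \<subseteq> {pt 0}" "set zs' \<subseteq> {pt 0}" "\<And>I. I \<in> set xs \<Longrightarrow> wf I"
  shows "isum E M (zs @ xs @ zs') = isum E M xs"
proof -
  have "wf I" if "I \<in> set (zs @ xs @ zs')" for I using that assms wf_pt0 by auto
  then have "isum E M (zs @ xs @ zs') = foldl iadd (pt 0) (zs @ xs @ zs')" by (rule isum_foldl)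
  also have "\<dots> = foldl iadd (pt 0) xs"
    using assms foldl_zeros[of "pt 0" zs] foldl_zeros[of "foldl iadd (pt 0) xs" zs'] wf_pt0 wf_foldl[of "pt 0" xs] by simp
  also have "\<dots> = isum E M xs" using isum_foldl[of xs] assms(3) by simp
  finally show ?thesis .
qed

lemma isum_snoc: "(\<And>I. I \<in> set xs \<Longrightarrow> wf I) \<Longrightarrow> wf J \<Longrightarrow> isum E M (xs @ [J]) = iadd (isum E M xs) J"
  using isum_foldl[of "xs @ [J]"] isum_foldl[of xs] by auto

lemma imul_0: "l \<in> F \<Longrightarrow> u \<in> F \<Longrightarrow> imul (Iv (Fin l) (Fin u)) 0 = pt 0"
  using rnd_ok[OF F_ok[OF zero_F]] by (simp add: fhull_def of_ext_def)

definition fini :: "ival \<Rightarrow> bool" where "fini I \<longleftrightarrow> (\<exists>l u. I = Iv (Fin l) (Fin u) \<and> l \<in> F \<and> u \<in> F \<and> l \<le> u)"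

lemma fini_wf: "fini I \<Longrightarrow> wf I"
  by (auto simp: fini_def wf_Fin)

lemma fini_imul_0: "fini I \<Longrightarrow> imul I 0 = pt 0"
  unfolding fini_def using imul_0 by blast

text \<open>\<open>psum n \<phi>\<close>: \<open>\<phi>\<close> is the interval semantics of a sum of products in a layer that has \<open>n\<close>
  hidden layers before it.\<close>

fun psum :: "nat \<Rightarrow> (ival list \<Rightarrow> ival) \<Rightarrow> bool" where
  "psum 0 \<phi> = (\<exists>row. length row = d \<and> set row \<subseteq> F \<and> (\<forall>B\<in>BB. \<phi> B = isum E M (map2 imul B row)))"
| "psum (Suc n) \<phi> = (\<exists>ts. (\<forall>(\<psi>, w)\<in>set ts. w \<in> F \<and> (\<forall>B\<in>BB. fini (act (\<psi> B))) \<and>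
      (\<exists>\<chi> c. psum n \<chi> \<and> c \<in> F \<and> (\<forall>B\<in>BB. \<psi> B = iadd (\<chi> B) (pt c)))) \<and>
     (\<forall>B\<in>BB. \<phi> B = isum E M (map (\<lambda>(\<psi>, w). imul (act (\<psi> B)) w) ts)))"

text \<open>The interval that enters \<sigma>, or the output, after n hidden layers. It is kept
  apart from \<open>psum\<close> because summands are appended before the bias is added.\<close>

definition preact :: "nat \<Rightarrow> (ival list \<Rightarrow> ival) \<Rightarrow> bool" where
  "preact n \<psi> \<longleftrightarrow> (\<exists>\<chi> c. psum n \<chi> \<and> c \<in> F \<and> (\<forall>B\<in>BB. \<psi> B = iadd (\<chi> B) (pt c)))"

lemma psum_Suc: "psum (Suc n) \<phi> \<longleftrightarrow> (\<exists>ts. (\<forall>(\<psi>, w)\<in>set ts. w \<in> F \<and> (\<forall>B\<in>BB. fini (act (\<psi> B))) \<and> preact n \<psi>) \<and>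
     (\<forall>B\<in>BB. \<phi> B = isum E M (map (\<lambda>(\<psi>, w). imul (act (\<psi> B)) w) ts)))"
  by (simp add: preact_def)

declare psum.simps(2) [simp del]

section \<open>Realising neurons by layers\<close>

lemma net_sharp_snoc: "ls \<noteq> [] \<Longrightarrow> net_sharp E M \<sigma> (ls @ [l]) B = aff_sharp E M l (map act (net_sharp E M \<sigma> ls B))"
proof (induction E M \<sigma> ls B rule: net_sharp.induct)
  case (3 E M \<sigma> l' v va Is) then show ?case by simp
qed auto

lemma wf_net_snoc: "wf_net E M din k ls \<Longrightarrow> wf_layer E M k k' l \<Longrightarrow> wf_net E M din k' (ls @ [l])"
proof (induction E M din k ls rule: wf_net.induct)
  case (2 E M din dout l')
  then show ?case by (simp add: wf_layer_def)
qed auto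

lemma zip_concat: "(\<And>j. j \<in> set js \<Longrightarrow> length (f j) = length (g j)) \<Longrightarrow>
    zip (concat (map f js)) (concat (map g js)) = concat (map (\<lambda>j. zip (f j) (g j)) js)"
  by (induction js) auto

lemma length_concat_eq: "(\<And>j. j \<in> set js \<Longrightarrow> length (f j) = length (g j)) \<Longrightarrow>
    length (concat (map f js)) = length (concat (map g js))"
  by (induction js) auto

text \<open>Neurons of the same layer are put side by side; a neuron ignores the inputs of the others by
  weights 0, which needs finite activations.\<close>

lemma realize:
  assumes "\<And>\<psi>. \<psi> \<in> set \<psi>s \<Longrightarrow> preact n \<psi>"
  shows "\<exists>ls. ls \<noteq> [] \<and> wf_net E M d (length \<psi>s) ls \<and> (\<forall>B\<in>BB. net_sharp E M \<sigma> ls B = map (\<lambda>\<psi>. \<psi> B) \<psi>s)"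
  using assms
proof (induction n arbitrary: \<psi>s)
  case 0
  define P where "P i row c \<longleftrightarrow> length row = d \<and> set row \<subseteq> F \<and> c \<in> F \<and>
      (\<forall>B\<in>BB. (\<psi>s ! i) B = iadd (isum E M (map2 imul B row)) (pt c))" for i row c
  have "\<exists>row c. P i row c" if "i < length \<psi>s" for i
  proof -
    have "preact 0 (\<psi>s ! i)" using 0 that by simp
    then obtain \<chi> c where \<chi>: "psum 0 \<chi>" "c \<in> F" "\<forall>B\<in>BB. (\<psi>s ! i) B = iadd (\<chi> B) (pt c)" unfolding preact_def by blast
    then obtain row where "length row = d" "set row \<subseteq> F" "\<forall>B\<in>BB. \<chi> B = isum E M (map2 imul B row)" by auto
    then show ?thesis unfolding P_def using \<chi>(2,3) by (intro exI[of _ row] exI[of _ c]) auto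
  qed
  then obtain row c where rc': "\<And>i. i < length \<psi>s \<Longrightarrow> P i (row i) (c i)" by metis
  note rc = rc'[unfolded P_def]
  define l where "l = (map row [0..<length \<psi>s], map c [0..<length \<psi>s])"
  have "wf_layer E M d (length \<psi>s) l" using rc by (auto simp: wf_layer_def l_def F_def)
  moreover have "aff_sharp E M l B = map (\<lambda>\<psi>. \<psi> B) \<psi>s" if "B \<in> BB" for B
    unfolding aff_sharp_def l_def fst_conv snd_conv using rc that by (intro nth_equalityI) auto
  ultimately show ?case by (intro exI[of _ "[l]"]) auto
next
  case (Suc n)
  define k where "k = length \<psi>s"
  define P where "P i ts c \<longleftrightarrow> (\<forall>(\<psi>, w)\<in>set ts. w \<in> F \<and> (\<forall>B\<in>BB. fini (act (\<psi> B))) \<and> preact n \<psi>) \<and> c \<in> F \<and>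
     (\<forall>B\<in>BB. (\<psi>s ! i) B = iadd (isum E M (map (\<lambda>(\<psi>, w). imul (act (\<psi> B)) w) ts)) (pt c))" for i ts c
  have "\<exists>ts c. P i ts c" if "i < k" for i
  proof -
    have "preact (Suc n) (\<psi>s ! i)" using Suc.prems that by (simp add: k_def)
    then obtain \<chi> c where \<chi>: "psum (Suc n) \<chi>" "c \<in> F" "\<forall>B\<in>BB. (\<psi>s ! i) B = iadd (\<chi> B) (pt c)" unfolding preact_def by blast
    obtain ts where "\<forall>(\<psi>, w)\<in>set ts. w \<in> F \<and> (\<forall>B\<in>BB. fini (act (\<psi> B))) \<and> preact n \<psi>"
      "\<forall>B\<in>BB. \<chi> B = isum E M (map (\<lambda>(\<psi>, w). imul (act (\<psi> B)) w) ts)" using \<chi>(1) unfolding psum_Suc by blast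
    then show ?thesis unfolding P_def using \<chi>(2,3) by (intro exI[of _ ts] exI[of _ c]) auto
  qed
  then obtain ts c where tc': "\<And>i. i < k \<Longrightarrow> P i (ts i) (c i)" by metis
  have tc: "\<And>i \<psi> w. i < k \<Longrightarrow> (\<psi>, w) \<in> set (ts i) \<Longrightarrow> w \<in> F \<and> (\<forall>B\<in>BB. fini (act (\<psi> B))) \<and> preact n \<psi>"
    "\<And>i. i < k \<Longrightarrow> c i \<in> F"
    "\<And>i B. i < k \<Longrightarrow> B \<in> BB \<Longrightarrow> (\<psi>s ! i) B = iadd (isum E M (map (\<lambda>(\<psi>, w). imul (act (\<psi> B)) w) (ts i))) (pt (c i))"
    using tc'[unfolded P_def] by blast+
  define H where "H = concat (map (\<lambda>j. map fst (ts j)) [0..<k])"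
  define wt where "wt i j = (if j = i then map snd (ts j) else replicate (length (ts j)) 0)" for i j
  define row where "row i = concat (map (wt i) [0..<k])" for i
  define l where "l = (map row [0..<k], map c [0..<k])"
  have "preact n \<psi>" if "\<psi> \<in> set H" for \<psi> using that tc(1) unfolding H_def by fastforce
  then obtain ls where ls: "ls \<noteq> []" "wf_net E M d (length H) ls" "\<forall>B\<in>BB. net_sharp E M \<sigma> ls B = map (\<lambda>\<psi>. \<psi> B) H"
    using Suc.IH by blast
  have lr: "length (row i) = length H" for i
    unfolding row_def H_def by (rule length_concat_eq) (simp add: wt_def)
  have sr: "set (row i) \<subseteq> F" if "i < k" for i
    using tc(1)[OF that] zero_F unfolding row_def wt_def by (auto split: if_splits)
  have wl: "wf_layer E M (length H) k l" using lr sr tc(2) by (auto simp: wf_layer_def l_def F_def[symmetric])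
  have sum: "isum E M (map2 imul (map act (map (\<lambda>\<psi>. \<psi> B) H)) (row i)) = isum E M (map (\<lambda>(\<psi>, w). imul (act (\<psi> B)) w) (ts i))"
    if i: "i < k" and B: "B \<in> BB" for i B
  proof -
    have fin: "fini (act (\<psi> B))" if "j < k" "\<psi> \<in> set (map fst (ts j))" for j \<psi> using that tc(1)[of j] B by fastforce
    have H': "map act (map (\<lambda>\<psi>. \<psi> B) H) = concat (map (\<lambda>j. map (\<lambda>\<psi>. act (\<psi> B)) (map fst (ts j))) [0..<k])"
      unfolding H_def map_concat by (simp add: comp_def)
    define seg where "seg j = map2 imul (map (\<lambda>\<psi>. act (\<psi> B)) (map fst (ts j))) (wt i j)" for j
    have "map2 imul (map act (map (\<lambda>\<psi>. \<psi> B) H)) (row i) = concat (map seg [0..<k])"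
      unfolding H' row_def by (subst zip_concat) (auto simp: wt_def seg_def[abs_def] map_concat comp_def)
    also have "[0..<k] = [0..<i] @ i # [Suc i..<k]" using i upt_add_eq_append[of 0 i "k - i"] upt_conv_Cons[OF i] by simp
    also have "concat (map seg \<dots>) = concat (map seg [0..<i]) @ seg i @ concat (map seg [Suc i..<k])" by simp
    finally have eq: "map2 imul (map act (map (\<lambda>\<psi>. \<psi> B) H)) (row i) = \<dots>" .
    have zero: "set (seg j) \<subseteq> {pt 0}" if "j \<noteq> i" "j < k" for j
      using fin[OF that(2)] that(1) unfolding seg_def wt_def by (auto simp: set_zip fini_imul_0)
    have zeros: "set (concat (map seg js)) \<subseteq> {pt 0}" if "\<forall>j\<in>set js. j \<noteq> i \<and> j < k" for js
      using zero that by (induction js) auto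
    have z12: "set (concat (map seg [0..<i])) \<subseteq> {pt 0}" "set (concat (map seg [Suc i..<k])) \<subseteq> {pt 0}"
      using i by (intro zeros; simp)+
    have si: "seg i = map (\<lambda>(\<psi>, w). imul (act (\<psi> B)) w) (ts i)"
      unfolding seg_def wt_def by (rule nth_equalityI) (auto simp: case_prod_beta)
    have wfs: "wf I" if "I \<in> set (seg i)" for I
      using that tc(1)[OF i] B unfolding si by (auto intro!: wf_imul[OF fini_wf])
    have "isum E M (map2 imul (map act (map (\<lambda>\<psi>. \<psi> B) H)) (row i)) = isum E M (seg i)"
      unfolding eq by (rule isum_padded[OF z12 wfs])
    then show ?thesis unfolding si .
  qed
  have "net_sharp E M \<sigma> (ls @ [l]) B = map (\<lambda>\<psi>. \<psi> B) \<psi>s" if B: "B \<in> BB" for B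
  proof -
    have "net_sharp E M \<sigma> (ls @ [l]) B = aff_sharp E M l (map act (map (\<lambda>\<psi>. \<psi> B) H))" using net_sharp_snoc ls B by simp
    also have "\<dots> = map (\<lambda>\<psi>. \<psi> B) \<psi>s"
      unfolding aff_sharp_def l_def fst_conv snd_conv using sum[OF _ B] tc(3)[OF _ B] by (intro nth_equalityI) (auto simp: k_def)
    finally show ?thesis .
  qed
  moreover have "wf_net E M d k (ls @ [l])" using wf_net_snoc ls(2) wl by blast
  ultimately show ?case unfolding k_def[symmetric] by (intro exI[of _ "ls @ [l]"]) auto
qed

section \<open>Bits carried by neurons\<close>

text \<open>A bit of a box has a lower (\<open>False\<close>) and an upper (\<open>True\<close>) value.\<close>

type_synonym bits = "bool \<Rightarrow> ival list \<Rightarrow> bool"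

definition monob :: "bits \<Rightarrow> bool" where
  "monob \<beta> \<longleftrightarrow> (\<forall>B\<in>BB. \<beta> False B \<longrightarrow> \<beta> True B)"

definition neg :: "bits \<Rightarrow> bits" where
  "neg \<beta> = (\<lambda>sd B. \<not> \<beta> (\<not> sd) B)"

lemma neg_neg [simp]: "neg (neg \<beta>) = \<beta>"
  by (simp add: neg_def)

lemma monob_neg [simp]: "monob (neg \<beta>) = monob \<beta>"
  by (auto simp: monob_def neg_def)

section \<open>Summands and finite partial sums\<close>

definition sv :: "real \<Rightarrow> real" where "sv x = fval (\<sigma> (Fin x))"

text \<open>One summand of a layer, seen at both ends: r gives the ends of the activation, and a
  negative weight makes each end of the product come from the opposite end of the
  activation.\<close>

definition ts :: "nat \<Rightarrow> (bool \<Rightarrow> ival list \<Rightarrow> real) \<Rightarrow> bool" where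
  "ts n t \<longleftrightarrow> (\<exists>\<psi> w r. preact n \<psi> \<and> w \<in> F \<and> (\<forall>B\<in>BB. act (\<psi> B) = Iv (Fin (r False B)) (Fin (r True B)) \<and>
     r False B \<le> r True B \<and> (\<forall>sd. r sd B \<in> F \<and> ok (r sd B * w) \<and> t sd B = rr (r (if 0 \<le> w then sd else \<not> sd) B * w))))"

definition fs :: "nat \<Rightarrow> (bool \<Rightarrow> ival list \<Rightarrow> real) \<Rightarrow> bool" where
  "fs n g \<longleftrightarrow> (\<exists>\<phi>. psum (Suc n) \<phi> \<and> (\<forall>B\<in>BB. \<phi> B = Iv (Fin (g False B)) (Fin (g True B)) \<and>
     g False B \<le> g True B \<and> (\<forall>sd. g sd B \<in> F)))"

lemma ok_between: "ok x \<Longrightarrow> ok z \<Longrightarrow> x \<le> y \<Longrightarrow> y \<le> z \<Longrightarrow> ok y"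
  unfolding ok_iff by linarith

lemma imul_fini:
  assumes "l \<le> u" "ok (l * w)" "ok (u * w)"
  shows "imul (Iv (Fin l) (Fin u)) w = Iv (Fin (rr ((if 0 \<le> w then l else u) * w))) (Fin (rr ((if 0 \<le> w then u else l) * w)))"
proof -
  have "(if 0 \<le> w then l else u) * w \<le> (if 0 \<le> w then u else l) * w"
    using assms(1) by (auto intro: mult_right_mono mult_right_mono_neg)
  then have le: "rr ((if 0 \<le> w then l else u) * w) \<le> rr ((if 0 \<le> w then u else l) * w)" by (rule rr_mono)
  show ?thesis using le assms(2,3) by (auto simp: rnd_ok intro!: fhullI)
qed

lemma iadd_fini:
  assumes "l \<le> u" "l' \<le> u'" "ok (l + l')" "ok (u + u')"
  shows "iadd (Iv (Fin l) (Fin u)) (Iv (Fin l') (Fin u')) = Iv (Fin (rr (l + l'))) (Fin (rr (u + u')))"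
proof -
  have "ok (l + u')" "ok (u + l')" using assms by (auto intro: ok_between[OF assms(3,4)])
  moreover have "rr (l + l') \<le> rr (l + u')" "rr (l + u') \<le> rr (u + u')" "rr (l + l') \<le> rr (u + l')" "rr (u + l') \<le> rr (u + u')"
    using assms by (auto intro: rr_mono)
  ultimately show ?thesis using assms by (auto simp: rnd_ok intro!: fhullI)
qed

lemma ts_ordered:
  assumes "ts n t" "B \<in> BB"
  shows "t False B \<le> t True B" "t sd B \<in> F"
proof -
  obtain \<psi> w r where h: "r False B \<le> r True B" "\<And>sd. r sd B \<in> F \<and> ok (r sd B * w) \<and> t sd B = rr (r (if 0 \<le> w then sd else \<not> sd) B * w)"
    using assms unfolding ts_def by blast
  have "r (if 0 \<le> w then False else True) B * w \<le> r (if 0 \<le> w then True else False) B * w"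
    using h(1) by (cases "0 \<le> w") (auto intro: mult_right_mono mult_right_mono_neg)
  then show "t False B \<le> t True B" using h(2)[of False] h(2)[of True] by (auto intro: rr_mono)
  show "t sd B \<in> F" using h rr_F by simp
qed

lemma fs_zero: "fs n (\<lambda>_ _. 0)"
  unfolding fs_def psum_Suc by (intro exI[of _ "\<lambda>_. pt 0"] conjI exI[of _ "[]"]) (auto simp: zero_F)

lemma psum_step:
  assumes \<phi>: "psum (Suc n) \<phi>" and t: "ts n t"
  shows "psum (Suc n) (\<lambda>B. iadd (\<phi> B) (Iv (Fin (t False B)) (Fin (t True B))))"
proof -
  obtain ls where ls: "\<forall>(\<psi>, w)\<in>set ls. w \<in> F \<and> (\<forall>B\<in>BB. fini (act (\<psi> B))) \<and> preact n \<psi>"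
    "\<forall>B\<in>BB. \<phi> B = isum E M (map (\<lambda>(\<psi>, w). imul (act (\<psi> B)) w) ls)" using \<phi> unfolding psum_Suc by blast
  obtain \<psi> w r where h: "preact n \<psi>" "w \<in> F" "\<And>B. B \<in> BB \<Longrightarrow> act (\<psi> B) = Iv (Fin (r False B)) (Fin (r True B)) \<and>
     r False B \<le> r True B \<and> (\<forall>sd. r sd B \<in> F \<and> ok (r sd B * w) \<and> t sd B = rr (r (if 0 \<le> w then sd else \<not> sd) B * w))"
    using t unfolding ts_def by blast
  define ls' where "ls' = ls @ [(\<psi>, w)]"
  have fin: "fini (act (\<psi> B))" if "B \<in> BB" for B using h(3)[OF that] by (auto simp: fini_def)
  have ls': "\<forall>(\<psi>, w)\<in>set ls'. w \<in> F \<and> (\<forall>B\<in>BB. fini (act (\<psi> B))) \<and> preact n \<psi>"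
    using ls(1) h(1,2) fin by (auto simp: ls'_def)
  have "iadd (\<phi> B) (Iv (Fin (t False B)) (Fin (t True B))) = isum E M (map (\<lambda>(\<psi>, w). imul (act (\<psi> B)) w) ls')"
    if B: "B \<in> BB" for B
  proof -
    have w1: "wf I" if "I \<in> set (map (\<lambda>(\<psi>, w). imul (act (\<psi> B)) w) ls)" for I
      using that ls(1) B by (auto intro!: wf_imul[OF fini_wf] dest!: bspec)
    have w2: "wf (imul (act (\<psi> B)) w)" using h(2) fin[OF B] by (intro wf_imul fini_wf)
    have "isum E M (map (\<lambda>(\<psi>, w). imul (act (\<psi> B)) w) ls @ [imul (act (\<psi> B)) w]) =
      iadd (isum E M (map (\<lambda>(\<psi>, w). imul (act (\<psi> B)) w) ls)) (imul (act (\<psi> B)) w)"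
      by (rule isum_snoc[OF w1 w2])
    then have "isum E M (map (\<lambda>(\<psi>, w). imul (act (\<psi> B)) w) ls') = iadd (\<phi> B) (imul (act (\<psi> B)) w)"
      unfolding ls'_def using ls(2) B by simp
    moreover have "imul (act (\<psi> B)) w = Iv (Fin (t False B)) (Fin (t True B))"
      unfolding h(3)[OF B, THEN conjunct1] using h(3)[OF B] by (subst imul_fini) (auto split: if_splits)
    ultimately show ?thesis by simp
  qed
  then show ?thesis unfolding psum_Suc using ls' by blast
qed

lemma fs_step:
  assumes "fs n g" "ts n t" "\<And>B sd. B \<in> BB \<Longrightarrow> ok (g sd B + t sd B)"
  shows "fs n (\<lambda>sd B. rr (g sd B + t sd B))"
proof -
  obtain \<phi> where \<phi>: "psum (Suc n) \<phi>" "\<And>B. B \<in> BB \<Longrightarrow> \<phi> B = Iv (Fin (g False B)) (Fin (g True B)) \<and> g False B \<le> g True B \<and> (\<forall>sd. g sd B \<in> F)"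
    using assms(1) unfolding fs_def by blast
  have "iadd (\<phi> B) (Iv (Fin (t False B)) (Fin (t True B))) = Iv (Fin (rr (g False B + t False B))) (Fin (rr (g True B + t True B)))"
    if B: "B \<in> BB" for B
    unfolding \<phi>(2)[OF B, THEN conjunct1] using \<phi>(2)[OF B] ts_ordered[OF assms(2) B] assms(3)[OF B] by (intro iadd_fini) blast+
  moreover have "rr (g False B + t False B) \<le> rr (g True B + t True B) \<and> (\<forall>sd. rr (g sd B + t sd B) \<in> F)" if "B \<in> BB" for B
    using \<phi>(2)[OF that] ts_ordered[OF assms(2) that] assms(3)[OF that] by (auto intro!: rr_mono rr_F add_mono)
  ultimately show ?thesis unfolding fs_def using psum_step[OF \<phi>(1) assms(2)] by blast
qed

text \<open>The instance of the abstract predicate of \<open>prog\<close>: every end of every box is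
  constrained according to the value of the bit at that same end.\<close>

definition Pg :: "nat \<Rightarrow> bits \<Rightarrow> real \<Rightarrow> real \<Rightarrow> real \<Rightarrow> real \<Rightarrow> bool" where
  "Pg n \<beta> l0 u0 l1 u1 \<longleftrightarrow> (\<exists>g. fs n g \<and> (\<forall>B\<in>BB. \<forall>sd. if \<beta> sd B then l1 \<le> g sd B \<and> g sd B \<le> u1 else l0 \<le> g sd B \<and> g sd B \<le> u0))"

lemma pair_Pg_zero: "pair (Pg n \<beta>) 0 0"
  unfolding pair_def Pg_def using fs_zero by (intro exI[of _ "\<lambda>_ _. 0"]) auto

definition tbit :: "nat \<Rightarrow> bits \<Rightarrow> real \<Rightarrow> real \<Rightarrow> bool" where
  "tbit n \<beta> c0 c1 \<longleftrightarrow> (\<exists>t. ts n t \<and> (\<forall>B\<in>BB. \<forall>sd. t sd B = (if \<beta> sd B then c1 else c0)))"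

text \<open>The bridge from arithmetic to networks. A summand that is realised by a term can be
  appended; the actual sums do not overflow because they lie between the bounds, whose sums do
  not.\<close>

lemma prog_Pg:
  assumes "\<And>c0 c1. (c0, c1) \<in> T \<Longrightarrow> tbit n \<beta> c0 c1"
  shows "prog T (Pg n \<beta>)"
  unfolding prog_def
proof (intro conjI allI impI)
  fix l0 u0 l1 u1 l0' u0' l1' u1'
  assume "Pg n \<beta> l0 u0 l1 u1" "l0' \<le> l0" "u0 \<le> u0'" "l1' \<le> l1" "u1 \<le> u1'"
  then show "Pg n \<beta> l0' u0' l1' u1'" unfolding Pg_def by (meson order_trans)
next
  fix l0 u0 l1 u1 c0 c1
  assume P: "Pg n \<beta> l0 u0 l1 u1" and c: "(c0, c1) \<in> T" and oks: "ok (l0 + c0)" "ok (u0 + c0)" "ok (l1 + c1)" "ok (u1 + c1)"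
  obtain g where g: "fs n g" "\<And>B sd. B \<in> BB \<Longrightarrow> if \<beta> sd B then l1 \<le> g sd B \<and> g sd B \<le> u1 else l0 \<le> g sd B \<and> g sd B \<le> u0"
    using P unfolding Pg_def by blast
  obtain t where t: "ts n t" "\<And>B sd. B \<in> BB \<Longrightarrow> t sd B = (if \<beta> sd B then c1 else c0)"
    using assms[OF c] unfolding tbit_def by blast
  have "ok (g sd B + t sd B)" if "B \<in> BB" for sd B
    using g(2)[OF that, of sd] t(2)[OF that, of sd] oks ok_between[of "l0 + c0" "u0 + c0"] ok_between[of "l1 + c1" "u1 + c1"]
    by (auto split: if_splits)
  then have "fs n (\<lambda>sd B. rr (g sd B + t sd B))" by (rule fs_step[OF g(1) t(1)])
  moreover have "if \<beta> sd B then rr (l1 + c1) \<le> rr (g sd B + t sd B) \<and> rr (g sd B + t sd B) \<le> rr (u1 + c1)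
    else rr (l0 + c0) \<le> rr (g sd B + t sd B) \<and> rr (g sd B + t sd B) \<le> rr (u0 + c0)" if "B \<in> BB" for sd B
    using g(2)[OF that, of sd] t(2)[OF that, of sd] by (auto intro!: rr_mono split: if_splits)
  ultimately show "Pg n \<beta> (rr (l0 + c0)) (rr (u0 + c0)) (rr (l1 + c1)) (rr (u1 + c1))"
    unfolding Pg_def by blast
qed

text \<open>The weight changes its sign, and this also exchanges the two ends.\<close>

lemma ts_neg:
  assumes "ts n t"
  shows "ts n (\<lambda>sd B. - t (\<not> sd) B)"
proof -
  obtain \<psi> w r where h: "preact n \<psi>" "w \<in> F" "\<And>B. B \<in> BB \<Longrightarrow> act (\<psi> B) = Iv (Fin (r False B)) (Fin (r True B)) \<and>
     r False B \<le> r True B \<and> (\<forall>sd. r sd B \<in> F \<and> ok (r sd B * w) \<and> t sd B = rr (r (if 0 \<le> w then sd else \<not> sd) B * w))"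
    using assms unfolding ts_def by blast
  have "- t (\<not> sd) B = rr (r (if 0 \<le> - w then sd else \<not> sd) B * - w)" if "B \<in> BB" for sd B
    using h(3)[OF that] by (cases "w = 0") (auto simp: rr_minus)
  then show ?thesis unfolding ts_def using h F_minus
    by (intro exI[of _ \<psi>] exI[of _ "- w"] exI[of _ r]) (auto simp: ok_minus)
qed

lemma tbit_neg: "tbit n \<beta> c0 c1 \<Longrightarrow> tbit n (neg \<beta>) (- c1) (- c0)"
proof -
  assume "tbit n \<beta> c0 c1"
  then obtain t where "ts n t" "\<forall>B\<in>BB. \<forall>sd. t sd B = (if \<beta> sd B then c1 else c0)" unfolding tbit_def by blast
  then show ?thesis unfolding tbit_def using ts_neg by (intro exI[of _ "\<lambda>sd B. - t (\<not> sd) B"]) (auto simp: neg_def)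
qed

text \<open>A program run on the negated sum is the mirror image of the program, for the
  complementary bit. This reduces pairs whose left value has the larger magnitude to the other
  case.\<close>

lemma prog_Pg_neg:
  assumes "\<And>c0 c1. (c0, c1) \<in> T \<Longrightarrow> tbit n \<beta> c0 c1"
  shows "prog T (\<lambda>l0 u0 l1 u1. Pg n (neg \<beta>) (- u1) (- l1) (- u0) (- l0))"
proof -
  define T' where "T' = (\<lambda>(c0, c1). (- c1, - c0)) ` T"
  have p: "prog T' (Pg n (neg \<beta>))" by (rule prog_Pg) (auto simp: T'_def intro: tbit_neg assms)
  show ?thesis unfolding prog_def
  proof (intro conjI allI impI)
    fix l0 u0 l1 u1 l0' u0' l1' u1'
    assume h: "Pg n (neg \<beta>) (- u1) (- l1) (- u0) (- l0)" "l0' \<le> l0" "u0 \<le> u0'" "l1' \<le> l1" "u1 \<le> u1'"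
    show "Pg n (neg \<beta>) (- u1') (- l1') (- u0') (- l0')" using prog_weaken[OF p h(1)] h by simp
  next
    fix l0 u0 l1 u1 c0 c1
    assume h: "Pg n (neg \<beta>) (- u1) (- l1) (- u0) (- l0)" "(c0, c1) \<in> T" "ok (l0 + c0)" "ok (u0 + c0)" "ok (l1 + c1)" "ok (u1 + c1)"
    have "(- c1, - c0) \<in> T'" using h by (force simp: T'_def)
    moreover have eq: "- u1 + - c1 = - (u1 + c1)" "- l1 + - c1 = - (l1 + c1)" "- u0 + - c0 = - (u0 + c0)" "- l0 + - c0 = - (l0 + c0)" by simp_all
    ultimately have "Pg n (neg \<beta>) (rr (- (u1 + c1))) (rr (- (l1 + c1))) (rr (- (u0 + c0))) (rr (- (l0 + c0)))"
      using p[unfolded prog_def, THEN conjunct2, rule_format, OF h(1), of "- c1" "- c0"] h(3-6) ok_minus unfolding eq by blast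
    then show "Pg n (neg \<beta>) (- rr (u1 + c1)) (- rr (l1 + c1)) (- rr (u0 + c0)) (- rr (l0 + c0))" unfolding rr_minus .
  qed
qed

section \<open>Activations as summands\<close>

lemma gamma_Fin: "gamma E M (Iv (Fin l) (Fin u)) = Fin ` {z \<in> F. l \<le> z \<and> z \<le> u}"
proof -
  have "v \<in> Fin ` {z \<in> F. l \<le> z \<and> z \<le> u}" if "v \<in> gamma E M (Iv (Fin l) (Fin u))" for v
    using that by (cases v) auto
  then show ?thesis by auto
qed

lemma finite_F: "finite F"
  by (rule finite_subset[of _ "fz ` {- N..N}"]) (use F_cases in force, simp)

text \<open>The abstraction of \<sigma> takes the extremes over all floats of an interval. They need
  not occur at its ends, so they are recorded through points x and y that attain them; s' is the
  orientation that makes the term increase with the bit.\<close>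

definition extremal :: "real \<Rightarrow> real \<Rightarrow> real \<Rightarrow> real \<Rightarrow> real \<Rightarrow> real \<Rightarrow> bool" where
  "extremal l u w s' t0 t1 \<longleftrightarrow> (\<exists>x y. x \<in> F \<and> l \<le> x \<and> x \<le> u \<and> y \<in> F \<and> l \<le> y \<and> y \<le> u \<and>
      t0 = rr (w * (s' * sv x)) \<and> t1 = rr (w * (s' * sv y)) \<and>
      (\<forall>z\<in>F. l \<le> z \<longrightarrow> z \<le> u \<longrightarrow> s' * sv x \<le> s' * sv z \<and> s' * sv z \<le> s' * sv y))"

lemma act_term:
  assumes \<psi>: "preact n \<psi>" "\<And>B. B \<in> BB \<Longrightarrow> \<psi> B = Iv (Fin (g False B)) (Fin (g True B)) \<and> g False B \<le> g True B \<and> (\<forall>sd. g sd B \<in> F)"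
    and fin: "\<And>B z. B \<in> BB \<Longrightarrow> z \<in> F \<Longrightarrow> g False B \<le> z \<Longrightarrow> z \<le> g True B \<Longrightarrow> \<sigma> (Fin z) = Fin (sv z) \<and> ok (w * sv z)"
    and s': "s' = 1 \<or> s' = - 1" and w: "w \<in> F" "0 \<le> w"
  shows "\<exists>t. ts n t \<and> (\<forall>B\<in>BB. extremal (g False B) (g True B) w s' (t False B) (t True B))"
proof -
  let ?S = "\<lambda>B. {z \<in> F. g False B \<le> z \<and> z \<le> g True B}"
  define P where "P B x y \<longleftrightarrow> x \<in> ?S B \<and> y \<in> ?S B \<and> act (\<psi> B) = Iv (Fin (sv x)) (Fin (sv y)) \<and>
    (\<forall>z\<in>?S B. sv x \<le> sv z \<and> sv z \<le> sv y)" for B x y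
  have "\<exists>x y. P B x y" if B: "B \<in> BB" for B
  proof -
    have im: "\<sigma> ` gamma E M (\<psi> B) = (\<lambda>z. Fin (sv z)) ` ?S B"
    proof -
      have "\<psi> B = Iv (Fin (g False B)) (Fin (g True B))" using \<psi>(2)[OF B] by blast
      then have "gamma E M (\<psi> B) = Fin ` ?S B" by (simp only: gamma_Fin)
      then show ?thesis using fin[OF B] by (simp only: image_image) (intro image_cong, auto)
    qed
    have "g False B \<in> ?S B" using \<psi>(2)[OF B] by auto
    then obtain x' y' where h: "x' \<in> (\<lambda>z. Fin (sv z)) ` ?S B" "y' \<in> (\<lambda>z. Fin (sv z)) ` ?S B"
      "fhull ((\<lambda>z. Fin (sv z)) ` ?S B) = Iv x' y'" "\<And>z. z \<in> (\<lambda>z. Fin (sv z)) ` ?S B \<Longrightarrow> ext x' \<le> ext z \<and> ext z \<le> ext y'"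
      using fhull_cases[of "(\<lambda>z. Fin (sv z)) ` ?S B"] finite_F by auto
    then obtain x y where xy: "x \<in> ?S B" "x' = Fin (sv x)" "y \<in> ?S B" "y' = Fin (sv y)" by blast
    have "sv x \<le> sv z \<and> sv z \<le> sv y" if "z \<in> ?S B" for z using h(4)[of "Fin (sv z)"] that xy by auto
    then show ?thesis unfolding P_def using xy h(3) im by (intro exI[of _ x] exI[of _ y]) (auto simp: sigma_sharp_def)
  qed
  then obtain X Y where XY: "\<And>B. B \<in> BB \<Longrightarrow> P B (X B) (Y B)" by metis
  define r where "r sd B = sv (if sd then Y B else X B)" for sd B
  have rF: "r sd B \<in> F" if "B \<in> BB" for sd B
  proof -
    have "(if sd then Y B else X B) \<in> ?S B" using XY[OF that] by (simp add: P_def)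
    then have "\<sigma> (Fin (if sd then Y B else X B)) = Fin (r sd B)" "(if sd then Y B else X B) \<in> F" using fin[OF that] by (simp_all add: r_def)
    then show ?thesis using valid[of "Fin (if sd then Y B else X B)"] by simp
  qed
  define t0 where "t0 sd B = rr (r sd B * w)" for sd B
  have t0: "ts n t0" unfolding ts_def
  proof (intro exI[of _ \<psi>] exI[of _ w] exI[of _ r] conjI ballI allI)
    fix B sd assume B: "B \<in> BB"
    have h: "X B \<in> ?S B" "Y B \<in> ?S B" "sv (X B) \<le> sv (Y B)" using XY[OF B] by (auto simp: P_def)
    show "act (\<psi> B) = Iv (Fin (r False B)) (Fin (r True B))" using XY[OF B] by (simp add: P_def r_def)
    show "r False B \<le> r True B" using h by (simp add: r_def)
    show "r sd B \<in> F" by (rule rF[OF B])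
    show "ok (r sd B * w)" using fin[OF B] h by (simp add: r_def mult.commute)
    show "t0 sd B = rr (r (if 0 \<le> w then sd else \<not> sd) B * w)" using w by (simp add: t0_def)
  qed (use \<psi> w in auto)
  show ?thesis
  proof (cases "s' = 1")
    case True
    have "extremal (g False B) (g True B) w s' (t0 False B) (t0 True B)" if "B \<in> BB" for B
      using XY[OF that] unfolding P_def extremal_def
      by (intro exI[of _ "X B"] exI[of _ "Y B"]) (auto simp: True t0_def r_def mult.commute)
    then show ?thesis using t0 by blast
  next
    case False
    then have s: "s' = - 1" using s' by simp
    have "extremal (g False B) (g True B) w s' (- t0 (\<not> False) B) (- t0 (\<not> True) B)" if "B \<in> BB" for B
      using XY[OF that] unfolding P_def extremal_def
      by (intro exI[of _ "Y B"] exI[of _ "X B"]) (auto simp: s t0_def r_def mult.commute rr_minus)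
    then show ?thesis using ts_neg[OF t0] by (intro exI[of _ "\<lambda>sd B. - t0 (\<not> sd) B"]) blast
  qed
qed

text \<open>In the first layer all weights are 0; in later layers the list of terms is empty. Only
  the bias remains.\<close>

lemma preact_const:
  assumes "c \<in> F"
  shows "preact n (\<lambda>_. pt c)"
proof -
  have "wf (pt c)" using assms by (simp only: wf_Fin order_refl simp_thms)
  then have e: "\<forall>B\<in>BB. pt c = iadd (pt 0) (pt c)" using iadd_0(2) by metis
  show ?thesis
proof (cases n)
  case 0
  have "psum 0 (\<lambda>_. pt 0)" unfolding psum.simps
  proof (intro exI[of _ "replicate d 0"] conjI ballI)
    fix B assume B: "B \<in> BB"
    have "I = pt 0" if I: "I \<in> set (map2 imul B (replicate d 0))" for I
    proof -
      obtain x w where "(x, w) \<in> set (zip B (replicate d 0))" "I = imul x w" using I by (auto simp del: iop.simps)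
      then have x: "x \<in> set B" "I = imul x 0" by (auto dest: set_zip_leftD set_zip_rightD simp del: iop.simps)
      then obtain l u where "x = Iv (Fin l) (Fin u)" "l \<in> F" "u \<in> F" using BB[OF B] by blast
      then show ?thesis using x(2) imul_0 by blast
    qed
    then have s: "set (map2 imul B (replicate d 0)) \<subseteq> {pt 0}" by blast
    show "pt 0 = isum E M (map2 imul B (replicate d 0))"
      using isum_padded[of "map2 imul B (replicate d 0)" "[]" "[]"] s by simp
  qed (auto simp: zero_F)
  then show ?thesis unfolding preact_def 0 using assms e by blast
next
  case (Suc k)
  have "psum (Suc k) (\<lambda>_. pt 0)" unfolding psum_Suc by (intro exI[of _ "[]"]) auto
  then show ?thesis unfolding preact_def Suc using assms e by blast
qed
qed

text \<open>A constant neuron serves every weight of either sign. The sign of v is moved into the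
  weight, so only |v| matters.\<close>

lemma tbit_const:
  assumes "c \<in> F" "\<sigma> (Fin c) = Fin v" "(c0, c1) \<in> csteps \<bar>v\<bar>"
  shows "tbit n \<beta> c0 c1"
proof -
  obtain w where w: "w \<in> F" "ok (\<bar>v\<bar> * w)" "c0 = rr (\<bar>v\<bar> * w)" "c1 = c0" using assms(3) unfolding csteps_def by auto
  have svc: "sv c = v" using assms(2) by (simp add: sv_def)
  define s' where "s' = (if 0 \<le> v \<longleftrightarrow> 0 \<le> w then 1 else - 1 :: real)"
  have eq: "\<bar>w\<bar> * (s' * v) = \<bar>v\<bar> * w" by (auto simp: s'_def)
  have oks: "ok (\<bar>w\<bar> * v)"
    using w(2) ok_minus[of "\<bar>w\<bar> * v"] by (cases "0 \<le> v"; cases "0 \<le> w") (simp_all add: mult.commute)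
  have aw: "\<bar>w\<bar> \<in> F" using w F_minus by (simp add: abs_real_def)
  have "\<exists>t. ts n t \<and> (\<forall>B\<in>BB. extremal c c \<bar>w\<bar> s' (t False B) (t True B))"
    by (rule act_term[OF preact_const[OF assms(1)], of "\<lambda>_ _. c" "\<bar>w\<bar>" s' n]) (use assms svc oks aw in \<open>auto simp: s'_def\<close>)
  then obtain t where t: "ts n t" "\<And>B. B \<in> BB \<Longrightarrow> extremal c c \<bar>w\<bar> s' (t False B) (t True B)" by blast
  have "t sd B = c0" if B: "B \<in> BB" for B sd
  proof -
    from t(2)[OF B, unfolded extremal_def] have "t False B = rr (\<bar>w\<bar> * (s' * v))" "t True B = rr (\<bar>w\<bar> * (s' * v))" using svc by (metis order_antisym)+
    then show ?thesis using eq w(3) by (cases sd) simp_all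
  qed
  then show ?thesis unfolding tbit_def using t(1) w(4) by auto
qed

text \<open>Some pre-activation is exactly \<open>q\<close> or \<open>p\<close>, according to \<open>\<beta>\<close>.\<close>

definition Code :: "nat \<Rightarrow> bits \<Rightarrow> real \<Rightarrow> real \<Rightarrow> bool" where
  "Code n \<beta> p q \<longleftrightarrow> (\<exists>\<psi>. preact n \<psi> \<and> (\<forall>B\<in>BB. \<psi> B = Iv (Fin (if \<beta> False B then q else p)) (Fin (if \<beta> True B then q else p))))"

lemma preact_of_fs:
  assumes "fs n g" "c \<in> F" "\<And>B sd. B \<in> BB \<Longrightarrow> ok (g sd B + c)"
  obtains \<psi> where "preact (Suc n) \<psi>" "\<And>B. B \<in> BB \<Longrightarrow> \<psi> B = Iv (Fin (rr (g False B + c))) (Fin (rr (g True B + c)))"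
proof -
  obtain \<phi> where \<phi>: "psum (Suc n) \<phi>" "\<And>B. B \<in> BB \<Longrightarrow> \<phi> B = Iv (Fin (g False B)) (Fin (g True B)) \<and> g False B \<le> g True B \<and> (\<forall>sd. g sd B \<in> F)"
    using assms(1) unfolding fs_def by blast
  have "iadd (\<phi> B) (pt c) = Iv (Fin (rr (g False B + c))) (Fin (rr (g True B + c)))" if "B \<in> BB" for B
    unfolding \<phi>(2)[OF that, THEN conjunct1] using \<phi>(2)[OF that] assms(3)[OF that] by (intro iadd_fini) auto
  moreover have "preact (Suc n) (\<lambda>B. iadd (\<phi> B) (pt c))" unfolding preact_def using \<phi>(1) assms(2) by blast
  ultimately show ?thesis using that by blast
qed

lemma code_of_pair:
  assumes "pair (Pg n \<beta>) x y" "c \<in> F" "rr (x + c) = p" "rr (y + c) = q" "p \<in> F" "q \<in> F"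
  shows "Code (Suc n) \<beta> p q"
proof -
  obtain g where g: "fs n g" "\<And>B sd. B \<in> BB \<Longrightarrow> g sd B = (if \<beta> sd B then y else x)"
    using assms(1) unfolding pair_def Pg_def by (metis order_antisym)
  have "ok (g sd B + c)" if "B \<in> BB" for B sd using g(2)[OF that, of sd] assms(3-6) by (auto simp: ok_def F_iff)
  then obtain \<psi> where "preact (Suc n) \<psi>" "\<And>B. B \<in> BB \<Longrightarrow> \<psi> B = Iv (Fin (rr (g False B + c))) (Fin (rr (g True B + c)))"
    using preact_of_fs[OF g(1) assms(2)] by metis
  then show ?thesis unfolding Code_def using g(2) assms(3,4) by (intro exI[of _ \<psi>]) auto
qed

text \<open>If the bit is off at the lower and on at the upper end, \<sigma> is applied to the whole
  interval from p to q; since it stays between its end values there, the extremes are exactly those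
  values. Otherwise the interval is a single point.\<close>

lemma code_term:
  assumes C: "Code n \<beta> p q" "monob \<beta>" "p \<le> q" "p \<in> F" "q \<in> F"
    and s': "s' = 1 \<or> s' = - 1" and w: "w \<in> F" "0 \<le> w" "ok (w * (s' * sv p))" "ok (w * (s' * sv q))"
    and b: "\<And>z. z \<in> F \<Longrightarrow> p \<le> z \<Longrightarrow> z \<le> q \<Longrightarrow> \<sigma> (Fin z) = Fin (sv z) \<and> s' * sv p \<le> s' * sv z \<and> s' * sv z \<le> s' * sv q"
  shows "tbit n \<beta> (rr (w * (s' * sv p))) (rr (w * (s' * sv q)))"
proof -
  obtain \<psi> where \<psi>: "preact n \<psi>" "\<And>B. B \<in> BB \<Longrightarrow> \<psi> B = Iv (Fin (if \<beta> False B then q else p)) (Fin (if \<beta> True B then q else p))"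
    using C(1) unfolding Code_def by blast
  define g where "g sd B = (if \<beta> sd B then q else p)" for sd B
  have mono: "\<beta> False B \<Longrightarrow> \<beta> True B" if "B \<in> BB" for B using C(2) that by (simp add: monob_def)
  have gr: "p \<le> g sd B" "g sd B \<le> q" for sd B using C by (auto simp: g_def)
  have "ok (w * sv z)" if z: "z \<in> F" "p \<le> z" "z \<le> q" for z
  proof -
    have "w * (s' * sv p) \<le> w * (s' * sv z)" "w * (s' * sv z) \<le> w * (s' * sv q)" using b[OF z] w(2) by (auto intro: mult_left_mono)
    then have "ok (w * (s' * sv z))" using ok_between w(3,4) by blast
    then show ?thesis using s' ok_minus[of "w * sv z"] by auto
  qed
  then have h2: "\<sigma> (Fin z) = Fin (sv z) \<and> ok (w * sv z)" if "B \<in> BB" "z \<in> F" "g False B \<le> z" "z \<le> g True B" for B z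
    using b[of z] that gr[of False B] gr[of True B] by simp
  have h1: "\<psi> B = Iv (Fin (g False B)) (Fin (g True B)) \<and> g False B \<le> g True B \<and> (\<forall>sd. g sd B \<in> F)" if "B \<in> BB" for B
    using \<psi>(2)[OF that] mono[OF that] C by (auto simp: g_def)
  have "\<exists>t. ts n t \<and> (\<forall>B\<in>BB. extremal (g False B) (g True B) w s' (t False B) (t True B))"
    by (rule act_term[OF \<psi>(1) h1 h2 s' w(1,2)])
  then obtain t where t: "ts n t" "\<And>B. B \<in> BB \<Longrightarrow> extremal (g False B) (g True B) w s' (t False B) (t True B)" by blast
  have "t sd B = (if \<beta> sd B then rr (w * (s' * sv q)) else rr (w * (s' * sv p)))" if B: "B \<in> BB" for B sd
  proof -
    obtain x y where xy: "x \<in> F" "g False B \<le> x" "x \<le> g True B" "y \<in> F" "g False B \<le> y" "y \<le> g True B"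
      "t False B = rr (w * (s' * sv x))" "t True B = rr (w * (s' * sv y))"
      and ex: "\<And>z. z \<in> F \<Longrightarrow> g False B \<le> z \<Longrightarrow> z \<le> g True B \<Longrightarrow> s' * sv x \<le> s' * sv z \<and> s' * sv z \<le> s' * sv y"
      using t(2)[OF B] unfolding extremal_def by blast
    have bx: "s' * sv p \<le> s' * sv x" "s' * sv x \<le> s' * sv q" using b[of x] xy(1-3) gr order_trans by metis+
    have bY: "s' * sv p \<le> s' * sv y" "s' * sv y \<le> s' * sv q" using b[of y] xy(4-6) gr order_trans by metis+
    consider "\<beta> False B" "\<beta> True B" | "\<not> \<beta> False B" "\<beta> True B" | "\<not> \<beta> False B" "\<not> \<beta> True B" using mono[OF B] by blast
    then have "s' * sv x = s' * (if \<beta> False B then sv q else sv p) \<and> s' * sv y = s' * (if \<beta> True B then sv q else sv p)"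
    proof cases
      case 1 then show ?thesis using xy by (auto simp: g_def)
    next
      case 2 then show ?thesis using ex[of p] ex[of q] bx bY C by (auto simp: g_def)
    next
      case 3 then show ?thesis using xy by (auto simp: g_def)
    qed
    then show ?thesis using xy(7,8) by (cases sd) auto
  qed
  then show ?thesis unfolding tbit_def using t(1) by auto
qed

definition BT :: "nat \<Rightarrow> bits \<Rightarrow> real \<Rightarrow> bool" where
  "BT n \<beta> v \<longleftrightarrow> (\<forall>w\<in>F. 0 \<le> w \<longrightarrow> ok (v * w) \<longrightarrow> tbit n \<beta> 0 (rr (v * w)))"

lemma BT_bsteps: "BT n \<beta> v \<Longrightarrow> (c0, c1) \<in> bsteps v \<Longrightarrow> tbit n \<beta> c0 c1"
  unfolding BT_def bsteps_def by auto

text \<open>The polarity that results depends on which of the two code values has activation 0. This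
  is why later statements offer a bit or its complement.\<close>

lemma code_BT:
  assumes C: "Code n \<beta> p q" "monob \<beta>" "p \<le> q" "p \<in> F" "q \<in> F"
    and b: "\<And>z. z \<in> F \<Longrightarrow> p \<le> z \<Longrightarrow> z \<le> q \<Longrightarrow> \<sigma> (Fin z) = Fin (sv z) \<and> min 0 v \<le> sv z \<and> sv z \<le> max 0 v"
  shows "sv p = 0 \<Longrightarrow> sv q = v \<Longrightarrow> BT n \<beta> \<bar>v\<bar>" and "sv q = 0 \<Longrightarrow> sv p = v \<Longrightarrow> BT n (neg \<beta>) \<bar>v\<bar>"
proof -
  define s where "s = (if 0 \<le> v then 1 else - 1 :: real)"
  have s: "s = 1 \<or> s = - 1" "- s = 1 \<or> - s = - 1" "s * v = \<bar>v\<bar>" by (auto simp: s_def)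
  have b': "0 \<le> s * sv z \<and> s * sv z \<le> \<bar>v\<bar>" if "z \<in> F" "p \<le> z" "z \<le> q" for z
    using b[OF that] by (auto simp: s_def split: if_splits)
  show "BT n \<beta> \<bar>v\<bar>" if h: "sv p = 0" "sv q = v"
  proof -
    have "tbit n \<beta> 0 (rr (\<bar>v\<bar> * w))" if w: "w \<in> F" "0 \<le> w" "ok (\<bar>v\<bar> * w)" for w
      using code_term[OF C s(1) w(1,2)] h s(3) w(3) b b' F_ok[OF zero_F] by (simp add: mult.commute)
    then show ?thesis by (auto simp: BT_def)
  qed
  show "BT n (neg \<beta>) \<bar>v\<bar>" if h: "sv q = 0" "sv p = v"
  proof -
    have "tbit n (neg \<beta>) 0 (rr (\<bar>v\<bar> * w))" if w: "w \<in> F" "0 \<le> w" "ok (\<bar>v\<bar> * w)" for w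
    proof -
      have e: "w * (- s * sv p) = - (\<bar>v\<bar> * w)" using h s(3) by (simp add: mult.commute)
      have "tbit n \<beta> (rr (- (\<bar>v\<bar> * w))) (rr (w * (- s * sv q)))" unfolding e[symmetric]
        by (rule code_term[OF C s(2) w(1,2)]) (use h s(3) w(3) b b' F_ok[OF zero_F] e ok_minus in \<open>auto simp: mult.commute\<close>)
      then have "tbit n \<beta> (- rr (\<bar>v\<bar> * w)) 0" using h by (simp add: rr_minus)
      from tbit_neg[OF this] show ?thesis by simp
    qed
    then show ?thesis by (auto simp: BT_def)
  qed
qed

end

section \<open>From thresholds at \<open>\<eta>\<close> to clean bits\<close>

text \<open>Here \<open>\<eta> = fz ie\<close>, and \<open>sg\<close> is the direction in which \<open>\<sigma>\<close> crosses from \<open>\<eta>\<close> to its successor.\<close>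

locale cnet = nets +
  fixes c1 c2 s0 sg lam :: real and ie :: int
  assumes c12: "c1 \<in> F" "c2 \<in> F" "\<sigma> (Fin c1) = Fin 0" "\<sigma> (Fin c2) = Fin s0"
    and s0: "p2 (- m - 2) + p2 (- 2 * m - 1) \<le> \<bar>s0\<bar>" "\<bar>s0\<bar> \<le> 5 / 4"
    and c_between: "\<And>z. z \<in> F \<Longrightarrow> min c1 c2 \<le> z \<Longrightarrow> z \<le> max c1 c2 \<Longrightarrow> \<sigma> (Fin z) = Fin (sv z) \<and> min 0 s0 \<le> sv z \<and> sv z \<le> max 0 s0"
    and ie: "p2 (a + 5) \<le> \<bar>fz ie\<bar>" "\<bar>fz ie\<bar> < 4" "\<bar>fz (ie + 1)\<bar> \<le> 4"
    and A: "p2 (a + 5) \<le> \<bar>sv (fz ie)\<bar>" "\<bar>sv (fz ie)\<bar> \<le> p2 (b - 6) * \<bar>fz ie\<bar>" "\<bar>sv (fz (ie + 1))\<bar> \<le> p2 (b - 6) * \<bar>fz ie\<bar>"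
    and sg: "sg = 1 \<or> sg = - 1" "sg * sv (fz ie) < sg * sv (fz (ie + 1))"
    and left: "\<And>x. x \<in> F \<Longrightarrow> x \<le> fz ie \<Longrightarrow> \<sigma> (Fin x) = Fin (sv x) \<and> sg * sv x \<le> sg * sv (fz ie) \<and> \<bar>sv x - sv (fz ie)\<bar> \<le> lam * (fz ie - x)"
    and right: "\<And>x. x \<in> F \<Longrightarrow> fz (ie + 1) \<le> x \<Longrightarrow> \<sigma> (Fin x) = Fin (sv x) \<and> sg * sv (fz (ie + 1)) \<le> sg * sv x \<and> \<bar>sv x - sv (fz (ie + 1))\<bar> \<le> lam * (x - fz (ie + 1))"
    and lam: "0 \<le> lam" "lam \<le> p2 (b - 7) * \<bar>sv (fz ie)\<bar>" "lam \<le> p2 (b - 7) * 2 ^ (M + 3)"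
begin

abbreviation eta :: real where "eta \<equiv> fz ie"
abbreviation eta' :: real where "eta' \<equiv> fz (ie + 1)"
definition B0 :: real where "B0 = sg * sv eta"
definition B1 :: real where "B1 = sg * sv eta'"

section \<open>The jump at \<eta> and the weight that contracts its surroundings\<close>

lemma four_Om: "4 \<le> Om"
  using p2_le_Om[of 2] b15 by simp

lemma eta_F: "eta \<in> F" "eta' \<in> F"
  using ie four_Om by (auto simp: F_iff)

lemma sv_F: "\<sigma> (Fin x) = Fin (sv x) \<Longrightarrow> x \<in> F \<Longrightarrow> sv x \<in> F"
  using valid[of "Fin x"] by simp

lemma sg_F: "v \<in> F \<Longrightarrow> sg * v \<in> F"
  using sg(1) F_minus by auto

lemma B_F: "B0 \<in> F" "B1 \<in> F"
  unfolding B0_def B1_def using left[OF eta_F(1)] right[OF eta_F(2)] eta_F by (auto intro!: sg_F sv_F)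

lemma abs_sg: "\<bar>sg * v\<bar> = \<bar>v\<bar>"
  using sg(1) by (auto simp: abs_mult)

lemma fz_2: "fz (idx 2) = 4"
  using fz_idx[of 2] ab b15 by simp

text \<open>The lower bound loses one binade because for a negative power of two \<eta> the gap
  towards 0 is half of the gap away from it.\<close>

lemma gap_eta:
  obtains x where "gap ie = p2 x" "a + 4 - m \<le> x" "x \<le> 1 - m" "\<bar>eta\<bar> \<le> p2 (m + 1) * p2 x"
proof -
  have lo: "- idx 2 \<le> ie" "ie < idx 2"
  proof -
    have "fz (- idx 2) \<le> fz ie" "fz ie < fz (idx 2)" using ie fz_2 fz_minus[of "idx 2"] by auto
    then show "- idx 2 \<le> ie" "ie < idx 2" by simp_all
  qed
  then have up: "gap ie \<le> p2 (1 - m)" using gap_symm_le[of 1 ie] ab b15 by simp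
  show ?thesis
  proof (cases "0 \<le> ie")
    case True
    obtain e where e: "a \<le> e" "gap ie = p2 (e - m)" "fz (ie + 1) \<le> p2 (e + 1)" using gap_exp[OF True] by metis
    have nn: "0 \<le> eta" using True by simp
    then have "p2 (a + 5 - m) \<le> gap ie" using gap_ge[of "a + 5" ie] ie by simp
    then have "a + 5 - m \<le> e - m" using e by simp
    then have le1: "a + 4 - m \<le> e - m" "e - m \<le> 1 - m" using up e by simp_all
    have "eta \<le> eta'" by simp
    then have "\<bar>eta\<bar> \<le> p2 (e + 1)" using e nn by linarith
    then have "\<bar>eta\<bar> \<le> p2 (m + 1) * p2 (e - m)" by (simp add: p2_add p2_diff)
    then show ?thesis using that[of "e - m"] e le1 by simp
  next
    case False
    define k where "k = - ie - 1"
    have k: "0 \<le> k" "gap k = gap ie" "fz (k + 1) = - eta" using False gap_minus[of ie] fz_minus[of ie] by (auto simp: k_def)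
    have neg: "eta < 0" using False fz_less[of ie 0] by simp
    obtain e where e: "a \<le> e" "gap k = p2 (e - m)" "fz (k + 1) \<le> p2 (e + 1)" using gap_exp[OF k(1)] by metis
    have "p2 (a + 4) < p2 (a + 5)" by simp
    then have "p2 (a + 4) < fz (k + 1)" using ie k neg by linarith
    then have "p2 (a + 4 - m) \<le> gap k" using gap_pred_ge[of "a + 4" "k + 1"] by simp
    then have "a + 4 - m \<le> e - m" using e by simp
    then have le1: "a + 4 - m \<le> e - m" "e - m \<le> 1 - m" using up e k by simp_all
    have "\<bar>eta\<bar> \<le> p2 (e + 1)" using e k neg by linarith
    then have "\<bar>eta\<bar> \<le> p2 (m + 1) * p2 (e - m)" by (simp add: p2_add p2_diff)
    then show ?thesis using that[of "e - m"] e k le1 by simp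
  qed
qed

definition xi :: int where "xi = (THE x. gap ie = p2 x)"

lemma xi: "gap ie = p2 xi" "a + 4 - m \<le> xi" "xi \<le> 1 - m" "\<bar>eta\<bar> \<le> p2 (m + 1) * p2 xi"
proof -
  obtain x where x: "gap ie = p2 x" "a + 4 - m \<le> x" "x \<le> 1 - m" "\<bar>eta\<bar> \<le> p2 (m + 1) * p2 x" using gap_eta by blast
  have "xi = x" unfolding xi_def using x(1) by (intro the_equality) auto
  then show "gap ie = p2 xi" "a + 4 - m \<le> xi" "xi \<le> 1 - m" "\<bar>eta\<bar> \<le> p2 (m + 1) * p2 xi" using x by auto
qed

text \<open>The closest neighbour is the one towards 0. Its distance is the last place of the binade
  below or around x, at least 2^(-M-1) times |x|.\<close>

lemma float_distance:
  assumes "x \<in> Fz" "y \<in> Fz" "x \<noteq> y"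
  shows "\<bar>x\<bar> * p2 (- m - 1) \<le> \<bar>x - y\<bar>"
proof -
  have pos: "fz i * p2 (- m - 1) \<le> \<bar>fz i - z\<bar>" if i: "1 \<le> i" and z: "z \<in> Fz" "z \<noteq> fz i" for i z
  proof -
    obtain j where j: "z = fz j" using z(1) by (auto simp: Fz_def)
    obtain e where e: "a \<le> e" "gap (i - 1) = p2 (e - m)" "fz (i - 1 + 1) \<le> p2 (e + 1)" using gap_exp[of "i - 1"] i by auto
    have "fz i * p2 (- m - 1) \<le> p2 (e + 1) * p2 (- m - 1)" using e(3) by (intro mult_right_mono) auto
    also have "\<dots> = gap (i - 1)" using e by (simp add: p2_add[symmetric])
    finally have le: "fz i * p2 (- m - 1) \<le> gap (i - 1)" .
    have "gap (i - 1) \<le> gap i" using gap_mono[of "i - 1" i] i by simp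
    moreover have "j \<le> i - 1 \<or> i + 1 \<le> j" using j z by force
    then have "fz j \<le> fz (i - 1) \<or> fz (i + 1) \<le> fz j" by simp
    moreover have "gap (i - 1) = fz i - fz (i - 1)" "gap i = fz (i + 1) - fz i" by (simp_all add: gap_def)
    ultimately show ?thesis using le j by linarith
  qed
  obtain i where i: "x = fz i" using assms by (auto simp: Fz_def)
  consider "i = 0" | "1 \<le> i" | "1 \<le> - i" by linarith
  then show ?thesis
  proof cases
    case 1 then show ?thesis using i by simp
  next
    case 2
    then have "0 \<le> x" using i by simp
    then show ?thesis using pos[OF 2, of y] assms i by simp
  next
    case 3
    have "fz (- i) = - x" using i fz_minus by simp
    moreover have "0 \<le> fz (- i)" using 3 by simp
    ultimately show ?thesis using pos[OF 3, of "- y"] assms Fz_minus by (simp add: abs_minus_commute)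
  qed
qed

text \<open>Scaling down by a power of two keeps the significand, so it is exact unless the result
  falls into the lowest range, where the grid is \<open>om\<close>.\<close>

lemma p2_scale_err:
  assumes "t \<in> Fz" "j \<le> 0"
  shows "\<bar>p2 j * t - rr (p2 j * t)\<bar> \<le> om / 2"
proof (cases "\<bar>p2 j * t\<bar> \<le> p2 (a + 1)")
  case True
  then show ?thesis using rr_err[of "p2 j * t" a] by (simp add: om_def)
next
  case False
  have pos: "p2 j * u \<in> Fz" if u: "u \<in> Fz" "p2 (a + 1) < p2 j * u" for u
  proof -
    obtain i where i: "u = fz i" using u by (auto simp: Fz_def)
    have "0 < p2 j * u" using u(2) p2_pos[of "a + 1"] by linarith
    then have "0 < u" using zero_less_mult_pos p2_pos by blast
    then obtain e where e: "p2 e \<le> u" "u < p2 (e + 1)" using p2_bracket by blast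
    have "p2 j * u < p2 j * p2 (e + 1)" using e by simp
    moreover have "p2 (j + (e + 1)) = p2 j * p2 (e + 1)" by (simp only: p2_add)
    ultimately have "p2 (a + 1) < p2 (j + (e + 1))" using u(2) by linarith
    then have je: "a + 1 \<le> j + e" by simp
    obtain n where n: "u = of_int n * p2 (e - m)" "2 ^ M \<le> n" "n \<le> 2 ^ (M + 1)"
      using binade_multiple[of e i] e i je assms(2) by auto
    have "\<bar>n\<bar> \<le> 2 ^ (M + 1)" using n two_M by simp
    then have "of_int n * p2 (j + e - m) \<in> Fz" using je by (intro Fz_mem) auto
    moreover have "of_int n * p2 (j + e - m) = p2 j * u" by (simp add: n p2_add p2_diff)
    ultimately show ?thesis by simp
  qed
  have "p2 j * t \<in> Fz"
  proof (cases "0 \<le> t")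
    case True
    then have "0 \<le> p2 j * t" by simp
    then show ?thesis using pos[OF assms(1)] False by linarith
  next
    case neg: False
    then have "p2 j * t \<le> 0" by (simp add: mult_nonneg_nonpos)
    then have "p2 j * (- t) \<in> Fz" using pos[OF Fz_minus[OF assms(1)]] False by simp
    then show ?thesis using Fz_minus by fastforce
  qed
  then show ?thesis by (simp add: rr_Fz)
qed

text \<open>The weight keeps the gap \<open>B1 - B0\<close> visible and makes the spread at most a quarter of the old one.\<close>

lemma contracting_weight:
  obtains w where "w \<in> F" "0 \<le> w" "w \<le> 1" "w * lam \<le> 3 / 16" "w * (B1 - B0) + om \<le> p2 xi / 2"
    "2 * om \<le> rr (w * B1) - rr (w * B0)" "\<And>t. t \<in> Fz \<Longrightarrow> \<bar>w * t - rr (w * t)\<bar> \<le> om / 2"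
proof -
  define g where "g = B1 - B0"
  have g0: "0 < g" using sg(2) by (simp add: g_def B0_def B1_def)
  have hom: "16 * om \<le> p2 xi" using om_p2[of 4] p2_le[of "a + 4 - m" xi] xi by simp
  have B: "B0 \<in> Fz" "B1 \<in> Fz" using B_F by (auto simp: F_iff)
  have gB: "\<bar>B0\<bar> * p2 (- m - 1) \<le> g" using float_distance[of B0 B1] B g0 by (simp add: g_def)
  have aB: "p2 (a + 5) \<le> \<bar>B0\<bar>" "\<bar>B0\<bar> = \<bar>sv eta\<bar>" using A(1) by (simp_all add: B0_def abs_sg)
  have "p2 (a + 5) * p2 (- m - 1) \<le> g" using order_trans[OF mult_right_mono[OF aB(1)] gB] by simp
  moreover have "p2 (a + 5) * p2 (- m - 1) = p2 (a + 4 - m)" unfolding p2_add[symmetric] by (rule arg_cong[of _ _ p2]) simp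
  moreover have "p2 (a + 4 - m) = 16 * om" using om_p2[of 4] by simp
  ultimately have g16: "16 * om \<le> g" by linarith
  have err: "\<bar>p2 j * t - rr (p2 j * t)\<bar> \<le> om / 2" if "j \<le> 0" "t \<in> Fz" for j t using p2_scale_err that by blast
  have diff: "2 * om \<le> rr (p2 j * B1) - rr (p2 j * B0)" if j: "j \<le> 0" "3 * om \<le> p2 j * g" for j
  proof -
    have "p2 j * g = p2 j * B1 - p2 j * B0" by (simp add: g_def right_diff_distrib)
    then show ?thesis using err[OF j(1) B(1)] err[OF j(1) B(2)] j(2) by linarith
  qed
  show ?thesis
  proof (cases "3 \<le> g")
    case True
    have j0: "a - m \<le> 0" using ab b15 by simp
    have om1: "om \<le> 1" using p2_le[of "a - m" 0] j0 by (simp add: om_def)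
    \<comment> \<open>The jump is so wide that the least weight keeps it visible. The exponents of
      the bound on \<open>lam\<close> add up to emin + emax - 4 = - 3.\<close>
    have "om * lam \<le> om * (p2 (b - 7) * 2 ^ (M + 3))" using lam by simp
    also have "\<dots> = p2 (a - m + (b - 7) + (m + 3))"
    proof -
      have "(2::real) ^ (M + 3) = p2 (m + 3)" using p2_nat[of "M + 3"] by simp
      then show ?thesis unfolding om_def by (simp only: p2_add mult.assoc)
    qed
    also have "\<dots> = p2 (- 3)" using ab by (intro arg_cong[of _ _ p2]) simp
    also have "\<dots> = 1 / 8" using p2_minus[of 3] by simp
    finally have l: "om * lam \<le> 3 / 16" by simp
    have "g \<le> \<bar>B1\<bar> + \<bar>B0\<bar>" by (simp add: g_def)
    also have "\<dots> \<le> 2 * p2 (b - 6) * \<bar>eta\<bar>" using A(2,3) by (simp add: B0_def B1_def abs_sg)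
    also have "\<dots> \<le> 2 * p2 (b - 6) * (p2 (m + 1) * p2 xi)" using xi(4) by simp
    finally have "om * g \<le> om * (2 * p2 (b - 6) * (p2 (m + 1) * p2 xi))" by simp
    also have "\<dots> = p2 (a - m + 1 + (b - 6) + (m + 1)) * p2 xi" unfolding om_def by (simp only: p2_add p2_num mult_ac)
    also have "a - m + 1 + (b - 6) + (m + 1) = - 3" using ab by simp
    finally have "om * g \<le> p2 xi / 8" using p2_minus[of 3] by simp
    then have h: "om * g + om \<le> p2 xi / 2" using hom p2_pos[of xi] by linarith
    show ?thesis
    proof (rule that[of om])
      show "2 * om \<le> rr (om * B1) - rr (om * B0)" using diff[OF j0] True om_pos by (simp add: om_def)
      show "\<bar>om * t - rr (om * t)\<bar> \<le> om / 2" if "t \<in> Fz" for t using err[OF j0 that] by (simp add: om_def)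
    qed (use om_F[of 1] om1 l h g_def in auto)
  next
    case False
    \<comment> \<open>A power of two is chosen as weight so that the jump is scaled to more than 3 *
      om, which survives two rounding errors of om / 2, and to at most 6 * om.\<close>
    obtain e where e: "p2 e \<le> 3 * om / g" "3 * om / g < p2 (e + 1)" using p2_bracket[of "3 * om / g"] g0 om_pos by auto
    define w where "w = p2 (e + 1)"
    have w1: "3 * om < w * g" using e(2) g0 by (simp add: w_def field_simps)
    have w2: "w * g \<le> 6 * om" using e(1) g0 p2_Suc[of e] by (simp add: w_def field_simps)
    have "3 * om / g > om" using False g0 om_pos by (simp add: field_simps)
    then have "p2 (a - m) < p2 (e + 1)" using e unfolding om_def by linarith
    then have j1: "a - m \<le> e + 1" by simp
    have "w * (16 * om) \<le> w * g" using g16 by (simp add: w_def)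
    then have "w * (16 * om) \<le> 16 * om" using w2 om_pos by linarith
    then have w1': "w \<le> 1" using om_pos by simp
    then have "p2 (e + 1) \<le> p2 0" by (simp add: w_def)
    then have j0: "e + 1 \<le> 0" by (simp only: p2_le)
    have one: "p2 (- m - 1) * p2 (m + 1) = 1" by (simp add: p2_add[symmetric])
    have "w * lam \<le> w * (p2 (b - 7) * \<bar>B0\<bar>)" using lam(2) aB(2) by (simp add: w_def)
    also have "\<dots> = w * (p2 (b - 7) * (\<bar>B0\<bar> * p2 (- m - 1) * p2 (m + 1)))" using one by simp
    also have "\<dots> \<le> w * (p2 (b - 7) * (g * p2 (m + 1)))" using gB by (intro mult_left_mono mult_right_mono) (auto simp: w_def)
    also have "\<dots> = (w * g) * p2 (b - 7 + (m + 1))" by (simp only: p2_add mult_ac)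
    also have "\<dots> \<le> (6 * om) * p2 (b - 7 + (m + 1))" using w2 by (intro mult_right_mono) auto
    also have "\<dots> = 6 * p2 (a - m + (b - 7 + (m + 1)))" unfolding om_def by (simp only: p2_add mult_ac)
    also have "a - m + (b - 7 + (m + 1)) = - 5" using ab by simp
    finally have l: "w * lam \<le> 3 / 16" using p2_minus[of 5] by simp
    have h: "w * g + om \<le> p2 xi / 2" using w2 hom om_pos by linarith
    show ?thesis
    proof (rule that[of w])
      show "w \<in> F" unfolding w_def using j1 j0 b15 by (intro p2_F) auto
      show "2 * om \<le> rr (w * B1) - rr (w * B0)" using diff[OF j0] w1 by (simp add: w_def)
      show "\<bar>w * t - rr (w * t)\<bar> \<le> om / 2" if "t \<in> Fz" for t using err[OF j0 that] by (simp add: w_def)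
    qed (use w1' l h in \<open>auto simp: w_def g_def\<close>)
  qed
qed

text \<open>Two sources of constants: if M is close to emax, the multiples of |\<sigma>(c2)| can be
  too small for the larger bases, and those of |\<sigma>(\<eta>)| are used for them.\<close>

definition Tc :: "(real \<times> real) set" where "Tc = csteps \<bar>s0\<bar> \<union> csteps \<bar>sv eta\<bar>"

lemma tbit_Tc: "(x0, x1) \<in> Tc \<Longrightarrow> tbit n \<beta> x0 x1"
  unfolding Tc_def using tbit_const[OF c12(2,4)] tbit_const[OF eta_F(1)] left[OF eta_F(1)] by auto

lemma prog_Tc: "prog Tc (Pg n \<beta>)"
  by (rule prog_Pg) (rule tbit_Tc)

lemma s0_F: "s0 \<in> F"
  using valid[of "Fin c2"] c12 by simp

lemma abs_F: "x \<in> F \<Longrightarrow> \<bar>x\<bar> \<in> F"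
  using F_minus by (simp add: abs_real_def)

lemma strong_s: "strong \<bar>s0\<bar> b"
  using good_strong[of "\<bar>s0\<bar>"] s0 abs_F[OF s0_F] by (simp add: F_iff)

lemma csteps_I: "w \<in> F \<Longrightarrow> ok (v * w) \<Longrightarrow> (rr (v * w), rr (v * w)) \<in> csteps v"
  unfolding csteps_def by blast

lemma amp_Tc: "amp Tc"
  unfolding amp_def
proof (intro conjI allI impI)
  fix e assume e: "a \<le> e \<and> e \<le> 6"
  obtain w where w: "w \<in> F" "0 \<le> w" "ok (\<bar>s0\<bar> * w)" "p2 (e - m) / 2 < rr (\<bar>s0\<bar> * w)" "rr (\<bar>s0\<bar> * w) \<le> p2 (e - m)"
    using K[OF strong_mono[OF strong_s], of e] e b15 by auto
  then show "\<exists>d\<in>Fz. p2 (e - m) / 2 < d \<and> d \<le> p2 (e - m) \<and> (d, d) \<in> Tc"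
    using csteps_I by (intro bexI[of _ "rr (\<bar>s0\<bar> * w)"]) (auto simp: Tc_def)
next
  fix e assume e: "a + 2 \<le> e \<and> e \<le> 6"
  have ae: "a \<le> e" "e < b" using e b15 by auto
  have fin: "\<exists>B\<in>Fz. p2 e \<le> B \<and> B \<le> 3 / 2 * p2 e \<and> (B, B) \<in> Tc \<and> (- B, - B) \<in> Tc"
    if v: "0 < v" "v * om \<le> p2 e / 8" "p2 e \<le> rr (v * Om)" "csteps v \<subseteq> Tc" for v
  proof -
    obtain w where w: "w \<in> F" "ok (v * w)" "p2 e \<le> rr (v * w)" "rr (v * w) \<le> 3 / 2 * p2 e"
      using base_constant[OF v(1-3) ae] by blast
    then show ?thesis using csteps_I[OF w(1,2)] csteps_minus v(4) by (intro bexI[of _ "rr (v * w)"]) auto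
  qed
  show "\<exists>B\<in>Fz. p2 e \<le> B \<and> B \<le> 3 / 2 * p2 e \<and> (B, B) \<in> Tc \<and> (- B, - B) \<in> Tc"
  proof (cases "p2 e \<le> rr (\<bar>s0\<bar> * Om)")
    case True
    have "\<bar>s0\<bar> * om \<le> 5 / 4 * om" using s0 by (intro mult_right_mono) auto
    moreover have "p2 (a + 5 - m) \<le> p2 e" using e m3 by simp
    then have "32 * om \<le> p2 e" using om_p2[of 5] by simp
    ultimately have "\<bar>s0\<bar> * om \<le> p2 e / 8" using om_pos by linarith
    moreover have "0 < \<bar>s0\<bar>" using s0 p2_pos[of "- m - 2"] p2_pos[of "- 2 * m - 1"] by linarith
    ultimately show ?thesis using fin[of "\<bar>s0\<bar>"] True by (auto simp: Tc_def)
  next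
    case False
    \<comment> \<open>The height |\<sigma>(c2)| can only fail for bases above 2^(emax-M-1). This
      lower bound on e makes |\<sigma>(\<eta>)| fine enough.\<close>
    have "p2 (b - m - 1) \<le> \<bar>s0\<bar> * Om" using good_bound[OF s0(1)] p2_pos[of "b - 2 * m - 1"] by linarith
    then have "p2 (b - m - 1) \<le> rr (\<bar>s0\<bar> * Om)" using ab b15 mb by (intro rr_ge p2_Fz) auto
    then have "p2 (b - m - 1) < p2 e" using False by linarith
    then have em: "b - m \<le> e" by simp
    have "p2 (b - 6) * \<bar>eta\<bar> \<le> p2 (b - 6) * 4" using ie(2) by (intro mult_left_mono) auto
    then have "\<bar>sv eta\<bar> \<le> p2 (b - 6) * 4" using A(2) by linarith
    then have "\<bar>sv eta\<bar> * om \<le> p2 (b - 6) * 4 * om" by (intro mult_right_mono) auto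
    also have "\<dots> = p2 (b - 6 + 2 + (a - m))" unfolding om_def by (simp only: p2_add p2_num) simp
    also have "\<dots> \<le> p2 (e - 3)" using ab em b15 by simp
    also have "\<dots> = p2 e / 8" by (simp add: p2_diff)
    finally have small: "\<bar>sv eta\<bar> * om \<le> p2 e / 8" .
    \<comment> \<open>2^(emin+5) times 2^emax is 2^6: the reason why bases are demanded only up to
      binade 6, which is enough for |\<eta>| < 4.\<close>
    have "p2 e \<le> p2 6" using e by (simp only: p2_le)
    also have "\<dots> = p2 (a + 5) * p2 b" using ab unfolding p2_add[symmetric] by (intro arg_cong[of _ _ p2]) simp
    also have "\<dots> \<le> \<bar>sv eta\<bar> * Om" using A(1) p2b_le_Om by (intro mult_mono) auto
    finally have "p2 e \<le> rr (\<bar>sv eta\<bar> * Om)" using e m3 by (intro rr_ge p2_Fz) auto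
    moreover have "0 < \<bar>sv eta\<bar>" using A(1) p2_pos[of "a + 5"] by linarith
    ultimately show ?thesis using fin[of "\<bar>sv eta\<bar>"] small by (auto simp: Tc_def)
  qed
qed

text \<open>\<open>PF n \<beta> R\<close>: some pre-activation is on the right of the jump at \<open>\<eta>\<close> exactly when \<open>\<beta>\<close> is on,
  at distance at most \<open>R\<close>.\<close>

definition inPF :: "bits \<Rightarrow> real \<Rightarrow> (bool \<Rightarrow> ival list \<Rightarrow> real) \<Rightarrow> ival list \<Rightarrow> bool" where
  "inPF \<beta> R g B \<longleftrightarrow> g False B \<le> g True B \<and> (\<forall>sd. g sd B \<in> F \<and>
     (if \<beta> sd B then eta' \<le> g sd B \<and> g sd B \<le> eta' + R else eta - R \<le> g sd B \<and> g sd B \<le> eta))"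

definition PF :: "nat \<Rightarrow> bits \<Rightarrow> real \<Rightarrow> bool" where
  "PF n \<beta> R \<longleftrightarrow> (\<exists>\<psi> g. preact n \<psi> \<and> (\<forall>B\<in>BB. \<psi> B = Iv (Fin (g False B)) (Fin (g True B)) \<and> inPF \<beta> R g B))"

section \<open>Contraction layer by layer\<close>

lemma F_split: "z \<in> F \<Longrightarrow> z \<le> eta \<or> eta' \<le> z"
  using F_cases[of z] by force

lemma sv_fin: "z \<in> F \<Longrightarrow> \<sigma> (Fin z) = Fin (sv z) \<and> sv z \<in> F"
  using F_split[of z] left right sv_F by blast

text \<open>Through \<sigma> and the contracting weight a spread R becomes at most R / 4, while the
  jump leaves 2 * om between the states. Subtracting v0, the product obtained at \<eta> itself, puts
  the off values at or below 0, the form in which the doubling programs start.\<close>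

lemma PF_start:
  assumes "PF n \<beta> R" "R = p2 r" "xi + 3 \<le> r" "r \<le> b + 1"
  shows "Pg n \<beta> (- (R / 4)) 0 (2 * om) (R / 4)"
proof -
  obtain \<psi> g where \<psi>: "preact n \<psi>" and p: "\<And>B. B \<in> BB \<Longrightarrow> \<psi> B = Iv (Fin (g False B)) (Fin (g True B)) \<and> inPF \<beta> R g B"
    using assms(1) unfolding PF_def by blast
  have g: "\<psi> B = Iv (Fin (g False B)) (Fin (g True B)) \<and> g False B \<le> g True B \<and> (\<forall>sd. g sd B \<in> F)" if "B \<in> BB" for B
    using p[OF that] by (simp add: inPF_def)
  have gr: "if \<beta> sd B then eta' \<le> g sd B \<and> g sd B \<le> eta' + R else eta - R \<le> g sd B \<and> g sd B \<le> eta" if "B \<in> BB" for B sd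
    using p[OF that] unfolding inPF_def by blast
  obtain w where w: "w \<in> F" "0 \<le> w" "w \<le> 1" "w * lam \<le> 3 / 16" "w * (B1 - B0) + om \<le> p2 xi / 2"
    "2 * om \<le> rr (w * B1) - rr (w * B0)" and err: "\<And>t. t \<in> Fz \<Longrightarrow> \<bar>w * t - rr (w * t)\<bar> \<le> om / 2"
    using contracting_weight by blast
  have okw: "ok (w * v)" if "v \<in> F" for v
  proof (rule okI)
    have "\<bar>w * v\<bar> \<le> 1 * \<bar>v\<bar>" unfolding abs_mult using w by (intro mult_right_mono) auto
    then show "\<bar>w * v\<bar> \<le> Om" using that by (simp add: F_iff)
  qed
  have fin: "\<sigma> (Fin z) = Fin (sv z) \<and> ok (w * sv z)" if "z \<in> F" for z using sv_fin[OF that] okw by blast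
  have "\<exists>t. ts n t \<and> (\<forall>B\<in>BB. extremal (g False B) (g True B) w sg (t False B) (t True B))"
  proof (rule act_term[of n \<psi> g w sg])
    show "\<psi> B = Iv (Fin (g False B)) (Fin (g True B)) \<and> g False B \<le> g True B \<and> (\<forall>sd. g sd B \<in> F)" if "B \<in> BB" for B
      by (rule g[OF that])
    show "\<sigma> (Fin z) = Fin (sv z) \<and> ok (w * sv z)" if "z \<in> F" for z by (rule fin[OF that])
  qed (rule \<psi> sg(1) w(1,2))+
  then obtain t where t: "ts n t" "\<And>B. B \<in> BB \<Longrightarrow> extremal (g False B) (g True B) w sg (t False B) (t True B)" by blast
  have R8: "8 * p2 xi \<le> R" using p2_le[of "xi + 3" r] assms by (simp add: p2_add)
  have R0: "0 < R" using assms by simp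
  have hom: "16 * om \<le> p2 xi" using om_p2[of 4] p2_le[of "a + 4 - m" xi] xi by simp
  have wlR: "w * (lam * R) \<le> 3 / 16 * R" using w(4) R0 by (simp add: mult.assoc[symmetric])
  have lo: "B0 - lam * R \<le> sg * sv x \<and> sg * sv x \<le> B0" if x: "x \<in> F" "x \<le> eta" "eta - R \<le> x" for x
  proof -
    have "lam * (eta - x) \<le> lam * R" using x lam by (intro mult_left_mono) auto
    then have "\<bar>sg * sv x - B0\<bar> \<le> lam * R" using left[OF x(1,2)] abs_sg[of "sv x - sv eta"] by (simp add: B0_def right_diff_distrib)
    then show ?thesis using left[OF x(1,2)] by (auto simp: B0_def)
  qed
  have hi: "B1 \<le> sg * sv x \<and> sg * sv x \<le> B1 + lam * R" if x: "x \<in> F" "eta' \<le> x" "x \<le> eta' + R" for x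
  proof -
    have "lam * (x - eta') \<le> lam * R" using x lam by (intro mult_left_mono) auto
    then have "\<bar>sg * sv x - B1\<bar> \<le> lam * R" using right[OF x(1,2)] abs_sg[of "sv x - sv eta'"] by (simp add: B1_def right_diff_distrib)
    then show ?thesis using right[OF x(1,2)] by (auto simp: B1_def)
  qed
  have B01: "B0 < B1" using sg(2) by (simp add: B0_def B1_def)
  have ee: "eta < eta'" by simp
  define v0 where "v0 = rr (w * B0)"
  \<comment> \<open>An interval that reaches across the jump has its extremes on the expected sides,
    because \<open>sg * sv\<close> is at most \<open>B0\<close> on the left and at least
    \<open>B1\<close> on the right.\<close>
  have vals: "\<exists>v\<in>Fz. t sd B = rr (w * v) \<and> (if \<beta> sd B then B1 \<le> v \<and> v \<le> B1 + lam * R else B0 - lam * R \<le> v \<and> v \<le> B0)"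
    if B: "B \<in> BB" for B sd
  proof -
    obtain x y where xy: "x \<in> F" "g False B \<le> x" "x \<le> g True B" "y \<in> F" "g False B \<le> y" "y \<le> g True B"
      "t False B = rr (w * (sg * sv x))" "t True B = rr (w * (sg * sv y))"
      and ex: "\<And>z. z \<in> F \<Longrightarrow> g False B \<le> z \<Longrightarrow> z \<le> g True B \<Longrightarrow> sg * sv x \<le> sg * sv z \<and> sg * sv z \<le> sg * sv y"
      using t(2)[OF B] unfolding extremal_def by blast
    have gF: "g False B \<in> F" "g True B \<in> F" "g False B \<le> g True B" using g[OF B] by auto
    have xin: "sg * sv x \<in> Fz" "sg * sv y \<in> Fz" using sv_fin xy sg_F by (auto simp: F_iff)
    show ?thesis
    proof (cases sd)
      case True
      show ?thesis
      proof (cases "\<beta> True B")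
        case on: True
        then have u: "eta' \<le> g True B" "g True B \<le> eta' + R" using gr[OF B, of True] by auto
        have "B1 \<le> sg * sv y" using hi[OF gF(2) u] ex[OF gF(2)] gF by auto
        moreover have "sg * sv y \<le> B1 + lam * R"
        proof (cases "eta' \<le> y")
          case True then show ?thesis using hi[OF xy(4)] xy(6) u by simp
        next
          case False
          then have "y \<le> eta" using F_split xy(4) by blast
          then have "sg * sv y \<le> B0" using left[OF xy(4)] by (simp add: B0_def)
          moreover have "0 \<le> lam * R" using lam R0 by simp
          ultimately show ?thesis using B01 by linarith
        qed
        ultimately show ?thesis using xin xy on True by (intro bexI[of _ "sg * sv y"]) auto
      next
        case off: False
        then have u: "g True B \<le> eta" "eta - R \<le> g True B" using gr[OF B, of True] by auto
        have "\<not> \<beta> False B"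
        proof
          assume "\<beta> False B"
          then have "eta' \<le> g False B" using gr[OF B, of False] by simp
          then show False using u gF(3) ee by linarith
        qed
        then have "eta - R \<le> g False B" using gr[OF B, of False] by simp
        then have "B0 - lam * R \<le> sg * sv y \<and> sg * sv y \<le> B0" using lo[OF xy(4)] xy u by simp
        then show ?thesis using xin xy off True by (intro bexI[of _ "sg * sv y"]) auto
      qed
    next
      case False
      show ?thesis
      proof (cases "\<beta> False B")
        case on: True
        then have u: "eta' \<le> g False B" using gr[OF B, of False] by auto
        have "\<beta> True B"
        proof (rule ccontr)
          assume "\<not> \<beta> True B"
          then have "g True B \<le> eta" using gr[OF B, of True] by simp
          then show False using u gF(3) ee by linarith
        qed
        then have "g True B \<le> eta' + R" using gr[OF B, of True] by simp
        then have "B1 \<le> sg * sv x \<and> sg * sv x \<le> B1 + lam * R" using hi[OF xy(1)] xy u by simp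
        then show ?thesis using xin xy on False by (intro bexI[of _ "sg * sv x"]) auto
      next
        case off: False
        then have u: "g False B \<le> eta" "eta - R \<le> g False B" using gr[OF B, of False] by auto
        have "sg * sv x \<le> B0" using lo[OF gF(1) u] ex[OF gF(1)] gF by auto
        moreover have "B0 - lam * R \<le> sg * sv x"
        proof (cases "x \<le> eta")
          case True then show ?thesis using lo[OF xy(1)] xy(2) u by simp
        next
          case False
          then have "eta' \<le> x" using F_split xy(1) by blast
          then have "B1 \<le> sg * sv x" using right[OF xy(1)] by (simp add: B1_def)
          moreover have "0 \<le> lam * R" using lam R0 by simp
          ultimately show ?thesis using B01 by linarith
        qed
        ultimately show ?thesis using xin xy off False by (intro bexI[of _ "sg * sv x"]) auto
      qed
    qed
  qed
  have B0F: "B0 \<in> Fz" using B_F by (simp add: F_iff)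
  have tb: "if \<beta> sd B then v0 + 2 * om \<le> t sd B \<and> t sd B \<le> v0 + R / 4 else v0 - R / 4 \<le> t sd B \<and> t sd B \<le> v0"
    if B: "B \<in> BB" for B sd
  proof -
    obtain v where v: "v \<in> Fz" "t sd B = rr (w * v)" "if \<beta> sd B then B1 \<le> v \<and> v \<le> B1 + lam * R else B0 - lam * R \<le> v \<and> v \<le> B0"
      using vals[OF B] by blast
    note e = err[OF v(1)] err[OF B0F]
    show ?thesis
    proof (cases "\<beta> sd B")
      case True
      then have v': "B1 \<le> v" "v \<le> B1 + lam * R" using v(3) by auto
      have "rr (w * B1) \<le> rr (w * v)" using v' w by (intro rr_mono mult_left_mono) auto
      moreover have "w * v \<le> w * (B1 + lam * R)" using v' w by (intro mult_left_mono) auto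
      then have "w * v \<le> w * B0 + w * (B1 - B0) + w * (lam * R)" by (simp add: algebra_simps)
      ultimately have "rr (w * B0) + 2 * om \<le> rr (w * v)" "rr (w * v) \<le> rr (w * B0) + R / 4"
        using e w(5,6) wlR R8 by linarith+
      then show ?thesis using True unfolding v(2) v0_def by simp
    next
      case False
      then have v': "B0 - lam * R \<le> v" "v \<le> B0" using v(3) by auto
      have "rr (w * v) \<le> v0" unfolding v0_def using v' w by (intro rr_mono mult_left_mono) auto
      moreover have "w * (B0 - lam * R) \<le> w * v" using v' w by (intro mult_left_mono) auto
      then have "w * B0 - w * (lam * R) \<le> w * v" by (simp add: algebra_simps)
      moreover have "om \<le> R / 16" using R8 hom p2_pos[of xi] om_pos by linarith
      ultimately have "rr (w * v) \<le> rr (w * B0)" "rr (w * B0) - R / 4 \<le> rr (w * v)"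
        using e wlR unfolding v0_def by linarith+
      then show ?thesis using False unfolding v(2) v0_def by simp
    qed
  qed
  have tF: "t sd B \<in> F" if "B \<in> BB" for sd B using ts_ordered(2)[OF t(1) that] .
  have "fs n (\<lambda>sd B. rr (0 + t sd B))" by (rule fs_step[OF fs_zero t(1)]) (use tF F_ok in simp)
  moreover have "rr (0 + t sd B) = t sd B" if "B \<in> BB" for sd B using tF[OF that] by (simp add: rr_Fz F_iff)
  ultimately have P: "Pg n \<beta> (v0 - R / 4) v0 (v0 + 2 * om) (v0 + R / 4)"
    unfolding Pg_def using tb by (intro exI[of _ "\<lambda>sd B. rr (0 + t sd B)"]) (simp cong: if_cong)
  \<comment> \<open>The constant - v0 comes from a constant neuron at \<eta> with weight w up to
    sign, so it cancels v0 exactly.\<close>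
  have "ok (\<bar>sv eta\<bar> * (if sg * sv eta < 0 then w else - w))"
    using okw[OF B_F(1)] ok_minus[of "w * B0"] sg(1) by (auto simp: B0_def abs_real_def mult.commute ok_minus)
  moreover have "\<bar>sv eta\<bar> * (if sg * sv eta < 0 then w else - w) = - (w * B0)"
    using sg(1) by (auto simp: B0_def abs_real_def)
  moreover have "(if sg * sv eta < 0 then w else - w) \<in> F" using w F_minus by simp
  ultimately have c: "(- v0, - v0) \<in> Tc" using csteps_I[of "if sg * sv eta < 0 then w else - w" "\<bar>sv eta\<bar>"]
    unfolding Tc_def v0_def rr_minus[symmetric] by auto
  have "p2 (r - 2) = R / 4" using assms by (simp add: p2_diff)
  moreover have "p2 (r - 2) \<in> Fz" using xi assms m3 by (intro p2_Fz) auto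
  ultimately have "R / 4 \<in> Fz" by (simp only:)
  then have RF: "R / 4 \<in> Fz" "- (R / 4) \<in> Fz" using Fz_minus by blast+
  have ROm: "R / 4 \<le> Om" using p2_le_Om[of "r - 2"] assms by (simp add: p2_diff)
  have omF: "2 * om \<in> Fz" "2 * om \<le> Om" using om_F[of 2] by (auto simp: F_iff)
  show ?thesis
    by (rule prog_step[OF prog_Tc c P]) (use RF ROm R0 omF in \<open>simp_all add: rr_Fz\<close>)
qed

lemma eta_rel: "\<bar>eta\<bar> * p2 (- m) \<le> 2 * p2 xi"
proof -
  have "\<bar>eta\<bar> * p2 (- m) \<le> p2 (m + 1) * p2 xi * p2 (- m)" using xi(4) by (intro mult_right_mono) auto
  also have "\<dots> = 2 * p2 xi" by (simp add: p2_add p2_minus)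
  finally show ?thesis .
qed

lemma PF_halve:
  assumes "PF n \<beta> R" "R = p2 r" "xi + 4 \<le> r" "r \<le> b + 1"
  shows "PF (Suc n) \<beta> (R / 2)"
proof -
  have y: "p2 (r - 2) = R / 4" using assms by (simp add: p2_diff)
  have st: "Pg n \<beta> (- p2 (r - 2)) 0 (2 * om) (p2 (r - 2))" using PF_start[OF assms(1,2)] assms(3,4) unfolding y by simp
  have r: "r - 2 < b" "xi + 2 \<le> r - 2" using assms by auto
  obtain l0 u0 l1 u1 where P: "Pg n \<beta> l0 u0 l1 u1" "eta - 2 * p2 (r - 2) \<le> rr (l0 + eta)" "rr (u0 + eta) \<le> eta"
    "eta' \<le> rr (l1 + eta)" "rr (u1 + eta) \<le> eta' + 2 * p2 (r - 2)"
    using halve[OF prog_Tc amp_Tc r xi(2,3) refl xi(1) eta_rel st] by blast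
  obtain g where g: "fs n g" "\<And>B sd. B \<in> BB \<Longrightarrow> if \<beta> sd B then l1 \<le> g sd B \<and> g sd B \<le> u1 else l0 \<le> g sd B \<and> g sd B \<le> u0"
    using P(1) unfolding Pg_def by blast
  have rg: "if \<beta> sd B then eta' \<le> rr (g sd B + eta) \<and> rr (g sd B + eta) \<le> eta' + R / 2 else eta - R / 2 \<le> rr (g sd B + eta) \<and> rr (g sd B + eta) \<le> eta"
    if "B \<in> BB" for B sd
    using g(2)[OF that, of sd] P(2-5) y rr_mono[of "l0 + eta" "g sd B + eta"] rr_mono[of "g sd B + eta" "u0 + eta"]
      rr_mono[of "l1 + eta" "g sd B + eta"] rr_mono[of "g sd B + eta" "u1 + eta"] by (auto split: if_splits)
  have "R / 2 \<le> p2 b" using p2_le[of "r - 1" b] assms by (simp add: p2_diff)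
  moreover have "p2 b + 4 \<le> Om"
  proof -
    have "p2 (b - m) \<le> p2 (b - 3)" using m3 by simp
    moreover have "8 \<le> p2 (b - 3)" using p2_le[of 3 "b - 3"] b15 by simp
    moreover have "p2 (b - 3) = p2 b / 8" by (simp add: p2_diff)
    ultimately show ?thesis using Om_p2 p2_Suc[of b] by linarith
  qed
  ultimately have ROm: "R / 2 + 4 \<le> Om" by simp
  have ok: "ok (g sd B + eta)" if "B \<in> BB" for B sd
    using rg[OF that, of sd] ROm ie unfolding ok_def by (auto simp: abs_le_iff split: if_splits)
  obtain \<psi> where \<psi>: "preact (Suc n) \<psi>" "\<And>B. B \<in> BB \<Longrightarrow> \<psi> B = Iv (Fin (rr (g False B + eta))) (Fin (rr (g True B + eta)))"
    using preact_of_fs[OF g(1) eta_F(1) ok] by blast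
  have "g False B \<le> g True B" if "B \<in> BB" for B using g(1) that unfolding fs_def by blast
  then have "inPF \<beta> (R / 2) (\<lambda>sd B. rr (g sd B + eta)) B" if "B \<in> BB" for B
    unfolding inPF_def using that rg[OF that] ok[OF that] rr_F by (auto intro!: rr_mono)
  then show ?thesis unfolding PF_def using \<psi>
    by (intro exI[of _ \<psi>] exI[of _ "\<lambda>sd B. rr (g sd B + eta)"]) simp
qed

text \<open>Pre-activations of the first hidden layer will be bounded by 3 * 2^(emax-1), and \<eta>
  and its successor by 4; this round number covers both and need not be a finite float.\<close>

definition R0 :: real where "R0 = p2 (b + 1)"
text \<open>The number of halvings from 2^(emax+1) down to 8 gaps at \<eta>, the spread from which
  \<open>settle\<close> applies after one more layer.\<close>

definition kc :: nat where "kc = nat (b - 2 - xi)"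

lemma PF_contract:
  assumes "PF n \<beta> R0"
  shows "PF (n + kc) \<beta> (p2 (xi + 3))"
proof -
  have it: "PF (n + j) \<beta> (p2 (b + 1 - int j))" if "int j \<le> b - 2 - xi" for j
    using that
  proof (induction j)
    case 0 then show ?case using assms by (simp add: R0_def)
  next
    case (Suc j)
    then have IH: "PF (n + j) \<beta> (p2 (b + 1 - int j))" by simp
    have "PF (Suc (n + j)) \<beta> (p2 (b + 1 - int j) / 2)"
      by (rule PF_halve[OF IH refl]) (use Suc.prems in simp_all)
    moreover have "p2 (b + 1 - int (Suc j)) = p2 (b + 1 - int j) / 2" using p2_diff[of "b + 1 - int j" 1] by simp
    ultimately show ?case by (simp only: add_Suc_right)
  qed
  have k: "int kc = b - 2 - xi" using xi b15 m3 by (simp add: kc_def)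
  have "PF (n + kc) \<beta> (p2 (b + 1 - int kc))" by (rule it) (simp add: k)
  moreover have "b + 1 - int kc = xi + 3" using k by simp
  ultimately show ?thesis by (simp only:)
qed

text \<open>After settling, the two states are 0 and 16 gaps. A base whose last place is 16 gaps
  turns them into neighbouring floats, and neighbours can be moved anywhere.\<close>

lemma adjacent_codes:
  assumes "PF n \<beta> (p2 (xi + 3))" "- N \<le> j" "j < N"
  shows "Code (Suc n) \<beta> (fz j) (fz (j + 1))"
proof -
  have r: "xi + 3 \<le> b + 1" using xi b15 m3 by simp
  have "p2 (xi + 3) / 4 = 2 * p2 xi" by (simp add: p2_add)
  then have "Pg n \<beta> (- (2 * p2 xi)) 0 (2 * om) (2 * p2 xi)" using PF_start[OF assms(1) refl _ r] by simp
  then have st: "Pg n \<beta> 0 0 (16 * p2 xi) (16 * p2 xi)" using settle[OF prog_Tc amp_Tc xi(2,3)] by blast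
  define e where "e = xi + 4 + m"
  have e: "a + 2 \<le> e" "e \<le> 6" "a \<le> e" "e \<le> 5" using xi by (auto simp: e_def)
  obtain B where B: "B \<in> Fz" "p2 e \<le> B" "B \<le> 3 / 2 * p2 e" "(B, B) \<in> Tc"
    using amp_obtain[OF amp_Tc e(1,2)] by metis
  obtain i where i: "B = fz i" "\<And>k. 0 \<le> k \<Longrightarrow> k \<le> 4 \<Longrightarrow> fz (i + k) = B + of_int k * p2 (e - m)"
    using base_grid[OF e(3) B(2,3,1)] by metis
  have U: "p2 (e - m) = 16 * p2 xi" by (simp add: e_def p2_add)
  have f1: "fz (i + 1) = 16 * p2 xi + B" using i(2)[of 1] U by simp
  have "p2 e \<le> p2 5" using e by (simp only: p2_le)
  then have B48: "B \<le> 48" using B(3) by simp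
  have B0': "0 < B" using B(2) p2_pos[of e] by linarith
  have "2 ^ 7 \<le> Om" using p2_le_Om[of 7] b15 by simp
  moreover have "16 * p2 xi \<le> 2 ^ 5" using p2_le[of "e - m" 5] e m3 U by simp
  ultimately have oks: "\<bar>B\<bar> \<le> Om" "\<bar>fz (i + 1)\<bar> \<le> Om" using B48 B0' f1 p2_pos[of xi] by auto
  have pr: "pair (Pg n \<beta>) (fz i) (fz (i + 1))"
  proof (rule pair_step[OF prog_Tc B(4), of n \<beta> 0 "16 * p2 xi"])
    show "pair (Pg n \<beta>) 0 (16 * p2 xi)" using st by (simp add: pair_def)
    show "fz i = rr (0 + B)" using i(1) by simp
    show "fz (i + 1) = rr (16 * p2 xi + B)" using f1[symmetric] by simp
  qed (use oks i(1) in auto)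
  have i0: "0 \<le> i" using B0' i(1) by simp
  have i10: "fz i < p2 10" using B48 i(1) by simp
  have "csteps \<bar>s0\<bar> \<subseteq> Tc" by (simp add: Tc_def)
  then have "pair (Pg n \<beta>) (fz j) (fz (j + 1))"
    using adjacent_walk[OF prog_Tc strong_s _ pr i0 i10 assms(2,3)] by blast
  then show ?thesis
    by (rule code_of_pair[where c = 0]) (use assms N_nonneg zero_F in \<open>auto simp: F_fz\<close>)
qed

section \<open>From adjacent codes to a strong bit\<close>

lemma s0_nz: "s0 \<noteq> 0"
proof
  assume "s0 = 0"
  then have "\<bar>s0\<bar> = 0" by simp
  then show False using s0(1) p2_pos[of "- m - 2"] p2_pos[of "- 2 * m - 1"] by linarith
qed

lemma sv_c: "sv c1 = 0" "sv c2 = s0"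
  using c12 by (simp_all add: sv_def)

text \<open>At this stage only adjacent codes are available. Between c1 and c2 the activation passes
  from zero to nonzero somewhere, and the two floats there yield a term that is exactly 0 in one
  state.\<close>

lemma activation_change:
  obtains j where "- N \<le> j" "j < N" "min c1 c2 \<le> fz j" "fz (j + 1) \<le> max c1 c2" "sv (fz j) = 0 \<longleftrightarrow> sv (fz (j + 1)) \<noteq> 0"
proof -
  obtain i1 i2 where i: "c1 = fz i1" "\<bar>i1\<bar> \<le> N" "c2 = fz i2" "\<bar>i2\<bar> \<le> N" using F_cases c12 by metis
  have "\<exists>j. min i1 i2 \<le> j \<and> j < max i1 i2 \<and> (sv (fz j) = 0 \<longleftrightarrow> sv (fz (j + 1)) \<noteq> 0)"
  proof (rule ccontr)
    assume no: "\<not> ?thesis"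
    have "(sv (fz (max i1 i2)) = 0) = (sv (fz (min i1 i2)) = 0)"
      by (rule step_up_index[of "min i1 i2" "max i1 i2" "\<lambda>j. (sv (fz j) = 0) = (sv (fz (min i1 i2)) = 0)"]) (use no in auto)
    then show False using sv_c s0_nz i by (cases "i1 \<le> i2") (auto simp: min_def max_def)
  qed
  then obtain j where j: "min i1 i2 \<le> j" "j < max i1 i2" "sv (fz j) = 0 \<longleftrightarrow> sv (fz (j + 1)) \<noteq> 0" by blast
  have "fz (min i1 i2) \<le> fz j" "fz (j + 1) \<le> fz (max i1 i2)" using j by simp_all
  then show ?thesis using that[of j] j i by (auto simp: min_def max_def split: if_splits)
qed

text \<open>The height may be as small as \<open>om\<close>; \<open>strong_tiny\<close> makes this
  sufficient for producing wide pairs.\<close>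

lemma tiny_bit:
  obtains v where "om \<le> v" "v \<le> 5 / 4"
    "\<And>n \<beta>. monob \<beta> \<Longrightarrow> PF n \<beta> R0 \<Longrightarrow> BT (Suc (n + kc)) \<beta> v \<or> BT (Suc (n + kc)) (neg \<beta>) v"
proof -
  obtain j where j: "- N \<le> j" "j < N" "min c1 c2 \<le> fz j" "fz (j + 1) \<le> max c1 c2" "sv (fz j) = 0 \<longleftrightarrow> sv (fz (j + 1)) \<noteq> 0"
    using activation_change by blast
  have F: "fz j \<in> F" "fz (j + 1) \<in> F" using j N_nonneg by (auto simp: F_fz)
  have le: "fz j \<le> fz (j + 1)" by simp
  define v where "v = (if sv (fz j) = 0 then sv (fz (j + 1)) else sv (fz j))"
  have v: "sv (fz j) = 0 \<and> sv (fz (j + 1)) = v \<or> sv (fz (j + 1)) = 0 \<and> sv (fz j) = v" "v \<noteq> 0"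
    using j(5) by (auto simp: v_def)
  have ends: "\<bar>sv z\<bar> \<le> \<bar>s0\<bar>" if "z \<in> F" "fz j \<le> z" "z \<le> fz (j + 1)" for z
    using c_between[OF that(1)] that j by auto
  have "\<bar>v\<bar> \<le> \<bar>s0\<bar>" using v(1) ends F le by auto
  then have v54: "\<bar>v\<bar> \<le> 5 / 4" using s0 by simp
  have "v \<in> F" using v(1) sv_fin F by auto
  then have "om \<le> \<bar>v\<bar>" using v(2) Fz_pos_ge abs_F by (auto simp: F_iff)
  moreover have "BT (Suc (n + kc)) \<beta> \<bar>v\<bar> \<or> BT (Suc (n + kc)) (neg \<beta>) \<bar>v\<bar>" if \<beta>: "monob \<beta>" "PF n \<beta> R0" for n \<beta>
  proof -
    have C: "Code (Suc (n + kc)) \<beta> (fz j) (fz (j + 1))" using adjacent_codes[OF PF_contract[OF \<beta>(2)] j(1,2)] .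
    have bet: "\<sigma> (Fin z) = Fin (sv z) \<and> min 0 v \<le> sv z \<and> sv z \<le> max 0 v" if z: "z \<in> F" "fz j \<le> z" "z \<le> fz (j + 1)" for z
    proof -
      obtain k where "z = fz k" using F_cases z(1) by blast
      then have "z = fz j \<or> z = fz (j + 1)" using z by force
      then show ?thesis using v(1) sv_fin[OF z(1)] by auto
    qed
    from v(1) show ?thesis
    proof
      assume "sv (fz j) = 0 \<and> sv (fz (j + 1)) = v"
      then show ?thesis using code_BT(1)[OF C \<beta>(1) le F bet] by blast
    next
      assume "sv (fz (j + 1)) = 0 \<and> sv (fz j) = v"
      then show ?thesis using code_BT(2)[OF C \<beta>(1) le F bet] by blast
    qed
  qed
  ultimately show ?thesis using that[of "\<bar>v\<bar>"] v54 by blast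
qed

lemma pair_neg: "pair (\<lambda>l0 u0 l1 u1. Pg n (neg \<beta>) (- u1) (- l1) (- u0) (- l0)) x y \<longleftrightarrow> pair (Pg n (neg \<beta>)) (- y) (- x)"
  by (simp add: pair_def)

lemma wide_code:
  assumes BT: "BT n \<beta> v" "om \<le> v" "v \<le> 5 / 4" and ij: "i < j" "fz i \<in> F" "fz j \<in> F"
    and nex: "\<not> (fz i < - p2 (b - 1) \<and> p2 (b - 1) < fz j)"
  shows "Code (Suc n) \<beta> (fz i) (fz j) \<or> Code (Suc n) (neg \<beta>) (fz i) (fz j)"
proof -
  define T where "T = Tc \<union> bsteps v"
  have tb: "tbit n \<beta> x0 x1" if "(x0, x1) \<in> T" for x0 x1 using that tbit_Tc BT_bsteps[OF BT(1)] by (auto simp: T_def)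
  have sub: "csteps \<bar>s0\<bar> \<subseteq> T" "bsteps v \<subseteq> T" by (auto simp: T_def Tc_def)
  have Om: "\<bar>fz i\<bar> \<le> Om" "\<bar>fz j\<bar> \<le> Om" using ij by (auto simp: F_iff)
  have st: "strong v 2" using strong_tiny BT by blast
  show ?thesis
  proof (cases "\<bar>fz i\<bar> \<le> fz j")
    case True
    have p: "prog T (Pg n \<beta>)" by (rule prog_Pg) (rule tb)
    have "fz j \<le> Om" using Om by simp
    then obtain x y c where xy: "pair (Pg n \<beta>) x y" "c \<in> F" "rr (x + c) = fz i" "rr (y + c) = fz j"
      using widen[OF p strong_s sub(1) st sub(2) pair_Pg_zero ij(1) True _ nex] by blast
    show ?thesis using code_of_pair[OF xy ij(2,3)] by blast
  next
    case False
    have lt: "fz i < fz j" using ij(1) by simp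
    have m: "fz (- i) = - fz i" "fz (- j) = - fz j" by (rule fz_minus)+
    have F': "\<bar>fz (- j)\<bar> \<le> fz (- i)" "fz (- i) \<le> Om" unfolding m using False lt Om by linarith+
    have nex': "\<not> (fz (- j) < - p2 (b - 1) \<and> p2 (b - 1) < fz (- i))" using nex m by auto
    let ?P = "\<lambda>l0 u0 l1 u1. Pg n (neg \<beta>) (- u1) (- l1) (- u0) (- l0)"
    have p: "prog T ?P" by (rule prog_Pg_neg) (rule tb)
    have z: "pair ?P 0 0" using pair_Pg_zero[of n "neg \<beta>"] by (simp add: pair_def)
    have "- j < - i" using ij by simp
    then obtain x y c where xy: "pair ?P x y" "c \<in> F" "rr (x + c) = fz (- j)" "rr (y + c) = fz (- i)"
      using widen[OF p strong_s sub(1) st sub(2) z _ F' nex'] by blast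
    have "rr (- y + - c) = fz i" "rr (- x + - c) = fz j" using xy(3,4) m rr_minus[of "y + c"] rr_minus[of "x + c"] by simp_all
    then have "Code (Suc n) (neg \<beta>) (fz i) (fz j)"
      using code_of_pair[of n "neg \<beta>" "- y" "- x" "- c"] xy(1,2) F_minus ij unfolding pair_neg by blast
    then show ?thesis by blast
  qed
qed

definition good_pair :: "real \<Rightarrow> real \<Rightarrow> real \<Rightarrow> bool" where
  "good_pair p q v \<longleftrightarrow> p \<in> F \<and> q \<in> F \<and> p < q \<and> (sv p = 0 \<and> sv q = v \<or> sv q = 0 \<and> sv p = v) \<and> strong \<bar>v\<bar> b \<and>
     (\<forall>z\<in>F. p \<le> z \<longrightarrow> z \<le> q \<longrightarrow> \<sigma> (Fin z) = Fin (sv z) \<and> min 0 v \<le> sv z \<and> sv z \<le> max 0 v)"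

lemma good_pair_BT:
  assumes "good_pair p q v" "monob \<beta>" "Code n \<beta> p q"
  shows "sv p = 0 \<Longrightarrow> BT n \<beta> \<bar>v\<bar>" "sv p \<noteq> 0 \<Longrightarrow> BT n (neg \<beta>) \<bar>v\<bar>"
proof -
  have h: "p \<in> F" "q \<in> F" "p \<le> q" "strong \<bar>v\<bar> b"
    "\<And>z. z \<in> F \<Longrightarrow> p \<le> z \<Longrightarrow> z \<le> q \<Longrightarrow> \<sigma> (Fin z) = Fin (sv z) \<and> min 0 v \<le> sv z \<and> sv z \<le> max 0 v"
    and vv: "sv p = 0 \<and> sv q = v \<or> sv q = 0 \<and> sv p = v"
    using assms(1) unfolding good_pair_def by auto
  have "om \<le> \<bar>v\<bar>" using h(4) unfolding strong_def by blast
  then have v0: "v \<noteq> 0" using om_pos by linarith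
  show "BT n \<beta> \<bar>v\<bar>" if "sv p = 0"
    using code_BT(1)[OF assms(3,2) h(3,1,2,5)] that vv v0 by auto
  show "BT n (neg \<beta>) \<bar>v\<bar>" if "sv p \<noteq> 0"
    using code_BT(2)[OF assms(3,2) h(3,1,2,5)] that vv by auto
qed

lemma good_pair_BT_either: "good_pair p q v \<Longrightarrow> monob \<beta> \<Longrightarrow> Code n \<beta> p q \<Longrightarrow> BT n \<beta> \<bar>v\<bar> \<or> BT n (neg \<beta>) \<bar>v\<bar>"
  using good_pair_BT by blast

text \<open>For the exceptional pairs: the available terms have a small value t instead of 0 in the
  off state, and the left target is so large that it absorbs them.\<close>

lemma wide_tbits_code:
  assumes T: "\<And>w. w \<in> F \<Longrightarrow> 0 \<le> w \<Longrightarrow> ok (\<bar>s0\<bar> * w) \<Longrightarrow> tbit n \<beta> (rr (t * w)) (rr (\<bar>s0\<bar> * w))"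
    and t: "0 \<le> t" "t \<le> p2 (- m - 2)" and ij: "i < j" "fz i \<in> F" "fz j \<in> F" "fz i < - p2 (b - 1)" "p2 (b - 1) < fz j"
  shows "Code (Suc n) \<beta> (fz i) (fz j) \<or> Code (Suc n) (neg \<beta>) (fz i) (fz j)"
proof -
  define T' where "T' = Tc \<union> {(rr (t * w), rr (\<bar>s0\<bar> * w)) |w. w \<in> F \<and> 0 \<le> w \<and> ok (\<bar>s0\<bar> * w)}"
  have tb: "tbit n \<beta> x0 x1" if "(x0, x1) \<in> T'" for x0 x1 using that tbit_Tc T by (auto simp: T'_def)
  have sub: "csteps \<bar>s0\<bar> \<subseteq> T'" by (auto simp: T'_def Tc_def)
  have st: "(rr (t * w), rr (\<bar>s0\<bar> * w)) \<in> T'" if "w \<in> F" "0 \<le> w" "ok (\<bar>s0\<bar> * w)" for w using that by (auto simp: T'_def)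
  have sF: "\<bar>s0\<bar> \<in> Fz" using abs_F[OF s0_F] by (simp add: F_iff)
  have iN: "\<bar>i\<bar> \<le> N" "\<bar>j\<bar> \<le> N" using ij F_fz by auto
  show ?thesis
  proof (cases "fz j \<le> - fz i")
    case True
    have p: "prog T' (Pg n \<beta>)" by (rule prog_Pg) (rule tb)
    have "pair (Pg n \<beta>) (fz i) (fz j)"
      using wide_pair[OF p sub pair_Pg_zero st s0 sF t _ ij(4) True] ij iN by auto
    then have "Code (Suc n) \<beta> (fz i) (fz j)" by (rule code_of_pair[where c = 0]) (use ij zero_F in auto)
    then show ?thesis by blast
  next
    case False
    have m: "fz (- i) = - fz i" "fz (- j) = - fz j" by (rule fz_minus)+
    let ?P = "\<lambda>l0 u0 l1 u1. Pg n (neg \<beta>) (- u1) (- l1) (- u0) (- l0)"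
    have p: "prog T' ?P" by (rule prog_Pg_neg) (rule tb)
    have z: "pair ?P 0 0" using pair_Pg_zero[of n "neg \<beta>"] by (simp add: pair_def)
    have "pair ?P (fz (- j)) (fz (- i))"
      using wide_pair[OF p sub z st s0 sF t, of "- j" "- i"] ij iN False m by auto
    then have "pair (Pg n (neg \<beta>)) (fz i) (fz j)" unfolding pair_neg m by simp
    then have "Code (Suc n) (neg \<beta>) (fz i) (fz j)" by (rule code_of_pair[where c = 0]) (use ij zero_F in auto)
    then show ?thesis by blast
  qed
qed

text \<open>If t exceeded 2^(-M-2), then t' would lie at least two floats above that power, which is
  beyond the bound of \<open>good_strong\<close>.\<close>

lemma strong_gap: "t \<in> Fz \<Longrightarrow> t' \<in> Fz \<Longrightarrow> t < t' \<Longrightarrow> t' \<le> 5 / 4 \<Longrightarrow> \<not> strong t' b \<Longrightarrow> t \<le> p2 (- m - 2)"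
proof (rule ccontr)
  assume h: "t \<in> Fz" "t' \<in> Fz" "t < t'" "t' \<le> 5 / 4" "\<not> strong t' b" "\<not> t \<le> p2 (- m - 2)"
  have "- m - 2 \<ge> a - m" using ab b15 by simp
  then have pF: "p2 (- m - 2) \<in> Fz" by (rule p2_Fz)
  obtain i0 where i0: "p2 (- m - 2) = fz i0" using pF by (auto simp: Fz_def)
  obtain i1 where i1: "t = fz i1" using h by (auto simp: Fz_def)
  obtain i2 where i2: "t' = fz i2" using h by (auto simp: Fz_def)
  have lt: "i0 < i1" "i1 < i2" using h i0 i1 i2 by auto
  have i00: "0 \<le> i0" using i0 p2_pos[of "- m - 2"] fz_nonneg[of i0] by simp
  obtain e where e: "a \<le> e" "gap i0 = p2 (e - m)" "fz (i0 + 1) \<le> p2 (e + 1)" using gap_exp[OF i00] by metis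
  have "fz i0 < fz (i0 + 1)" by simp
  then have "p2 (- m - 2) < p2 (e + 1)" using e i0 by linarith
  then have "- m - 2 \<le> e" by simp
  then have g: "p2 (- 2 * m - 2) \<le> gap i0" using e by simp
  have "gap i0 \<le> gap (i0 + 1)" using gap_mono[of i0 "i0 + 1"] i00 by simp
  moreover have "fz (i0 + 2) = fz i0 + gap i0 + gap (i0 + 1)" by (simp add: gap_def add.assoc)
  moreover have "fz (i0 + 2) \<le> fz i2" using lt by simp
  moreover have "p2 (- 2 * m - 1) = 2 * p2 (- 2 * m - 2)" 
    unfolding p2_Suc[symmetric] by (rule arg_cong[of _ _ p2]) simp
  ultimately have "p2 (- m - 2) + p2 (- 2 * m - 1) \<le> t'" using g i0 i2 by linarith
  then show False using good_strong h by blast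
qed

lemma p0q0:
  obtains i j where "fz i = min c1 c2" "fz j = max c1 c2" "i < j" "good_pair (fz i) (fz j) s0"
proof -
  obtain i1 i2 where i: "c1 = fz i1" "c2 = fz i2" using F_cases c12 by metis
  have ne: "c1 \<noteq> c2" using sv_c s0_nz by auto
  have g: "good_pair (min c1 c2) (max c1 c2) s0"
    unfolding good_pair_def using c12 sv_c ne strong_s c_between by (auto simp: min_def max_def)
  show ?thesis
  proof (cases "c1 \<le> c2")
    case True
    then have mm: "min c1 c2 = fz i1" "max c1 c2 = fz i2" unfolding i(1)[symmetric] i(2)[symmetric] by auto
    have "fz i1 < fz i2" using True ne i by linarith
    then have "i1 < i2" by simp
    with mm g show ?thesis using that[of i1 i2] by presburger
  next
    case False
    then have mm: "min c1 c2 = fz i2" "max c1 c2 = fz i1" unfolding i(1)[symmetric] i(2)[symmetric] by auto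
    have "fz i2 < fz i1" using False i by linarith
    then have "i2 < i1" by simp
    with mm g show ?thesis using that[of i2 i1] by presburger
  qed
qed

lemma wide_code_PF:
  assumes "i < j" "fz i \<in> F" "fz j \<in> F" "\<not> (fz i < - p2 (b - 1) \<and> p2 (b - 1) < fz j)" "monob \<beta>" "PF n \<beta> R0"
  shows "Code (n + (kc + 2)) \<beta> (fz i) (fz j) \<or> Code (n + (kc + 2)) (neg \<beta>) (fz i) (fz j)"
proof -
  obtain v where v: "om \<le> v" "v \<le> 5 / 4" "BT (Suc (n + kc)) \<beta> v \<or> BT (Suc (n + kc)) (neg \<beta>) v"
    using tiny_bit assms(5,6) by metis
  from v(3) show ?thesis
    using wide_code[OF _ v(1,2) assms(1-4), of "Suc (n + kc)" \<beta>] wide_code[OF _ v(1,2) assms(1-4), of "Suc (n + kc)" "neg \<beta>"] by auto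
qed

lemma good_near:
  assumes "good_pair (fz i) (fz j) v" "\<not> (fz i < - p2 (b - 1) \<and> p2 (b - 1) < fz j)" "monob \<beta>" "PF n \<beta> R0"
  shows "BT (n + (kc + 2)) \<beta> \<bar>v\<bar> \<or> BT (n + (kc + 2)) (neg \<beta>) \<bar>v\<bar>"
proof -
  have "i < j" "fz i \<in> F" "fz j \<in> F" using assms(1) by (auto simp: good_pair_def)
  from wide_code_PF[OF this assms(2-4)] show ?thesis
    using good_pair_BT_either[OF assms(1), of \<beta>] good_pair_BT_either[OF assms(1), of "neg \<beta>"] assms(3) by auto
qed

text \<open>One layer more than in \<open>good_near\<close>: the pair \<open>(fz k, fz l)\<close>
  can be reached directly, and its terms then drive the exceptional pair
  \<open>(fz i, fz j)\<close>.\<close>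

lemma good_far:
  assumes ij: "fz i < - p2 (b - 1)" "p2 (b - 1) < fz j" "good_pair (fz i) (fz j) s0"
    and kl: "k < l" "fz k \<in> F" "fz l \<in> F" "\<not> (fz k < - p2 (b - 1) \<and> p2 (b - 1) < fz l)"
    and t: "0 \<le> t" "t \<le> p2 (- m - 2)"
    and C: "\<And>n \<beta>. monob \<beta> \<Longrightarrow> Code n \<beta> (fz k) (fz l) \<Longrightarrow>
      (\<forall>w\<in>F. 0 \<le> w \<longrightarrow> ok (\<bar>s0\<bar> * w) \<longrightarrow> tbit n \<beta> (rr (t * w)) (rr (\<bar>s0\<bar> * w))) \<or>
      (\<forall>w\<in>F. 0 \<le> w \<longrightarrow> ok (\<bar>s0\<bar> * w) \<longrightarrow> tbit n (neg \<beta>) (rr (t * w)) (rr (\<bar>s0\<bar> * w)))"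
    and \<beta>: "monob \<beta>" "PF n \<beta> R0"
  shows "BT (n + (kc + 3)) \<beta> \<bar>s0\<bar> \<or> BT (n + (kc + 3)) (neg \<beta>) \<bar>s0\<bar>"
proof -
  have ij': "i < j" "fz i \<in> F" "fz j \<in> F" using ij(3) by (auto simp: good_pair_def)
  have step: "Code (n + (kc + 3)) \<beta> (fz i) (fz j) \<or> Code (n + (kc + 3)) (neg \<beta>) (fz i) (fz j)"
    if "\<forall>w\<in>F. 0 \<le> w \<longrightarrow> ok (\<bar>s0\<bar> * w) \<longrightarrow> tbit (n + (kc + 2)) \<gamma> (rr (t * w)) (rr (\<bar>s0\<bar> * w))" "\<gamma> = \<beta> \<or> \<gamma> = neg \<beta>" for \<gamma>
  proof -
    have eq: "Suc (n + (kc + 2)) = n + (kc + 3)" by simp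
    have "Code (Suc (n + (kc + 2))) \<gamma> (fz i) (fz j) \<or> Code (Suc (n + (kc + 2))) (neg \<gamma>) (fz i) (fz j)"
      by (rule wide_tbits_code[OF _ t ij' ij(1,2)]) (use that(1) in blast)
    then show ?thesis unfolding eq using that(2) neg_neg[of \<beta>] by (elim disjE) simp_all
  qed
  have "Code (n + (kc + 3)) \<beta> (fz i) (fz j) \<or> Code (n + (kc + 3)) (neg \<beta>) (fz i) (fz j)"
    using wide_code_PF[OF kl \<beta>]
  proof
    assume "Code (n + (kc + 2)) \<beta> (fz k) (fz l)"
    from C[OF \<beta>(1) this] show ?thesis using step by blast
  next
    assume "Code (n + (kc + 2)) (neg \<beta>) (fz k) (fz l)"
    from C[OF _ this] \<beta>(1) show ?thesis using step[of \<beta>] step[of "neg \<beta>"] by auto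
  qed
  then show ?thesis
    using good_pair_BT_either[OF ij(3), of \<beta>] good_pair_BT_either[OF ij(3), of "neg \<beta>"] \<beta>(1) by auto
qed

lemma sign_between: "0 \<le> sg * x \<Longrightarrow> sg * x \<le> sg * v \<Longrightarrow> min 0 v \<le> x \<and> x \<le> max 0 v"
  using sg(1) by auto

lemma sign_between': "sg * v \<le> sg * x \<Longrightarrow> sg * x \<le> 0 \<Longrightarrow> min 0 v \<le> x \<and> x \<le> max 0 v"
  using sg(1) by auto

text \<open>The exceptional case: \<open>c1\<close> and \<open>c2\<close> are so far apart on both sides of 0 that their distance
  overflows. Then \<open>\<eta>\<close> lies between them and cuts the range of activations in two.\<close>

lemma strong_bits:
  obtains p q v K where "good_pair p q v"
    "\<And>n \<beta>. monob \<beta> \<Longrightarrow> PF n \<beta> R0 \<Longrightarrow> BT (n + K) \<beta> \<bar>v\<bar> \<or> BT (n + K) (neg \<beta>) \<bar>v\<bar>"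
proof -
  obtain i j where ij: "fz i = min c1 c2" "fz j = max c1 c2" "i < j" "good_pair (fz i) (fz j) s0" using p0q0 by blast
  show ?thesis
  proof (cases "fz i < - p2 (b - 1) \<and> p2 (b - 1) < fz j")
    case False
    then show ?thesis using that[OF ij(4), of "kc + 2"] good_near[OF ij(4)] by blast
  next
    case True
    have "p2 3 \<le> p2 (b - 1)" using b15 by (simp only: p2_le)
    then have b8: "8 \<le> p2 (b - 1)" by simp
    have e4: "eta < 4" "- 4 < eta" "eta' \<le> 4" "- 4 \<le> eta'" using ie by auto
    have ee: "eta < eta'" by simp
    have B01: "B0 < B1" using sg(2) by (simp add: B0_def B1_def)
    have BF: "B0 \<in> Fz" "B1 \<in> Fz" using B_F by (auto simp: F_iff)
    have range: "\<sigma> (Fin z) = Fin (sv z) \<and> min 0 s0 \<le> sv z \<and> sv z \<le> max 0 s0" if "z \<in> F" "fz i \<le> z" "z \<le> fz j" for z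
      using c_between[of z] that ij by simp
    have nl: "\<not> (fz k < - p2 (b - 1) \<and> p2 (b - 1) < eta')" "\<not> (eta < - p2 (b - 1) \<and> p2 (b - 1) < fz k)" for k
      using e4 b8 by auto
    show ?thesis
    proof (cases "c1 \<le> c2")
      case c: True
      then have ci: "fz i = c1" "fz j = c2" using ij by auto
      have ord: "c1 < eta" "eta' < c2" using True ci e4 b8 by linarith+
      have B0p: "0 \<le> B0" using left[OF c12(1)] ord sv_c by (simp add: B0_def)
      have B1s: "B1 \<le> sg * s0" using right[OF c12(2)] ord sv_c by (simp add: B1_def)
      have sgs: "sg * s0 = \<bar>s0\<bar>" using B0p B01 B1s abs_sg[of s0] by linarith
      have pos: "0 \<le> sg * sv z \<and> sg * sv z \<le> \<bar>s0\<bar>" if "z \<in> F" "c1 \<le> z" "z \<le> c2" for z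
        using range[OF that(1)] that(2,3) sgs sg(1) unfolding ci by (auto simp: min_def max_def split: if_splits)
      show ?thesis
      \<comment> \<open>Either the activation at the successor of \<eta> is strong and takes the
        place of \<sigma>(c2), or \<open>strong_gap\<close> bounds the one at \<eta> by 2^(-M-2), so
        that the range from \<eta> to c2 yields terms with a negligible off value.\<close>
      proof (cases "strong B1 b")
        case True
        have g: "good_pair c1 eta' (sv eta')"
          unfolding good_pair_def
        proof (intro conjI ballI impI)
          show "strong \<bar>sv eta'\<bar> b" using True B0p B01 abs_sg[of "sv eta'"] by (simp add: B1_def)
          show "c1 < eta'" using ord ee by linarith
          show "sv c1 = 0 \<and> sv eta' = sv eta' \<or> sv eta' = 0 \<and> sv c1 = sv eta'" using sv_c by simp
          fix z assume z: "z \<in> F" "c1 \<le> z" "z \<le> eta'"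
          have "z \<le> eta \<or> z = eta'" using F_split[OF z(1)] z(3) by auto
          then have "sg * sv z \<le> sg * sv eta'" using left[OF z(1)] B01 unfolding B0_def B1_def by auto
          moreover have "0 \<le> sg * sv z" using pos[OF z(1,2)] z(3) ord by linarith
          ultimately have "min 0 (sv eta') \<le> sv z \<and> sv z \<le> max 0 (sv eta')" using sign_between by blast
          then show "\<sigma> (Fin z) = Fin (sv z)" "min 0 (sv eta') \<le> sv z" "sv z \<le> max 0 (sv eta')" using sv_fin[OF z(1)] by auto
        qed (use c12 eta_F in auto)
        show ?thesis using that[OF g, of "kc + 2"] good_near[OF g[folded ci(1)] nl(1)] by blast
      next
        case False
        have "B0 \<le> p2 (- m - 2)" using strong_gap[OF BF B01 _ False] B1s sgs s0 by linarith
        moreover have "(\<forall>w\<in>F. 0 \<le> w \<longrightarrow> ok (\<bar>s0\<bar> * w) \<longrightarrow> tbit n \<beta> (rr (B0 * w)) (rr (\<bar>s0\<bar> * w)))"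
          if \<beta>: "monob \<beta>" "Code n \<beta> eta (fz j)" for n \<beta>
        proof (intro ballI impI)
          fix w assume w: "w \<in> F" "0 \<le> w" "ok (\<bar>s0\<bar> * w)"
          have "B0 * w \<le> \<bar>s0\<bar> * w" using B01 B1s sgs w by (intro mult_right_mono) auto
          moreover have "0 \<le> B0 * w" using B0p w by simp
          ultimately have okB: "ok (B0 * w)" using ok_between[OF F_ok[OF zero_F] w(3)] by blast
          have "tbit n \<beta> (rr (w * (sg * sv eta))) (rr (w * (sg * sv c2)))"
          proof (rule code_term[OF \<beta>(2)[unfolded ci] \<beta>(1) _ eta_F(1) c12(2) sg(1) w(1,2)])
            show "eta \<le> c2" using ord ee by linarith
            show "ok (w * (sg * sv eta))" using okB by (simp add: B0_def mult.commute)
            show "ok (w * (sg * sv c2))" using w(3) sgs sv_c by (simp add: mult.commute)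
            fix z assume z: "z \<in> F" "eta \<le> z" "z \<le> c2"
            have "z = eta \<or> eta' \<le> z" using F_split[OF z(1)] z(2) by auto
            then have "sg * sv eta \<le> sg * sv z" using right[OF z(1)] B01 unfolding B0_def B1_def by auto
            moreover have "sg * sv z \<le> sg * sv c2" using pos[OF z(1)] z ord sgs sv_c by simp
            ultimately show "\<sigma> (Fin z) = Fin (sv z) \<and> sg * sv eta \<le> sg * sv z \<and> sg * sv z \<le> sg * sv c2" using sv_fin[OF z(1)] by blast
          qed
          then show "tbit n \<beta> (rr (B0 * w)) (rr (\<bar>s0\<bar> * w))" using sgs sv_c by (simp add: B0_def mult.commute)
        qed
        moreover have "ie < j" using ord ee ci by (metis fz_less less_trans)
        ultimately show ?thesis using that[OF ij(4), of "kc + 3"] 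
            good_far[OF _ _ ij(4) _ eta_F(1) _ nl(2) B0p, of j] True c12 ci by blast
      qed
    next
      case c: False
      then have ci: "fz i = c2" "fz j = c1" using ij by auto
      have ord: "c2 < eta" "eta' < c1" using True ci e4 b8 by linarith+
      have B1n: "B1 \<le> 0" using right[OF c12(1)] ord sv_c by (simp add: B1_def)
      have B0s: "sg * s0 \<le> B0" using left[OF c12(2)] ord sv_c by (simp add: B0_def)
      have sgs: "sg * s0 = - \<bar>s0\<bar>" using B1n B01 B0s abs_sg[of s0] by linarith
      have neg: "- \<bar>s0\<bar> \<le> sg * sv z \<and> sg * sv z \<le> 0" if "z \<in> F" "c2 \<le> z" "z \<le> c1" for z
        using range[OF that(1)] that(2,3) sgs sg(1) unfolding ci by (auto simp: min_def max_def split: if_splits)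
      show ?thesis
      proof (cases "strong (- B0) b")
        case True
        have g: "good_pair eta c1 (sv eta)"
          unfolding good_pair_def
        proof (intro conjI ballI impI)
          have "- B0 = \<bar>sv eta\<bar>" using B1n B01 abs_sg[of "sv eta"] unfolding B0_def by linarith
          then show "strong \<bar>sv eta\<bar> b" using True by simp
          show "eta < c1" using ord ee by linarith
          show "sv eta = 0 \<and> sv c1 = sv eta \<or> sv c1 = 0 \<and> sv eta = sv eta" using sv_c by simp
          fix z assume z: "z \<in> F" "eta \<le> z" "z \<le> c1"
          have "z = eta \<or> eta' \<le> z" using F_split[OF z(1)] z(2) by auto
          then have "sg * sv eta \<le> sg * sv z" using right[OF z(1)] B01 unfolding B0_def B1_def by auto
          moreover have "sg * sv z \<le> 0" using neg[OF z(1)] z ord by linarith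
          ultimately have "min 0 (sv eta) \<le> sv z \<and> sv z \<le> max 0 (sv eta)" using sign_between' by blast
          then show "\<sigma> (Fin z) = Fin (sv z)" "min 0 (sv eta) \<le> sv z" "sv z \<le> max 0 (sv eta)" using sv_fin[OF z(1)] by auto
        qed (use c12 eta_F in auto)
        show ?thesis using that[OF g, of "kc + 2"] good_near[OF g[folded ci(2)] nl(2)] by blast
      next
        case False
        have mB: "- B1 \<in> Fz" "- B0 \<in> Fz" using BF Fz_minus by auto
        have "- B1 \<le> p2 (- m - 2)" using strong_gap[OF mB _ _ False] B01 B0s sgs s0 by linarith
        moreover have "(\<forall>w\<in>F. 0 \<le> w \<longrightarrow> ok (\<bar>s0\<bar> * w) \<longrightarrow> tbit n (neg \<beta>) (rr (- B1 * w)) (rr (\<bar>s0\<bar> * w)))"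
          if \<beta>: "monob \<beta>" "Code n \<beta> (fz i) eta'" for n \<beta>
        proof (intro ballI impI)
          fix w assume w: "w \<in> F" "0 \<le> w" "ok (\<bar>s0\<bar> * w)"
          have "- B1 * w \<le> \<bar>s0\<bar> * w" using B01 B0s sgs w by (intro mult_right_mono) auto
          moreover have "0 \<le> - B1 * w" using B1n w by (intro mult_nonneg_nonneg) auto
          ultimately have okB: "ok (- B1 * w)" using ok_between[OF F_ok[OF zero_F] w(3)] by blast
          have "tbit n \<beta> (rr (w * (sg * sv c2))) (rr (w * (sg * sv eta')))"
          proof (rule code_term[OF \<beta>(2)[unfolded ci] \<beta>(1) _ c12(2) eta_F(2) sg(1) w(1,2)])
            show "c2 \<le> eta'" using ord ee by linarith
            show "ok (w * (sg * sv eta'))" using okB ok_minus[of "B1 * w"] by (simp add: B1_def mult.commute)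
            show "ok (w * (sg * sv c2))" using w(3) sgs sv_c ok_minus[of "\<bar>s0\<bar> * w"] by (simp add: mult.commute)
            fix z assume z: "z \<in> F" "c2 \<le> z" "z \<le> eta'"
            have "z \<le> eta \<or> z = eta'" using F_split[OF z(1)] z(3) by auto
            then have "sg * sv z \<le> sg * sv eta'" using left[OF z(1)] B01 unfolding B0_def B1_def by auto
            moreover have "sg * sv c2 \<le> sg * sv z" using neg[OF z(1)] z ord sgs sv_c by simp
            ultimately show "\<sigma> (Fin z) = Fin (sv z) \<and> sg * sv c2 \<le> sg * sv z \<and> sg * sv z \<le> sg * sv eta'" using sv_fin[OF z(1)] by blast
          qed
          then have "tbit n \<beta> (- rr (\<bar>s0\<bar> * w)) (- rr (- B1 * w))" using sgs sv_c 
            by (simp add: B1_def mult.commute rr_minus[symmetric])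
          from tbit_neg[OF this] show "tbit n (neg \<beta>) (rr (- B1 * w)) (rr (\<bar>s0\<bar> * w))" by simp
        qed
        moreover have "i < ie + 1" using ord ee ci by (metis fz_less less_trans)
        moreover have "0 \<le> - B1" using B1n by simp
        ultimately show ?thesis using that[OF ij(4), of "kc + 3"]
            good_far[OF _ _ ij(4) _ _ eta_F(2) nl(1), of i "- B1"] True c12 ci by blast
      qed
    qed
  qed
qed

text \<open>A strong bit can be walked to p and q exactly, and its complement as well by the
  mirrored program. Hence a bit survives to the next layer and becomes available in both
  polarities.\<close>

lemma persist:
  assumes g: "good_pair p q v" and \<beta>: "monob \<beta>" "BT n \<beta> \<bar>v\<bar>"
  shows "BT (Suc n) \<beta> \<bar>v\<bar>" "BT (Suc n) (neg \<beta>) \<bar>v\<bar>"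
proof -
  have st: "strong \<bar>v\<bar> b" using g by (simp add: good_pair_def)
  have walk: "pair P x y" if P: "prog T P" "pair P 0 0" and T: "csteps \<bar>s0\<bar> \<subseteq> T" "bsteps \<bar>v\<bar> \<subseteq> T" and xy: "x \<in> F" "y \<in> F" "x \<le> y" for P T x y
  proof -
    obtain i j where i: "x = fz i" "\<bar>i\<bar> \<le> N" "y = fz j" "\<bar>j\<bar> \<le> N" using F_cases xy by metis
    have "pair P (fz i) (fz i)" using const_walk[OF P(1) strong_s T(1), of 0 i] P(2) i N_nonneg by simp
    moreover have "gap k \<le> p2 (b - m)" if "i \<le> k" "k < j" for k
    proof -
      have "- N \<le> k" "k < N" using that i(2,4) by linarith+
      then obtain e where "gap k = p2 (e - m)" "e \<le> b" by (rule gap_exp_bounded)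
      then show ?thesis by simp
    qed
    ultimately show ?thesis unfolding i using on_walk[OF P(1) st T(2), of "fz i" i j] i xy by (auto simp: F_iff)
  qed
  define T where "T = Tc \<union> bsteps \<bar>v\<bar>"
  have tb: "tbit n \<beta> x0 x1" if "(x0, x1) \<in> T" for x0 x1 using that tbit_Tc BT_bsteps[OF \<beta>(2)] by (auto simp: T_def)
  have sub: "csteps \<bar>s0\<bar> \<subseteq> T" "bsteps \<bar>v\<bar> \<subseteq> T" by (auto simp: T_def Tc_def)
  have pq: "p \<in> F" "q \<in> F" "p \<le> q" using g by (auto simp: good_pair_def)
  have p1: "prog T (Pg n \<beta>)" by (rule prog_Pg) (rule tb)
  have "pair (Pg n \<beta>) p q" using walk[OF p1 pair_Pg_zero sub pq] .
  then have C1: "Code (Suc n) \<beta> p q" by (rule code_of_pair[where c = 0]) (use pq zero_F in \<open>auto simp: rr_Fz F_iff\<close>)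
  let ?P = "\<lambda>l0 u0 l1 u1. Pg n (neg \<beta>) (- u1) (- l1) (- u0) (- l0)"
  have p2: "prog T ?P" by (rule prog_Pg_neg) (rule tb)
  have z: "pair ?P 0 0" using pair_Pg_zero[of n "neg \<beta>"] by (simp add: pair_def)
  have "pair ?P (- q) (- p)" using walk[OF p2 z sub, of "- q" "- p"] pq F_minus by simp
  then have "pair (Pg n (neg \<beta>)) p q" unfolding pair_neg by simp
  then have C2: "Code (Suc n) (neg \<beta>) p q" by (rule code_of_pair[where c = 0]) (use pq zero_F in \<open>auto simp: rr_Fz F_iff\<close>)
  show "BT (Suc n) \<beta> \<bar>v\<bar>" "BT (Suc n) (neg \<beta>) \<bar>v\<bar>"
    using good_pair_BT[OF g _ C1] good_pair_BT[OF g _ C2] \<beta>(1) by (cases "sv p = 0"; simp)+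
qed

end

section \<open>Gates and level sets\<close>

context fp
begin

text \<open>Both ends of a gap are multiples of the gap itself with significands of one binade,
  which allows one gap to be mapped exactly onto another.\<close>

lemma gap_multiple:
  obtains e j where "a \<le> e" "gap k = p2 (e - m)" "fz k = of_int j * p2 (e - m)" "\<bar>j\<bar> \<le> 2 ^ (M + 1)" "\<bar>j + 1\<bar> \<le> 2 ^ (M + 1)"
proof -
  have pos: "\<exists>e j. a \<le> e \<and> gap k = p2 (e - m) \<and> fz k = of_int j * p2 (e - m) \<and> 0 \<le> j \<and> j + 1 \<le> 2 ^ (M + 1)" if k: "0 \<le> k" for k
  proof -
    obtain e where e: "a \<le> e" "gap k = p2 (e - m)" "e = a \<or> p2 e \<le> fz k" "fz (k + 1) \<le> p2 (e + 1)" using gap_exp[OF k] by metis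
    have "fz k < fz (k + 1)" by simp
    have "\<exists>j. fz k = of_int j * p2 (e - m)"
    proof (cases "p2 e \<le> fz k")
      case True
      have "fz k \<le> p2 (e + 1)" using e(4) \<open>fz k < fz (k + 1)\<close> by linarith
      then show ?thesis using binade_multiple[OF e(1) True] by metis
    next
      case False
      then have ea: "e = a" using e(3) by simp
      have "fz k < fz (idx a)" using False ea fz_idx[of a] by simp
      then have "k < 2 ^ M" by (simp add: idx_def)
      then have "nat k \<le> 2 ^ M" using k by (simp add: nat_le_iff)
      then have "fzn (nat k) = real (nat k) * om" by (rule fzn_block0)
      then have "fz k = of_int k * om" using fz_int[of "nat k"] k by simp
      then show ?thesis unfolding ea om_def by blast
    qed
    then obtain j where j: "fz k = of_int j * p2 (e - m)" by blast
    have "0 \<le> fz k" using k by simp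
    then have "0 \<le> j" unfolding j using mult_neg_pos[of "of_int j" "p2 (e - m)"] by (cases "j < 0") auto
    moreover have "p2 (e + 1) = 2 ^ (M + 1) * p2 (e - m)" by (simp add: p2_add p2_diff p2_nat)
    then have "(of_int j + 1) * p2 (e - m) \<le> 2 ^ (M + 1) * p2 (e - m)"
      using e(2,4) j by (simp add: gap_def algebra_simps)
    then have "of_int (j + 1) \<le> (2::real) ^ (M + 1)" by (simp add: mult_le_cancel_right)
    then have "of_int (j + 1) \<le> (of_int (2 ^ (M + 1)) :: real)" by simp
    then have "j + 1 \<le> 2 ^ (M + 1)" by (simp only: of_int_le_iff)
    ultimately show ?thesis using e j by blast
  qed
  show ?thesis
  proof (cases "0 \<le> k")
    case True
    then obtain e j where "a \<le> e" "gap k = p2 (e - m)" "fz k = of_int j * p2 (e - m)" "0 \<le> j" "j + 1 \<le> 2 ^ (M + 1)" using pos by blast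
    then show ?thesis using that[of e j] by simp
  next
    case False
    then obtain e j where j: "a \<le> e" "gap (- k - 1) = p2 (e - m)" "fz (- k - 1) = of_int j * p2 (e - m)" "0 \<le> j" "j + 1 \<le> 2 ^ (M + 1)"
      using pos[of "- k - 1"] by auto
    have g: "gap k = p2 (e - m)" using j(2) gap_minus[of k] by simp
    have "- fz k = fz (- k - 1) + gap (- k - 1)" using fz_minus[of k] by (simp add: gap_def)
    then have "fz k = of_int (- j - 1) * p2 (e - m)" using j by (simp add: algebra_simps)
    then show ?thesis using that[of e "- j - 1"] g j by simp
  qed
qed

end

context nets
begin

section \<open>Thresholds on the inputs\<close>

fun endp :: "bool \<Rightarrow> ival \<Rightarrow> real" where
  "endp sd (Iv x y) = fval (if sd then y else x)"
| "endp sd Top = 0"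

lemma BB_nth:
  assumes "B \<in> BB" "i < d"
  shows "B ! i = Iv (Fin (endp False (B ! i))) (Fin (endp True (B ! i)))"
    "endp False (B ! i) \<le> endp True (B ! i)" "endp sd (B ! i) \<in> F" "\<bar>endp sd (B ! i)\<bar> \<le> 1"
proof -
  have "B ! i \<in> set B" using BB[OF assms(1)] assms(2) by simp
  then obtain l u where "B ! i = Iv (Fin l) (Fin u)" "l \<in> F" "u \<in> F" "- 1 \<le> l" "l \<le> u" "u \<le> 1" using BB[OF assms(1)] by blast
  then show "B ! i = Iv (Fin (endp False (B ! i))) (Fin (endp True (B ! i)))"
    "endp False (B ! i) \<le> endp True (B ! i)" "endp sd (B ! i) \<in> F" "\<bar>endp sd (B ! i)\<bar> \<le> 1" by auto
qed

lemma input_neuron: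
  assumes i: "i < d" and w: "w \<in> F" and c: "c \<in> F"
    and ok1: "\<And>x. x \<in> F \<Longrightarrow> \<bar>x\<bar> \<le> 1 \<Longrightarrow> ok (x * w)" and ok2: "\<And>x. x \<in> F \<Longrightarrow> \<bar>x\<bar> \<le> 1 \<Longrightarrow> ok (rr (x * w) + c)"
  defines "g \<equiv> \<lambda>sd B. rr (rr (endp (if 0 \<le> w then sd else \<not> sd) (B ! i) * w) + c)"
  obtains \<psi> where "preact 0 \<psi>" "\<And>B. B \<in> BB \<Longrightarrow> \<psi> B = Iv (Fin (g False B)) (Fin (g True B))"
    "\<And>B. B \<in> BB \<Longrightarrow> g False B \<le> g True B" "\<And>B sd. B \<in> BB \<Longrightarrow> g sd B \<in> F"
proof -
  define row where "row = replicate i 0 @ [w] @ replicate (d - i - 1) 0"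
  define \<phi> where "\<phi> B = imul (B ! i) w" for B
  have ep: "endp (if 0 \<le> w then False else \<not> False) (B ! i) * w \<le> endp (if 0 \<le> w then True else \<not> True) (B ! i) * w" if "B \<in> BB" for B
    using BB_nth(2)[OF that i] by (cases "0 \<le> w") (auto intro: mult_right_mono mult_right_mono_neg)
  have val: "\<phi> B = Iv (Fin (rr (endp (if 0 \<le> w then False else \<not> False) (B ! i) * w))) (Fin (rr (endp (if 0 \<le> w then True else \<not> True) (B ! i) * w)))" if B: "B \<in> BB" for B
    unfolding \<phi>_def by (subst BB_nth(1)[OF B i], subst imul_fini) (use BB_nth[OF B i] ok1 in auto)
  have sum: "isum E M (map2 imul B row) = \<phi> B" if B: "B \<in> BB" for B
  proof -
    have len: "length B = d" using BB[OF B] by simp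
    have z: "I = pt 0" if I: "I \<in> set (map2 imul xs (replicate k 0))" "set xs \<subseteq> set B" for I xs k
    proof -
      obtain x y where "(x, y) \<in> set (zip xs (replicate k 0))" "I = imul x y" using I by (auto simp del: iop.simps)
      then have x: "x \<in> set B" "I = imul x 0" using I(2) by (auto dest: set_zip_leftD set_zip_rightD simp del: iop.simps)
      then obtain l u where "x = Iv (Fin l) (Fin u)" "l \<in> F" "u \<in> F" using BB[OF B] by blast
      then show ?thesis using x(2) imul_0 by blast
    qed
    have spl: "B = take i B @ [B ! i] @ drop (Suc i) B" using i len by (simp add: id_take_nth_drop[symmetric])
    have "map2 imul B row = map2 imul (take i B @ [B ! i] @ drop (Suc i) B) row" using spl by simp
    also have "\<dots> = map2 imul (take i B) (replicate i 0) @ [\<phi> B] @ map2 imul (drop (Suc i) B) (replicate (d - i - 1) 0)"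
      unfolding row_def \<phi>_def using i len by (simp add: zip_append1 del: iop.simps)
    finally have m2: "map2 imul B row = \<dots>" .
    have wf: "wf (\<phi> B)" using ep[OF B] BB_nth[OF B i] ok1 unfolding val[OF B] wf_Fin by (auto intro!: rr_F rr_mono)
    have "isum E M (map2 imul B row) = isum E M [\<phi> B]"
      unfolding m2 using z[of _ "take i B" i] z[of _ "drop (Suc i) B" "d - i - 1"] wf
      by (intro isum_padded) (auto simp: set_take_subset set_drop_subset simp del: iop.simps)
    then show ?thesis by simp
  qed
  have "psum 0 \<phi>" unfolding psum.simps using i w zero_F sum by (intro exI[of _ row]) (auto simp: row_def)
  moreover have "iadd (\<phi> B) (pt c) = Iv (Fin (g False B)) (Fin (g True B))" if B: "B \<in> BB" for B
    unfolding val[OF B] g_def using ep[OF B] BB_nth[OF B i] ok2 by (intro iadd_fini rr_mono) auto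
  moreover have "g False B \<le> g True B" if "B \<in> BB" for B
    unfolding g_def using rr_mono[OF ep[OF that]] by (intro rr_mono) linarith
  moreover have "g sd B \<in> F" if "B \<in> BB" for sd B
    unfolding g_def using ok2 BB_nth[OF that i] by (intro rr_F) blast
  ultimately show ?thesis
    using that[of "\<lambda>B. iadd (\<phi> B) (pt c)"] c unfolding preact_def by blast
qed

end

context cnet
begin

lemma R0_ge: "32 \<le> R0"
proof -
  have "p2 5 \<le> p2 (b + 1)" using b15 by (simp only: p2_le)
  then show ?thesis by (simp add: R0_def)
qed

definition thr :: "nat \<Rightarrow> int \<Rightarrow> bits" where
  "thr i k sd B \<longleftrightarrow> fz (k + 1) \<le> endp sd (B ! i)"

lemma thr_iff: "B \<in> BB \<Longrightarrow> i < d \<Longrightarrow> thr i k sd B \<longleftrightarrow> fz k < endp sd (B ! i)"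
proof -
  assume "B \<in> BB" "i < d"
  then obtain l where "endp sd (B ! i) = fz l" using BB_nth(3) F_cases by metis
  then show ?thesis by (auto simp: thr_def)
qed

lemma monob_thr: "i < d \<Longrightarrow> monob (thr i k)"
  unfolding monob_def thr_def using BB_nth(2) order_trans by blast

text \<open>The weight is, up to sign, the quotient of the gap at \<eta> by the gap at
  \<open>fz k\<close>, a power of two. The two ends of the input gap are therefore mapped exactly
  onto \<eta> and its successor, and monotone rounding takes care of all other inputs.\<close>

lemma thr_PF:
  assumes i: "i < d" and k: "- 1 \<le> fz k" "fz k < 1"
  shows "PF 0 (thr i k) R0 \<or> PF 0 (neg (thr i k)) R0"
proof -
  obtain e j where e: "a \<le> e" "gap k = p2 (e - m)" "fz k = of_int j * p2 (e - m)" "\<bar>j\<bar> \<le> 2 ^ (M + 1)" "\<bar>j + 1\<bar> \<le> 2 ^ (M + 1)"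
    by (rule gap_multiple)
  obtain e' l where l: "a \<le> e'" "gap ie = p2 (e' - m)" "eta = of_int l * p2 (e' - m)" "\<bar>l\<bar> \<le> 2 ^ (M + 1)" "\<bar>l + 1\<bar> \<le> 2 ^ (M + 1)"
    by (rule gap_multiple)
  have xe: "xi = e' - m" using l(2) xi(1) by simp
  have "fz k < fz (idx 0)" using k fz_idx[of 0] ab b15 by simp
  then have "fz (k + 1) \<le> fz (idx 0)" by simp
  then have k1: "fz (k + 1) \<le> 1" using fz_idx[of 0] ab b15 by simp
  define W where "W = p2 (e' - e)"
  have "gap k \<le> 2" using k k1 by (simp add: gap_def)
  then have "p2 (e - m) \<le> p2 1" using e(2) by simp
  then have em: "e - m \<le> 1" by (simp only: p2_le)
  have Wb: "e' - e \<le> b" "a - m \<le> e' - e" using xi xe e(1) em ab by linarith+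
  have WF: "W \<in> F" "- W \<in> F" unfolding W_def using p2_F[of "e' - e"] Wb F_minus by auto
  have Wp: "0 < W" "W \<le> p2 b" unfolding W_def using Wb by simp_all
  have hh: "W * p2 (e - m) = p2 xi" unfolding W_def xe p2_add[symmetric] by simp
  have wz: "fz k * W = of_int j * p2 xi" "fz (k + 1) * W = of_int (j + 1) * p2 xi" "eta = of_int l * p2 xi" "eta' = eta + p2 xi"
  proof -
    show "fz k * W = of_int j * p2 xi" unfolding e(3) hh[symmetric] by (simp only: mult_ac)
    have "fz (k + 1) * W = fz k * W + W * p2 (e - m)" unfolding e(2)[symmetric] gap_def by (simp add: algebra_simps)
    then show "fz (k + 1) * W = of_int (j + 1) * p2 xi" unfolding \<open>fz k * W = _\<close> hh by (simp add: algebra_simps)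
    show "eta = of_int l * p2 xi" using l(3) xe by simp
    show "eta' = eta + p2 xi" using xi(1) by (simp add: gap_def)
  qed
  have mul: "of_int n * p2 xi \<in> Fz" "\<bar>of_int n * p2 xi\<bar> \<le> 4" if n: "\<bar>n\<bar> \<le> 2 ^ (M + 1)" for n
  proof -
    show "of_int n * p2 xi \<in> Fz" unfolding xe by (rule Fz_mem[OF n l(1)])
    have "\<bar>of_int n\<bar> \<le> (2::real) ^ (M + 1)" using n by (metis of_int_abs of_int_le_iff of_int_numeral of_int_power)
    then have "\<bar>of_int n\<bar> * p2 xi \<le> 2 ^ (M + 1) * p2 (1 - m)" using xi(3) by (intro mult_mono) auto
    also have "\<dots> = 4" by (simp add: p2_diff p2_nat)
    finally show "\<bar>of_int n * p2 xi\<bar> \<le> 4" by (simp add: abs_mult)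
  qed
  have big: "p2 4 \<le> p2 (b - 1)" "p2 b = 2 * p2 (b - 1)" "R0 = 4 * p2 (b - 1)" 
    using b15 p2_Suc[of "b - 1"] p2_Suc[of b] by (simp_all add: R0_def del: p2_num)
  have b16: "16 \<le> p2 (b - 1)" using big(1) by simp
  have f3: "3 * p2 (b - 1) \<in> Fz" "3 * p2 (b - 1) \<le> Om"
  proof -
    have "of_int 3 * p2 (b - 1 + m - m) \<in> Fz" 
    proof (rule Fz_mem)
      have "(2::int) ^ 2 \<le> 2 ^ (M + 1)" using M3 by (intro power_increasing) auto
      then show "\<bar>3::int\<bar> \<le> 2 ^ (M + 1)" by simp
    qed (use ab b15 m3 in linarith)
    then show "3 * p2 (b - 1) \<in> Fz" by simp
    have "p2 (b - m) \<le> p2 (b - 1)" using m3 by (simp only: p2_le)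
    then show "3 * p2 (b - 1) \<le> Om" unfolding Om_p2 using big(3) R0_def by linarith
  qed
  have bound: "\<bar>x * v\<bar> \<le> 2 * p2 (b - 1)" if "\<bar>x\<bar> \<le> 1" "\<bar>v\<bar> = W" for x v
  proof -
    have "\<bar>x\<bar> * \<bar>v\<bar> \<le> 1 * W" using that Wp by (intro mult_mono) auto
    then show ?thesis using Wp big(2) by (simp add: abs_mult)
  qed
  have fb: "2 * p2 (b - 1) \<in> Fz" unfolding big(2)[symmetric] using b15 ab m3 by (intro p2_Fz) linarith
  have bound': "\<bar>rr (x * v)\<bar> \<le> 2 * p2 (b - 1)" if "\<bar>x\<bar> \<le> 1" "\<bar>v\<bar> = W" for x v
    using bound[OF that] rr_le[OF _ fb, of "x * v"] rr_ge[OF _ Fz_minus[OF fb], of "x * v"] by (auto simp: abs_le_iff)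
  have bound2: "\<bar>rr (x * v) + c\<bar> \<le> Om" "\<bar>rr (rr (x * v) + c)\<bar> \<le> 3 * p2 (b - 1)" if "\<bar>x\<bar> \<le> 1" "\<bar>v\<bar> = W" "\<bar>c\<bar> \<le> 4" for x v c
  proof -
    have t: "\<bar>rr (x * v) + c\<bar> \<le> 3 * p2 (b - 1)" using bound'[OF that(1,2)] that(3) b16 by linarith
    then show "\<bar>rr (x * v) + c\<bar> \<le> Om" using f3 by linarith
    show "\<bar>rr (rr (x * v) + c)\<bar> \<le> 3 * p2 (b - 1)"
      using t rr_le[OF _ f3(1), of "rr (x * v) + c"] rr_ge[OF _ Fz_minus[OF f3(1)], of "rr (x * v) + c"] by (auto simp: abs_le_iff)
  qed
  have okx: "ok (x * v)" if "\<bar>x\<bar> \<le> 1" "\<bar>v\<bar> = W" for x v using bound[OF that] b16 f3 by (intro okI) linarith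
  have okc: "ok (rr (x * v) + c)" if "\<bar>x\<bar> \<le> 1" "\<bar>v\<bar> = W" "\<bar>c\<bar> \<le> 4" for x v c using bound2[OF that] by (intro okI)
  have eb: "eta' \<le> 4" "- 4 < eta" "eta < 4" "- 4 \<le> eta'" using ie by auto
  have cF: "c \<in> F" if "c \<in> Fz" "\<bar>c\<bar> \<le> 4" for c using that four_Om by (simp add: F_iff)
  have Wabs: "\<bar>W\<bar> = W" "\<bar>- W\<bar> = W" using Wp by simp_all
  have fin: "PF 0 \<beta> R0"
    if v: "v = W \<or> v = - W" and c: "c \<in> F" "\<bar>c\<bar> \<le> 4"
      and off: "\<And>sd B. B \<in> BB \<Longrightarrow> \<not> \<beta> sd B \<Longrightarrow> rr (rr (endp (if 0 \<le> v then sd else \<not> sd) (B ! i) * v) + c) \<le> eta"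
      and on: "\<And>sd B. B \<in> BB \<Longrightarrow> \<beta> sd B \<Longrightarrow> eta' \<le> rr (rr (endp (if 0 \<le> v then sd else \<not> sd) (B ! i) * v) + c)" for \<beta> v c
  proof -
    define g where "g sd B = rr (rr (endp (if 0 \<le> v then sd else \<not> sd) (B ! i) * v) + c)" for sd B
    have vW: "\<bar>v\<bar> = W" "v \<in> F" using v Wabs WF by auto
    obtain \<psi> where \<psi>: "preact 0 \<psi>" "\<And>B. B \<in> BB \<Longrightarrow> \<psi> B = Iv (Fin (g False B)) (Fin (g True B))"
      "\<And>B. B \<in> BB \<Longrightarrow> g False B \<le> g True B" "\<And>B sd. B \<in> BB \<Longrightarrow> g sd B \<in> F"
      unfolding g_def by (rule input_neuron[OF i vW(2) c(1) okx[OF _ vW(1)] okc[OF _ vW(1) c(2)]]) blast+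
    have "inPF \<beta> R0 g B" if B: "B \<in> BB" for B
    proof -
      have ab: "\<bar>g sd B\<bar> \<le> 3 * p2 (b - 1)" for sd unfolding g_def by (rule bound2(2)[OF BB_nth(4)[OF B i] vW(1) c(2)])
      then have "eta - R0 \<le> g sd B \<and> g sd B \<le> eta' + R0" for sd using ab[of sd] eb big(3) b16 by linarith
      then show ?thesis unfolding inPF_def using \<psi>(3,4)[OF B] off[OF B] on[OF B] unfolding g_def by auto
    qed
    then show ?thesis unfolding PF_def using \<psi>(1,2) by blast
  qed
  show ?thesis
  \<comment> \<open>The bias must be a float. For equal signs the coefficient l - j is small enough;
    for opposite signs it could be too large, and a reflected map with coefficient l + j + 1 is
    used.\<close>
  proof (cases "0 \<le> l \<and> 0 \<le> j \<or> l \<le> 0 \<and> j \<le> 0")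
    case True
    then have n: "\<bar>l - j\<bar> \<le> 2 ^ (M + 1)" using e(4) l(4) by linarith
    define c where "c = of_int (l - j) * p2 xi"
    have c: "c \<in> F" "\<bar>c\<bar> \<le> 4" unfolding c_def using mul[OF n] cF by auto
    have s: "fz k * W + c = eta" "fz (k + 1) * W + c = eta'" unfolding wz c_def by (simp_all add: algebra_simps)
    have "PF 0 (thr i k) R0"
    proof (rule fin[of W c])
      fix sd B assume B: "B \<in> BB" "\<not> thr i k sd B"
      then have "endp sd (B ! i) * W \<le> fz k * W" using thr_iff[OF B(1) i] Wp by (intro mult_right_mono) auto
      then have "rr (endp sd (B ! i) * W) \<le> fz k * W" unfolding wz using mul[OF e(4)] by (intro rr_le) auto
      then have "rr (endp sd (B ! i) * W) + c \<le> eta" using s by linarith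
      then show "rr (rr (endp (if 0 \<le> W then sd else \<not> sd) (B ! i) * W) + c) \<le> eta" using Wp by (simp add: rr_le)
    next
      fix sd B assume B: "B \<in> BB" "thr i k sd B"
      then have "fz (k + 1) * W \<le> endp sd (B ! i) * W" unfolding thr_def using Wp by (intro mult_right_mono) auto
      then have "fz (k + 1) * W \<le> rr (endp sd (B ! i) * W)" unfolding wz using mul[OF e(5)] by (intro rr_ge) auto
      then have "eta' \<le> rr (endp sd (B ! i) * W) + c" using s by linarith
      then show "eta' \<le> rr (rr (endp (if 0 \<le> W then sd else \<not> sd) (B ! i) * W) + c)" using Wp by (simp add: rr_ge)
    qed (use c in auto)
    then show ?thesis ..
  next
    case False
    then have n: "\<bar>l + j + 1\<bar> \<le> 2 ^ (M + 1)" using e(4,5) l(4,5) by linarith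
    define c where "c = of_int (l + j + 1) * p2 xi"
    have c: "c \<in> F" "\<bar>c\<bar> \<le> 4" unfolding c_def using mul[OF n] cF by auto
    have s: "- (fz k * W) + c = eta'" "- (fz (k + 1) * W) + c = eta" unfolding wz c_def by (simp_all add: algebra_simps)
    have "PF 0 (neg (thr i k)) R0"
    proof (rule fin[of "- W" c])
      fix sd B assume B: "B \<in> BB" "\<not> neg (thr i k) sd B"
      then have "thr i k (\<not> sd) B" by (simp add: neg_def)
      then have "fz (k + 1) * W \<le> endp (\<not> sd) (B ! i) * W" unfolding thr_def using Wp by (intro mult_right_mono) auto
      then have "fz (k + 1) * W \<le> rr (endp (\<not> sd) (B ! i) * W)" unfolding wz using mul[OF e(5)] by (intro rr_ge) auto
      then have "- rr (endp (\<not> sd) (B ! i) * W) + c \<le> eta" using s by linarith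
      then show "rr (rr (endp (if 0 \<le> - W then sd else \<not> sd) (B ! i) * - W) + c) \<le> eta" using Wp by (simp add: rr_minus rr_le)
    next
      fix sd B assume B: "B \<in> BB" "neg (thr i k) sd B"
      then have "endp (\<not> sd) (B ! i) * W \<le> fz k * W" using thr_iff[OF B(1) i] Wp by (intro mult_right_mono) (auto simp: neg_def)
      then have "rr (endp (\<not> sd) (B ! i) * W) \<le> fz k * W" unfolding wz using mul[OF e(4)] by (intro rr_le) auto
      then have "eta' \<le> - rr (endp (\<not> sd) (B ! i) * W) + c" using s by linarith
      then show "eta' \<le> rr (rr (endp (if 0 \<le> - W then sd else \<not> sd) (B ! i) * - W) + c)" using Wp by (simp add: rr_minus rr_ge)
    qed (use c in auto)
    then show ?thesis ..
  qed
qed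

end

locale gates = cnet +
  fixes p q v :: real and K :: nat
  assumes good: "good_pair p q v"
    and bits: "\<And>n \<beta>. monob \<beta> \<Longrightarrow> PF n \<beta> R0 \<Longrightarrow> BT (n + K) \<beta> \<bar>v\<bar> \<or> BT (n + K) (neg \<beta>) \<bar>v\<bar>"
begin

section \<open>Bits in both polarities and their gates\<close>

definition Bit :: "nat \<Rightarrow> bits \<Rightarrow> bool" where
  "Bit n \<beta> \<longleftrightarrow> monob \<beta> \<and> BT n \<beta> \<bar>v\<bar> \<and> BT n (neg \<beta>) \<bar>v\<bar>"

lemma strong_v: "strong \<bar>v\<bar> b"
  using good by (simp add: good_pair_def)

lemma Bit_neg: "Bit n \<beta> \<Longrightarrow> Bit n (neg \<beta>)"
  by (simp add: Bit_def)

lemma BT_Bit: "monob \<beta> \<Longrightarrow> BT n \<beta> \<bar>v\<bar> \<Longrightarrow> Bit (Suc n) \<beta>"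
  unfolding Bit_def using persist[OF good] by blast

lemma Bit_Suc: "Bit n \<beta> \<Longrightarrow> Bit (Suc n) \<beta>"
  using BT_Bit unfolding Bit_def by blast

lemma Bit_lift: "n \<le> n' \<Longrightarrow> Bit n \<beta> \<Longrightarrow> Bit n' \<beta>"
  by (induction rule: dec_induct) (auto intro: Bit_Suc)

lemma PF_Bit: "monob \<beta> \<Longrightarrow> PF n \<beta> R0 \<Longrightarrow> Bit (Suc (n + K)) \<beta>"
  using bits[of \<beta> n] BT_Bit[of \<beta> "n + K"] BT_Bit[of "neg \<beta>" "n + K"] Bit_neg[of _ "neg \<beta>"] by auto

lemma tbit_cong: "(\<And>B sd. B \<in> BB \<Longrightarrow> \<beta> sd B = \<gamma> sd B) \<Longrightarrow> tbit n \<beta> x0 x1 = tbit n \<gamma> x0 x1"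
  unfolding tbit_def by auto

lemma Bit_cong:
  assumes "Bit n \<gamma>" "\<And>B sd. B \<in> BB \<Longrightarrow> \<beta> sd B = \<gamma> sd B"
  shows "Bit n \<beta>"
proof -
  have "tbit n \<beta> x0 x1 = tbit n \<gamma> x0 x1" "tbit n (neg \<beta>) x0 x1 = tbit n (neg \<gamma>) x0 x1" for x0 x1
    using assms(2) by (intro tbit_cong; simp add: neg_def)+
  moreover have "monob \<beta> = monob \<gamma>" using assms(2) by (simp add: monob_def)
  ultimately show ?thesis using assms(1) unfolding Bit_def BT_def by simp
qed

lemma ie_N: "- N \<le> ie" "ie < N"
proof -
  have "\<bar>fz ie\<bar> \<le> Om" using eta_F by (simp add: F_iff)
  then have "\<bar>ie\<bar> \<le> N" by (simp only: abs_fz_le)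
  moreover have "eta < fz N" unfolding fz_N using ie four_Om by linarith
  then have "ie < N" by simp
  ultimately show "- N \<le> ie" "ie < N" by auto
qed

lemma fs_const:
  assumes "\<bar>j\<bar> \<le> N"
  obtains g where "fs n g" "\<And>B sd. B \<in> BB \<Longrightarrow> g sd B = fz j"
proof -
  have "pair (Pg n (\<lambda>_ _. False)) (fz j) (fz j)"
    by (rule const_walk[OF prog_Tc strong_s _ _ _ assms, where i = 0]) (use pair_Pg_zero N_nonneg in \<open>auto simp: Tc_def\<close>)
  then obtain g where g: "fs n g" "\<forall>B\<in>BB. \<forall>sd. fz j \<le> g sd B \<and> g sd B \<le> fz j" unfolding pair_def Pg_def by auto
  show ?thesis by (rule that[OF g(1)]) (use g(2) in \<open>auto intro: order_antisym\<close>)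
qed

text \<open>The sum starts at \<eta>; an on bit moves it to the successor, and later summands cannot
  lower it. Since c is at most half of the last place at 16, the sum saturates there however many
  bits are on, which keeps the spread within \<open>R0\<close>.\<close>

lemma or_PF:
  assumes "finite X" "\<And>\<beta>. \<beta> \<in> X \<Longrightarrow> BT n \<beta> \<bar>v\<bar>"
  shows "PF (Suc n) (\<lambda>sd B. \<exists>\<beta>\<in>X. \<beta> sd B) R0"
proof -
  obtain c w where c: "gap ie / 2 < c" "c \<le> gap ie" and w: "w \<in> F" "0 \<le> w" "ok (\<bar>v\<bar> * w)" "c = rr (\<bar>v\<bar> * w)"
    using K_gap[OF strong_v ie_N] by metis
  have u: "eta' \<le> 4" "- 4 \<le> eta'" "- 4 < eta" "c \<le> p2 (4 - m) / 2" "0 \<le> c" "c \<le> 1"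
  proof -
    have "p2 xi \<le> p2 (3 - m)" "p2 xi \<le> p2 0" using xi m3 by (simp_all only: p2_le)
    moreover have "p2 (4 - m) = 2 * p2 (3 - m)" using p2_Suc[of "3 - m"] by simp
    ultimately show "c \<le> p2 (4 - m) / 2" "c \<le> 1" using c(2) xi(1) p2_0 by linarith+
    show "0 \<le> c" using c(1) gap_pos[of ie] by linarith
  qed (use ie in auto)
  have Om16: "16 + 1 \<le> Om"
  proof -
    have "p2 5 \<le> Om" using b15 ab m3 by (intro p2_le_Om) linarith
    then show ?thesis by simp
  qed
  have "\<exists>g. fs n g \<and> (\<forall>B\<in>BB. \<forall>sd. if \<exists>\<beta>\<in>Y. \<beta> sd B then eta' \<le> g sd B \<and> g sd B \<le> 16 else g sd B = eta)" if "finite Y" "Y \<subseteq> X" for Y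
    using that
  proof (induction Y)
    case empty
    have "\<bar>ie\<bar> \<le> N" using ie_N by linarith
    then show ?case using fs_const by (metis empty_iff)
  next
    case (insert \<beta> Y)
    then obtain g where g: "fs n g" "\<And>B sd. B \<in> BB \<Longrightarrow> if \<exists>\<beta>\<in>Y. \<beta> sd B then eta' \<le> g sd B \<and> g sd B \<le> 16 else g sd B = eta" by auto
    have "tbit n \<beta> 0 c" using assms(2)[of \<beta>] insert.prems w unfolding BT_def by blast
    then obtain t where t: "ts n t" "\<And>B sd. B \<in> BB \<Longrightarrow> t sd B = (if \<beta> sd B then c else 0)" unfolding tbit_def by blast
    have ok: "ok (g sd B + t sd B)" if "B \<in> BB" for B sd
      using g(2)[OF that, of sd] t(2)[OF that, of sd] u Om16 ie by (intro okI) (auto split: if_splits)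
    have up: "rr (x + c) \<le> 16" if "x \<le> 16" for x
      using rr_up_le[of 4 "x + c"] that u(4) ab b15 by simp
    have "if \<exists>\<beta>\<in>insert \<beta> Y. \<beta> sd B then eta' \<le> rr (g sd B + t sd B) \<and> rr (g sd B + t sd B) \<le> 16 else rr (g sd B + t sd B) = eta"
      if B: "B \<in> BB" for B sd
    proof (cases "\<exists>\<beta>\<in>Y. \<beta> sd B")
      case True
      then have gb: "eta' \<le> g sd B" "g sd B \<le> 16" using g(2)[OF B, of sd] by auto
      have "0 \<le> t sd B" "t sd B \<le> c" using t(2)[OF B] u(5) by auto
      then have "eta' \<le> rr (g sd B + t sd B)" "rr (g sd B + t sd B) \<le> rr (g sd B + c)" using gb by (auto intro!: rr_ge rr_mono)
      then show ?thesis using True up[OF gb(2)] by auto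
    next
      case False
      then have gb: "g sd B = eta" using g(2)[OF B, of sd] by auto
      show ?thesis
      proof (cases "\<beta> sd B")
        case True
        then show ?thesis using gb t(2)[OF B] rr_step_up(1)[OF c] u by auto
      next
        case False
        then show ?thesis using \<open>\<not> (\<exists>\<beta>\<in>Y. \<beta> sd B)\<close> gb t(2)[OF B] by auto
      qed
    qed
    then show ?case using fs_step[OF g(1) t(1) ok] by blast
  qed
  from this[OF assms(1) order_refl] obtain g where g0: "fs n g \<and> (\<forall>B\<in>BB. \<forall>sd. if \<exists>\<beta>\<in>X. \<beta> sd B then eta' \<le> g sd B \<and> g sd B \<le> 16 else g sd B = eta)" ..
  have g: "fs n g" "\<And>B sd. B \<in> BB \<Longrightarrow> if \<exists>\<beta>\<in>X. \<beta> sd B then eta' \<le> g sd B \<and> g sd B \<le> 16 else g sd B = eta"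
    using g0 by simp_all
  have gF: "g False B \<le> g True B" "g sd B \<in> F" if "B \<in> BB" for B sd using g(1) that unfolding fs_def by auto
  obtain \<psi> where \<psi>: "preact (Suc n) \<psi>" "\<And>B. B \<in> BB \<Longrightarrow> \<psi> B = Iv (Fin (rr (g False B + 0))) (Fin (rr (g True B + 0)))"
    using preact_of_fs[OF g(1) zero_F] gF F_ok by (metis add.right_neutral)
  have "\<psi> B = Iv (Fin (g False B)) (Fin (g True B))" if "B \<in> BB" for B
    using \<psi>(2)[OF that] gF(2)[OF that] by (simp add: rr_Fz F_iff)
  moreover have "inPF (\<lambda>sd B. \<exists>\<beta>\<in>X. \<beta> sd B) R0 g B" if "B \<in> BB" for B
    unfolding inPF_def
  proof (intro conjI allI)
    fix sd show "if \<exists>\<beta>\<in>X. \<beta> sd B then eta' \<le> g sd B \<and> g sd B \<le> eta' + R0 else eta - R0 \<le> g sd B \<and> g sd B \<le> eta"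
      using g(2)[OF that, of sd] u R0_ge by (auto split: if_splits)
  qed (use gF that in auto)
  ultimately show ?thesis unfolding PF_def using \<psi>(1) by blast
qed

definition G :: nat where "G = K + 2"

lemma Bit_or:
  assumes "finite X" "\<And>\<beta>. \<beta> \<in> X \<Longrightarrow> Bit n \<beta>"
  shows "Bit (n + G) (\<lambda>sd B. \<exists>\<beta>\<in>X. \<beta> sd B)"
proof -
  have "Bit (Suc (Suc n + K)) (\<lambda>sd B. \<exists>\<beta>\<in>X. \<beta> sd B)"
    using assms by (intro PF_Bit or_PF) (auto simp: Bit_def monob_def)
  then show ?thesis by (simp add: G_def)
qed

lemma Bit_and:
  assumes "finite X" "\<And>\<beta>. \<beta> \<in> X \<Longrightarrow> Bit n \<beta>"
  shows "Bit (n + G) (\<lambda>sd B. \<forall>\<beta>\<in>X. \<beta> sd B)"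
proof -
  have "Bit (n + G) (neg (\<lambda>sd B. \<exists>\<beta>\<in>neg ` X. \<beta> sd B))"
    using assms by (intro Bit_neg Bit_or) (auto intro: Bit_neg)
  then show ?thesis by (simp add: neg_def)
qed

text \<open>Thresholds outside [-1, 1) are constant on the admissible boxes and are given by an
  empty conjunction or disjunction.\<close>

lemma Bit_thr:
  assumes "i < d"
  shows "Bit G (thr i k)"
proof -
  consider "fz k < - 1" | "- 1 \<le> fz k" "fz k < 1" | "1 \<le> fz k" by linarith
  then show ?thesis
  proof cases
    case 1
    have "Bit (0 + G) (\<lambda>sd B. \<forall>\<beta>\<in>{}. \<beta> sd B)" by (rule Bit_and) auto
    moreover have "thr i k sd B" if "B \<in> BB" for sd B unfolding thr_iff[OF that assms] using BB_nth(4)[OF that assms, of sd] 1 by linarith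
    ultimately show ?thesis using Bit_cong[of G _ "thr i k"] by simp
  next
    case 2
    then have "Bit (Suc (0 + K)) (thr i k)"
      using thr_PF[OF assms 2] PF_Bit[of "thr i k" 0] PF_Bit[of "neg (thr i k)" 0] Bit_neg[of _ "neg (thr i k)"] monob_thr[OF assms] by auto
    then show ?thesis by (rule Bit_lift[rotated]) (simp add: G_def)
  next
    case 3
    have "Bit (0 + G) (\<lambda>sd B. \<exists>\<beta>\<in>{}. \<beta> sd B)" by (rule Bit_or) auto
    moreover have "\<not> thr i k sd B" if "B \<in> BB" for sd B unfolding thr_iff[OF that assms] using BB_nth(4)[OF that assms, of sd] 3 by linarith
    ultimately show ?thesis using Bit_cong[of G _ "thr i k"] by simp
  qed
qed

text \<open>The exact abstraction of a predicate \<open>Q\<close>: its minimum (\<open>False\<close>) and maximum (\<open>True\<close>) over the box.\<close>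

definition lev :: "(fl list \<Rightarrow> bool) \<Rightarrow> bits" where
  "lev Q sd B \<longleftrightarrow> (if sd then \<exists>xs\<in>gamma_box E M B. Q xs else \<forall>xs\<in>gamma_box E M B. Q xs)"

lemma gamma_nth: "B \<in> BB \<Longrightarrow> i < d \<Longrightarrow> gamma E M (B ! i) = Fin ` {z \<in> F. endp False (B ! i) \<le> z \<and> z \<le> endp True (B ! i)}"
  using BB_nth(1) gamma_Fin by metis

lemma gamma_box_eq:
  "B \<in> BB \<Longrightarrow> gamma_box E M B = {map Fin zs |zs. length zs = d \<and> (\<forall>i<d. zs ! i \<in> F \<and> endp False (B ! i) \<le> zs ! i \<and> zs ! i \<le> endp True (B ! i))}"
  (is "_ \<Longrightarrow> _ = ?R")
proof -
  assume B: "B \<in> BB"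
  have len: "length B = d" using BB[OF B] by simp
  have "xs \<in> ?R" if "xs \<in> gamma_box E M B" for xs
  proof -
    have xs: "length xs = d" "\<And>i. i < d \<Longrightarrow> xs ! i \<in> Fin ` {z \<in> F. endp False (B ! i) \<le> z \<and> z \<le> endp True (B ! i)}"
      using that len gamma_nth[OF B] unfolding gamma_box_def by auto
    have e: "xs = map Fin (map fval xs)" using xs by (intro nth_equalityI) fastforce+
    have r: "map fval xs ! i \<in> F \<and> endp False (B ! i) \<le> map fval xs ! i \<and> map fval xs ! i \<le> endp True (B ! i)" if "i < d" for i
      using xs(2)[OF that] xs(1) that by auto
    have l: "length (map fval xs) = d" using xs(1) by simp
    show ?thesis unfolding mem_Collect_eq by (rule exI[of _ "map fval xs"], intro conjI, rule e, rule l, intro allI impI, rule r)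
  qed
  moreover have "xs \<in> gamma_box E M B" if "xs \<in> ?R" for xs
    using that len gamma_nth[OF B] unfolding gamma_box_def by auto
  ultimately show ?thesis by blast
qed

lemma Bit_lev: "Bit (G + G + G) (lev Q)"
proof -
  \<comment> \<open>Because \<open>neg\<close> exchanges the ends, the same conjunction says at the
    lower end that B lies inside C and at the upper end that B meets C.\<close>
  define sub where "sub C = (\<lambda>sd B. \<forall>\<beta>\<in>(\<lambda>i. thr i (fst (C ! i) - 1)) ` {..<d} \<union> (\<lambda>i. neg (thr i (snd (C ! i)))) ` {..<d}. \<beta> sd B)"
    for C :: "(int \<times> int) list"
  define in_box where "in_box C zs \<longleftrightarrow> length zs = d \<and> (\<forall>i<d. zs ! i \<in> F \<and> fz (fst (C ! i)) \<le> zs ! i \<and> zs ! i \<le> fz (snd (C ! i)))"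
    for C :: "(int \<times> int) list" and zs
  define X where "X = {C. set C \<subseteq> {- N..N} \<times> {- N..N} \<and> length C = d \<and> (\<forall>i<d. fst (C ! i) \<le> snd (C ! i)) \<and> (\<forall>zs. in_box C zs \<longrightarrow> Q (map Fin zs))}"
  have "finite X" unfolding X_def
    by (rule finite_subset[OF _ finite_lists_length_eq[of "{- N..N} \<times> {- N..N}" d]]) auto
  moreover have "Bit (G + G) \<beta>" if "\<beta> \<in> sub ` X" for \<beta>
    using that unfolding sub_def by (auto intro!: Bit_and Bit_neg Bit_thr)
  ultimately have or: "Bit (G + G + G) (\<lambda>sd B. \<exists>\<beta>\<in>sub ` X. \<beta> sd B)" by (intro Bit_or) auto
  have lt: "thr i (k - 1) sd B \<longleftrightarrow> fz k \<le> endp sd (B ! i)" "neg (thr i k) sd B \<longleftrightarrow> endp (\<not> sd) (B ! i) \<le> fz k" if "B \<in> BB" "i < d" for i k sd B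
    using thr_iff[OF that, of k "\<not> sd"] by (auto simp: thr_def neg_def)
  have sub: "sub C sd B \<longleftrightarrow> (\<forall>i<d. fz (fst (C ! i)) \<le> endp sd (B ! i) \<and> endp (\<not> sd) (B ! i) \<le> fz (snd (C ! i)))" if "B \<in> BB" for C sd B
  proof -
    have "sub C sd B \<longleftrightarrow> (\<forall>i<d. thr i (fst (C ! i) - 1) sd B \<and> neg (thr i (snd (C ! i))) sd B)"
      unfolding sub_def ball_Un ball_simps unfolding Ball_def lessThan_iff by (simp only: all_conj_distrib imp_conjR)
    also have "\<dots> \<longleftrightarrow> (\<forall>i<d. fz (fst (C ! i)) \<le> endp sd (B ! i) \<and> endp (\<not> sd) (B ! i) \<le> fz (snd (C ! i)))"
      by (intro all_cong arg_cong2[of _ _ _ _ "(\<and>)"] lt[OF that])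
    finally show ?thesis .
  qed
  have "lev Q sd B \<longleftrightarrow> (\<exists>C\<in>X. sub C sd B)" if B: "B \<in> BB" for sd B
  proof -
    have box: "gamma_box E M B = {map Fin zs |zs. length zs = d \<and> (\<forall>i<d. zs ! i \<in> F \<and> endp False (B ! i) \<le> zs ! i \<and> zs ! i \<le> endp True (B ! i))}"
      by (rule gamma_box_eq[OF B])
    have exC: "\<exists>C. set C \<subseteq> {- N..N} \<times> {- N..N} \<and> length C = d \<and> (\<forall>i<d. fz (fst (C ! i)) = x i \<and> fz (snd (C ! i)) = y i)"
      if xy: "\<And>i. i < d \<Longrightarrow> x i \<in> F \<and> y i \<in> F" for x y :: "nat \<Rightarrow> real"
    proof -
      have "\<forall>i. \<exists>kl. i < d \<longrightarrow> fz (fst kl) = x i \<and> fz (snd kl) = y i \<and> kl \<in> {- N..N} \<times> {- N..N}"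
      proof
        fix i show "\<exists>kl. i < d \<longrightarrow> fz (fst kl) = x i \<and> fz (snd kl) = y i \<and> kl \<in> {- N..N} \<times> {- N..N}"
      proof (cases "i < d")
        case True
        then obtain k l where "x i = fz k" "\<bar>k\<bar> \<le> N" "y i = fz l" "\<bar>l\<bar> \<le> N" using xy F_cases by metis
        then show ?thesis by (intro exI[of _ "(k, l)"]) auto
      qed auto
      qed
      from choice[OF this] obtain kl where kl: "\<forall>i. i < d \<longrightarrow> fz (fst (kl i)) = x i \<and> fz (snd (kl i)) = y i \<and> kl i \<in> {- N..N} \<times> {- N..N}" ..
      then show ?thesis by (intro exI[of _ "map kl [0..<d]"]) auto
    qed
    show ?thesis
    proof (cases sd)
      case False
      have "lev Q sd B \<longleftrightarrow> (\<forall>zs. length zs = d \<and> (\<forall>i<d. zs ! i \<in> F \<and> endp False (B ! i) \<le> zs ! i \<and> zs ! i \<le> endp True (B ! i)) \<longrightarrow> Q (map Fin zs))"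
        unfolding lev_def box using False by auto
      also have "\<dots> \<longleftrightarrow> (\<exists>C\<in>X. sub C sd B)"
      proof
        assume h: "\<forall>zs. length zs = d \<and> (\<forall>i<d. zs ! i \<in> F \<and> endp False (B ! i) \<le> zs ! i \<and> zs ! i \<le> endp True (B ! i)) \<longrightarrow> Q (map Fin zs)"
        obtain C where C: "set C \<subseteq> {- N..N} \<times> {- N..N}" "length C = d" "\<And>i. i < d \<Longrightarrow> fz (fst (C ! i)) = endp False (B ! i) \<and> fz (snd (C ! i)) = endp True (B ! i)"
          using exC[of "\<lambda>i. endp False (B ! i)" "\<lambda>i. endp True (B ! i)"] BB_nth(3)[OF B] by blast
        have "fst (C ! i) \<le> snd (C ! i)" if "i < d" for i
          using C(3)[OF that] BB_nth(2)[OF B that] fz_le by metis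
        then have "C \<in> X" unfolding X_def in_box_def using C h by auto
        moreover have "sub C sd B" unfolding sub[OF B] using C(3) False by simp
        ultimately show "\<exists>C\<in>X. sub C sd B" by blast
      next
        assume "\<exists>C\<in>X. sub C sd B"
        then obtain C where C: "C \<in> X" "sub C sd B" by blast
        have "in_box C zs" if "length zs = d" "\<forall>i<d. zs ! i \<in> F \<and> endp False (B ! i) \<le> zs ! i \<and> zs ! i \<le> endp True (B ! i)" for zs
          unfolding in_box_def using that C(2)[unfolded sub[OF B]] False by fastforce
        then show "\<forall>zs. length zs = d \<and> (\<forall>i<d. zs ! i \<in> F \<and> endp False (B ! i) \<le> zs ! i \<and> zs ! i \<le> endp True (B ! i)) \<longrightarrow> Q (map Fin zs)"
          using C(1) unfolding X_def by blast
      qed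
      finally show ?thesis .
    next
      case True
      have "lev Q sd B \<longleftrightarrow> (\<exists>zs. length zs = d \<and> (\<forall>i<d. zs ! i \<in> F \<and> endp False (B ! i) \<le> zs ! i \<and> zs ! i \<le> endp True (B ! i)) \<and> Q (map Fin zs))"
        unfolding lev_def box using True by auto
      also have "\<dots> \<longleftrightarrow> (\<exists>C\<in>X. sub C sd B)"
      proof
        assume "\<exists>zs. length zs = d \<and> (\<forall>i<d. zs ! i \<in> F \<and> endp False (B ! i) \<le> zs ! i \<and> zs ! i \<le> endp True (B ! i)) \<and> Q (map Fin zs)"
        then obtain zs where z: "length zs = d" "\<And>i. i < d \<Longrightarrow> zs ! i \<in> F \<and> endp False (B ! i) \<le> zs ! i \<and> zs ! i \<le> endp True (B ! i)" "Q (map Fin zs)" by blast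
        obtain C where C: "set C \<subseteq> {- N..N} \<times> {- N..N}" "length C = d" "\<And>i. i < d \<Longrightarrow> fz (fst (C ! i)) = zs ! i \<and> fz (snd (C ! i)) = zs ! i"
          using exC[of "\<lambda>i. zs ! i" "\<lambda>i. zs ! i"] z(2) by blast
        have "zs' = zs" if "in_box C zs'" for zs'
          using that C(3) z(1) unfolding in_box_def by (intro nth_equalityI) (auto intro!: order_antisym)
        moreover have "fst (C ! i) \<le> snd (C ! i)" if "i < d" for i
          using C(3)[OF that] fz_le[of "fst (C ! i)" "snd (C ! i)"] by simp
        ultimately have "C \<in> X" unfolding X_def using C z(3) by auto
        moreover have "sub C sd B" unfolding sub[OF B] using C(3) z(2) True by simp
        ultimately show "\<exists>C\<in>X. sub C sd B" by blast
      next
        assume "\<exists>C\<in>X. sub C sd B"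
        then obtain C where C: "C \<in> X" "sub C sd B" by blast
        have meet: "fz (fst (C ! i)) \<le> endp True (B ! i)" "endp False (B ! i) \<le> fz (snd (C ! i))"
          "fz (fst (C ! i)) \<le> fz (snd (C ! i))" "fz (fst (C ! i)) \<in> F" if "i < d" for i
        proof -
          show "fz (fst (C ! i)) \<le> endp True (B ! i)" "endp False (B ! i) \<le> fz (snd (C ! i))"
            using C(2) that True unfolding sub[OF B] by auto
          have "C ! i \<in> {- N..N} \<times> {- N..N}" "fst (C ! i) \<le> snd (C ! i)" using C(1) that nth_mem[of i C] unfolding X_def by auto
          then show "fz (fst (C ! i)) \<le> fz (snd (C ! i))" "fz (fst (C ! i)) \<in> F" by (auto simp: F_fz abs_le_iff)
        qed
        \<comment> \<open>A common point of B and C: coordinatewise the larger of the two lower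
          ends.\<close>
        define zs where "zs = map (\<lambda>i. max (fz (fst (C ! i))) (endp False (B ! i))) [0..<d]"
        have zs: "length zs = d" "\<And>i. i < d \<Longrightarrow> zs ! i = max (fz (fst (C ! i))) (endp False (B ! i))" by (auto simp: zs_def)
        have zF: "zs ! i \<in> F" if "i < d" for i using zs(2)[OF that] meet(4)[OF that] BB_nth(3)[OF B that] by (simp add: max_def)
        have "in_box C zs" unfolding in_box_def using zs meet zF by auto
        then have "Q (map Fin zs)" using C(1) unfolding X_def by blast
        moreover have "zs ! i \<in> F \<and> endp False (B ! i) \<le> zs ! i \<and> zs ! i \<le> endp True (B ! i)" if "i < d" for i
          using zF[OF that] zs(2)[OF that] meet[OF that] BB_nth(2)[OF B that] by auto
        ultimately show "\<exists>zs. length zs = d \<and> (\<forall>i<d. zs ! i \<in> F \<and> endp False (B ! i) \<le> zs ! i \<and> zs ! i \<le> endp True (B ! i)) \<and> Q (map Fin zs)"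
          using zs(1) by blast
      qed
      finally show ?thesis .
    qed
  qed
  then show ?thesis by (intro Bit_cong[OF or]) simp
qed

end

section \<open>The output neuron\<close>

context fp
begin

lemma ext_rnd_mono:
  assumes "x \<le> y"
  shows "ext (rnd E M x) \<le> ext (rnd E M y)"
proof -
  define h where "h = p2 (b - m) / 2"
  have h: "0 < h" by (simp add: h_def)
  have c: "rnd E M z = MInf \<and> z \<le> - Om - h \<or> - Om - h < z \<and> z < Om + h \<and> rnd E M z = Fin (rr z) \<or> rnd E M z = PInf \<and> Om + h \<le> z" for z
    using rnd_MInf[of z] rnd_PInf[of z] rnd_ok[of z] ok_iff[of z] unfolding h_def[symmetric] by (auto simp: abs_less_iff not_less)
  show ?thesis
    using c[of x] c[of y] assms h Om_pos rr_mono[OF assms] by auto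
qed

lemma rnd_not_NaN: "rnd E M x \<noteq> NaN"
  unfolding rnd_def Let_def by simp

lemma fadd_not_NaN: "u \<noteq> NaN \<Longrightarrow> fadd E M u (Fin l) \<noteq> NaN"
  using rnd_not_NaN by (cases u) auto

lemma fadd_mono:
  assumes "u \<noteq> NaN" "u' \<noteq> NaN" "ext u \<le> ext u'" "l \<le> l'"
  shows "ext (fadd E M u (Fin l)) \<le> ext (fadd E M u' (Fin l'))"
  using assms ext_rnd_mono by (cases u; cases u') auto

end

context nets
begin

text \<open>Unlike \<open>fs\<close>, the partial sums described by \<open>es\<close> may be infinite.\<close>

definition es :: "nat \<Rightarrow> (bool \<Rightarrow> ival list \<Rightarrow> fl) \<Rightarrow> bool" where
  "es n g \<longleftrightarrow> (\<exists>\<phi>. psum (Suc n) \<phi> \<and> (\<forall>B\<in>BB. \<phi> B = Iv (g False B) (g True B) \<and> ext (g False B) \<le> ext (g True B) \<and>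
     (\<forall>sd. fvalid E M (g sd B) \<and> g sd B \<noteq> NaN)))"

lemma fs_es: "fs n g \<Longrightarrow> es n (\<lambda>sd B. Fin (g sd B))"
  unfolding fs_def es_def by auto

text \<open>The added interval is finite, so opposite infinities never meet and no NaN
  arises.\<close>

lemma iadd_ext:
  assumes "x \<noteq> NaN" "y \<noteq> NaN" "ext x \<le> ext y" "l \<le> u"
  shows "iadd (Iv x y) (Iv (Fin l) (Fin u)) = Iv (fadd E M x (Fin l)) (fadd E M y (Fin u))"
  unfolding iop.simps
proof (rule fhullI)
  show "NaN \<notin> {fadd E M x (Fin l), fadd E M x (Fin u), fadd E M y (Fin l), fadd E M y (Fin u)}"
    using fadd_not_NaN assms(1,2) by (auto simp: eq_commute[of NaN])
  fix z assume "z \<in> {fadd E M x (Fin l), fadd E M x (Fin u), fadd E M y (Fin l), fadd E M y (Fin u)}"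
  then show "ext (fadd E M x (Fin l)) \<le> ext z \<and> ext z \<le> ext (fadd E M y (Fin u))"
    using fadd_mono assms by auto
qed auto

lemma es_step:
  assumes "es n g" "ts n t"
  shows "es n (\<lambda>sd B. fadd E M (g sd B) (Fin (t sd B)))"
proof -
  obtain \<phi> where \<phi>: "psum (Suc n) \<phi>" "\<And>B. B \<in> BB \<Longrightarrow> \<phi> B = Iv (g False B) (g True B) \<and> ext (g False B) \<le> ext (g True B) \<and>
     (\<forall>sd. fvalid E M (g sd B) \<and> g sd B \<noteq> NaN)"
    using assms(1) unfolding es_def by blast
  let ?\<phi> = "\<lambda>B. iadd (\<phi> B) (Iv (Fin (t False B)) (Fin (t True B)))"
  have "?\<phi> B = Iv (fadd E M (g False B) (Fin (t False B))) (fadd E M (g True B) (Fin (t True B)))" if "B \<in> BB" for B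
    unfolding \<phi>(2)[OF that, THEN conjunct1] using \<phi>(2)[OF that] ts_ordered(1)[OF assms(2) that] by (intro iadd_ext) auto
  moreover have "ext (fadd E M (g False B) (Fin (t False B))) \<le> ext (fadd E M (g True B) (Fin (t True B)))" if "B \<in> BB" for B
    using \<phi>(2)[OF that] ts_ordered(1)[OF assms(2) that] by (intro fadd_mono) auto
  moreover have "fvalid E M (fadd E M (g sd B) (Fin (t sd B))) \<and> fadd E M (g sd B) (Fin (t sd B)) \<noteq> NaN" if "B \<in> BB" for sd B
    using \<phi>(2)[OF that] ts_ordered(2)[OF assms(2) that] by (intro conjI fvalid_fadd fadd_not_NaN) auto
  ultimately show ?thesis unfolding es_def using psum_step[OF \<phi>(1) assms(2)] by blast
qed

end

context gates
begin

section \<open>Extremes of the target over a box\<close>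

lemma gamma_box_finite: "B \<in> BB \<Longrightarrow> finite (gamma_box E M B)" and gamma_box_nonempty: "B \<in> BB \<Longrightarrow> gamma_box E M B \<noteq> {}"
proof -
  assume B: "B \<in> BB"
  have "gamma_box E M B \<subseteq> map Fin ` {zs. set zs \<subseteq> F \<and> length zs = d}"
    unfolding gamma_box_eq[OF B] by (auto simp: set_conv_nth)
  then show "finite (gamma_box E M B)" using finite_lists_length_eq[OF finite_F] finite_subset by blast
  have "map Fin (map (\<lambda>i. endp False (B ! i)) [0..<d]) \<in> gamma_box E M B"
    unfolding gamma_box_eq[OF B] using BB_nth(2,3)[OF B]
    by (intro CollectI exI[of _ "map (\<lambda>i. endp False (B ! i)) [0..<d]"]) simp
  then show "gamma_box E M B \<noteq> {}" by blast
qed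

definition extr :: "(fl list \<Rightarrow> fl) \<Rightarrow> bool \<Rightarrow> ival list \<Rightarrow> fl" where
  "extr \<phi> sd B = of_ext ((if sd then Max else Min) (ext ` \<phi> ` gamma_box E M B))"

text \<open>The extremes are attained on the finite box, so a predicate that increases with the
  target value is decided by the extreme at the same end. Being \<open>MInf\<close> decreases with
  the value, which is why its bit is read at the opposite end.\<close>

lemma extr:
  assumes B: "B \<in> BB" and \<phi>: "\<And>xs. fvalid E M (\<phi> xs) \<and> \<phi> xs \<noteq> NaN"
  shows "fvalid E M (extr \<phi> sd B)" "extr \<phi> sd B \<noteq> NaN"
    and "lev (\<lambda>xs. x \<le> ext (\<phi> xs)) sd B \<longleftrightarrow> x \<le> ext (extr \<phi> sd B)"
    and "lev (\<lambda>xs. \<phi> xs = MInf) (\<not> sd) B \<longleftrightarrow> extr \<phi> sd B = MInf"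
proof -
  let ?S = "ext ` \<phi> ` gamma_box E M B"
  have fin: "finite ?S" "?S \<noteq> {}" using gamma_box_finite[OF B] gamma_box_nonempty[OF B] by auto
  have "(if sd then Max else Min) ?S \<in> ?S" using Max_in[OF fin] Min_in[OF fin] by simp
  then obtain xs where xs: "xs \<in> gamma_box E M B" "(if sd then Max else Min) ?S = ext (\<phi> xs)" by blast
  have e: "extr \<phi> sd B = \<phi> xs" unfolding extr_def xs(2) using of_ext_ext \<phi> by blast
  then show "fvalid E M (extr \<phi> sd B)" "extr \<phi> sd B \<noteq> NaN" using \<phi> by simp_all
  have le: "if sd then ext (\<phi> ys) \<le> ext (\<phi> xs) else ext (\<phi> xs) \<le> ext (\<phi> ys)" if "ys \<in> gamma_box E M B" for ys
    using Max_ge[OF fin(1), of "ext (\<phi> ys)"] Min_le[OF fin(1), of "ext (\<phi> ys)"] that xs(2) by (cases sd) auto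
  show "lev (\<lambda>xs. x \<le> ext (\<phi> xs)) sd B \<longleftrightarrow> x \<le> ext (extr \<phi> sd B)"
  proof (cases sd)
    case True
    then have "ext (\<phi> ys) \<le> ext (\<phi> xs)" if "ys \<in> gamma_box E M B" for ys using le[OF that] by simp
    then show ?thesis unfolding lev_def e using True xs(1) by (auto intro: order_trans)
  next
    case False
    then have "ext (\<phi> xs) \<le> ext (\<phi> ys)" if "ys \<in> gamma_box E M B" for ys using le[OF that] by simp
    then show ?thesis unfolding lev_def e using False xs(1) by (auto intro: order_trans)
  qed
  have M: "\<phi> ys = MInf \<longleftrightarrow> ext (\<phi> ys) \<le> - \<infinity>" for ys by (cases "\<phi> ys") auto
  show "lev (\<lambda>xs. \<phi> xs = MInf) (\<not> sd) B \<longleftrightarrow> extr \<phi> sd B = MInf"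
  proof (cases sd)
    case True
    then have "ext (\<phi> ys) \<le> ext (\<phi> xs)" if "ys \<in> gamma_box E M B" for ys using le[OF that] by simp
    then show ?thesis unfolding lev_def e M using True xs(1) by (simp only: not_True_eq_False if_False) (blast intro: order_trans)
  next
    case False
    then have "ext (\<phi> xs) \<le> ext (\<phi> ys)" if "ys \<in> gamma_box E M B" for ys using le[OF that] by simp
    then show ?thesis unfolding lev_def e M using False xs(1) by (simp only: not_False_eq_True if_True) (blast intro: order_trans)
  qed
qed

text \<open>The partial sum of the output neuron after the terms of all levels up to \<open>fz k\<close>.\<close>

definition cap :: "int \<Rightarrow> fl \<Rightarrow> fl" where
  "cap k y = (if y = MInf then MInf else if ext y \<le> ereal (fz k) then y else Fin (fz k))"

text \<open>\<open>MInf\<close> absorbs every finite summand, and \<open>PInf\<close> is carried as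
  the current float \<open>fz k\<close> until a final term overflows.\<close>

lemma cap_step:
  assumes y: "fvalid E M y" "y \<noteq> NaN" and k: "- N \<le> k" "k < N" and c: "gap k / 2 < c" "c \<le> gap k"
  shows "fadd E M (cap k y) (Fin (if ereal (fz (k + 1)) \<le> ext y then c else 0)) = cap (k + 1) y"
proof -
  have F: "fz k \<in> F" "fz (k + 1) \<in> F" using k by (auto simp: F_fz)
  have up: "rnd E M (fz k + c) = Fin (fz (k + 1))"
  proof -
    have "\<bar>fz k\<bar> \<le> Om" "\<bar>fz (k + 1)\<bar> \<le> Om" using F by (simp_all add: F_iff)
    then have "\<bar>fz k + c\<bar> \<le> Om" using c gap_pos[of k] gap_def[of k] by linarith
    then show ?thesis using rnd_ok[OF okI, of "fz k + c"] rr_step_up(1)[OF c] by simp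
  qed
  have id: "rnd E M x = Fin x" if "x \<in> F" for x using rnd_ok[OF F_ok[OF that]] rr_Fz that by (simp add: F_iff)
  show ?thesis
  proof (cases y)
    case (Fin r)
    then obtain l where l: "r = fz l" "\<bar>l\<bar> \<le> N" using y F_cases by auto
    then show ?thesis using Fin up id[of "fz l"] id[OF F(1)] F_fz[of l]
      by (cases "l \<le> k"; cases "l = k + 1") (auto simp: cap_def)
  qed (use y up in \<open>auto simp: cap_def\<close>)
qed

theorem output_neuron:
  assumes \<phi>: "\<And>xs. fvalid E M (\<phi> xs) \<and> \<phi> xs \<noteq> NaN"
  obtains \<psi> n where "preact n \<psi>" "\<And>B. B \<in> BB \<Longrightarrow> \<psi> B = Iv (extr \<phi> False B) (extr \<phi> True B)"
proof -
  define n where "n = G + G + G"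
  have trm: "\<exists>t. ts n t \<and> (\<forall>B\<in>BB. \<forall>sd. t sd B = (if lev Q sd B then c else 0))"
    if "w \<in> F" "0 \<le> w" "ok (\<bar>v\<bar> * w)" "c = rr (\<bar>v\<bar> * w)" for Q c w
  proof -
    have "BT n (lev Q) \<bar>v\<bar>" using Bit_lev[of Q] unfolding Bit_def n_def by blast
    then have "tbit n (lev Q) 0 c" unfolding BT_def using that by blast
    then show ?thesis unfolding tbit_def .
  qed
  note ex = extr[where \<phi> = \<phi>, OF _ \<phi>]
  define R where "R k \<longleftrightarrow> (\<exists>g. es n g \<and> (\<forall>B\<in>BB. \<forall>sd. g sd B = cap k (extr \<phi> sd B)))" for k
  have N0: "0 < N"
    using odd_N N_nonneg by (cases "N = 0") auto
  \<comment> \<open>A summand above half of this gap overflows when it is added to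
    \<open>Om\<close>, and its negative does so at - \<open>Om\<close>. It serves both infinite
    values.\<close>
  have gN: "gap (N - 1) = p2 (b - m)"
  proof (rule gap_form[OF a_le_b])
    have "fz (N + 1) = fz (idx (b + 1))" using fz_N1 fz_idx[of "b + 1"] a_le_b by simp
    then have "N + 1 = idx b + 2 ^ M" using idx_Suc[of b] by simp
    moreover have "(2::int) ^ 1 \<le> 2 ^ M" using M3 by (intro power_increasing) auto
    ultimately show "idx b \<le> N - 1" "N - 1 < idx (b + 1)" using idx_Suc[of b] by auto
  qed
  obtain c w where c: "p2 (b - m) / 2 < c" "c \<le> p2 (b - m)" and w: "w \<in> F" "0 \<le> w" "ok (\<bar>v\<bar> * w)" "c = rr (\<bar>v\<bar> * w)"
    using K_gap[OF strong_v, of "N - 1"] N0 unfolding gN by auto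
  have OF: "Om \<in> F" "- Om \<in> F" using Om_F F_minus by auto
  have id: "rnd E M x = Fin x" if "x \<in> F" for x using rnd_ok[OF F_ok[OF that]] rr_Fz that by (simp add: F_iff)
  have "R (- N)"
  proof -
    obtain g where g: "fs n g" "\<And>B sd. B \<in> BB \<Longrightarrow> g sd B = fz (- N)" by (rule fs_const[of "- N"]) (use N0 in auto)
    \<comment> \<open>Negative infinity has to be produced before any other term, while the sum is
      still - \<open>Om\<close>. Its bit is on for low target values, so the term enters negated
      with its ends exchanged.\<close>
    obtain t where t: "ts n t" "\<And>B sd. B \<in> BB \<Longrightarrow> t sd B = (if lev (\<lambda>xs. \<phi> xs = MInf) sd B then c else 0)" using trm[OF w] by blast
    have "fadd E M (Fin (g sd B)) (Fin (- t (\<not> sd) B)) = cap (- N) (extr \<phi> sd B)" if B: "B \<in> BB" for B sd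
    proof (cases "extr \<phi> sd B = MInf")
      case True
      then show ?thesis using ex(4)[OF B, of sd] t(2)[OF B] g(2)[OF B] rnd_MInf[of "- Om - c"] c by (simp add: cap_def fz_minus fz_N)
    next
      case False
      have "extr \<phi> sd B = Fin (- Om)" if "ext (extr \<phi> sd B) \<le> ereal (- Om)"
        using that ex(1,2)[OF B, of sd] False by (cases "extr \<phi> sd B") (auto simp: F_iff)
      then show ?thesis using False ex(4)[OF B, of sd] t(2)[OF B] g(2)[OF B] id[OF OF(2)] by (simp add: cap_def fz_minus fz_N)
    qed
    then show ?thesis unfolding R_def using es_step[OF fs_es[OF g(1)] ts_neg[OF t(1)]] by blast
  qed
  moreover have "R (k + 1)" if k: "- N \<le> k" "k < N" "R k" for k
  proof -
    obtain g where g: "es n g" "\<And>B sd. B \<in> BB \<Longrightarrow> g sd B = cap k (extr \<phi> sd B)" using k(3) unfolding R_def by blast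
    obtain c w where c: "gap k / 2 < c" "c \<le> gap k" and w: "w \<in> F" "0 \<le> w" "ok (\<bar>v\<bar> * w)" "c = rr (\<bar>v\<bar> * w)"
      using K_gap[OF strong_v k(1,2)] by metis
    obtain t where t: "ts n t" "\<And>B sd. B \<in> BB \<Longrightarrow> t sd B = (if lev (\<lambda>xs. ereal (fz (k + 1)) \<le> ext (\<phi> xs)) sd B then c else 0)" using trm[OF w] by blast
    have "fadd E M (g sd B) (Fin (t sd B)) = cap (k + 1) (extr \<phi> sd B)" if B: "B \<in> BB" for B sd
      unfolding g(2)[OF B] t(2)[OF B] ex(3)[OF B] by (rule cap_step[OF ex(1,2)[OF B] k(1,2) c])
    then show ?thesis unfolding R_def using es_step[OF g(1) t(1)] by blast
  qed
  ultimately have "R N" using step_up_index[of "- N" N R] N0 by auto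
  then obtain g where g: "es n g" "\<And>B sd. B \<in> BB \<Longrightarrow> g sd B = cap N (extr \<phi> sd B)" unfolding R_def by blast
  \<comment> \<open>At this point an infinite maximum or minimum is still represented by
    \<open>Om\<close>; the last term makes it overflow.\<close>
  obtain t where t: "ts n t" "\<And>B sd. B \<in> BB \<Longrightarrow> t sd B = (if lev (\<lambda>xs. \<infinity> \<le> ext (\<phi> xs)) sd B then c else 0)" using trm[OF w] by blast
  have val: "fadd E M (g sd B) (Fin (t sd B)) = extr \<phi> sd B" if B: "B \<in> BB" for B sd
    unfolding g(2)[OF B] t(2)[OF B] ex(3)[OF B] cap_def fz_N
    using ex(1,2)[OF B, of sd] rnd_PInf[of "Om + c"] c id by (cases "extr \<phi> sd B") (auto simp: F_iff)
  obtain \<chi> where \<chi>: "psum (Suc n) \<chi>" "\<And>B. B \<in> BB \<Longrightarrow> \<chi> B = Iv (extr \<phi> False B) (extr \<phi> True B) \<and> ext (extr \<phi> False B) \<le> ext (extr \<phi> True B)"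
    using es_step[OF g(1) t(1)] val unfolding es_def by auto
  have wf: "wf (\<chi> B)" if "B \<in> BB" for B
    using \<chi>(2)[OF that] ex(1,2)[OF that] by (simp add: wf_ival_def)
  have "preact (Suc n) (\<lambda>B. iadd (\<chi> B) (pt 0))" unfolding preact_def using \<chi>(1) zero_F by blast
  moreover have "iadd (\<chi> B) (pt 0) = Iv (extr \<phi> False B) (extr \<phi> True B)" if "B \<in> BB" for B
    using iadd_0(1)[OF wf[OF that]] \<chi>(2)[OF that] by simp
  ultimately show ?thesis using that by blast
qed

end

context cnet
begin

section \<open>Assembling the network for all admissible boxes\<close>

lemma network_exists:
  assumes \<phi>: "\<And>xs. fvalid E M (\<phi> xs) \<and> \<phi> xs \<noteq> NaN"
  shows "\<exists>ls. wf_net E M d 1 ls \<and> (\<forall>B\<in>BB. net_sharp E M \<sigma> ls B =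
    [Iv (of_ext (Min (ext ` \<phi> ` gamma_box E M B))) (of_ext (Max (ext ` \<phi> ` gamma_box E M B)))])"
proof -
  obtain p q v K where pq: "good_pair p q v"
    "\<And>n \<beta>. monob \<beta> \<Longrightarrow> PF n \<beta> R0 \<Longrightarrow> BT (n + K) \<beta> \<bar>v\<bar> \<or> BT (n + K) (neg \<beta>) \<bar>v\<bar>"
    using strong_bits by blast
  interpret gates E M \<sigma> d BB c1 c2 s0 sg lam ie p q v K
    using pq by unfold_locales blast+
  obtain \<psi> n where \<psi>: "preact n \<psi>" "\<And>B. B \<in> BB \<Longrightarrow> \<psi> B = Iv (extr \<phi> False B) (extr \<phi> True B)"
    by (rule output_neuron[where \<phi> = \<phi>, OF \<phi>]) blast
  obtain ls where ls: "wf_net E M d (length [\<psi>]) ls" "\<forall>B\<in>BB. net_sharp E M \<sigma> ls B = map (\<lambda>\<psi>. \<psi> B) [\<psi>]"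
    using realize[of "[\<psi>]" n] \<psi>(1) by auto
  have "wf_net E M d 1 ls" using ls(1) by simp
  moreover have "\<forall>B\<in>BB. net_sharp E M \<sigma> ls B =
    [Iv (of_ext (Min (ext ` \<phi> ` gamma_box E M B))) (of_ext (Max (ext ` \<phi> ` gamma_box E M B)))]"
    using ls(2) \<psi>(2) by (simp add: extr_def)
  ultimately show ?thesis by blast
qed

end

context fp
begin

text \<open>A point of the box is fixed and one coordinate is varied over the whole component, which
  therefore consists of reals in [-1, 1]. In particular it cannot be \<open>Top\<close>, which
  contains NaN.\<close>

lemma box_component:
  assumes wf: "\<forall>I\<in>set B. wf_ival E M I" and sub: "gamma_box E M B \<subseteq> {xs. \<forall>v\<in>set xs. \<exists>r. v = Fin r \<and> -1 \<le> r \<and> r \<le> 1}"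
    and I: "I \<in> set B"
  shows "\<exists>l u. I = Iv (Fin l) (Fin u) \<and> l \<in> F \<and> u \<in> F \<and> - 1 \<le> l \<and> l \<le> u \<and> u \<le> 1"
proof -
  define pick where "pick J = (case J of Top \<Rightarrow> NaN | Iv x y \<Rightarrow> x)" for J
  have pick: "pick J \<in> gamma E M J" if "J \<in> set B" for J
    using wf that by (cases J) (auto simp: pick_def wf_ival_def fvalid_def)
  obtain i where i: "i < length B" "I = B ! i" using I by (auto simp: in_set_conv_nth)
  have in_range: "\<exists>r. x = Fin r \<and> -1 \<le> r \<and> r \<le> 1" if "x \<in> gamma E M I" for x
  proof -
    have "(map pick B)[i := x] \<in> gamma_box E M B"
      using that pick i unfolding gamma_box_def by (auto simp: nth_list_update)
    then have "\<forall>v\<in>set ((map pick B)[i := x]). \<exists>r. v = Fin r \<and> -1 \<le> r \<and> r \<le> 1" using sub by blast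
    moreover have "x \<in> set ((map pick B)[i := x])" using i(1) by (intro set_update_memI) simp
    ultimately show ?thesis by blast
  qed
  have "wf_ival E M I" using wf I by blast
  show ?thesis
  proof (cases I)
    case Top
    then show ?thesis using in_range[of NaN] by (simp add: fvalid_def)
  next
    case (Iv x y)
    then have xy: "x \<in> gamma E M I" "y \<in> gamma E M I" using \<open>wf_ival E M I\<close> by (auto simp: wf_ival_def)
    then obtain l u where "x = Fin l" "-1 \<le> l" "y = Fin u" "u \<le> 1" using in_range by meson
    then show ?thesis using Iv \<open>wf_ival E M I\<close> by (auto simp: wf_ival_def fvalid_def F_def)
  qed
qed

end

context nets
begin

lemma cond1_cnet:
  assumes "cond1 E M \<sigma>"
  shows "\<exists>c1 c2 s0 sg lam ie. cnet E M \<sigma> d BB c1 c2 s0 sg lam ie"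
proof -
  have eps: "feps M = p2 (- m - 1)" by (simp add: feps_def p2_def)
  obtain c1 c2 s where C1: "c1 \<in> F" "c2 \<in> F" "\<sigma> (Fin c1) = Fin 0" "\<sigma> (Fin c2) = Fin s"
      "feps M / 2 + 2 * feps M ^ 2 \<le> \<bar>s\<bar>" "\<bar>s\<bar> \<le> 5 / 4 - 2 * feps M"
      "\<And>x. x \<in> F \<Longrightarrow> min c1 c2 \<le> x \<and> x \<le> max c1 c2 \<Longrightarrow> \<exists>t. \<sigma> (Fin x) = Fin t \<and> min 0 s \<le> t \<and> t \<le> max 0 s"
    using assms[unfolded cond1_def, THEN conjunct1] unfolding F_def by blast
  obtain \<eta> A0 A1 lam where C2: "\<eta> \<in> F" "p2 (a + 5) \<le> \<bar>\<eta>\<bar>" "\<bar>\<eta>\<bar> \<le> 4 - 8 * feps M"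
      "\<sigma> (Fin \<eta>) = Fin A0" "\<sigma> (fsucc E M \<eta>) = Fin A1" "p2 (a + 5) \<le> \<bar>A0\<bar>"
      "\<bar>A0\<bar> \<le> p2 (b - 6) * \<bar>\<eta>\<bar>" "\<bar>A1\<bar> \<le> p2 (b - 6) * \<bar>\<eta>\<bar>"
      "\<And>x y. x \<in> F \<Longrightarrow> y \<in> F \<Longrightarrow> x \<le> \<eta> \<and> fle (fsucc E M \<eta>) (Fin y) \<Longrightarrow>
           (fle (\<sigma> (Fin x)) (\<sigma> (Fin \<eta>)) \<and> fless (\<sigma> (Fin \<eta>)) (\<sigma> (fsucc E M \<eta>)) \<and>
            fle (\<sigma> (fsucc E M \<eta>)) (\<sigma> (Fin y)))
         \<or> (fle (\<sigma> (Fin \<eta>)) (\<sigma> (Fin x)) \<and> fless (\<sigma> (fsucc E M \<eta>)) (\<sigma> (Fin \<eta>)) \<and>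
            fle (\<sigma> (Fin y)) (\<sigma> (fsucc E M \<eta>)))"
      "0 \<le> lam" "lam \<le> p2 (b - 7) * min \<bar>A0\<bar> (2 ^ (M + 3))"
      "\<And>x y. x \<in> F \<Longrightarrow> y \<in> F \<Longrightarrow> x \<le> \<eta> \<and> fle (fsucc E M \<eta>) (Fin y) \<Longrightarrow>
              (\<exists>t. \<sigma> (Fin x) = Fin t \<and> \<bar>t - A0\<bar> \<le> lam * \<bar>x - \<eta>\<bar>) \<and>
              (\<exists>t. \<sigma> (Fin y) = Fin t \<and> \<bar>t - A1\<bar> \<le> lam * \<bar>y - fval (fsucc E M \<eta>)\<bar>)"
    using assms[unfolded cond1_def p2_def[symmetric], THEN conjunct2] unfolding F_def by (elim bexE exE conjE) (erule meta_allE | assumption | blast)+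
  obtain ie where ie: "\<eta> = fz ie" "\<bar>ie\<bar> \<le> N" using C2(1) F_cases by blast
  have "0 < feps M" by (simp add: eps)
  then have lt4: "\<bar>fz ie\<bar> < 4" using C2(3) ie(1) by linarith
  have i2: "fz (idx 2) = 4" using fz_idx[of 2] ab b15 by simp
  have "4 \<le> Om" using p2_le_Om[of 2] b15 by simp
  then have "fz ie < fz N" unfolding fz_N using lt4 by linarith
  then have su: "fsucc E M \<eta> = Fin (fz (ie + 1))" using succ_fz ie by simp
  have "fz ie < fz (idx 2)" using lt4 i2 by linarith
  then have "fz (ie + 1) \<le> fz (idx 2)" by simp
  moreover have "fz ie < fz (ie + 1)" by simp
  ultimately have le4: "\<bar>fz (ie + 1)\<bar> \<le> 4" using lt4 i2 by linarith
  have F1: "fz ie \<in> F" "fz (ie + 1) \<in> F" using le4 lt4 \<open>4 \<le> Om\<close> by (auto simp: F_iff)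
  have sv: "sv (fz ie) = A0" "sv (fz (ie + 1)) = A1" using C2(4) C2(5)[unfolded su] ie(1) by (simp_all add: sv_def)
  have dir: "A0 < A1 \<or> A1 < A0"
  proof -
    have "fz ie \<le> \<eta> \<and> fle (fsucc E M \<eta>) (Fin (fz (ie + 1)))" using su ie(1) by (simp add: fle_def)
    from C2(9)[OF F1 this] show ?thesis using C2(4,5) by (auto simp: fless_def)
  qed
  \<comment> \<open>Which alternative of (C2) holds is decided by the values at \<eta> and its
    successor alone, so one direction applies to all x and y.\<close>
  define sg :: real where "sg = (if A0 < A1 then 1 else - 1)"
  have left: "\<sigma> (Fin x) = Fin (sv x) \<and> sg * sv x \<le> sg * A0 \<and> \<bar>sv x - A0\<bar> \<le> lam * (fz ie - x)" if x: "x \<in> F" "x \<le> fz ie" for x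
  proof -
    have h: "x \<le> \<eta> \<and> fle (fsucc E M \<eta>) (Fin (fz (ie + 1)))" using x su ie(1) by (simp add: fle_def)
    obtain t where t: "\<sigma> (Fin x) = Fin t" "\<bar>t - A0\<bar> \<le> lam * \<bar>x - \<eta>\<bar>" using C2(12)[OF x(1) F1(2) h] by blast
    have "sg * t \<le> sg * A0" using C2(9)[OF x(1) F1(2) h] t(1) C2(4,5) by (auto simp: fle_def fless_def sg_def)
    then show ?thesis using t x ie(1) by (simp add: sv_def)
  qed
  have right: "\<sigma> (Fin x) = Fin (sv x) \<and> sg * A1 \<le> sg * sv x \<and> \<bar>sv x - A1\<bar> \<le> lam * (x - fz (ie + 1))" if x: "x \<in> F" "fz (ie + 1) \<le> x" for x
  proof -
    have h: "fz ie \<le> \<eta> \<and> fle (fsucc E M \<eta>) (Fin x)" using x su ie(1) by (simp add: fle_def)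
    obtain t where t: "\<sigma> (Fin x) = Fin t" "\<bar>t - A1\<bar> \<le> lam * \<bar>x - fval (fsucc E M \<eta>)\<bar>" using C2(12)[OF F1(1) x(1) h] by blast
    have "sg * A1 \<le> sg * t" using C2(9)[OF F1(1) x(1) h] t(1) C2(4,5) by (auto simp: fle_def fless_def sg_def)
    then show ?thesis using t x su by (simp add: sv_def)
  qed
  have "cnet E M \<sigma> d BB c1 c2 s sg lam ie"
  proof unfold_locales
    show "c1 \<in> F" "c2 \<in> F" "\<sigma> (Fin c1) = Fin 0" "\<sigma> (Fin c2) = Fin s" using C1(1-4) .
    have e: "- m - 2 + 1 = - m - 1" "- 2 * m - 2 + 1 = - 2 * m - 1" "(- m - 1) + (- m - 1) = - 2 * m - 2" by simp_all
    have "p2 (- m - 1) = 2 * p2 (- m - 2)" using p2_Suc[of "- m - 2"] unfolding e(1) .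
    moreover have "p2 (- 2 * m - 1) = 2 * (p2 (- m - 1) * p2 (- m - 1))"
      using p2_Suc[of "- 2 * m - 2"] p2_add[of "- m - 1" "- m - 1"] unfolding e(2,3) by linarith
    ultimately have "feps M / 2 = p2 (- m - 2)" "2 * feps M ^ 2 = p2 (- 2 * m - 1)"
      unfolding eps power2_eq_square by linarith+
    then show "p2 (- m - 2) + p2 (- 2 * m - 1) \<le> \<bar>s\<bar>" using C1(5) by simp
    show "\<bar>s\<bar> \<le> 5 / 4" using C1(6) \<open>0 < feps M\<close> by linarith
    show "\<sigma> (Fin z) = Fin (sv z) \<and> min 0 s \<le> sv z \<and> sv z \<le> max 0 s" if "z \<in> F" "min c1 c2 \<le> z" "z \<le> max c1 c2" for z
      using C1(7)[OF that(1)] that(2,3) by (auto simp: sv_def)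
    show "p2 (a + 5) \<le> \<bar>fz ie\<bar>" using C2(2) unfolding ie(1) .
    show "\<bar>fz ie\<bar> < 4" "\<bar>fz (ie + 1)\<bar> \<le> 4" using lt4 le4 .
    show "p2 (a + 5) \<le> \<bar>sv (fz ie)\<bar>" "\<bar>sv (fz ie)\<bar> \<le> p2 (b - 6) * \<bar>fz ie\<bar>"
      "\<bar>sv (fz (ie + 1))\<bar> \<le> p2 (b - 6) * \<bar>fz ie\<bar>"
      unfolding sv using C2(6-8) unfolding ie(1) .
    show "sg = 1 \<or> sg = - 1" by (simp add: sg_def)
    show "sg * sv (fz ie) < sg * sv (fz (ie + 1))" unfolding sv using dir by (auto simp: sg_def)
    show "0 \<le> lam" using C2(10) .
    have "p2 (b - 7) * min \<bar>A0\<bar> (2 ^ (M + 3)) \<le> p2 (b - 7) * \<bar>A0\<bar>"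
      "p2 (b - 7) * min \<bar>A0\<bar> (2 ^ (M + 3)) \<le> p2 (b - 7) * 2 ^ (M + 3)"
      by (intro mult_left_mono p2_nonneg min.cobounded1 min.cobounded2)+
    then show "lam \<le> p2 (b - 7) * \<bar>sv (fz ie)\<bar>" "lam \<le> p2 (b - 7) * 2 ^ (M + 3)"
      unfolding sv using C2(11) by linarith+
  qed (unfold sv, rule left right; assumption)+
  then show ?thesis by blast
qed

end

theorem theorem1:
  fixes E M :: nat and \<sigma> :: "fl \<Rightarrow> fl"
  assumes "E \<ge> 5" and "M \<ge> 3" and "M \<le> 2 ^ (E - 1)"
    and "\<forall>v. fvalid E M v \<longrightarrow> fvalid E M (\<sigma> v)"
    and "cond1 E M \<sigma>"
  shows "\<forall>(d::nat) (f :: real list \<Rightarrow> real). \<exists>ls :: layer list.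
           wf_net E M d 1 ls \<and>
           (\<forall>B :: ival list. length B = d \<and> (\<forall>I\<in>set B. wf_ival E M I) \<and>
              gamma_box E M B \<subseteq> {xs. \<forall>v\<in>set xs. \<exists>r. v = Fin r \<and> -1 \<le> r \<and> r \<le> 1} \<longrightarrow>
              (let S = (\<lambda>xs. rnd E M (f (map fval xs))) ` gamma_box E M B in
               gamma E M (hd (net_sharp E M \<sigma> ls B)) =
               gamma E M (Iv (of_ext (Min (ext ` S))) (of_ext (Max (ext ` S))))))"
proof (intro allI)
  fix d :: nat and f :: "real list \<Rightarrow> real"
  interpret fp E M using assms(1-3) by unfold_locales
  \<comment> \<open>All boxes of the statement together: the construction is carried out once, for
    the whole family, and yields a single network.\<close>
  define BB where "BB = {B. length B = d \<and> (\<forall>I\<in>set B. wf_ival E M I) \<and>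
    gamma_box E M B \<subseteq> {xs. \<forall>v\<in>set xs. \<exists>r. v = Fin r \<and> -1 \<le> r \<and> r \<le> 1}}"
  interpret nets E M \<sigma> d BB
  proof unfold_locales
    fix B assume "B \<in> BB"
    then show "length B = d \<and> (\<forall>I\<in>set B. \<exists>l u. I = Iv (Fin l) (Fin u) \<and> l \<in> F \<and> u \<in> F \<and> - 1 \<le> l \<and> l \<le> u \<and> u \<le> 1)"
      using box_component[of B] unfolding BB_def by blast
  qed (use assms(4) in blast)
  obtain c1 c2 s0 sg lam ie where "cnet E M \<sigma> d BB c1 c2 s0 sg lam ie" using cond1_cnet[OF assms(5)] by blast
  then interpret cnet E M \<sigma> d BB c1 c2 s0 sg lam ie .
  define \<phi> where "\<phi> xs = rnd E M (f (map fval xs))" for xs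
  obtain ls where ls: "wf_net E M d 1 ls" "\<And>B. B \<in> BB \<Longrightarrow> net_sharp E M \<sigma> ls B =
      [Iv (of_ext (Min (ext ` \<phi> ` gamma_box E M B))) (of_ext (Max (ext ` \<phi> ` gamma_box E M B)))]"
    using network_exists[of \<phi>] fvalid_rnd rnd_not_NaN unfolding \<phi>_def by blast
  show "\<exists>ls. wf_net E M d 1 ls \<and>
     (\<forall>B. length B = d \<and> (\<forall>I\<in>set B. wf_ival E M I) \<and>
        gamma_box E M B \<subseteq> {xs. \<forall>v\<in>set xs. \<exists>r. v = Fin r \<and> -1 \<le> r \<and> r \<le> 1} \<longrightarrow>
        (let S = (\<lambda>xs. rnd E M (f (map fval xs))) ` gamma_box E M B in
         gamma E M (hd (net_sharp E M \<sigma> ls B)) =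
         gamma E M (Iv (of_ext (Min (ext ` S))) (of_ext (Max (ext ` S))))))"
  proof (intro exI[of _ ls] conjI allI impI)
    fix B assume B: "length B = d \<and> (\<forall>I\<in>set B. wf_ival E M I) \<and>
      gamma_box E M B \<subseteq> {xs. \<forall>v\<in>set xs. \<exists>r. v = Fin r \<and> -1 \<le> r \<and> r \<le> 1}"
    then have "B \<in> BB" by (simp add: BB_def)
    from ls(2)[OF this] show "let S = (\<lambda>xs. rnd E M (f (map fval xs))) ` gamma_box E M B in
         gamma E M (hd (net_sharp E M \<sigma> ls B)) =
         gamma E M (Iv (of_ext (Min (ext ` S))) (of_ext (Max (ext ` S))))"
      unfolding Let_def \<phi>_def by simp
  qed (rule ls(1))
qed

end
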